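(* Suppose $\kappa(\omega)$ does not exist. Then for every ordinal $\alpha$, $\mathrm{TFAG}$ fails the $\alpha$-ary Schröder–Bernstein property.
   Context: $\kappa(\omega)$ is the least cardinal $\kappa$ with $\kappa\to(\omega)^{<\omega}_2$. $\mathrm{TFAG}$ is the theory of torsion-free abelian groups, with embeddings being injective group homomorphisms. For structures $M,N$ and tuples $\bar a,\bar b$: $(M,\bar a)\leq(N,\bar b)$ means there is an embedding $f:M\to N$ with $f(\bar a)=\bar b$; $(M,\bar a)\sim(N,\bar b)$ means $\leq$ both ways. Inductively: $\sim_0$ is $\sim$; for limit $\delta$, $\sim_\delta$ iff $\sim_\beta$ for all $\beta<\delta$; $(M,\bar a)\sim_{\beta+1}(N,\bar b)$ iff every $a\in M$ has some $b\in N$ with $(M,\bar a a)\sim_\beta(N,\bar b b)$, and vice versa. $M\sim_\alpha N$ means $(M,\emptyset)\sim_\alpha(N,\emptyset)$. A pinned name for a model of $\Phi$ is $(P,\dot M)$ with $P$ a forcing notion, $P\Vdash\dot M\in\mathrm{Mod}(\check\Phi)$ (models with universe $\mathbb{N}$), and $P\times P\Vdash\dot M_0\cong\dot M_1$. $(P,\dot M)\sim_\alpha(Q,\dot N)$ means $P\times Q\times R\Vdash\dot M\sim_\alpha\dot N$ for some/any forcing $R$ collapsing $\alpha,P,Q,\dot M,\dot N$ to be countable; $(P,\dot M)\cong(Q,\dot N)$ means $P\times Q\Vdash\dot M\cong\dot N$. $\Phi$ has the $\alpha$-ary Schröder–Bernstein property if $(P,\dot M)\sim_\alpha(Q,\dot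 N)$ implies $(P,\dot M)\cong(Q,\dot N)$ for all pinned names for models of $\Phi$. *)

theory Defs
  imports Main
begin

section \<open>The set-theoretic universe\<close>

text \<open>
  The ambient universe of ZFC is a type of this class. As HOL predicates and functions play the
  role of classes, separation and replacement are single axioms. Choice is inherited from the
  choice operator of HOL: by replacement, a HOL choice function restricted to a set is a set.
\<close>

class zfc_universe =
  fixes elts :: "'a \<Rightarrow> 'a set"
  assumes extensionality: "elts x = elts y \<Longrightarrow> x = y"
    and foundation: "wf {(x, y). x \<in> elts y}"
    and infinity: "\<exists>z. (\<exists>e\<in>elts z. elts e = {}) \<and> (\<forall>n\<in>elts z. \<exists>m\<in>elts z. elts m = insert n (elts n))"
    and pairing: "\<exists>z. elts z = {x, y}"
    and union: "\<exists>z. elts z = (\<Union>y\<in>elts x. elts y)"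
    and powerset: "\<exists>z. elts z = {y. elts y \<subseteq> elts x}"
    and separation: "\<exists>z. elts z = {y \<in> elts x. A y}"
    and replacement: "\<exists>z. elts z = F ` elts x"

text \<open>The set with the given elements; only meaningful when the collection is not a proper class.\<close>

definition vset :: "'v::zfc_universe set \<Rightarrow> 'v" where
  "vset A = (THE z. elts z = A)"

definition opair :: "'v::zfc_universe \<Rightarrow> 'v \<Rightarrow> 'v" where
  "opair x y = vset {vset {x}, vset {x, y}}"

definition Ord :: "'v::zfc_universe \<Rightarrow> bool" where
  "Ord x \<longleftrightarrow> (\<forall>y\<in>elts x. elts y \<subseteq> elts x) \<and> (\<forall>y\<in>elts x. \<forall>z\<in>elts y. elts z \<subseteq> elts y)"

definition Card :: "'v::zfc_universe \<Rightarrow> bool" where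
  "Card \<kappa> \<longleftrightarrow> Ord \<kappa> \<and> (\<forall>\<beta>\<in>elts \<kappa>. \<nexists>f. bij_betw f (elts \<beta>) (elts \<kappa>))"

text \<open>
  \<open>\<kappa> \<rightarrow> (\<omega>)\<^sup><\<^sup>\<omega>\<^sub>2\<close>: every 2-colouring of the finite subsets of \<open>\<kappa>\<close> has a homogeneous set
  of order type \<open>\<omega>\<close>, where homogeneous means that for each \<open>n\<close> the colouring is constant on its
  \<open>n\<close>-element subsets. The set \<open>H\<close> has order type \<open>\<omega>\<close> when \<open>h\<close> enumerates it increasingly.
\<close>

definition arrows_omega :: "'v::zfc_universe \<Rightarrow> bool" where
  "arrows_omega \<kappa> \<longleftrightarrow>
    (\<forall>c :: 'v set \<Rightarrow> bool. \<exists>H \<subseteq> elts \<kappa>.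
      (\<exists>h :: nat \<Rightarrow> 'v. range h = H \<and> (\<forall>i j. i < j \<longrightarrow> h i \<in> elts (h j))) \<and>
      (\<forall>s t. s \<subseteq> H \<and> t \<subseteq> H \<and> finite s \<and> finite t \<and> card s = card t \<longrightarrow> c s = c t))"

definition is_kappa_omega :: "'v::zfc_universe \<Rightarrow> bool" where
  "is_kappa_omega \<kappa> \<longleftrightarrow>
    Card \<kappa> \<and> arrows_omega \<kappa> \<and> (\<forall>\<mu>\<in>elts \<kappa>. Card \<mu> \<longrightarrow> \<not> arrows_omega \<mu>)"


section \<open>Formulas of set theory\<close>

text \<open>
  Formulas of the language of set theory with parameters, with binding represented by
  functions. They are interpreted only through the forcing relation below.
\<close>

datatype 'v fm =
    FMem 'v 'v  (infix "\<^bold>\<in>" 55)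
  | FEq 'v 'v  (infix "\<^bold>=" 55)
  | FNot "'v fm"  ("\<^bold>\<not> _" [50] 50)
  | FAnd "'v fm" "'v fm"  (infixr "\<^bold>\<and>" 45)
  | FAll "'v \<Rightarrow> 'v fm"  (binder "\<^bold>\<forall>" 10)

definition FOr :: "'v fm \<Rightarrow> 'v fm \<Rightarrow> 'v fm"  (infixr "\<^bold>\<or>" 40) where
  "(\<phi> \<^bold>\<or> \<psi>) = (\<^bold>\<not> (\<^bold>\<not> \<phi> \<^bold>\<and> \<^bold>\<not> \<psi>))"

definition FImp :: "'v fm \<Rightarrow> 'v fm \<Rightarrow> 'v fm"  (infixr "\<^bold>\<longrightarrow>" 35) where
  "(\<phi> \<^bold>\<longrightarrow> \<psi>) = (\<^bold>\<not> (\<phi> \<^bold>\<and> \<^bold>\<not> \<psi>))"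

definition FIff :: "'v fm \<Rightarrow> 'v fm \<Rightarrow> 'v fm"  (infixr "\<^bold>\<longleftrightarrow>" 35) where
  "(\<phi> \<^bold>\<longleftrightarrow> \<psi>) = ((\<phi> \<^bold>\<longrightarrow> \<psi>) \<^bold>\<and> (\<psi> \<^bold>\<longrightarrow> \<phi>))"

definition FEx :: "('v \<Rightarrow> 'v fm) \<Rightarrow> 'v fm"  (binder "\<^bold>\<exists>" 10) where
  "(\<^bold>\<exists>x. \<phi> x) = (\<^bold>\<not> (\<^bold>\<forall>x. \<^bold>\<not> \<phi> x))"

subsection \<open>Basic notions\<close>

definition is_empty :: "'v \<Rightarrow> 'v fm" where
  "is_empty x = (\<^bold>\<forall>y. \<^bold>\<not> y \<^bold>\<in> x)"

definition is_succ :: "'v \<Rightarrow> 'v \<Rightarrow> 'v fm" where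
  "is_succ s x = (\<^bold>\<forall>z. z \<^bold>\<in> s \<^bold>\<longleftrightarrow> z \<^bold>\<in> x \<^bold>\<or> z \<^bold>= x)"

definition is_limit :: "'v \<Rightarrow> 'v fm" where
  "is_limit x = (\<^bold>\<not> is_empty x \<^bold>\<and> \<^bold>\<not> (\<^bold>\<exists>y. is_succ x y))"

definition inductive_set_fm :: "'v \<Rightarrow> 'v fm" where
  "inductive_set_fm w =
    ((\<^bold>\<exists>e. is_empty e \<^bold>\<and> e \<^bold>\<in> w) \<^bold>\<and> (\<^bold>\<forall>n. n \<^bold>\<in> w \<^bold>\<longrightarrow> (\<^bold>\<exists>s. is_succ s n \<^bold>\<and> s \<^bold>\<in> w)))"

definition is_omega :: "'v \<Rightarrow> 'v fm" where
  "is_omega w =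
    (inductive_set_fm w \<^bold>\<and> (\<^bold>\<forall>v. inductive_set_fm v \<^bold>\<longrightarrow> (\<^bold>\<forall>n. n \<^bold>\<in> w \<^bold>\<longrightarrow> n \<^bold>\<in> v)))"

definition is_upair :: "'v \<Rightarrow> 'v \<Rightarrow> 'v \<Rightarrow> 'v fm" where
  "is_upair u x y = (\<^bold>\<forall>z. z \<^bold>\<in> u \<^bold>\<longleftrightarrow> z \<^bold>= x \<^bold>\<or> z \<^bold>= y)"

definition is_pair :: "'v \<Rightarrow> 'v \<Rightarrow> 'v \<Rightarrow> 'v fm" where
  "is_pair u x y = (\<^bold>\<exists>s d. is_upair s x x \<^bold>\<and> is_upair d x y \<^bold>\<and> is_upair u s d)"

definition is_prod :: "'v \<Rightarrow> 'v \<Rightarrow> 'v \<Rightarrow> 'v fm" where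
  "is_prod c a b = (\<^bold>\<forall>u. u \<^bold>\<in> c \<^bold>\<longleftrightarrow> (\<^bold>\<exists>x y. x \<^bold>\<in> a \<^bold>\<and> y \<^bold>\<in> b \<^bold>\<and> is_pair u x y))"

text \<open>\<open>(x, y) \<in> f\<close>; for a function \<open>f\<close> this says \<open>f(x) = y\<close>.\<close>

definition maps_to :: "'v \<Rightarrow> 'v \<Rightarrow> 'v \<Rightarrow> 'v fm" where
  "maps_to f x y = (\<^bold>\<exists>u. is_pair u x y \<^bold>\<and> u \<^bold>\<in> f)"

definition is_fun :: "'v \<Rightarrow> 'v \<Rightarrow> 'v \<Rightarrow> 'v fm" where
  "is_fun f a b =
    ((\<^bold>\<forall>u. u \<^bold>\<in> f \<^bold>\<longrightarrow> (\<^bold>\<exists>x y. x \<^bold>\<in> a \<^bold>\<and> y \<^bold>\<in> b \<^bold>\<and> is_pair u x y)) \<^bold>\<and>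
     (\<^bold>\<forall>x. x \<^bold>\<in> a \<^bold>\<longrightarrow> (\<^bold>\<exists>y. maps_to f x y \<^bold>\<and> (\<^bold>\<forall>z. maps_to f x z \<^bold>\<longrightarrow> z \<^bold>= y))))"

definition is_inj :: "'v \<Rightarrow> 'v fm" where
  "is_inj f = (\<^bold>\<forall>x y z. maps_to f x z \<^bold>\<and> maps_to f y z \<^bold>\<longrightarrow> x \<^bold>= y)"

definition is_surj :: "'v \<Rightarrow> 'v \<Rightarrow> 'v fm" where
  "is_surj f b = (\<^bold>\<forall>y. y \<^bold>\<in> b \<^bold>\<longrightarrow> (\<^bold>\<exists>x. maps_to f x y))"

definition is_countable :: "'v \<Rightarrow> 'v fm" where
  "is_countable x = (\<^bold>\<exists>w f. is_omega w \<^bold>\<and> is_fun f x w \<^bold>\<and> is_inj f)"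

subsection \<open>Torsion-free abelian groups with universe \<open>\<nat>\<close>\<close>

text \<open>
  A structure with universe \<open>\<omega>\<close> is given by its addition \<open>M : \<omega> \<times> \<omega> \<rightarrow> \<omega>\<close>. Zero and negation
  of a group are determined by addition and preserved by additive maps.
\<close>

definition is_op :: "'v \<Rightarrow> 'v \<Rightarrow> 'v fm" where
  "is_op w M = (\<^bold>\<exists>c. is_prod c w w \<^bold>\<and> is_fun M c w)"

definition add :: "'v \<Rightarrow> 'v \<Rightarrow> 'v \<Rightarrow> 'v \<Rightarrow> 'v fm" where
  "add M x y z = (\<^bold>\<exists>u. is_pair u x y \<^bold>\<and> maps_to M u z)"

definition abelian_group_fm :: "'v \<Rightarrow> 'v \<Rightarrow> 'v \<Rightarrow> 'v fm" where
  "abelian_group_fm w M e =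
    (is_op w M \<^bold>\<and> e \<^bold>\<in> w \<^bold>\<and>
     (\<^bold>\<forall>x y z. add M x y z \<^bold>\<longrightarrow> add M y x z) \<^bold>\<and>
     (\<^bold>\<forall>x y z xy yz r. add M x y xy \<^bold>\<and> add M y z yz \<^bold>\<and> add M xy z r \<^bold>\<longrightarrow> add M x yz r) \<^bold>\<and>
     (\<^bold>\<forall>x. x \<^bold>\<in> w \<^bold>\<longrightarrow> add M e x x) \<^bold>\<and>
     (\<^bold>\<forall>x. x \<^bold>\<in> w \<^bold>\<longrightarrow> (\<^bold>\<exists>y. y \<^bold>\<in> w \<^bold>\<and> add M x y e)))"

text \<open>\<open>s\<close> is the sequence of multiples \<open>n \<mapsto> n \<cdot> x\<close>.\<close>

definition is_multiples :: "'v \<Rightarrow> 'v \<Rightarrow> 'v \<Rightarrow> 'v \<Rightarrow> 'v \<Rightarrow> 'v fm" where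
  "is_multiples w M e x s =
    (is_fun s w w \<^bold>\<and>
     (\<^bold>\<forall>n. is_empty n \<^bold>\<longrightarrow> maps_to s n e) \<^bold>\<and>
     (\<^bold>\<forall>n m y z. n \<^bold>\<in> w \<^bold>\<and> is_succ m n \<^bold>\<and> maps_to s n y \<^bold>\<and> add M y x z \<^bold>\<longrightarrow> maps_to s m z))"

definition TFAG :: "'v \<Rightarrow> 'v fm" where
  "TFAG M =
    (\<^bold>\<exists>w e. is_omega w \<^bold>\<and> abelian_group_fm w M e \<^bold>\<and>
      (\<^bold>\<forall>x s n. x \<^bold>\<in> w \<^bold>\<and> is_multiples w M e x s \<^bold>\<and> n \<^bold>\<in> w \<^bold>\<and> \<^bold>\<not> is_empty n \<^bold>\<and> maps_to s n e
        \<^bold>\<longrightarrow> x \<^bold>= e))"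

definition is_hom :: "'v \<Rightarrow> 'v \<Rightarrow> 'v \<Rightarrow> 'v fm" where
  "is_hom f M N =
    (\<^bold>\<forall>x y z x' y' z'. add M x y z \<^bold>\<and> maps_to f x x' \<^bold>\<and> maps_to f y y' \<^bold>\<and> maps_to f z z'
      \<^bold>\<longrightarrow> add N x' y' z')"

definition iso_fm :: "'v \<Rightarrow> 'v \<Rightarrow> 'v fm" where
  "iso_fm M N =
    (\<^bold>\<exists>w f. is_omega w \<^bold>\<and> is_fun f w w \<^bold>\<and> is_inj f \<^bold>\<and> is_surj f w \<^bold>\<and> is_hom f M N)"

subsection \<open>The relations \<open>\<sim>\<^sub>\<alpha>\<close>\<close>

text \<open>
  Tuples are functions from some \<open>n \<in> \<omega>\<close> to \<open>\<omega>\<close>. The last conjunct of \<open>embeds_fm\<close> says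
  \<open>b = f \<circ> a\<close>.
\<close>

definition embeds_fm :: "'v \<Rightarrow> 'v \<Rightarrow> 'v \<Rightarrow> 'v \<Rightarrow> 'v fm" where
  "embeds_fm M a N b =
    (\<^bold>\<exists>w f. is_omega w \<^bold>\<and> is_fun f w w \<^bold>\<and> is_inj f \<^bold>\<and> is_hom f M N \<^bold>\<and>
      (\<^bold>\<forall>i y. maps_to b i y \<^bold>\<longleftrightarrow> (\<^bold>\<exists>x. maps_to a i x \<^bold>\<and> maps_to f x y)))"

text \<open>\<open>a'\<close> is the tuple \<open>a\<close> of length \<open>n\<close> followed by \<open>x\<close>.\<close>

definition is_append :: "'v \<Rightarrow> 'v \<Rightarrow> 'v \<Rightarrow> 'v \<Rightarrow> 'v fm" where
  "is_append a' a n x = (\<^bold>\<forall>u. u \<^bold>\<in> a' \<^bold>\<longleftrightarrow> u \<^bold>\<in> a \<^bold>\<or> is_pair u n x)"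

definition in_level :: "'v \<Rightarrow> 'v \<Rightarrow> 'v \<Rightarrow> 'v \<Rightarrow> 'v fm" where
  "in_level S \<beta> a b = (\<^bold>\<exists>t. is_pair t a b \<^bold>\<and> maps_to S \<beta> t)"

definition in_level_append :: "'v \<Rightarrow> 'v \<Rightarrow> 'v \<Rightarrow> 'v \<Rightarrow> 'v \<Rightarrow> 'v \<Rightarrow> 'v \<Rightarrow> 'v fm" where
  "in_level_append S \<beta> n a x b y =
    (\<^bold>\<exists>a' b'. is_append a' a n x \<^bold>\<and> is_append b' b n y \<^bold>\<and> in_level S \<beta> a' b')"

text \<open>
  \<open>S\<close> satisfies the recursion defining \<open>(M, a) \<sim>\<^sub>\<beta> (N, b)\<close> for all \<open>\<beta> \<le> \<alpha>\<close>, where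
  \<open>in_level S \<beta> a b\<close> stands for \<open>(M, a) \<sim>\<^sub>\<beta> (N, b)\<close>.
\<close>

definition sim_recursion :: "'v \<Rightarrow> 'v \<Rightarrow> 'v \<Rightarrow> 'v \<Rightarrow> 'v \<Rightarrow> 'v fm" where
  "sim_recursion w \<alpha> M N S =
    (\<^bold>\<forall>\<beta> n a b. (\<beta> \<^bold>\<in> \<alpha> \<^bold>\<or> \<beta> \<^bold>= \<alpha>) \<^bold>\<and> n \<^bold>\<in> w \<^bold>\<and> is_fun a n w \<^bold>\<and> is_fun b n w \<^bold>\<longrightarrow>
      (in_level S \<beta> a b \<^bold>\<longleftrightarrow>
        (is_empty \<beta> \<^bold>\<and> embeds_fm M a N b \<^bold>\<and> embeds_fm N b M a) \<^bold>\<or>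
        (is_limit \<beta> \<^bold>\<and> (\<^bold>\<forall>\<gamma>. \<gamma> \<^bold>\<in> \<beta> \<^bold>\<longrightarrow> in_level S \<gamma> a b)) \<^bold>\<or>
        (\<^bold>\<exists>\<gamma>. is_succ \<beta> \<gamma> \<^bold>\<and>
          (\<^bold>\<forall>x. x \<^bold>\<in> w \<^bold>\<longrightarrow> (\<^bold>\<exists>y. y \<^bold>\<in> w \<^bold>\<and> in_level_append S \<gamma> n a x b y)) \<^bold>\<and>
          (\<^bold>\<forall>y. y \<^bold>\<in> w \<^bold>\<longrightarrow> (\<^bold>\<exists>x. x \<^bold>\<in> w \<^bold>\<and> in_level_append S \<gamma> n a x b y)))))"

definition sim_fm :: "'v \<Rightarrow> 'v \<Rightarrow> 'v \<Rightarrow> 'v fm" where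
  "sim_fm \<alpha> M N =
    (\<^bold>\<exists>w S e. is_omega w \<^bold>\<and> is_empty e \<^bold>\<and> sim_recursion w \<alpha> M N S \<^bold>\<and> in_level S \<alpha> e e)"


section \<open>Forcing\<close>

text \<open>A forcing notion is a preorder with a greatest element; \<open>Le P q p\<close> means that \<open>q\<close> is stronger.\<close>

record 'v forcing =
  Cond :: 'v
  Le :: "'v \<Rightarrow> 'v \<Rightarrow> bool"
  Top :: 'v

definition forcing_notion :: "'v::zfc_universe forcing \<Rightarrow> bool" where
  "forcing_notion P \<longleftrightarrow>
    (\<forall>p\<in>elts (Cond P). Le P p p) \<and>
    (\<forall>p\<in>elts (Cond P). \<forall>q\<in>elts (Cond P). \<forall>r\<in>elts (Cond P). Le P p q \<longrightarrow> Le P q r \<longrightarrow> Le P p r) \<and>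
    Top P \<in> elts (Cond P) \<and> (\<forall>p\<in>elts (Cond P). Le P p (Top P))"

definition below :: "'v::zfc_universe forcing \<Rightarrow> 'v \<Rightarrow> 'v set" where
  "below P p = {q \<in> elts (Cond P). Le P q p}"

inductive is_name :: "'v::zfc_universe forcing \<Rightarrow> 'v \<Rightarrow> bool" for P where
  "(\<And>u. u \<in> elts x \<Longrightarrow> \<exists>z s. u = opair z s \<and> s \<in> elts (Cond P) \<and> is_name P z) \<Longrightarrow> is_name P x"

text \<open>
  The usual clause for \<open>p \<tturnstile> x = y\<close>. It determines the relation by recursion on the
  well-founded \<open>\<in>\<close>, so the least solution is the only one.
\<close>

inductive forces_eq :: "'v::zfc_universe forcing \<Rightarrow> 'v \<Rightarrow> 'v \<Rightarrow> 'v \<Rightarrow> bool" for P where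
  "(\<And>z s q. opair z s \<in> elts x \<Longrightarrow> q \<in> below P p \<Longrightarrow> q \<in> below P s \<Longrightarrow>
      \<exists>r\<in>below P q. \<exists>z' s'. opair z' s' \<in> elts y \<and> r \<in> below P s' \<and> forces_eq P z z' r) \<Longrightarrow>
   (\<And>z' s' q. opair z' s' \<in> elts y \<Longrightarrow> q \<in> below P p \<Longrightarrow> q \<in> below P s' \<Longrightarrow>
      \<exists>r\<in>below P q. \<exists>z s. opair z s \<in> elts x \<and> r \<in> below P s \<and> forces_eq P z z' r) \<Longrightarrow>
   forces_eq P x y p"

primrec forces :: "'v::zfc_universe forcing \<Rightarrow> 'v fm \<Rightarrow> 'v \<Rightarrow> bool" where
  "forces P (x \<^bold>\<in> y) p \<longleftrightarrow>
    (\<forall>q\<in>below P p. \<exists>r\<in>below P q. \<exists>z s. opair z s \<in> elts y \<and> r \<in> below P s \<and> forces_eq P x z r)"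
| "forces P (x \<^bold>= y) p \<longleftrightarrow> forces_eq P x y p"
| "forces P (\<^bold>\<not> \<phi>) p \<longleftrightarrow> (\<forall>q\<in>below P p. \<not> forces P \<phi> q)"
| "forces P (\<phi> \<^bold>\<and> \<psi>) p \<longleftrightarrow> forces P \<phi> p \<and> forces P \<psi> p"
| "forces P (FAll \<phi>) p \<longleftrightarrow> (\<forall>x. is_name P x \<longrightarrow> forces P (\<phi> x) p)"

definition forced :: "'v::zfc_universe forcing \<Rightarrow> 'v fm \<Rightarrow> bool"  (infix "\<tturnstile>" 5) where
  "(P \<tturnstile> \<phi>) \<longleftrightarrow> (\<forall>p\<in>elts (Cond P). forces P \<phi> p)"

function check :: "'v::zfc_universe forcing \<Rightarrow> 'v \<Rightarrow> 'v" where
  "check P x = vset ((\<lambda>y. opair (check P y) (Top P)) ` elts x)"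
  by auto
termination
proof (relation "inv_image {(x, y). x \<in> elts y} snd", goal_cases)
  case 1
  show ?case by (intro wf_inv_image foundation)
next
  case (2 P x y)
  then show ?case by (simp only: in_inv_image snd_conv mem_Collect_eq case_prod_conv)
qed

declare check.simps [simp del]

lemma elts_vset_upair: "elts (vset {x, y}) = {x, y :: 'v::zfc_universe}"
proof -
  obtain z :: 'v where z: "elts z = {x, y}" using pairing by meson
  show ?thesis unfolding vset_def
  proof (rule theI)
    show "elts z = {x, y}" by (fact z)
    show "u = z" if "elts u = {x, y}" for u using that z by (intro extensionality) (simp only:)
  qed
qed

text \<open>
  The name obtained by applying \<open>j\<close> hereditarily to the conditions in a name. For
  \<open>j = (\<lambda>p. (p, 1))\<close> it turns a \<open>P\<close>-name into the corresponding \<open>P \<times> Q\<close>-name.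
\<close>

function lift_name :: "('v::zfc_universe \<Rightarrow> 'v) \<Rightarrow> 'v \<Rightarrow> 'v" where
  "lift_name j x = vset ((\<lambda>(z, p). opair (lift_name j z) (j p)) ` {(z, p). opair z p \<in> elts x})"
  by auto
termination
proof (relation "inv_image ({(x, y). x \<in> elts y}\<^sup>+) snd", goal_cases)
  case 1
  show ?case by (intro wf_inv_image wf_trancl foundation)
next
  case (2 j x t z p)
  then have "opair z p \<in> elts x" by (metis case_prodD mem_Collect_eq)
  moreover have "z \<in> elts (vset {z})" "vset {z} \<in> elts (opair z p)"
    by (simp_all add: opair_def elts_vset_upair elts_vset_upair [of z z, simplified])
  ultimately have "(z, vset {z}) \<in> {(x, y). x \<in> elts y}"
      "(vset {z}, opair z p) \<in> {(x, y). x \<in> elts y}"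
      "(opair z p, x) \<in> {(x, y). x \<in> elts y}"
    by (simp_all only: mem_Collect_eq case_prod_conv)
  then have "(z, x) \<in> {(x, y). x \<in> elts y}\<^sup>+"
    by (blast intro: trancl.intros)
  then show ?case using 2 by (simp only: in_inv_image snd_conv)
qed

declare lift_name.simps [simp del]

definition prod_forcing :: "'v::zfc_universe forcing \<Rightarrow> 'v forcing \<Rightarrow> 'v forcing"  (infixr "\<otimes>" 70) where
  "P \<otimes> Q =
    \<lparr>Cond = vset ((\<lambda>(p, q). opair p q) ` (elts (Cond P) \<times> elts (Cond Q))),
     Le = (\<lambda>u v. \<exists>p q p' q'. u = opair p q \<and> v = opair p' q' \<and> Le P p p' \<and> Le Q q q'),
     Top = opair (Top P) (Top Q)\<rparr>"

definition left_name :: "'v::zfc_universe forcing \<Rightarrow> 'v \<Rightarrow> 'v" where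
  "left_name Q M = lift_name (\<lambda>p. opair p (Top Q)) M"

definition right_name :: "'v::zfc_universe forcing \<Rightarrow> 'v \<Rightarrow> 'v" where
  "right_name P N = lift_name (\<lambda>q. opair (Top P) q) N"


section \<open>Pinned names and Schroeder--Bernstein properties\<close>

text \<open>The parameter \<open>\<Phi>\<close> is the formula defining \<open>Mod(\<Phi>)\<close>, as \<open>TFAG\<close> above.\<close>

definition pinned_name :: "('v::zfc_universe \<Rightarrow> 'v fm) \<Rightarrow> 'v forcing \<Rightarrow> 'v \<Rightarrow> bool" where
  "pinned_name \<Phi> P M \<longleftrightarrow>
    forcing_notion P \<and> is_name P M \<and> (P \<tturnstile> \<Phi> M) \<and>
    (P \<otimes> P \<tturnstile> iso_fm (left_name P M) (right_name P M))"

definition pinned_iso :: "'v::zfc_universe forcing \<Rightarrow> 'v \<Rightarrow> 'v forcing \<Rightarrow> 'v \<Rightarrow> bool" where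
  "pinned_iso P M Q N \<longleftrightarrow> (P \<otimes> Q \<tturnstile> iso_fm (left_name Q M) (right_name P N))"

definition collapses :: "'v::zfc_universe forcing \<Rightarrow> 'v \<Rightarrow> bool" where
  "collapses R x \<longleftrightarrow> (R \<tturnstile> is_countable (check R x))"

definition pinned_sim ::
    "'v::zfc_universe \<Rightarrow> 'v forcing \<Rightarrow> 'v \<Rightarrow> 'v forcing \<Rightarrow> 'v \<Rightarrow> bool" where
  "pinned_sim \<alpha> P M Q N \<longleftrightarrow>
    (\<exists>R. forcing_notion R \<and>
      collapses R \<alpha> \<and> collapses R (Cond P) \<and> collapses R (Cond Q) \<and>
      collapses R M \<and> collapses R N \<and>
      (P \<otimes> Q \<otimes> R \<tturnstile>
        sim_fm (check (P \<otimes> Q \<otimes> R) \<alpha>)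
          (left_name (Q \<otimes> R) M)
          (right_name P (left_name R N))))"

definition Schroeder_Bernstein :: "('v::zfc_universe \<Rightarrow> 'v fm) \<Rightarrow> 'v \<Rightarrow> bool" where
  "Schroeder_Bernstein \<Phi> \<alpha> \<longleftrightarrow>
    (\<forall>P M Q N. pinned_name \<Phi> P M \<and> pinned_name \<Phi> Q N \<and> pinned_sim \<alpha> P M Q N
      \<longrightarrow> pinned_iso P M Q N)"

end

theory Submission
  imports Defs "HOL-Library.Countable_Set" "HOL-Library.Function_Algebras"
    "HOL-Computational_Algebra.Polynomial" "HOL-Computational_Algebra.Primes"
begin

text \<open>
  Two torsion-free groups are built that differ only in a sign: along a tree of rank \<open>\<alpha>\<close>, divisibility by
  infinitely many primes ties the value of a vector at the root to its value at \<open>\<infinity>\<close> with sign \<open>1\<close> or \<open>-1\<close>, and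
  the values at neighbouring nodes, and at leaves and \<open>\<infinity>\<close>, to each other. Multiplying the values in a part of the
  tree by \<open>-1\<close> embeds each group in the other, and the place where the sign is wrong can be moved to nodes outside
  the finite subtree considered so far; each move of the back-and-forth game costs one rank, so the groups are
  \<open>\<sim>\<^sub>\<alpha>\<close>-equivalent. An isomorphism would multiply all values by one constant: it is constant at each leaf since
  only constant polynomials are units, and it is propagated through the tree since the values at a node are
  eventually constant along its children. The constant would have to be equal to its negative.

  The groups have to be rigid even under back-and-forth systems, that is, potential isomorphisms. For this the
  vectors are spread over the lists of ordinals below a cardinal \<open>\<kappa>\<close>, and a colouring of these lists is coded by
  divisibility. If \<open>\<kappa>(\<omega>)\<close> does not exist, there is a colouring by natural numbers such that no sequence of
  ordinals looks like its own shift, and a list of length \<open>1\<close> can only be mapped to itself: otherwise the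
  extensions of the two would produce a sequence that looks like its shift.

  The pinned names consist of a generic enumeration of each group. They are forced to be isomorphic only if there is
  a back-and-forth system between the groups.
\<close>

section \<open>Sets, ordinals and cardinals\<close>

text \<open>The embeddings are multiplications by factors that must be -1 at \<open>Dn []\<close>,
  to change the sign \<epsilon>, and 1 at \<open>Inf\<close>. By eventual constancy along children,
  a factor of -1 at a position that is not a leaf recurs at some child, so it descends to a leaf,
  and only there can it be repaired. The repair is the polynomial \<open>2 * n - 1\<close>: it is -1
  at 0, the place of \<open>Dn p\<close>, and 1 at 1, the place compared with \<open>Inf\<close>. It
  vanishes at no integer, so multiplication is injective, but it is no unit, so multiplication is
  not onto: the groups embed in each other without being isomorphic. In the game the multiplication
  has to be its own inverse on the vectors played so far, so the leaves where the repair takes place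
  must lie outside the positions that these vectors use.

  Partial isomorphisms of a back-and-forth system preserve infinite divisibility by a prime. Each
  family of functionals therefore has its own prime, and what the proof needs to know about vectors
  is phrased as the common kernel of such a family. Both groups have the same families except for
  the one containing \<open>Root\<close>.\<close>

lemma mem_induct: "(\<And>x::'v::zfc_universe. (\<And>y. y \<in> elts x \<Longrightarrow> Q y) \<Longrightarrow> Q x) \<Longrightarrow> Q a"
  using wf_induct_rule[OF foundation, of Q a] by blast

lemma mem_not_refl: "x \<notin> elts (x::'v::zfc_universe)"
  using wf_not_refl[OF foundation, of x] by auto

lemma mem_not_sym: "x \<in> elts y \<Longrightarrow> y \<notin> elts (x::'v::zfc_universe)"
  using wf_not_sym[OF foundation, of x y] by auto

definition is_set :: "'v::zfc_universe set \<Rightarrow> bool" where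
  "is_set A \<longleftrightarrow> (\<exists>z. elts z = A)"

lemma elts_vset: "is_set A \<Longrightarrow> elts (vset A) = A"
proof -
  assume "is_set A"
  then obtain z where z: "elts z = A" unfolding is_set_def by blast
  have "(THE z. elts z = A) = z"
    by (rule the_equality[of _ z]) (use z extensionality in blast)+
  then show ?thesis using z by (simp add: vset_def)
qed

lemma is_set_elts [simp]: "is_set (elts z)"
  by (auto simp: is_set_def)

lemma is_set_subset: "is_set A \<Longrightarrow> B \<subseteq> A \<Longrightarrow> is_set B"
proof -
  assume A: "is_set A" "B \<subseteq> A"
  obtain a where a: "elts a = A" using A(1) unfolding is_set_def by blast
  obtain z where z: "elts z = {y \<in> elts a. y \<in> B}" using separation[of a "\<lambda>y. y \<in> B"] by blast
  have "elts z = B" unfolding z a using A(2) by blast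
  then show ?thesis unfolding is_set_def by blast
qed

lemma is_set_image: "is_set (A :: 'v::zfc_universe set) \<Longrightarrow> is_set ((f :: 'v \<Rightarrow> 'v) ` A)"
proof -
  assume A: "is_set A"
  obtain a where a: "elts a = A" using A unfolding is_set_def by blast
  show ?thesis unfolding is_set_def a[symmetric] by (rule replacement)
qed

lemma is_set_UN:
  fixes A :: "'v::zfc_universe set" and f :: "'v \<Rightarrow> 'v set"
  assumes A: "is_set A" and f: "\<And>x. x \<in> A \<Longrightarrow> is_set (f x)"
  shows "is_set (\<Union>x\<in>A. f x)"
proof -
  obtain z where z: "elts z = (\<lambda>x. vset (f x)) ` A" using is_set_image[OF A] unfolding is_set_def by blast
  obtain w where w: "elts w = (\<Union>y\<in>elts z. elts y)" using union[of z] by blast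
  have "elts w = (\<Union>x\<in>A. f x)" unfolding w z using f by (auto simp: elts_vset)
  then show ?thesis unfolding is_set_def by blast
qed

lemma is_set_empty [simp]: "is_set {}"
  using is_set_subset[OF is_set_elts, of "{}"] by simp

lemma is_set_insert: "is_set A \<Longrightarrow> is_set (insert x A)"
proof -
  assume A: "is_set A"
  obtain a where a: "elts a = A" using A unfolding is_set_def by blast
  obtain b where b: "elts b = {x}" using pairing[of x x] by auto
  obtain c where c: "elts c = {a, b}" using pairing[of a b] by blast
  obtain w where w: "elts w = (\<Union>y\<in>elts c. elts y)" using union[of c] by blast
  have "elts w = insert x A" unfolding w c by (auto simp: a b)
  then show ?thesis unfolding is_set_def by blast
qed

lemma is_set_finite: "finite A \<Longrightarrow> is_set A"
  by (induction rule: finite_induct) (auto intro: is_set_insert)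

lemma is_set_Un: "is_set A \<Longrightarrow> is_set B \<Longrightarrow> is_set (A \<union> B)"
  using is_set_UN[OF is_set_finite[of "{vset A, vset B}"], of elts] by (simp add: elts_vset)

lemma opair_iff [simp]: "opair x y = opair x' y' \<longleftrightarrow> x = x' \<and> y = (y'::'v::zfc_universe)"
proof
  assume "opair x y = opair x' y'"
  then have "elts (opair x y) = elts (opair x' y')" by simp
  moreover have s: "elts (vset {a}) = {a}" for a :: "'v::zfc_universe" using elts_vset_upair[of a a] by simp
  ultimately have e: "{vset {x}, vset {x, y}} = {vset {x'}, vset {x', y'}}"
    by (simp add: opair_def elts_vset_upair)
  have "elts ` {vset {x}, vset {x, y}} = elts ` {vset {x'}, vset {x', y'}}" using e by simp
  then have "{{x}, {x, y}} = {{x'}, {x', y'}}" by (simp add: elts_vset_upair s)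
  then show "x = x' \<and> y = y'" by (auto simp: doubleton_eq_iff)
qed simp

text \<open>Lists, functions and points of the tree are HOL objects, not elements of the universe;
  an injective coding into a set transfers the set axioms to them. The argument of type
  \<open>itself\<close> names the universe that is meant.\<close>

definition small :: "'v::zfc_universe itself \<Rightarrow> 'a set \<Rightarrow> bool" where
  "small V A \<longleftrightarrow> (\<exists>f :: 'a \<Rightarrow> 'v. inj_on f A \<and> is_set (f ` A))"

lemma smallI: "inj_on (f :: 'a \<Rightarrow> 'v::zfc_universe) A \<Longrightarrow> is_set B \<Longrightarrow> f ` A \<subseteq> B \<Longrightarrow> small TYPE('v) A"
  unfolding small_def using is_set_subset by metis

lemma smallE:
  assumes "small TYPE('v::zfc_universe) A"
  obtains f :: "'a \<Rightarrow> 'v::zfc_universe" where "inj_on f A" "is_set (f ` A)"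
  using assms unfolding small_def by blast

lemma small_inj: "small TYPE('v::zfc_universe) B \<Longrightarrow> inj_on f A \<Longrightarrow> f ` A \<subseteq> B \<Longrightarrow> small TYPE('v) A"
proof -
  assume B: "small TYPE('v) B" and f: "inj_on f A" "f ` A \<subseteq> B"
  obtain g :: "_ \<Rightarrow> 'v" where g: "inj_on g B" "is_set (g ` B)" using B by (rule smallE)
  show ?thesis
    by (rule smallI[of "g \<circ> f" _ "g ` B"]) (use f g in \<open>auto intro: comp_inj_on inj_on_subset\<close>)
qed

lemma small_subset: "small TYPE('v::zfc_universe) B \<Longrightarrow> A \<subseteq> B \<Longrightarrow> small TYPE('v) A"
  by (rule small_inj[of B id]) auto

lemma small_image: "small TYPE('v::zfc_universe) A \<Longrightarrow> small TYPE('v) (f ` A)"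
  by (rule small_inj[of A "inv_into A f"]) (auto intro: inj_on_inv_into inv_into_into)

lemma is_set_small: "small TYPE('v::zfc_universe) A \<Longrightarrow> is_set (A :: 'v set)"
proof -
  assume "small TYPE('v) A"
  then obtain f :: "'v \<Rightarrow> 'v" where f: "inj_on f A" "is_set (f ` A)" by (rule smallE)
  have "A = inv_into A f ` f ` A" using f(1) by (simp add: inv_into_image_cancel)
  then show ?thesis using is_set_image[OF f(2)] by metis
qed

lemma small_is_set: "is_set (A :: 'v::zfc_universe set) \<Longrightarrow> small TYPE('v) A"
  by (rule smallI[of id]) auto

lemma small_elts [simp]: "small TYPE('v) (elts (z::'v::zfc_universe))"
  by (rule small_is_set) simp

lemma small_Times:
  assumes "small TYPE('v::zfc_universe) A" "small TYPE('v) B"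
  shows "small TYPE('v) (A \<times> B)"
proof -
  obtain f :: "_ \<Rightarrow> 'v" where f: "inj_on f A" "is_set (f ` A)" using assms(1) by (rule smallE)
  obtain g :: "_ \<Rightarrow> 'v" where g: "inj_on g B" "is_set (g ` B)" using assms(2) by (rule smallE)
  show ?thesis
  proof (rule smallI)
    show "inj_on (\<lambda>(a, b). opair (f a) (g b)) (A \<times> B)"
      using f(1) g(1) by (auto simp: inj_on_def)
    show "is_set (\<Union>x\<in>f ` A. opair x ` g ` B)"
      using f(2) g(2) by (intro is_set_UN is_set_image)
  qed auto
qed

lemma small_Pow:
  assumes "small TYPE('v::zfc_universe) A"
  shows "small TYPE('v) (Pow A)"
proof -
  obtain f :: "_ \<Rightarrow> 'v" where f: "inj_on f A" "is_set (f ` A)" using assms by (rule smallE)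
  obtain z where z: "elts z = f ` A" using f(2) unfolding is_set_def by blast
  obtain w where w: "elts w = {y. elts y \<subseteq> elts z}" using powerset[of z] by blast
  have e: "elts (vset (f ` X)) = f ` X" if "X \<subseteq> A" for X
    using is_set_subset[OF f(2)] that by (intro elts_vset) blast
  show ?thesis
  proof (rule smallI)
    show "inj_on (\<lambda>X. vset (f ` X)) (Pow A)"
    proof (rule inj_onI)
      fix X Y assume "X \<in> Pow A" "Y \<in> Pow A" "vset (f ` X) = vset (f ` Y)"
      then have "f ` X = f ` Y" using e by (metis PowD)
      then show "X = Y" using f(1) \<open>X \<in> Pow A\<close> \<open>Y \<in> Pow A\<close> by (simp add: inj_on_image_eq_iff)
    qed
    show "is_set (elts w)" by simp
    show "(\<lambda>X. vset (f ` X)) ` Pow A \<subseteq> elts w" unfolding w z using e by (force intro: imageI)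
  qed
qed

lemma small_insert: "small TYPE('v::zfc_universe) A \<Longrightarrow> small TYPE('v) (insert a A)"
proof (cases "a \<in> A")
  case False
  assume A: "small TYPE('v) A"
  show ?thesis
    \<comment> \<open>The new point is coded by the empty set and every old point by its singleton,
      so the power set of \<open>A\<close> has room for it.\<close>
    by (rule small_inj[OF small_Pow[OF A], of "\<lambda>x. if x = a then {} else {x}"]) (auto simp: inj_on_def)
qed (simp add: insert_absorb)

section \<open>Natural numbers and omega in the universe\<close>

primrec vnat :: "nat \<Rightarrow> 'v::zfc_universe" where
  "vnat 0 = vset {}"
| "vnat (Suc n) = vset (insert (vnat n) (elts (vnat n)))"

lemma elts_vnat: "elts (vnat 0 :: 'v::zfc_universe) = {}"
  "elts (vnat (Suc n) :: 'v) = insert (vnat n) (elts (vnat n))"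
  by (simp_all add: elts_vset is_set_insert)

lemma elts_vnat_eq: "elts (vnat n :: 'v::zfc_universe) = vnat ` {..<n}"
  by (induction n) (simp_all add: elts_vnat lessThan_Suc del: vnat.simps)

lemma vnat_mem_less: "m < n \<Longrightarrow> (vnat m :: 'v::zfc_universe) \<in> elts (vnat n)"
  by (auto simp: elts_vnat_eq)

lemma vnat_inj [simp]: "vnat m = (vnat n :: 'v::zfc_universe) \<longleftrightarrow> m = n"
  by (metis vnat_mem_less mem_not_refl linorder_neqE_nat)

definition omega :: "'v::zfc_universe" where
  "omega = vset (range vnat)"

lemma elts_omega: "elts (omega :: 'v::zfc_universe) = range vnat"
proof -
  obtain z :: 'v where z: "\<exists>e\<in>elts z. elts e = {}" "\<forall>n\<in>elts z. \<exists>m\<in>elts z. elts m = insert n (elts n)"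
    using infinity by blast
  have "vnat n \<in> elts z" for n
  proof (induction n)
    case 0
    then show ?case using z(1) by (metis elts_vnat(1) extensionality)
  next
    case (Suc n)
    then show ?case using z(2) by (metis elts_vnat(2) extensionality)
  qed
  then have "is_set (range vnat :: 'v set)" using is_set_subset[OF is_set_elts] by blast
  then show ?thesis by (simp add: omega_def elts_vset)
qed

lemma vnat_in_omega [simp]: "vnat n \<in> elts omega"
  by (simp add: elts_omega)

lemma small_countable: "countable A \<Longrightarrow> small TYPE('v::zfc_universe) A"
proof -
  assume "countable A"
  then obtain f :: "_ \<Rightarrow> nat" where "inj_on f A" by (auto simp: countable_def)
  then have "inj_on (vnat \<circ> f) A" by (auto simp: inj_on_def)
  then show ?thesis by (rule smallI[where B = "elts omega"]) auto
qed

text \<open>The fixed value \<open>c\<close> outside \<open>A\<close> makes such a function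
  determined by its graph over \<open>A\<close>, a subset of a small product.\<close>

lemma small_functions:
  fixes A :: "'a set"
  assumes "small TYPE('v::zfc_universe) A" "small TYPE('v) B"
  shows "small TYPE('v) {f. (\<forall>x. x \<notin> A \<longrightarrow> f x = c) \<and> (\<forall>x\<in>A. f x \<in> B)}" (is "small _ ?F")
proof (rule small_inj)
  show "small TYPE('v) (Pow (A \<times> B))" using assms by (intro small_Pow small_Times)
  show "inj_on (\<lambda>f. {(x, f x) | x. x \<in> A}) ?F"
  proof (rule inj_onI)
    fix f g assume fg: "f \<in> ?F" "g \<in> ?F" and e: "{(x, f x) | x. x \<in> A} = {(x, g x) | x. x \<in> A}"
    show "f = g"
    proof
      fix x
      show "f x = g x"
      proof (cases "x \<in> A")
        case True
        then have "(x, f x) \<in> {(x, g x) | x. x \<in> A}" using e by blast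
        then show ?thesis by blast
      qed (use fg in simp)
    qed
  qed
qed auto

lemma small_lists:
  assumes "small TYPE('v::zfc_universe) A"
  shows "small TYPE('v) (lists A)"
proof (rule small_inj)
  show "small TYPE('v) (Pow ((UNIV :: nat set) \<times> A))"
    by (intro small_Pow small_Times assms small_countable) simp
  show "inj_on (\<lambda>l. {(i, l ! i) | i. i < length l}) (lists A)"
  proof (rule inj_onI)
    fix k l assume e: "{(i, k ! i) | i. i < length k} = {(i, l ! i) | i. i < length l}"
    have "fst ` {(i, k ! i) | i. i < length k} = {..<length k}" by force
    moreover have "fst ` {(i, l ! i) | i. i < length l} = {..<length l}" by force
    ultimately have len: "length k = length l" using e by (metis lessThan_eq_iff)
    show "k = l"
    proof (rule nth_equalityI[OF len])
      fix i assume "i < length k"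
      then have "(i, k ! i) \<in> {(i, l ! i) | i. i < length l}" using e by blast
      then show "k ! i = l ! i" by blast
    qed
  qed
qed auto

section \<open>Ordinals and cardinals\<close>

lemma Ord_mem: "Ord x \<Longrightarrow> y \<in> elts x \<Longrightarrow> Ord (y::'v::zfc_universe)"
  unfolding Ord_def by blast

lemma Ord_trans: "Ord x \<Longrightarrow> y \<in> elts x \<Longrightarrow> z \<in> elts y \<Longrightarrow> z \<in> elts (x::'v::zfc_universe)"
  unfolding Ord_def by blast

lemma Ord_linear: "Ord (x::'v::zfc_universe) \<Longrightarrow> Ord y \<Longrightarrow> x \<in> elts y \<or> x = y \<or> y \<in> elts x"
proof (induction x arbitrary: y rule: mem_induct)
  case (1 x)
  note IHx = this
  show ?case using IHx(3)
  proof (induction y rule: mem_induct)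
    case (1 y)
    show ?case
    proof (rule ccontr)
      assume n: "\<not> ?thesis"
      have "elts x \<subseteq> elts y"
      proof
        fix z assume z: "z \<in> elts x"
        have "z \<in> elts y \<or> z = y \<or> y \<in> elts z" using IHx(1)[OF z] Ord_mem[OF IHx(2) z] 1(2) by blast
        then show "z \<in> elts y" using n z Ord_trans[OF IHx(2) z] by blast
      qed
      moreover have "elts y \<subseteq> elts x"
      proof
        fix z assume z: "z \<in> elts y"
        have "x \<in> elts z \<or> x = z \<or> z \<in> elts x" using 1(1)[OF z Ord_mem[OF 1(2) z]] by blast
        then show "z \<in> elts x" using n z Ord_trans[OF 1(2) z] by blast
      qed
      ultimately show False using n extensionality by blast
    qed
  qed
qed

text \<open>Choice in HOL gives a well-order of \<open>A\<close>; its Mostowski collapse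
  \<open>\<phi>\<close> is injective, and its range is a transitive set of ordinals, hence an
  ordinal.\<close>

lemma small_ordinal:
  fixes A :: "'a set"
  assumes "small TYPE('v::zfc_universe) A"
  shows "\<exists>\<mu> f. Ord (\<mu>::'v) \<and> bij_betw f A (elts \<mu>)"
proof -
  obtain r where r: "well_order_on A r" using well_order_on by blast
  then have wfr: "wf (r - Id)" and tot: "total_on A r" and tr: "trans r" and anti: "antisym r" and rA: "r \<subseteq> A \<times> A"
    by (auto simp: well_order_on_def linear_order_on_def partial_order_on_def preorder_on_def refl_on_def)
  define \<phi> :: "'a \<Rightarrow> 'v" where "\<phi> = wfrec (r - Id) (\<lambda>f a. vset (f ` {b. (b, a) \<in> r - Id}))"
  have sm: "is_set (\<phi> ` B)" if "B \<subseteq> A" for B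
    by (rule is_set_small[OF small_image[OF small_subset[OF assms that]]])
  have unf: "\<phi> a = vset (\<phi> ` {b. (b, a) \<in> r - Id})" for a
    unfolding \<phi>_def by (subst wfrec[OF wfr]) (rule arg_cong[where f = vset], rule image_cong, auto simp: cut_def)
  have el: "elts (\<phi> a) = \<phi> ` {b. (b, a) \<in> r - Id}" for a
    by (subst unf, rule elts_vset, rule sm) (use rA in auto)
  have trn: "z \<in> elts (\<phi> a)" if "y \<in> elts (\<phi> a)" "z \<in> elts y" for a y z
  proof -
    from that obtain b c where b: "y = \<phi> b" "(b, a) \<in> r" "b \<noteq> a" and c: "z = \<phi> c" "(c, b) \<in> r" "c \<noteq> b"
      unfolding el by (auto simp: el)
    then have "(c, a) \<in> r" "c \<noteq> a" using tr anti by (blast dest: transD antisymD)+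
    then show ?thesis using c by (auto simp: el)
  qed
  have O: "Ord (\<phi> a)" for a
  proof -
    have "elts y \<subseteq> elts (\<phi> a)" if "y \<in> elts (\<phi> a)" for y using trn that by blast
    moreover have "elts z \<subseteq> elts y" if y: "y \<in> elts (\<phi> a)" and z: "z \<in> elts y" for y z
    proof -
      obtain b where "y = \<phi> b" using y unfolding el by blast
      then show ?thesis using trn z by blast
    qed
    ultimately show ?thesis unfolding Ord_def by blast
  qed
  have inj: "inj_on \<phi> A"
  proof (rule inj_onI, rule ccontr)
    fix a b assume ab: "a \<in> A" "b \<in> A" "\<phi> a = \<phi> b" "a \<noteq> b"
    then have "(a, b) \<in> r - Id \<or> (b, a) \<in> r - Id" using tot by (auto simp: total_on_def)
    then have "\<phi> a \<in> elts (\<phi> b) \<or> \<phi> b \<in> elts (\<phi> a)" unfolding el by blast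
    then show False using ab(3) mem_not_refl by metis
  qed
  define \<mu> where "\<mu> = vset (\<phi> ` A)"
  have e\<mu>: "elts \<mu> = \<phi> ` A" unfolding \<mu>_def by (rule elts_vset[OF sm]) simp
  have "elts (\<phi> a) \<subseteq> \<phi> ` A" for a unfolding el using rA by blast
  then have "Ord \<mu>" unfolding Ord_def e\<mu> using O by (auto simp: Ord_def)
  moreover have "bij_betw \<phi> A (elts \<mu>)" using inj by (simp add: bij_betw_def e\<mu>)
  ultimately show ?thesis by blast
qed

lemma small_cardinal:
  fixes A :: "'a set"
  assumes "small TYPE('v::zfc_universe) A"
  shows "\<exists>\<kappa> f. Card (\<kappa>::'v) \<and> bij_betw f A (elts \<kappa>)"
proof -
  define E where "E = {\<mu>::'v. Ord \<mu> \<and> (\<exists>f. bij_betw f A (elts \<mu>))}"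
  have "E \<noteq> {}" using small_ordinal[OF assms] by (auto simp: E_def)
  then obtain \<kappa> where \<kappa>: "\<kappa> \<in> E" "\<And>y. y \<in> elts \<kappa> \<Longrightarrow> y \<notin> E"
    using wfE_min[OF foundation, of _ E] by (metis ex_in_conv case_prodI mem_Collect_eq)
  have "\<nexists>f. bij_betw f (elts \<beta>) (elts \<kappa>)" if b: "\<beta> \<in> elts \<kappa>" for \<beta>
  proof
    assume "\<exists>f. bij_betw f (elts \<beta>) (elts \<kappa>)"
    then have "\<exists>f. bij_betw f (elts \<kappa>) (elts \<beta>)" using bij_betw_inv by blast
    then have "\<exists>f. bij_betw f A (elts \<beta>)" using \<kappa>(1) bij_betw_trans unfolding E_def by blast
    then have "\<beta> \<in> E" using \<kappa>(1) b Ord_mem unfolding E_def by blast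
    then show False using \<kappa>(2) b by blast
  qed
  then show ?thesis using \<kappa>(1) unfolding E_def Card_def by blast
qed

text \<open>A \<in>-minimal cardinal with the partition property would be
  \<kappa>(\<omega>).\<close>

lemma not_arrows_omega:
  assumes "\<nexists>\<kappa> :: 'v::zfc_universe. is_kappa_omega \<kappa>"
  shows "Card (\<kappa>::'v) \<Longrightarrow> \<not> arrows_omega \<kappa>"
proof (induction \<kappa> rule: mem_induct)
  case (1 \<kappa>)
  then show ?case using assms unfolding is_kappa_omega_def by blast
qed

section \<open>The forcing relation\<close>

definition dense_below :: "'v::zfc_universe forcing \<Rightarrow> ('v \<Rightarrow> bool) \<Rightarrow> 'v \<Rightarrow> bool" where
  "dense_below F A p \<longleftrightarrow> (\<forall>q\<in>below F p. \<exists>r\<in>below F q. A r)"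

definition upn :: "'v::zfc_universe forcing \<Rightarrow> 'v \<Rightarrow> 'v \<Rightarrow> 'v" where
  "upn F a b = vset {opair a (Top F), opair b (Top F)}"

definition opn :: "'v::zfc_universe forcing \<Rightarrow> 'v \<Rightarrow> 'v \<Rightarrow> 'v" where
  "opn F a b = upn F (upn F a a) (upn F a b)"

text \<open>Binders are arbitrary HOL functions on names, which may tell names apart that are forced
  to be equal. Substitution of equals therefore cannot be proved once for all formulas; it is a
  property to be derived for each concrete one.\<close>

definition extensional :: "'v::zfc_universe forcing \<Rightarrow> ('v \<Rightarrow> 'v fm) \<Rightarrow> bool" where
  "extensional F \<phi> \<longleftrightarrow> (\<forall>x y. \<forall>p\<in>elts (Cond F). is_name F x \<longrightarrow> is_name F y \<longrightarrow> forces_eq F x y p \<longrightarrow>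
     forces F (\<phi> x) p \<longrightarrow> forces F (\<phi> y) p)"

text \<open>Every name needed below has only check names as elements; \<open>R u r\<close> says that \<open>r\<close> puts
  the check name of \<open>u\<close> into \<open>N\<close>.\<close>

definition relname :: "'v::zfc_universe forcing \<Rightarrow> 'v \<Rightarrow> ('v \<Rightarrow> 'v \<Rightarrow> bool) \<Rightarrow> bool" where
  "relname F N R \<longleftrightarrow>
    (\<forall>v\<in>elts N. \<exists>u. \<exists>s\<in>elts (Cond F). v = opair (check F u) s) \<and>
    (\<forall>r\<in>elts (Cond F). \<forall>u. R u r \<longleftrightarrow> (\<exists>s. opair (check F u) s \<in> elts N \<and> r \<in> below F s))"

locale forcing =
  fixes F :: "'v::zfc_universe forcing"
  assumes forcing_notion: "forcing_notion F"
begin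

abbreviation C where "C \<equiv> elts (Cond F)"

lemma below_C: "q \<in> below F p \<Longrightarrow> q \<in> C"
  by (simp add: below_def)

lemma below_refl: "p \<in> C \<Longrightarrow> p \<in> below F p"
  using forcing_notion by (auto simp: below_def forcing_notion_def)

lemma below_trans: "p \<in> C \<Longrightarrow> q \<in> below F p \<Longrightarrow> r \<in> below F q \<Longrightarrow> r \<in> below F p"
  using forcing_notion unfolding below_def forcing_notion_def by blast

lemma Top_C: "Top F \<in> C"
  using forcing_notion unfolding forcing_notion_def by blast

lemma below_Top: "p \<in> C \<Longrightarrow> p \<in> below F (Top F)"
  using forcing_notion unfolding below_def forcing_notion_def by blast

lemma dense_belowI: "(\<And>q. q \<in> below F p \<Longrightarrow> q \<in> C \<Longrightarrow> \<exists>r\<in>below F q. A r) \<Longrightarrow> dense_below F A p"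
  unfolding dense_below_def using below_C by blast

lemma dense_belowD: "dense_below F A p \<Longrightarrow> q \<in> below F p \<Longrightarrow> \<exists>r\<in>below F q. r \<in> C \<and> A r"
  unfolding dense_below_def using below_C by blast

lemma dense_below_mono: "dense_below F A p \<Longrightarrow> p \<in> C \<Longrightarrow> q \<in> below F p \<Longrightarrow> dense_below F A q"
  unfolding dense_below_def using below_trans by blast

lemma dense_below_weaken: "dense_below F A p \<Longrightarrow> (\<And>r. r \<in> C \<Longrightarrow> r \<in> below F p \<Longrightarrow> A r \<Longrightarrow> B r) \<Longrightarrow> p \<in> C \<Longrightarrow> dense_below F B p"
  unfolding dense_below_def using below_trans below_C by meson

lemma dense_below_all: "p \<in> C \<Longrightarrow> (\<And>q. q \<in> below F p \<Longrightarrow> q \<in> C \<Longrightarrow> A q) \<Longrightarrow> dense_below F A p"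
  unfolding dense_below_def using below_refl below_C by blast

lemma dense_below_dense: "p \<in> C \<Longrightarrow> dense_below F (dense_below F A) p \<Longrightarrow> dense_below F A p"
  unfolding dense_below_def using below_trans below_refl below_C by meson

lemma is_nameD: "is_name F x \<Longrightarrow> opair z s \<in> elts x \<Longrightarrow> is_name F z \<and> s \<in> C"
  by (erule is_name.cases) (metis opair_iff)

lemma forces_eqD1: "forces_eq F x y p \<Longrightarrow> opair z s \<in> elts x \<Longrightarrow> q \<in> below F p \<Longrightarrow> q \<in> below F s \<Longrightarrow>
   \<exists>r\<in>below F q. \<exists>z' s'. opair z' s' \<in> elts y \<and> r \<in> below F s' \<and> forces_eq F z z' r"
  by (erule forces_eq.cases) simp

lemma forces_eqD2: "forces_eq F x y p \<Longrightarrow> opair z' s' \<in> elts y \<Longrightarrow> q \<in> below F p \<Longrightarrow> q \<in> below F s' \<Longrightarrow>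
   \<exists>r\<in>below F q. \<exists>z s. opair z s \<in> elts x \<and> r \<in> below F s \<and> forces_eq F z z' r"
  by (erule forces_eq.cases) simp

lemma forces_eq_mono: "forces_eq F x y p \<Longrightarrow> p \<in> C \<Longrightarrow> q \<in> below F p \<Longrightarrow> forces_eq F x y q"
  by (rule forces_eq.intros) (meson below_trans forces_eqD1 forces_eqD2)+

lemma forces_eq_refl: "is_name F x \<Longrightarrow> forces_eq F x x p"
proof -
  assume "is_name F x"
  then have "\<forall>p. forces_eq F x x p"
  proof (induction rule: is_name.induct)
    case IH: (1 x)
    show ?case
    proof (intro allI forces_eq.intros)
      fix p z s q assume z: "opair z s \<in> elts x" and q: "q \<in> below F p" "q \<in> below F s"
      have "forces_eq F z z q" using IH[OF z] by auto
      then show "\<exists>r\<in>below F q. \<exists>z' s'. opair z' s' \<in> elts x \<and> r \<in> below F s' \<and> forces_eq F z z' r"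
        "\<exists>r\<in>below F q. \<exists>z' s'. opair z' s' \<in> elts x \<and> r \<in> below F s' \<and> forces_eq F z' z r"
        using z q below_refl below_C by blast+
    qed
  qed
  then show ?thesis by blast
qed

lemma forces_eq_sym: "forces_eq F x y p \<Longrightarrow> forces_eq F y x p"
proof (induction rule: forces_eq.induct)
  case (1 x p y)
  show ?case by (rule forces_eq.intros) (use 1 in meson)+
qed

text \<open>The second equality is assumed only at \<open>q\<close> below \<open>p\<close> because
  in the induction the partner in \<open>w\<close> of an element of \<open>y\<close> appears only at
  a stronger condition than the partner in \<open>y\<close> of an element of
  \<open>x\<close>.\<close>

lemma forces_eq_trans_below: "forces_eq F x y p \<Longrightarrow> p \<in> C \<Longrightarrow> q \<in> below F p \<Longrightarrow> forces_eq F y w q \<Longrightarrow> forces_eq F x w q"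
proof (induction arbitrary: q w rule: forces_eq.induct)
  case (1 x p y)
  note p = \<open>p \<in> C\<close> and q = \<open>q \<in> below F p\<close> and yw = \<open>forces_eq F y w q\<close>
  show ?case
  proof (rule forces_eq.intros)
    fix z s q' assume z: "opair z s \<in> elts x" and q': "q' \<in> below F q" "q' \<in> below F s"
    have "q' \<in> below F p" using below_trans[OF p q q'(1)] .
    from 1(1)[OF z this q'(2)] obtain r z' s' where r: "r \<in> below F q'" "opair z' s' \<in> elts y" "r \<in> below F s'"
      and IH: "\<And>q'' w. r \<in> C \<Longrightarrow> q'' \<in> below F r \<Longrightarrow> forces_eq F z' w q'' \<Longrightarrow> forces_eq F z w q''" by blast
    have rq: "r \<in> below F q" using below_trans[OF below_C[OF q] q'(1) r(1)] .
    from forces_eqD1[OF yw r(2) rq r(3)] obtain r' z'' s'' where r': "r' \<in> below F r" "opair z'' s'' \<in> elts w"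
      "r' \<in> below F s''" "forces_eq F z' z'' r'" by blast
    have "forces_eq F z z'' r'" by (rule IH[OF below_C[OF r(1)] r'(1,4)])
    then show "\<exists>r\<in>below F q'. \<exists>z' s'. opair z' s' \<in> elts w \<and> r \<in> below F s' \<and> forces_eq F z z' r"
      using r' below_trans[OF below_C[OF q'(1)] r(1) r'(1)] by blast
  next
    fix z'' s'' q' assume z: "opair z'' s'' \<in> elts w" and q': "q' \<in> below F q" "q' \<in> below F s''"
    from forces_eqD2[OF yw z q'] obtain r z' s' where r: "r \<in> below F q'" "opair z' s' \<in> elts y" "r \<in> below F s'"
      "forces_eq F z' z'' r" by blast
    have rp: "r \<in> below F p" using below_trans[OF p q] below_trans[OF below_C[OF q] q'(1) r(1)] by blast
    from 1(2)[OF r(2) rp r(3)] obtain r' z s where r': "r' \<in> below F r" "opair z s \<in> elts x" "r' \<in> below F s"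
      and IH: "\<And>q'' w. r' \<in> C \<Longrightarrow> q'' \<in> below F r' \<Longrightarrow> forces_eq F z' w q'' \<Longrightarrow> forces_eq F z w q''" by blast
    have r'C: "r' \<in> C" using r'(1) below_C by blast
    have "forces_eq F z z'' r'"
      by (rule IH[OF r'C below_refl[OF r'C]]) (rule forces_eq_mono[OF r(4) below_C[OF r(1)] r'(1)])
    then show "\<exists>r\<in>below F q'. \<exists>z s. opair z s \<in> elts x \<and> r \<in> below F s \<and> forces_eq F z z'' r"
      using r' below_trans[OF below_C[OF q'(1)] r(1) r'(1)] by blast
  qed
qed

lemma forces_eq_trans: "forces_eq F x y p \<Longrightarrow> forces_eq F y z p \<Longrightarrow> p \<in> C \<Longrightarrow> forces_eq F x z p"
  by (rule forces_eq_trans_below) (auto intro: below_refl)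

lemma forces_eq_dense: "dense_below F (forces_eq F x y) p \<Longrightarrow> p \<in> C \<Longrightarrow> is_name F x \<Longrightarrow> is_name F y \<Longrightarrow> forces_eq F x y p"
proof (rule forces_eq.intros)
  fix z s q assume a: "dense_below F (forces_eq F x y) p" "p \<in> C" "is_name F x" "opair z s \<in> elts x" "q \<in> below F p" "q \<in> below F s"
  then obtain r where r: "r \<in> below F q" "r \<in> C" "forces_eq F x y r" using dense_belowD by blast
  have "r \<in> below F s" using below_trans[OF _ a(6) r(1)] is_nameD[OF a(3,4)] by blast
  from forces_eqD1[OF r(3) a(4) below_refl[OF r(2)] this]
  show "\<exists>r\<in>below F q. \<exists>z' s'. opair z' s' \<in> elts y \<and> r \<in> below F s' \<and> forces_eq F z z' r"
    using below_trans[OF below_C[OF a(5)] r(1)] by blast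
next
  fix z s q assume a: "dense_below F (forces_eq F x y) p" "p \<in> C" "is_name F y" "opair z s \<in> elts y" "q \<in> below F p" "q \<in> below F s"
  then obtain r where r: "r \<in> below F q" "r \<in> C" "forces_eq F x y r" using dense_belowD by blast
  have "r \<in> below F s" using below_trans[OF _ a(6) r(1)] is_nameD[OF a(3,4)] by blast
  from forces_eqD2[OF r(3) a(4) below_refl[OF r(2)] this]
  show "\<exists>r\<in>below F q. \<exists>z' s'. opair z' s' \<in> elts x \<and> r \<in> below F s' \<and> forces_eq F z' z r"
    using below_trans[OF below_C[OF a(5)] r(1)] by blast
qed

lemma forces_mem: "forces F (x \<^bold>\<in> y) p \<longleftrightarrow>
   dense_below F (\<lambda>r. \<exists>z s. opair z s \<in> elts y \<and> r \<in> below F s \<and> forces_eq F x z r) p"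
  by (simp add: dense_below_def)

text \<open>Names are required here because the element conditions of an arbitrary set need not lie in the
  forcing notion, where transitivity could fail. Only formulas whose parameters are names occur below.\<close>

inductive named :: "'v fm \<Rightarrow> bool" where
  "is_name F x \<Longrightarrow> is_name F y \<Longrightarrow> named (x \<^bold>\<in> y)"
| "is_name F x \<Longrightarrow> is_name F y \<Longrightarrow> named (x \<^bold>= y)"
| "named \<phi> \<Longrightarrow> named (\<^bold>\<not> \<phi>)"
| "named \<phi> \<Longrightarrow> named \<psi> \<Longrightarrow> named (\<phi> \<^bold>\<and> \<psi>)"
| "(\<And>x. is_name F x \<Longrightarrow> named (\<phi> x)) \<Longrightarrow> named (FAll \<phi>)"

lemma forces_mono: "forces F \<phi> p \<Longrightarrow> p \<in> C \<Longrightarrow> q \<in> below F p \<Longrightarrow> forces F \<phi> q"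
proof (induction \<phi>)
  case (FMem x y)
  then show ?case unfolding forces_mem by (rule dense_below_mono)
next
  case (FEq x y)
  then show ?case by (auto intro: forces_eq_mono)
next
  case (FNot \<phi>)
  then show ?case using below_trans by auto
qed auto

lemma forces_dense: "named \<phi> \<Longrightarrow> dense_below F (forces F \<phi>) p \<Longrightarrow> p \<in> C \<Longrightarrow> forces F \<phi> p"
proof (induction arbitrary: p rule: named.induct)
  case (1 x y)
  have "dense_below F (dense_below F (\<lambda>r. \<exists>z s. opair z s \<in> elts y \<and> r \<in> below F s \<and> forces_eq F x z r)) p"
    by (rule dense_below_weaken[OF 1(3) _ 1(4)]) (simp only: forces_mem)
  then show ?case unfolding forces_mem by (rule dense_below_dense[OF 1(4)])
next
  case (2 x y)
  have "dense_below F (forces_eq F x y) p" using 2(3) by (simp add: dense_below_def)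
  then show ?case using forces_eq_dense 2 by simp
next
  case (3 \<phi>)
  show ?case
  proof (simp, intro ballI notI)
    fix q assume q: "q \<in> below F p" "forces F \<phi> q"
    obtain r where r: "r \<in> below F q" "r \<in> C" "forces F (\<^bold>\<not> \<phi>) r" using dense_belowD[OF 3(3) q(1)] by blast
    then show False using forces_mono[OF q(2) below_C[OF q(1)] r(1)] below_refl by auto
  qed
next
  case (4 \<phi> \<psi>)
  have "dense_below F (forces F \<phi>) p" "dense_below F (forces F \<psi>) p"
    by (rule dense_below_weaken[OF 4(5) _ 4(6)], simp)+
  then show ?case using 4(3,4)[OF _ 4(6)] by simp
next
  case (5 \<phi>)
  have "forces F (\<phi> x) p" if "is_name F x" for x
    by (rule 5(2)[OF that _ 5(4)], rule dense_below_weaken[OF 5(3) _ 5(4)]) (use that in simp)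
  then show ?case by simp
qed

lemma forces_FOr: "p \<in> C \<Longrightarrow> forces F (\<phi> \<^bold>\<or> \<psi>) p \<longleftrightarrow> dense_below F (\<lambda>r. forces F \<phi> r \<or> forces F \<psi> r) p"
  unfolding FOr_def dense_below_def forces.simps by (meson below_C below_refl below_trans)

text \<open>Implication is defined through negation, so unfolding it yields only densely many
  conditions forcing \<open>\<psi>\<close>; \<open>forces_dense\<close> closes this gap and is the
  reason why \<open>\<psi>\<close> has to be \<open>named\<close>.\<close>

lemma forces_FImp: "named \<psi> \<Longrightarrow> p \<in> C \<Longrightarrow> forces F (\<phi> \<^bold>\<longrightarrow> \<psi>) p \<longleftrightarrow> (\<forall>q\<in>below F p. forces F \<phi> q \<longrightarrow> forces F \<psi> q)"
proof
  assume n: "named \<psi>" and p: "p \<in> C" and f: "forces F (\<phi> \<^bold>\<longrightarrow> \<psi>) p"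
  show "\<forall>q\<in>below F p. forces F \<phi> q \<longrightarrow> forces F \<psi> q"
  proof (intro ballI impI)
    fix q assume q: "q \<in> below F p" "forces F \<phi> q"
    have "\<exists>s\<in>below F r. forces F \<psi> s" if "r \<in> below F q" for r
      using f forces_mono[OF q(2) below_C[OF q(1)] that] below_trans[OF p q(1) that]
      unfolding FImp_def forces.simps by blast
    then show "forces F \<psi> q" by (intro forces_dense[OF n _ below_C[OF q(1)]]) (auto simp: dense_below_def)
  qed
next
  assume n: "named \<psi>" and p: "p \<in> C" and f: "\<forall>q\<in>below F p. forces F \<phi> q \<longrightarrow> forces F \<psi> q"
  then show "forces F (\<phi> \<^bold>\<longrightarrow> \<psi>) p"
    unfolding FImp_def forces.simps by (meson below_C below_refl)
qed

lemma forces_FEx: "forces F (FEx \<phi>) p \<longleftrightarrow> dense_below F (\<lambda>r. \<exists>x. is_name F x \<and> forces F (\<phi> x) r) p"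
  unfolding FEx_def forces.simps dense_below_def by blast

lemma named_FOr [intro]: "named \<phi> \<Longrightarrow> named \<psi> \<Longrightarrow> named (\<phi> \<^bold>\<or> \<psi>)"
  unfolding FOr_def by (intro named.intros)

lemma named_FImp [intro]: "named \<phi> \<Longrightarrow> named \<psi> \<Longrightarrow> named (\<phi> \<^bold>\<longrightarrow> \<psi>)"
  unfolding FImp_def by (intro named.intros)

lemma named_FIff [intro]: "named \<phi> \<Longrightarrow> named \<psi> \<Longrightarrow> named (\<phi> \<^bold>\<longleftrightarrow> \<psi>)"
  unfolding FIff_def by (intro named.intros named_FImp)

lemma named_FEx [intro]: "(\<And>x. is_name F x \<Longrightarrow> named (\<phi> x)) \<Longrightarrow> named (FEx \<phi>)"
  unfolding FEx_def by (intro named.intros)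

lemmas named_intros = named.intros named_FOr named_FImp named_FIff named_FEx

lemma forces_FIff: "named \<phi> \<Longrightarrow> named \<psi> \<Longrightarrow> p \<in> C \<Longrightarrow>
   forces F (\<phi> \<^bold>\<longleftrightarrow> \<psi>) p \<longleftrightarrow> (\<forall>q\<in>below F p. forces F \<phi> q \<longleftrightarrow> forces F \<psi> q)"
  unfolding FIff_def by (auto simp: forces_FImp)

subsection \<open>Substitution of equals\<close>

lemma extensional_mem_left: "extensional F (\<lambda>x. x \<^bold>\<in> t)"
  unfolding extensional_def forces_mem
proof (intro allI ballI impI)
  fix x y p assume a: "p \<in> C" "forces_eq F x y p"
    "dense_below F (\<lambda>r. \<exists>z s. opair z s \<in> elts t \<and> r \<in> below F s \<and> forces_eq F x z r) p"
  show "dense_below F (\<lambda>r. \<exists>z s. opair z s \<in> elts t \<and> r \<in> below F s \<and> forces_eq F y z r) p"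
  proof (rule dense_below_weaken[OF a(3) _ a(1)])
    fix r assume r: "r \<in> C" "r \<in> below F p"
    have "forces_eq F y x r" using forces_eq_sym[OF forces_eq_mono[OF a(2,1) r(2)]] .
    then show "\<exists>z s. opair z s \<in> elts t \<and> r \<in> below F s \<and> forces_eq F x z r \<Longrightarrow>
      \<exists>z s. opair z s \<in> elts t \<and> r \<in> below F s \<and> forces_eq F y z r"
      using forces_eq_trans r(1) by blast
  qed
qed

lemma forces_mem_right: "forces_eq F y y' p \<Longrightarrow> p \<in> C \<Longrightarrow> forces F (x \<^bold>\<in> y) p \<Longrightarrow> forces F (x \<^bold>\<in> y') p"
  unfolding forces_mem
proof (rule dense_belowI)
  fix q assume a: "forces_eq F y y' p" "p \<in> C"
    "dense_below F (\<lambda>r. \<exists>z s. opair z s \<in> elts y \<and> r \<in> below F s \<and> forces_eq F x z r) p" "q \<in> below F p" "q \<in> C"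
  then obtain r z s where r: "r \<in> below F q" "r \<in> C" "opair z s \<in> elts y" "r \<in> below F s" "forces_eq F x z r"
    using dense_belowD[OF a(3,4)] by blast
  have "r \<in> below F p" using below_trans a(2,4) r(1) by blast
  from forces_eqD1[OF a(1) r(3) this r(4)] obtain r' z' s' where r': "r' \<in> below F r" "opair z' s' \<in> elts y'"
    "r' \<in> below F s'" "forces_eq F z z' r'" by blast
  have "forces_eq F x z' r'"
    using forces_eq_trans[OF forces_eq_mono[OF r(5) r(2) r'(1)] r'(4)] below_C[OF r'(1)] by blast
  then show "\<exists>r\<in>below F q. \<exists>z s. opair z s \<in> elts y' \<and> r \<in> below F s \<and> forces_eq F x z r"
    using r' below_trans[OF a(5) r(1) r'(1)] by blast
qed

lemma extensional_mem_right: "extensional F (\<lambda>x. t \<^bold>\<in> x)"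
  unfolding extensional_def using forces_mem_right by blast

lemma extensional_eq_left: "extensional F (\<lambda>x. x \<^bold>= t)"
  unfolding extensional_def forces.simps using forces_eq_sym forces_eq_trans by blast

lemma extensional_eq_right: "extensional F (\<lambda>x. t \<^bold>= x)"
  unfolding extensional_def forces.simps using forces_eq_trans by blast

lemma extensional_const: "extensional F (\<lambda>x. \<phi>)"
  unfolding extensional_def by blast

lemma extensional_not: "extensional F \<phi> \<Longrightarrow> extensional F (\<lambda>x. \<^bold>\<not> \<phi> x)"
  unfolding extensional_def forces.simps using below_C forces_eq_mono forces_eq_sym by blast

lemma extensional_and: "extensional F \<phi> \<Longrightarrow> extensional F \<psi> \<Longrightarrow> extensional F (\<lambda>x. \<phi> x \<^bold>\<and> \<psi> x)"
  unfolding extensional_def by auto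

lemma extensional_all: "(\<And>z. extensional F (\<lambda>x. \<phi> x z)) \<Longrightarrow> extensional F (\<lambda>x. FAll (\<phi> x))"
  unfolding extensional_def by auto

lemma extensional_or: "extensional F \<phi> \<Longrightarrow> extensional F \<psi> \<Longrightarrow> extensional F (\<lambda>x. \<phi> x \<^bold>\<or> \<psi> x)"
  unfolding FOr_def by (intro extensional_not extensional_and)

lemma extensional_imp: "extensional F \<phi> \<Longrightarrow> extensional F \<psi> \<Longrightarrow> extensional F (\<lambda>x. \<phi> x \<^bold>\<longrightarrow> \<psi> x)"
  unfolding FImp_def by (intro extensional_not extensional_and)

lemma extensional_iff: "extensional F \<phi> \<Longrightarrow> extensional F \<psi> \<Longrightarrow> extensional F (\<lambda>x. \<phi> x \<^bold>\<longleftrightarrow> \<psi> x)"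
  unfolding FIff_def by (intro extensional_imp extensional_and)

lemma extensional_ex: "(\<And>z. extensional F (\<lambda>x. \<phi> x z)) \<Longrightarrow> extensional F (\<lambda>x. FEx (\<phi> x))"
  unfolding FEx_def by (intro extensional_not extensional_all)

lemmas extensional_intros = extensional_const extensional_mem_left extensional_mem_right extensional_eq_left
  extensional_eq_right extensional_not extensional_and extensional_all extensional_or extensional_imp
  extensional_iff extensional_ex

lemma extensionalD: "extensional F \<phi> \<Longrightarrow> forces_eq F x y p \<Longrightarrow> is_name F x \<Longrightarrow> is_name F y \<Longrightarrow> p \<in> C \<Longrightarrow>
   forces F (\<phi> x) p \<longleftrightarrow> forces F (\<phi> y) p"
  unfolding extensional_def using forces_eq_sym by blast

lemma forces_eqI:
  assumes "is_name F x" "is_name F y" "p \<in> C"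
    and "\<And>z q. is_name F z \<Longrightarrow> q \<in> below F p \<Longrightarrow> q \<in> C \<Longrightarrow> forces F (z \<^bold>\<in> x) q \<longleftrightarrow> forces F (z \<^bold>\<in> y) q"
  shows "forces_eq F x y p"
proof -
  have *: "forces F (z \<^bold>\<in> x) q" if "is_name F x" "opair z s \<in> elts x" "q \<in> below F s" for x z s q
    unfolding forces_mem
  proof (rule dense_belowI)
    fix r assume r: "r \<in> below F q" "r \<in> C"
    have "r \<in> below F s" using below_trans[OF _ that(3) r(1)] is_nameD[OF that(1,2)] by blast
    moreover have "forces_eq F z z r" using is_nameD[OF that(1,2)] forces_eq_refl by blast
    ultimately show "\<exists>r\<in>below F r. \<exists>z' s. opair z' s \<in> elts x \<and> r \<in> below F s \<and> forces_eq F z z' r"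
      using that(2) below_refl[OF r(2)] by blast
  qed
  show ?thesis
  proof (rule forces_eq.intros)
    fix z s q assume z: "opair z s \<in> elts x" "q \<in> below F p" "q \<in> below F s"
    have "forces F (z \<^bold>\<in> y) q" using *[OF assms(1) z(1,3)] assms(4)[OF _ z(2) below_C[OF z(2)]] is_nameD[OF assms(1) z(1)] by blast
    then show "\<exists>r\<in>below F q. \<exists>z' s'. opair z' s' \<in> elts y \<and> r \<in> below F s' \<and> forces_eq F z z' r"
      unfolding forces_mem dense_below_def using below_refl[OF below_C[OF z(2)]] by blast
  next
    fix z s q assume z: "opair z s \<in> elts y" "q \<in> below F p" "q \<in> below F s"
    have "forces F (z \<^bold>\<in> x) q" using *[OF assms(2) z(1,3)] assms(4)[OF _ z(2) below_C[OF z(2)]] is_nameD[OF assms(2) z(1)] by blast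
    then show "\<exists>r\<in>below F q. \<exists>z' s'. opair z' s' \<in> elts x \<and> r \<in> below F s' \<and> forces_eq F z' z r"
      unfolding forces_mem dense_below_def using below_refl[OF below_C[OF z(2)]] forces_eq_sym by blast
  qed
qed

subsection \<open>Pairs and check names\<close>

lemma elts_upn: "elts (upn F a b) = {opair a (Top F), opair b (Top F)}"
  by (simp add: upn_def elts_vset_upair)

lemma is_name_upn [simp, intro]: "is_name F a \<Longrightarrow> is_name F b \<Longrightarrow> is_name F (upn F a b)"
  by (rule is_name.intros) (auto simp: elts_upn Top_C)

lemma is_name_opn [simp, intro]: "is_name F a \<Longrightarrow> is_name F b \<Longrightarrow> is_name F (opn F a b)"
  by (simp add: opn_def)

lemma forces_mem_upn: "p \<in> C \<Longrightarrow> forces F (z \<^bold>\<in> upn F a b) p \<longleftrightarrow> dense_below F (\<lambda>r. forces_eq F z a r \<or> forces_eq F z b r) p"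
  unfolding forces_mem elts_upn
  by (rule iffI; erule dense_below_weaken) (auto intro: below_Top)

lemma forces_is_upair: "is_name F u \<Longrightarrow> is_name F a \<Longrightarrow> is_name F b \<Longrightarrow> p \<in> C \<Longrightarrow>
   forces F (is_upair u a b) p \<longleftrightarrow> forces_eq F u (upn F a b) p"
proof
  assume n: "is_name F u" "is_name F a" "is_name F b" and p: "p \<in> C"
  have *: "forces F (is_upair u a b) p \<longleftrightarrow> (\<forall>z. is_name F z \<longrightarrow>
      (\<forall>q\<in>below F p. forces F (z \<^bold>\<in> u) q \<longleftrightarrow> forces F (z \<^bold>\<in> upn F a b) q))"
    unfolding is_upair_def using n p
    by (simp add: forces_FIff named_intros forces_FOr forces_mem_upn below_C del: forces.simps(1))
  { assume "forces F (is_upair u a b) p"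
    then show "forces_eq F u (upn F a b) p" unfolding * using n p by (intro forces_eqI) auto }
  { assume e: "forces_eq F u (upn F a b) p"
    show "forces F (is_upair u a b) p" unfolding *
      using extensionalD[OF extensional_mem_right forces_eq_mono[OF e p]] n below_C by blast }
qed

lemma upn_cong: "forces_eq F a a' p \<Longrightarrow> forces_eq F b b' p \<Longrightarrow> is_name F a \<Longrightarrow> is_name F b \<Longrightarrow> is_name F a' \<Longrightarrow> is_name F b'
   \<Longrightarrow> p \<in> C \<Longrightarrow> forces_eq F (upn F a b) (upn F a' b') p"
proof -
  assume a: "forces_eq F a a' p" "forces_eq F b b' p" "is_name F a" "is_name F b" "is_name F a'" "is_name F b'" "p \<in> C"
  have e1: "extensional F (\<lambda>x. is_upair u x b)" for u unfolding is_upair_def by (intro extensional_intros)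
  have e2: "extensional F (\<lambda>y. is_upair u x y)" for u x unfolding is_upair_def by (intro extensional_intros)
  have "forces F (is_upair (upn F a b) a b) p" using a by (simp add: forces_is_upair forces_eq_refl)
  then have "forces F (is_upair (upn F a b) a' b) p" using extensionalD[OF e1 a(1)] a by blast
  then have "forces F (is_upair (upn F a b) a' b') p" using extensionalD[OF e2 a(2)] a by blast
  then show ?thesis using a by (simp add: forces_is_upair)
qed

lemma opn_cong: "forces_eq F a a' p \<Longrightarrow> forces_eq F b b' p \<Longrightarrow> is_name F a \<Longrightarrow> is_name F b \<Longrightarrow> is_name F a' \<Longrightarrow> is_name F b'
   \<Longrightarrow> p \<in> C \<Longrightarrow> forces_eq F (opn F a b) (opn F a' b') p"
  unfolding opn_def by (simp add: upn_cong)

text \<open>Which of the two ways of matching is realised may depend on the generic filter, so only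
  a dense disjunction can be concluded.\<close>

lemma upn_inject:
  assumes e: "forces_eq F (upn F a b) (upn F c d) p" and n: "is_name F a" "is_name F b" "is_name F c" "is_name F d" and p: "p \<in> C"
  shows "dense_below F (\<lambda>r. (forces_eq F a c r \<and> forces_eq F b d r) \<or> (forces_eq F a d r \<and> forces_eq F b c r)) p"
proof (rule dense_belowI)
  fix q assume q: "q \<in> below F p" "q \<in> C"
  have m: "forces F (a \<^bold>\<in> upn F a b) p" "forces F (b \<^bold>\<in> upn F a b) p" "forces F (c \<^bold>\<in> upn F c d) p" "forces F (d \<^bold>\<in> upn F c d) p"
    using n p by (auto simp: forces_mem_upn intro!: dense_below_all forces_eq_refl simp del: forces.simps)
  have "forces F (a \<^bold>\<in> upn F c d) p" "forces F (b \<^bold>\<in> upn F c d) p" "forces F (c \<^bold>\<in> upn F a b) p" "forces F (d \<^bold>\<in> upn F a b) p"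
    using m forces_mem_right[OF e p] forces_mem_right[OF forces_eq_sym[OF e] p] by blast+
  then have d: "dense_below F (\<lambda>r. forces_eq F a c r \<or> forces_eq F a d r) p" "dense_below F (\<lambda>r. forces_eq F b c r \<or> forces_eq F b d r) p"
     "dense_below F (\<lambda>r. forces_eq F c a r \<or> forces_eq F c b r) p" "dense_below F (\<lambda>r. forces_eq F d a r \<or> forces_eq F d b r) p"
    using p by (simp_all add: forces_mem_upn del: forces.simps)
  obtain r1 where r1: "r1 \<in> below F q" "r1 \<in> C" "forces_eq F a c r1 \<or> forces_eq F a d r1" using dense_belowD[OF d(1) q(1)] by blast
  have b1: "r1 \<in> below F p" using below_trans p q(1) r1(1) by blast
  obtain r2 where r2: "r2 \<in> below F r1" "r2 \<in> C" "forces_eq F b c r2 \<or> forces_eq F b d r2" using dense_belowD[OF d(2) b1] by blast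
  have b2: "r2 \<in> below F p" using below_trans p b1 r2(1) by blast
  obtain r3 where r3: "r3 \<in> below F r2" "r3 \<in> C" "forces_eq F c a r3 \<or> forces_eq F c b r3" using dense_belowD[OF d(3) b2] by blast
  have b3: "r3 \<in> below F p" using below_trans p b2 r3(1) by blast
  obtain r where r: "r \<in> below F r3" "r \<in> C" "forces_eq F d a r \<or> forces_eq F d b r" using dense_belowD[OF d(4) b3] by blast
  have rq: "r \<in> below F q" using below_trans q r1 r2 r3 r by blast
  have r3r: "forces_eq F c a r \<or> forces_eq F c b r" using r3 r forces_eq_mono by blast
  have r2r: "forces_eq F b c r \<or> forces_eq F b d r" using r2 r3 r forces_eq_mono by meson
  have r1r: "forces_eq F a c r \<or> forces_eq F a d r" using r1 r2 r3 r forces_eq_mono by meson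
  have "(forces_eq F a c r \<and> forces_eq F b d r) \<or> (forces_eq F a d r \<and> forces_eq F b c r)"
    using r1r r2r r3r r(2,3) forces_eq_sym forces_eq_trans by meson
  then show "\<exists>r\<in>below F q. (forces_eq F a c r \<and> forces_eq F b d r) \<or> (forces_eq F a d r \<and> forces_eq F b c r)"
    using rq by blast
qed

text \<open>Both alternatives of \<open>upn_inject\<close> lead to the same two equalities. These
  hold densely, and a forced equality that holds densely holds outright.\<close>

lemma opn_inject:
  assumes e: "forces_eq F (opn F a b) (opn F c d) p" and n: "is_name F a" "is_name F b" "is_name F c" "is_name F d" and p: "p \<in> C"
  shows "forces_eq F a c p \<and> forces_eq F b d p"
proof -
  have "dense_below F (\<lambda>r. forces_eq F a c r \<and> forces_eq F b d r) p"
  proof (rule dense_belowI)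
    fix q assume q: "q \<in> below F p" "q \<in> C"
    obtain r where r: "r \<in> below F q" "r \<in> C"
      "(forces_eq F (upn F a a) (upn F c c) r \<and> forces_eq F (upn F a b) (upn F c d) r) \<or>
       (forces_eq F (upn F a a) (upn F c d) r \<and> forces_eq F (upn F a b) (upn F c c) r)"
      using dense_belowD[OF upn_inject[OF e[unfolded opn_def]] q(1)] n p by (meson is_name_upn)
    from r(3) show "\<exists>r\<in>below F q. forces_eq F a c r \<and> forces_eq F b d r"
    proof (elim disjE conjE)
      assume u: "forces_eq F (upn F a a) (upn F c c) r" "forces_eq F (upn F a b) (upn F c d) r"
      obtain s where s: "s \<in> below F r" "s \<in> C" "forces_eq F a c s"
        using dense_belowD[OF upn_inject[OF u(1) n(1,1,3,3) r(2)] below_refl[OF r(2)]] by blast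
      obtain t where t: "t \<in> below F s" "t \<in> C" "(forces_eq F a c t \<and> forces_eq F b d t) \<or> (forces_eq F a d t \<and> forces_eq F b c t)"
        using dense_belowD[OF upn_inject[OF u(2) n r(2)] s(1)] by blast
      have "forces_eq F a c t" using forces_eq_mono s t by blast
      then have "forces_eq F a c t \<and> forces_eq F b d t" using t(2,3) forces_eq_sym forces_eq_trans by meson
      then show ?thesis using below_trans q r s t by meson
    next
      assume u: "forces_eq F (upn F a a) (upn F c d) r" "forces_eq F (upn F a b) (upn F c c) r"
      obtain s where s: "s \<in> below F r" "s \<in> C" "forces_eq F a c s \<and> forces_eq F a d s"
        using dense_belowD[OF upn_inject[OF u(1) n(1,1,3,4) r(2)] below_refl[OF r(2)]] by blast
      obtain t where t: "t \<in> below F s" "t \<in> C" "forces_eq F a c t \<and> forces_eq F b c t"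
        using dense_belowD[OF upn_inject[OF u(2) n(1,2,3,3) r(2)] s(1)] by blast
      have "forces_eq F a d t" using forces_eq_mono s t by blast
      then have "forces_eq F a c t \<and> forces_eq F b d t" using t(2,3) forces_eq_sym forces_eq_trans by meson
      then show ?thesis using below_trans q r s t by meson
    qed
  qed
  then show ?thesis using n p
    by (auto intro!: forces_eq_dense elim!: dense_below_weaken)
qed

lemma elts_check: "elts (check F x) = (\<lambda>y. opair (check F y) (Top F)) ` elts x"
  by (subst check.simps) (simp add: elts_vset is_set_image)

lemma is_name_check [simp, intro]: "is_name F (check F x)"
proof (induction x rule: mem_induct)
  case (1 x)
  then show ?case by (intro is_name.intros) (auto simp: elts_check Top_C)
qed

lemma check_upair: "check F (vset {a, b}) = upn F (check F a) (check F b)"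
  by (rule extensionality) (simp add: elts_check elts_upn elts_vset_upair)

lemma check_opair: "check F (opair a b) = opn F (check F a) (check F b)"
  using check_upair[of a a] by (simp add: opair_def opn_def check_upair)

text \<open>Absoluteness: a partner found at a stronger condition is, by the induction hypothesis,
  equal in the ground universe, where conditions no longer matter.\<close>

lemma forces_eq_check: "p \<in> C \<Longrightarrow> forces_eq F (check F a) (check F b) p \<longleftrightarrow> a = b"
proof (induction a arbitrary: b p rule: mem_induct)
  case (1 a)
  show ?case
  proof
    assume e: "forces_eq F (check F a) (check F b) p"
    have "elts a = elts b"
    proof (intro set_eqI iffI)
      fix y assume y: "y \<in> elts a"
      then have "opair (check F y) (Top F) \<in> elts (check F a)" by (auto simp: elts_check)
      from forces_eqD1[OF e this below_refl below_Top] 1(2) obtain r z' s' where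
        "r \<in> below F p" "opair z' s' \<in> elts (check F b)" "forces_eq F (check F y) z' r" by blast
      then show "y \<in> elts b" using 1(1)[OF y] below_C by (auto simp: elts_check)
    next
      fix y assume y: "y \<in> elts b"
      then have "opair (check F y) (Top F) \<in> elts (check F b)" by (auto simp: elts_check)
      from forces_eqD2[OF e this below_refl below_Top] 1(2) obtain r z' s' where
        "r \<in> below F p" "opair z' s' \<in> elts (check F a)" "forces_eq F z' (check F y) r" by blast
      then show "y \<in> elts a" using 1(1) below_C by (auto simp: elts_check)
    qed
    then show "a = b" by (rule extensionality)
  qed (simp add: forces_eq_refl)
qed

lemma is_name_relname: "relname F N R \<Longrightarrow> is_name F N"
  by (rule is_name.intros) (auto simp: relname_def)

lemma relname_mono: "relname F N R \<Longrightarrow> R u r \<Longrightarrow> r \<in> C \<Longrightarrow> r' \<in> below F r \<Longrightarrow> R u r'"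
proof -
  assume a: "relname F N R" "R u r" "r \<in> C" "r' \<in> below F r"
  then obtain s where s: "opair (check F u) s \<in> elts N" "r \<in> below F s" unfolding relname_def by blast
  have "s \<in> C" using is_nameD[OF is_name_relname[OF a(1)] s(1)] by blast
  then have "r' \<in> below F s" using below_trans s(2) a(4) by blast
  then show ?thesis using a(1) s(1) below_C[OF a(4)] unfolding relname_def by blast
qed

lemma relname_check: "relname F (check F a) (\<lambda>u r. u \<in> elts a)"
  unfolding relname_def
proof (intro conjI ballI allI)
  fix r u assume r: "r \<in> C"
  have "u = u'" if "check F u = check F u'" for u'
    using forces_eq_check[OF Top_C, of u u'] forces_eq_refl[OF is_name_check] that by metis
  then show "u \<in> elts a \<longleftrightarrow> (\<exists>s. opair (check F u) s \<in> elts (check F a) \<and> r \<in> below F s)"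
    using below_Top[OF r] by (auto simp: elts_check)
qed (auto simp: elts_check Top_C)

lemma forces_mem_relname: "relname F N R \<Longrightarrow> p \<in> C \<Longrightarrow>
  forces F (x \<^bold>\<in> N) p \<longleftrightarrow> dense_below F (\<lambda>r. \<exists>u. R u r \<and> forces_eq F x (check F u) r) p"
  unfolding forces_mem
proof (rule iffI; erule dense_below_weaken)
  fix r assume N: "relname F N R" and r: "r \<in> C" and ex: "\<exists>z s. opair z s \<in> elts N \<and> r \<in> below F s \<and> forces_eq F x z r"
  then obtain z s where z: "opair z s \<in> elts N" "r \<in> below F s" "forces_eq F x z r" by blast
  then obtain u where "z = check F u" using N unfolding relname_def by (metis opair_iff)
  then show "\<exists>u. R u r \<and> forces_eq F x (check F u) r" using N r z unfolding relname_def by blast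
next
  fix r assume N: "relname F N R" and r: "r \<in> C" and ex: "\<exists>u. R u r \<and> forces_eq F x (check F u) r"
  then show "\<exists>z s. opair z s \<in> elts N \<and> r \<in> below F s \<and> forces_eq F x z r" unfolding relname_def by blast
qed

lemma forces_mem_check: "p \<in> C \<Longrightarrow>
  forces F (x \<^bold>\<in> check F a) p \<longleftrightarrow> dense_below F (\<lambda>r. \<exists>u\<in>elts a. forces_eq F x (check F u) r) p"
  using forces_mem_relname[OF relname_check] by (simp add: Bex_def del: forces.simps)

lemma forces_check_mem_relname: "relname F N R \<Longrightarrow> p \<in> C \<Longrightarrow>
  forces F (check F u \<^bold>\<in> N) p \<longleftrightarrow> dense_below F (R u) p"
proof -
  assume N: "relname F N R" and p: "p \<in> C"
  show ?thesis unfolding forces_mem_relname[OF N p]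
    by (rule iffI; erule dense_below_weaken[OF _ _ p]) (auto simp: forces_eq_check intro: forces_eq_refl)
qed

lemma forces_check_mem_check: "p \<in> C \<Longrightarrow> forces F (check F u \<^bold>\<in> check F a) p \<longleftrightarrow> u \<in> elts a"
  unfolding forces_check_mem_relname[OF relname_check]
  using below_refl by (auto simp: dense_below_def dest: below_C)

end

text \<open>The shape in which the formulas know tuples: a set-theoretic function from a natural
  number to omega.\<close>

definition tup :: "nat list \<Rightarrow> 'v::zfc_universe" where
  "tup t = vset ((\<lambda>i. opair (vnat i) (vnat (t ! i))) ` {..<length t})"

lemma elts_tup: "elts (tup t) = (\<lambda>i. opair (vnat i) (vnat (t ! i))) ` {..<length t}"
  unfolding tup_def by (rule elts_vset) (simp add: is_set_finite)

definition vpair_rel :: "('v::zfc_universe \<Rightarrow> 'v \<Rightarrow> bool) \<Rightarrow> bool" where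
  "vpair_rel R \<longleftrightarrow> (\<forall>u r. R u r \<longrightarrow> (\<exists>a b. u = opair a b))"

lemma vpair_relD: "vpair_rel R \<Longrightarrow> R u r \<Longrightarrow> \<exists>a b. u = opair a b"
  unfolding vpair_rel_def by blast

context forcing
begin

lemma dense_below_self: "dense_below F A p \<Longrightarrow> p \<in> C \<Longrightarrow> \<exists>r\<in>below F p. r \<in> C \<and> A r"
  using dense_belowD below_refl by blast

lemma forces_denseI: "named \<phi> \<Longrightarrow> p \<in> C \<Longrightarrow> (\<And>q. q \<in> below F p \<Longrightarrow> q \<in> C \<Longrightarrow> \<exists>r\<in>below F q. forces F \<phi> r) \<Longrightarrow> forces F \<phi> p"
  by (rule forces_dense) (auto intro: dense_belowI)

lemma forces_FExI: "p \<in> C \<Longrightarrow> is_name F x \<Longrightarrow> forces F (\<phi> x) p \<Longrightarrow> forces F (FEx \<phi>) p"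
  unfolding forces_FEx using forces_mono by (blast intro: dense_below_all)

lemma forces_eq_iff_mem:
  assumes "is_name F s" "is_name F t" "p \<in> C"
  shows "(\<forall>z. is_name F z \<longrightarrow> (\<forall>q\<in>below F p. forces F (z \<^bold>\<in> s) q \<longleftrightarrow> forces F (z \<^bold>\<in> t) q)) \<longleftrightarrow> forces_eq F s t p"
proof
  assume "forces_eq F s t p"
  then show "\<forall>z. is_name F z \<longrightarrow> (\<forall>q\<in>below F p. forces F (z \<^bold>\<in> s) q \<longleftrightarrow> forces F (z \<^bold>\<in> t) q)"
    using extensionalD[OF extensional_mem_right forces_eq_mono] assms below_C by blast
qed (intro forces_eqI assms, blast)

subsection \<open>Pairs and functions\<close>

lemma extensional_is_upair:
  "extensional F (\<lambda>u. is_upair u a b)" "extensional F (\<lambda>x. is_upair u x b)" "extensional F (\<lambda>x. is_upair u a x)"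
  "extensional F (\<lambda>x. is_upair u x x)"
  unfolding is_upair_def by (intro extensional_intros)+

lemma extensional_is_pair:
  "extensional F (\<lambda>u. is_pair u a b)" "extensional F (\<lambda>x. is_pair u x b)" "extensional F (\<lambda>x. is_pair u a x)"
  unfolding is_pair_def by (intro extensional_intros extensional_is_upair)+

lemma extensional_maps_to:
  "extensional F (\<lambda>f. maps_to f a b)" "extensional F (\<lambda>x. maps_to f x b)" "extensional F (\<lambda>x. maps_to f a x)"
  unfolding maps_to_def by (intro extensional_intros extensional_is_pair)+

lemma extensional_is_empty: "extensional F is_empty"
proof -
  have "extensional F (\<lambda>x. \<^bold>\<forall>y. \<^bold>\<not> y \<^bold>\<in> x)" by (intro extensional_intros)
  then show ?thesis unfolding is_empty_def[abs_def] .
qed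

lemma extensional_is_succ: "extensional F (\<lambda>s. is_succ s x)" "extensional F (\<lambda>x. is_succ s x)"
  unfolding is_succ_def by (intro extensional_intros)+

lemma extensional_is_fun:
  "extensional F (\<lambda>f. is_fun f a b)" "extensional F (\<lambda>a. is_fun f a b)" "extensional F (\<lambda>b. is_fun f a b)"
  unfolding is_fun_def by (intro extensional_intros extensional_is_pair extensional_maps_to)+

lemmas extensional_fm = extensional_is_upair extensional_is_pair extensional_maps_to extensional_is_empty
  extensional_is_succ extensional_is_fun

inductive_cases named_memE: "named (x \<^bold>\<in> y)"
inductive_cases named_eqE: "named (x \<^bold>= y)"
inductive_cases named_notE: "named (\<^bold>\<not> \<phi>)"
inductive_cases named_andE: "named (\<phi> \<^bold>\<and> \<psi>)"
inductive_cases named_allE: "named (FAll \<phi>)"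

lemma named_basic [simp]:
  "named (x \<^bold>\<in> y) \<longleftrightarrow> is_name F x \<and> is_name F y"
  "named (x \<^bold>= y) \<longleftrightarrow> is_name F x \<and> is_name F y"
  "named (\<^bold>\<not> \<phi>) \<longleftrightarrow> named \<phi>"
  "named (\<phi> \<^bold>\<and> \<psi>) \<longleftrightarrow> named \<phi> \<and> named \<psi>"
  "named (FAll \<chi>) \<longleftrightarrow> (\<forall>x. is_name F x \<longrightarrow> named (\<chi> x))"
  by (blast intro: named.intros elim: named_memE named_eqE named_notE named_andE named_allE)+

lemma named_derived [simp]:
  "named (\<phi> \<^bold>\<or> \<psi>) \<longleftrightarrow> named \<phi> \<and> named \<psi>"
  "named (\<phi> \<^bold>\<longrightarrow> \<psi>) \<longleftrightarrow> named \<phi> \<and> named \<psi>"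
  "named (\<phi> \<^bold>\<longleftrightarrow> \<psi>) \<longleftrightarrow> named \<phi> \<and> named \<psi>"
  "named (FEx \<chi>) \<longleftrightarrow> (\<forall>x. is_name F x \<longrightarrow> named (\<chi> x))"
  by (auto simp: FOr_def FImp_def FIff_def FEx_def)

lemma named_defs [simp]:
  "is_name F x \<Longrightarrow> named (is_empty x)"
  "is_name F s \<Longrightarrow> is_name F x \<Longrightarrow> named (is_succ s x)"
  "is_name F u \<Longrightarrow> is_name F x \<Longrightarrow> is_name F y \<Longrightarrow> named (is_upair u x y)"
  "is_name F u \<Longrightarrow> is_name F x \<Longrightarrow> is_name F y \<Longrightarrow> named (is_pair u x y)"
  "is_name F f \<Longrightarrow> is_name F x \<Longrightarrow> is_name F y \<Longrightarrow> named (maps_to f x y)"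
  "is_name F f \<Longrightarrow> is_name F x \<Longrightarrow> is_name F y \<Longrightarrow> named (is_fun f x y)"
  "is_name F x \<Longrightarrow> named (is_limit x)"
  "is_name F x \<Longrightarrow> named (inductive_set_fm x)"
  "is_name F x \<Longrightarrow> named (is_omega x)"
  "is_name F f \<Longrightarrow> named (is_inj f)"
  "is_name F f \<Longrightarrow> is_name F x \<Longrightarrow> named (is_surj f x)"
  "is_name F f \<Longrightarrow> is_name F x \<Longrightarrow> is_name F y \<Longrightarrow> named (is_prod f x y)"
  "is_name F f \<Longrightarrow> is_name F x \<Longrightarrow> is_name F y \<Longrightarrow> is_name F z \<Longrightarrow> named (add f x y z)"
  "is_name F w \<Longrightarrow> is_name F f \<Longrightarrow> named (is_op w f)"
  "is_name F w \<Longrightarrow> is_name F f \<Longrightarrow> is_name F x \<Longrightarrow> is_name F y \<Longrightarrow> is_name F z \<Longrightarrow> named (is_multiples w f x y z)"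
  "is_name F f \<Longrightarrow> is_name F x \<Longrightarrow> is_name F y \<Longrightarrow> named (is_hom f x y)"
  "is_name F x \<Longrightarrow> is_name F y \<Longrightarrow> named (iso_fm x y)"
  "is_name F x \<Longrightarrow> is_name F a \<Longrightarrow> is_name F y \<Longrightarrow> is_name F b \<Longrightarrow> named (embeds_fm x a y b)"
  "is_name F x \<Longrightarrow> is_name F a \<Longrightarrow> is_name F y \<Longrightarrow> is_name F b \<Longrightarrow> named (is_append x a y b)"
  "is_name F x \<Longrightarrow> is_name F a \<Longrightarrow> is_name F y \<Longrightarrow> is_name F b \<Longrightarrow> named (in_level x a y b)"
  by (simp_all add: is_empty_def is_succ_def is_upair_def is_pair_def maps_to_def is_fun_def is_limit_def
      inductive_set_fm_def is_omega_def is_inj_def is_surj_def is_prod_def add_def is_op_def is_multiples_def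
      is_hom_def iso_fm_def embeds_fm_def is_append_def in_level_def)

lemma forces_is_pair: "is_name F u \<Longrightarrow> is_name F x \<Longrightarrow> is_name F y \<Longrightarrow> p \<in> C \<Longrightarrow>
   forces F (is_pair u x y) p \<longleftrightarrow> forces_eq F u (opn F x y) p"
proof
  assume n: "is_name F u" "is_name F x" "is_name F y" and p: "p \<in> C"
  { assume h: "forces F (is_pair u x y) p"
    have "dense_below F (forces_eq F u (opn F x y)) p"
    proof (rule dense_belowI)
      fix q assume q: "q \<in> below F p" "q \<in> C"
      have "forces F (is_pair u x y) q" using h forces_mono p q by blast
      then obtain r s where r: "r \<in> below F q" "r \<in> C" "is_name F s"
        and r2: "forces F (\<^bold>\<exists>d. is_upair s x x \<^bold>\<and> is_upair d x y \<^bold>\<and> is_upair u s d) r"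
        unfolding is_pair_def forces_FEx[of _ q] using dense_below_self q(2) by blast
      obtain t d where t: "t \<in> below F r" "t \<in> C" "is_name F d"
        "forces F (is_upair s x x \<^bold>\<and> is_upair d x y \<^bold>\<and> is_upair u s d) t"
        using r2 unfolding forces_FEx[of _ r] using dense_below_self r(2) by blast
      have e: "forces_eq F s (upn F x x) t" "forces_eq F d (upn F x y) t" "forces_eq F u (upn F s d) t"
        using t(3,4) n r(3) t(2) by (simp_all add: forces_is_upair)
      have "forces_eq F (upn F s d) (opn F x y) t"
        unfolding opn_def by (rule upn_cong[OF e(1,2)]) (use n r t in simp_all)
      then have "forces_eq F u (opn F x y) t" using forces_eq_trans e(3) t(2) by blast
      then show "\<exists>r\<in>below F q. forces_eq F u (opn F x y) r" using below_trans q(2) r(1) t(1) by blast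
    qed
    then show "forces_eq F u (opn F x y) p" using forces_eq_dense p n by simp }
  { assume e: "forces_eq F u (opn F x y) p"
    show "forces F (is_pair u x y) p" unfolding is_pair_def
      apply (rule forces_FExI[OF p, of "upn F x x"], simp add: n)
      apply (rule forces_FExI[OF p, of "upn F x y"], simp add: n)
      using e n p by (simp add: forces_is_upair forces_eq_refl opn_def) }
qed

text \<open>Formulas mention a pair only through an existential quantifier; every witness is forced
  to be equal to the canonical pair name \<open>opn\<close>, so that name can be
  substituted.\<close>

lemma forces_ex_pair:
  assumes \<phi>: "extensional F \<phi>" "\<And>u. is_name F u \<Longrightarrow> named (\<phi> u)" and n: "is_name F x" "is_name F y" and p: "p \<in> C"
  shows "forces F (\<^bold>\<exists>u. is_pair u x y \<^bold>\<and> \<phi> u) p \<longleftrightarrow> forces F (\<phi> (opn F x y)) p"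
proof
  assume h: "forces F (\<^bold>\<exists>u. is_pair u x y \<^bold>\<and> \<phi> u) p"
  show "forces F (\<phi> (opn F x y)) p"
  proof (rule forces_denseI[OF _ p])
    fix q assume q: "q \<in> below F p" "q \<in> C"
    obtain r u where r: "r \<in> below F q" "r \<in> C" "is_name F u" "forces F (is_pair u x y \<^bold>\<and> \<phi> u) r"
      using dense_belowD[OF h[unfolded forces_FEx] q(1)] by blast
    have "forces_eq F u (opn F x y) r" "forces F (\<phi> u) r" using r n by (simp_all add: forces_is_pair del: forces.simps(1))
    then have "forces F (\<phi> (opn F x y)) r" using extensionalD[OF \<phi>(1) _ r(3) is_name_opn[OF n] r(2)] by blast
    then show "\<exists>r\<in>below F q. forces F (\<phi> (opn F x y)) r" using r(1) by blast
  qed (use \<phi>(2) n in simp)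
next
  assume h: "forces F (\<phi> (opn F x y)) p"
  show "forces F (\<^bold>\<exists>u. is_pair u x y \<^bold>\<and> \<phi> u) p"
    by (rule forces_FExI[OF p is_name_opn[OF n]]) (use h n p in \<open>simp add: forces_is_pair forces_eq_refl del: forces.simps(1)\<close>)
qed

lemma forces_maps_to: "is_name F f \<Longrightarrow> is_name F x \<Longrightarrow> is_name F y \<Longrightarrow> p \<in> C \<Longrightarrow>
   forces F (maps_to f x y) p \<longleftrightarrow> forces F (opn F x y \<^bold>\<in> f) p"
  unfolding maps_to_def by (rule forces_ex_pair[OF extensional_mem_left]) simp_all

text \<open>Every element of \<open>N\<close> is densely equal to a check name, so a bounded
  quantifier in the extension turns into a quantifier over the ground universe. Extensionality of
  \<open>\<phi>\<close> carries the result to arbitrary names.\<close>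

lemma forces_all_mem:
  assumes N: "relname F N R" and \<phi>: "extensional F \<phi>" "\<And>x. is_name F x \<Longrightarrow> named (\<phi> x)" and p: "p \<in> C"
  shows "forces F (\<^bold>\<forall>x. x \<^bold>\<in> N \<^bold>\<longrightarrow> \<phi> x) p \<longleftrightarrow> (\<forall>q\<in>below F p. \<forall>u. R u q \<longrightarrow> forces F (\<phi> (check F u)) q)"
proof
  assume h: "forces F (\<^bold>\<forall>x. x \<^bold>\<in> N \<^bold>\<longrightarrow> \<phi> x) p"
  show "\<forall>q\<in>below F p. \<forall>u. R u q \<longrightarrow> forces F (\<phi> (check F u)) q"
  proof (intro ballI allI impI)
    fix q u assume q: "q \<in> below F p" "R u q"
    have qC: "q \<in> C" using q below_C by blast
    have "forces F (check F u \<^bold>\<in> N \<^bold>\<longrightarrow> \<phi> (check F u)) p" using h by simp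
    then have "forces F (check F u \<^bold>\<in> N) q \<longrightarrow> forces F (\<phi> (check F u)) q"
      using q(1) p \<phi>(2) by (simp add: forces_FImp del: forces.simps)
    moreover have "forces F (check F u \<^bold>\<in> N) q"
      unfolding forces_check_mem_relname[OF N qC] using relname_mono[OF N q(2) qC] by (intro dense_below_all qC)
    ultimately show "forces F (\<phi> (check F u)) q" by blast
  qed
next
  assume h: "\<forall>q\<in>below F p. \<forall>u. R u q \<longrightarrow> forces F (\<phi> (check F u)) q"
  have "forces F (x \<^bold>\<in> N \<^bold>\<longrightarrow> \<phi> x) p" if x: "is_name F x" for x
    unfolding forces_FImp[OF \<phi>(2)[OF x] p]
  proof (intro ballI impI)
    fix q assume q: "q \<in> below F p" "forces F (x \<^bold>\<in> N) q"
    have qC: "q \<in> C" using q below_C by blast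
    show "forces F (\<phi> x) q"
    proof (rule forces_denseI[OF \<phi>(2)[OF x] qC])
      fix q' assume q': "q' \<in> below F q" "q' \<in> C"
      obtain r u where r: "r \<in> below F q'" "r \<in> C" "R u r" "forces_eq F x (check F u) r"
        using dense_belowD[OF q(2)[unfolded forces_mem_relname[OF N qC]] q'(1)] by blast
      have "r \<in> below F p" using below_trans p q(1) qC q'(1) r(1) by blast
      then have "forces F (\<phi> (check F u)) r" using h r(3) by blast
      then have "forces F (\<phi> x) r" using extensionalD[OF \<phi>(1) r(4) x _ r(2)] by simp
      then show "\<exists>r\<in>below F q'. forces F (\<phi> x) r" using r(1) by blast
    qed
  qed
  then show "forces F (\<^bold>\<forall>x. x \<^bold>\<in> N \<^bold>\<longrightarrow> \<phi> x) p" by simp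
qed

lemma forces_ex_mem:
  assumes N: "relname F N R" and \<phi>: "extensional F \<phi>" "\<And>x. is_name F x \<Longrightarrow> named (\<phi> x)" and p: "p \<in> C"
  shows "forces F (\<^bold>\<exists>x. x \<^bold>\<in> N \<^bold>\<and> \<phi> x) p \<longleftrightarrow> dense_below F (\<lambda>r. \<exists>u. R u r \<and> forces F (\<phi> (check F u)) r) p"
proof
  assume h: "forces F (\<^bold>\<exists>x. x \<^bold>\<in> N \<^bold>\<and> \<phi> x) p"
  show "dense_below F (\<lambda>r. \<exists>u. R u r \<and> forces F (\<phi> (check F u)) r) p"
  proof (rule dense_belowI)
    fix q assume q: "q \<in> below F p" "q \<in> C"
    obtain r x where r: "r \<in> below F q" "r \<in> C" "is_name F x" "forces F (x \<^bold>\<in> N) r" "forces F (\<phi> x) r"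
      using dense_belowD[OF h[unfolded forces_FEx] q(1)] by auto
    obtain s u where s: "s \<in> below F r" "s \<in> C" "R u s" "forces_eq F x (check F u) s"
      using dense_below_self[OF r(4)[unfolded forces_mem_relname[OF N r(2)]] r(2)] by blast
    have "forces F (\<phi> (check F u)) s" using extensionalD[OF \<phi>(1) s(4) r(3) _ s(2)] forces_mono[OF r(5,2) s(1)] by simp
    then show "\<exists>r\<in>below F q. \<exists>u. R u r \<and> forces F (\<phi> (check F u)) r"
      using s below_trans[OF q(2) r(1) s(1)] by blast
  qed
next
  assume h: "dense_below F (\<lambda>r. \<exists>u. R u r \<and> forces F (\<phi> (check F u)) r) p"
  show "forces F (\<^bold>\<exists>x. x \<^bold>\<in> N \<^bold>\<and> \<phi> x) p" unfolding forces_FEx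
  proof (rule dense_below_weaken[OF h _ p])
    fix r assume r: "r \<in> C" "\<exists>u. R u r \<and> forces F (\<phi> (check F u)) r"
    then obtain u where u: "R u r" "forces F (\<phi> (check F u)) r" by blast
    have "forces F (check F u \<^bold>\<in> N) r"
      unfolding forces_check_mem_relname[OF N r(1)] using relname_mono[OF N u(1) r(1)] by (intro dense_below_all r)
    then show "\<exists>x. is_name F x \<and> forces F (x \<^bold>\<in> N \<^bold>\<and> \<phi> x) r" using u(2) by auto
  qed
qed

lemmas forces_all_check = forces_all_mem[OF relname_check]
lemmas forces_ex_check = forces_ex_mem[OF relname_check]

lemma forces_all_check': "extensional F \<phi> \<Longrightarrow> (\<And>x. is_name F x \<Longrightarrow> named (\<phi> x)) \<Longrightarrow> p \<in> C \<Longrightarrow>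
   forces F (\<^bold>\<forall>x. x \<^bold>\<in> check F a \<^bold>\<longrightarrow> \<phi> x) p \<longleftrightarrow> (\<forall>u\<in>elts a. forces F (\<phi> (check F u)) p)"
proof -
  assume a: "extensional F \<phi>" "\<And>x. is_name F x \<Longrightarrow> named (\<phi> x)" "p \<in> C"
  have "(\<forall>q\<in>below F p. \<forall>u. u \<in> elts a \<longrightarrow> forces F (\<phi> (check F u)) q) \<longleftrightarrow> (\<forall>u\<in>elts a. forces F (\<phi> (check F u)) p)"
    using forces_mono[OF _ a(3)] below_refl[OF a(3)] by blast
  then show ?thesis using forces_all_check[OF a, of a] by blast
qed

lemma forces_maps_to_relname:
  assumes N: "relname F N R" "vpair_rel R" and n: "is_name F x" "is_name F y" and p: "p \<in> C"
  shows "forces F (maps_to N x y) p \<longleftrightarrow>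
    dense_below F (\<lambda>r. \<exists>a b. R (opair a b) r \<and> forces_eq F x (check F a) r \<and> forces_eq F y (check F b) r) p"
  unfolding forces_maps_to[OF is_name_relname[OF N(1)] n p] forces_mem_relname[OF N(1) p]
proof (rule iffI; erule dense_below_weaken[OF _ _ p])
  fix r assume r: "r \<in> C" "\<exists>u. R u r \<and> forces_eq F (opn F x y) (check F u) r"
  then obtain a b where u: "R (opair a b) r" "forces_eq F (opn F x y) (check F (opair a b)) r"
    using vpair_relD[OF N(2)] by blast
  then show "\<exists>a b. R (opair a b) r \<and> forces_eq F x (check F a) r \<and> forces_eq F y (check F b) r"
    unfolding check_opair using opn_inject[OF _ n is_name_check is_name_check r(1)] by blast
next
  fix r assume r: "r \<in> C" "\<exists>a b. R (opair a b) r \<and> forces_eq F x (check F a) r \<and> forces_eq F y (check F b) r"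
  then show "\<exists>u. R u r \<and> forces_eq F (opn F x y) (check F u) r"
    using check_opair opn_cong[OF _ _ n is_name_check is_name_check r(1)] by metis
qed

lemma forces_maps_to_check:
  assumes N: "relname F N R" and p: "p \<in> C"
  shows "forces F (maps_to N (check F a) (check F b)) p \<longleftrightarrow> dense_below F (R (opair a b)) p"
  unfolding forces_maps_to[OF is_name_relname[OF N(1)] is_name_check is_name_check p] check_opair[symmetric]
  by (rule forces_check_mem_relname[OF N p])

lemma forces_maps_to_checkI:
  assumes N: "relname F N R" and p: "p \<in> C" and R: "R (opair a b) p"
  shows "forces F (maps_to N (check F a) (check F b)) p"
  unfolding forces_maps_to_check[OF N p] using relname_mono[OF N R p] by (intro dense_below_all p)

text \<open>Totality is required only densely, because the value at a given argument may be left to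
  the generic filter; uniqueness can be tested at single conditions since \<open>R\<close> persists
  downwards.\<close>

lemma is_fun_relname:
  assumes N: "relname F N R" and p: "p \<in> C"
    and R: "\<And>u r. r \<in> C \<Longrightarrow> R u r \<Longrightarrow> \<exists>a\<in>elts A. \<exists>b\<in>elts B. u = opair a b"
    and total: "\<And>a r. a \<in> elts A \<Longrightarrow> r \<in> C \<Longrightarrow> \<exists>s\<in>below F r. \<exists>b. R (opair a b) s"
    and func: "\<And>a b b' r. r \<in> C \<Longrightarrow> R (opair a b) r \<Longrightarrow> R (opair a b') r \<Longrightarrow> b = b'"
  shows "forces F (is_fun N (check F A) (check F B)) p"
proof -
  have nN: "is_name F N" by (rule is_name_relname[OF N])
  have 1: "forces F (\<^bold>\<forall>u. u \<^bold>\<in> N \<^bold>\<longrightarrow> (\<^bold>\<exists>x y. x \<^bold>\<in> check F A \<^bold>\<and> y \<^bold>\<in> check F B \<^bold>\<and> is_pair u x y)) p"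
  proof (subst forces_all_mem[OF N _ _ p], goal_cases)
    case 1
    show ?case by (intro extensional_intros extensional_fm)
  next
    case 3
    show ?case
    proof (intro ballI allI impI)
      fix q u assume q: "q \<in> below F p" "R u q"
      have qC: "q \<in> C" using q below_C by blast
      obtain a b where ab: "a \<in> elts A" "b \<in> elts B" "u = opair a b" using R[OF qC q(2)] by blast
      show "forces F (\<^bold>\<exists>x y. x \<^bold>\<in> check F A \<^bold>\<and> y \<^bold>\<in> check F B \<^bold>\<and> is_pair (check F u) x y) q"
        by (rule forces_FExI[OF qC is_name_check[of a]], rule forces_FExI[OF qC is_name_check[of b]])
          (simp add: forces_check_mem_check[OF qC] ab forces_is_pair[OF _ _ _ qC] check_opair forces_eq_refl del: forces.simps(1))
    qed
  qed simp
  have 2: "forces F (\<^bold>\<forall>x. x \<^bold>\<in> check F A \<^bold>\<longrightarrow> (\<^bold>\<exists>y. maps_to N x y \<^bold>\<and> (\<^bold>\<forall>z. maps_to N x z \<^bold>\<longrightarrow> z \<^bold>= y))) p"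
  proof (subst forces_all_check'[OF _ _ p], goal_cases)
    case 1
    show ?case by (intro extensional_intros extensional_fm)
  next
    case 3
    show ?case
    proof
      fix a assume a: "a \<in> elts A"
      have vp: "dense_below F (\<lambda>r. \<exists>b. R (opair a b) r \<and> forces_eq F z (check F b) r) q"
        if z: "is_name F z" "q \<in> C" "forces F (maps_to N (check F a) z) q" for z q
      proof (rule dense_belowI)
        fix q' assume q': "q' \<in> below F q" "q' \<in> C"
        have "forces F (opn F (check F a) z \<^bold>\<in> N) q" using z nN by (simp add: forces_maps_to del: forces.simps)
        from dense_belowD[OF this[unfolded forces_mem_relname[OF N z(2)]] q'(1)]
        obtain r u where r: "r \<in> below F q'" "r \<in> C" "R u r" "forces_eq F (opn F (check F a) z) (check F u) r" by blast
        obtain a' b where u: "u = opair a' b" using R[OF r(2,3)] by blast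
        have "a = a' \<and> forces_eq F z (check F b) r"
          using opn_inject[OF r(4)[unfolded u check_opair] _ z(1) _ _ r(2)] forces_eq_check[OF r(2)] by simp
        then show "\<exists>r\<in>below F q'. \<exists>b. R (opair a b) r \<and> forces_eq F z (check F b) r" using r(1,3) u by blast
      qed
      show "forces F (\<^bold>\<exists>y. maps_to N (check F a) y \<^bold>\<and> (\<^bold>\<forall>z. maps_to N (check F a) z \<^bold>\<longrightarrow> z \<^bold>= y)) p"
        unfolding forces_FEx
      proof (rule dense_belowI)
        fix q assume q: "q \<in> below F p" "q \<in> C"
        obtain s b where s: "s \<in> below F q" "R (opair a b) s" using total[OF a q(2)] by blast
        have sC: "s \<in> C" using s below_C by blast
        have "forces F (\<^bold>\<forall>z. maps_to N (check F a) z \<^bold>\<longrightarrow> z \<^bold>= check F b) s"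
        proof (simp only: forces.simps(5), intro allI impI)
          fix z assume z: "is_name F z"
          show "forces F (maps_to N (check F a) z \<^bold>\<longrightarrow> z \<^bold>= check F b) s"
          proof (subst forces_FImp[OF _ sC], simp add: z, intro ballI impI)
            fix t assume t: "t \<in> below F s" "forces F (maps_to N (check F a) z) t"
            have tC: "t \<in> C" using t below_C by blast
            have "dense_below F (forces_eq F z (check F b)) t"
            proof (rule dense_below_weaken[OF vp[OF z tC t(2)] _ tC])
              fix r assume r: "r \<in> C" "r \<in> below F t" "\<exists>b. R (opair a b) r \<and> forces_eq F z (check F b) r"
              have "R (opair a b) r" using relname_mono[OF N s(2) sC] below_trans[OF sC t(1) r(2)] by blast
              then show "forces_eq F z (check F b) r" using r(3) func[OF r(1)] by blast
            qed
            then show "forces F (z \<^bold>= check F b) t" using forces_eq_dense tC z by simp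
          qed
        qed
        moreover have "forces F (maps_to N (check F a) (check F b)) s" by (rule forces_maps_to_checkI[OF N sC s(2)])
        ultimately show "\<exists>r\<in>below F q. \<exists>x. is_name F x \<and> forces F (maps_to N (check F a) x \<^bold>\<and> (\<^bold>\<forall>z. maps_to N (check F a) z \<^bold>\<longrightarrow> z \<^bold>= x)) r"
          using s(1) by auto
      qed
    qed
  qed (use nN in simp)
  show ?thesis unfolding is_fun_def using 1 2 by simp
qed

lemma is_inj_relname:
  assumes N: "relname F N R" "vpair_rel R" and p: "p \<in> C"
    and inj: "\<And>a a' b r. r \<in> C \<Longrightarrow> R (opair a b) r \<Longrightarrow> R (opair a' b) r \<Longrightarrow> a = a'"
  shows "forces F (is_inj N) p"
proof -
  have nN: "is_name F N" by (rule is_name_relname[OF N(1)])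
  show ?thesis unfolding is_inj_def forces.simps(5)
  proof (intro allI impI)
    fix x y z assume n: "is_name F x" "is_name F y" "is_name F z"
    show "forces F (maps_to N x z \<^bold>\<and> maps_to N y z \<^bold>\<longrightarrow> x \<^bold>= y) p"
    proof (subst forces_FImp[OF _ p], simp add: n, intro ballI impI)
      fix q assume q: "q \<in> below F p" "forces F (maps_to N x z \<^bold>\<and> maps_to N y z) q"
      have qC: "q \<in> C" using q below_C by blast
      have "dense_below F (forces_eq F x y) q"
      proof (rule dense_belowI)
        fix q' assume q': "q' \<in> below F q" "q' \<in> C"
        have m: "forces F (maps_to N x z) q" "forces F (maps_to N y z) q" using q(2) by simp_all
        obtain r a b where r: "r \<in> below F q'" "r \<in> C" "R (opair a b) r" "forces_eq F x (check F a) r" "forces_eq F z (check F b) r"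
          using dense_belowD[OF m(1)[unfolded forces_maps_to_relname[OF N n(1,3) qC]] q'(1)] by blast
        have rq: "r \<in> below F q" using below_trans[OF qC q'(1) r(1)] .
        obtain s a' b' where s: "s \<in> below F r" "s \<in> C" "R (opair a' b') s" "forces_eq F y (check F a') s" "forces_eq F z (check F b') s"
          using dense_belowD[OF m(2)[unfolded forces_maps_to_relname[OF N n(2,3) qC]] rq] by blast
        have e: "forces_eq F x (check F a) s" "forces_eq F z (check F b) s" using r s forces_eq_mono by blast+
        then have "forces_eq F (check F b) (check F b') s" using s forces_eq_sym forces_eq_trans by blast
        then have "b = b'" using forces_eq_check[OF s(2)] by blast
        then have "a = a'" using inj[OF s(2)] s(3) relname_mono[OF N(1) r(3,2) s(1)] by blast
        then have "forces_eq F x y s" using e(1) s forces_eq_sym forces_eq_trans by blast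
        then show "\<exists>r\<in>below F q'. forces_eq F x y r" using below_trans[OF q'(2) r(1) s(1)] by blast
      qed
      then show "forces F (x \<^bold>= y) q" using forces_eq_dense qC n by simp
    qed
  qed
qed

lemma is_surj_relname:
  assumes N: "relname F N R" and p: "p \<in> C"
    and surj: "\<And>b r. b \<in> elts B \<Longrightarrow> r \<in> C \<Longrightarrow> \<exists>s\<in>below F r. \<exists>a. R (opair a b) s"
  shows "forces F (is_surj N (check F B)) p"
proof -
  have nN: "is_name F N" by (rule is_name_relname[OF N(1)])
  show ?thesis unfolding is_surj_def
  proof (subst forces_all_check'[OF _ _ p], goal_cases)
    case 1
    show ?case by (intro extensional_intros extensional_fm)
  next
    case 3
    show ?case
    proof
      fix b assume b: "b \<in> elts B"
      show "forces F (\<^bold>\<exists>x. maps_to N x (check F b)) p" unfolding forces_FEx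
      proof (rule dense_belowI)
        fix q assume q: "q \<in> below F p" "q \<in> C"
        obtain s a where s: "s \<in> below F q" "R (opair a b) s" using surj[OF b q(2)] by blast
        then show "\<exists>r\<in>below F q. \<exists>x. is_name F x \<and> forces F (maps_to N x (check F b)) r"
          using forces_maps_to_checkI[OF N below_C[OF s(1)] s(2)] by blast
      qed
    qed
  qed (use nN in simp)
qed

lemma is_fun_total:
  assumes f: "forces F (is_fun f (check F A) (check F B)) p" and n: "is_name F f" and p: "p \<in> C" and a: "a \<in> elts A"
  shows "dense_below F (\<lambda>r. \<exists>b\<in>elts B. forces F (maps_to f (check F a) (check F b)) r) p"
proof (rule dense_belowI)
  fix q assume q: "q \<in> below F p" "q \<in> C"
  have "forces F (check F a \<^bold>\<in> check F A \<^bold>\<longrightarrow> (\<^bold>\<exists>y. maps_to f (check F a) y \<^bold>\<and> (\<^bold>\<forall>z. maps_to f (check F a) z \<^bold>\<longrightarrow> z \<^bold>= y))) p"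
    using f unfolding is_fun_def by simp
  then have "forces F (\<^bold>\<exists>y. maps_to f (check F a) y \<^bold>\<and> (\<^bold>\<forall>z. maps_to f (check F a) z \<^bold>\<longrightarrow> z \<^bold>= y)) q"
    using n p q a by (simp add: forces_FImp forces_check_mem_check del: forces.simps)
  then obtain r y where r': "r \<in> below F q" "r \<in> C" "is_name F y"
      "forces F (maps_to f (check F a) y \<^bold>\<and> (\<^bold>\<forall>z. maps_to f (check F a) z \<^bold>\<longrightarrow> z \<^bold>= y)) r"
    unfolding forces_FEx[of _ q] using dense_below_self[OF _ q(2)] by blast
  then have r: "r \<in> below F q" "r \<in> C" "is_name F y" "forces F (maps_to f (check F a) y) r" by simp_all
  have m: "forces F (opn F (check F a) y \<^bold>\<in> f) r" using r(4) n r by (simp add: forces_maps_to del: forces.simps)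
  have "forces F (u \<^bold>\<in> f \<^bold>\<longrightarrow> (\<^bold>\<exists>x z. x \<^bold>\<in> check F A \<^bold>\<and> z \<^bold>\<in> check F B \<^bold>\<and> is_pair u x z)) p" if "is_name F u" for u
    using f that unfolding is_fun_def by simp
  then have "forces F (opn F (check F a) y \<^bold>\<in> f \<^bold>\<longrightarrow> (\<^bold>\<exists>x z. x \<^bold>\<in> check F A \<^bold>\<and> z \<^bold>\<in> check F B \<^bold>\<and> is_pair (opn F (check F a) y) x z)) p"
    using r(3) by blast
  then have "forces F (\<^bold>\<exists>x z. x \<^bold>\<in> check F A \<^bold>\<and> z \<^bold>\<in> check F B \<^bold>\<and> is_pair (opn F (check F a) y) x z) r"
    using n p q r m below_trans[OF p q(1) r(1)] by (simp add: forces_FImp del: forces.simps)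
  then obtain s x where s: "s \<in> below F r" "s \<in> C" "is_name F x"
    "forces F (\<^bold>\<exists>z. x \<^bold>\<in> check F A \<^bold>\<and> z \<^bold>\<in> check F B \<^bold>\<and> is_pair (opn F (check F a) y) x z) s"
    unfolding forces_FEx[of _ r] using dense_below_self[OF _ r(2)] by blast
  then obtain t z where t: "t \<in> below F s" "t \<in> C" "is_name F z"
    "forces F (x \<^bold>\<in> check F A \<^bold>\<and> z \<^bold>\<in> check F B \<^bold>\<and> is_pair (opn F (check F a) y) x z) t"
    unfolding forces_FEx[of _ s] using dense_below_self[OF _ s(2)] by blast
  then have zB: "forces F (z \<^bold>\<in> check F B) t" and "forces_eq F (opn F (check F a) y) (opn F x z) t"
    using r(3) s(3) by (simp_all add: forces_is_pair del: forces.simps(1))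
  then have yz: "forces_eq F y z t" using opn_inject[of "check F a" y x z t] r(3) s(3) t(2,3) by simp
  obtain v b where v: "v \<in> below F t" "v \<in> C" "b \<in> elts B" "forces_eq F z (check F b) v"
    using dense_below_self[OF zB[unfolded forces_mem_check[OF t(2)]] t(2)] by blast
  have "forces_eq F y (check F b) v" using forces_eq_trans[OF forces_eq_mono[OF yz t(2) v(1)] v(4,2)] .
  moreover have "v \<in> below F r" using below_trans[OF r(2) s(1)] below_trans[OF s(2) t(1) v(1)] by blast
  ultimately have "forces F (maps_to f (check F a) (check F b)) v"
    using extensionalD[OF extensional_maps_to(3), of y "check F b" v f "check F a"] forces_mono[OF r(4,2)] r(3) v(2) by simp
  moreover have "v \<in> below F q" using below_trans[OF q(2) r(1)] \<open>v \<in> below F r\<close> by blast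
  ultimately show "\<exists>r\<in>below F q. \<exists>b\<in>elts B. forces F (maps_to f (check F a) (check F b)) r" using v(3) by blast
qed

lemma is_fun_unique:
  assumes f: "forces F (is_fun f (check F A) (check F B)) p" and n: "is_name F f" and p: "p \<in> C" and a: "a \<in> elts A"
    and m: "forces F (maps_to f (check F a) (check F b)) p" "forces F (maps_to f (check F a) (check F b')) p"
  shows "b = b'"
proof -
  have "forces F (check F a \<^bold>\<in> check F A \<^bold>\<longrightarrow> (\<^bold>\<exists>y. maps_to f (check F a) y \<^bold>\<and> (\<^bold>\<forall>z. maps_to f (check F a) z \<^bold>\<longrightarrow> z \<^bold>= y))) p"
    using f unfolding is_fun_def by simp
  then have "forces F (\<^bold>\<exists>y. maps_to f (check F a) y \<^bold>\<and> (\<^bold>\<forall>z. maps_to f (check F a) z \<^bold>\<longrightarrow> z \<^bold>= y)) p"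
    using n p a below_refl by (simp add: forces_FImp forces_check_mem_check del: forces.simps)
  then obtain r y where r: "r \<in> below F p" "r \<in> C" "is_name F y"
    "forces F (maps_to f (check F a) y \<^bold>\<and> (\<^bold>\<forall>z. maps_to f (check F a) z \<^bold>\<longrightarrow> z \<^bold>= y)) r"
    unfolding forces_FEx[of _ p] using dense_below_self[OF _ p] by blast
  have "forces_eq F (check F c) y r" if "forces F (maps_to f (check F a) (check F c)) p" for c
  proof -
    have "forces F (maps_to f (check F a) (check F c) \<^bold>\<longrightarrow> check F c \<^bold>= y) r" using r(4) by simp
    then show ?thesis using forces_mono[OF that p r(1)] r below_refl[OF r(2)] by (simp add: forces_FImp)
  qed
  from this[OF m(1)] this[OF m(2)] have "forces_eq F (check F b) (check F b') r"
    using forces_eq_sym forces_eq_trans r(2) by blast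
  then show ?thesis using forces_eq_check[OF r(2)] by blast
qed

lemma is_fun_mem:
  assumes f: "forces F (is_fun f (check F A) (check F B)) p" and n: "is_name F f" "is_name F z" and p: "p \<in> C"
    and m: "forces F (z \<^bold>\<in> f) p"
  shows "dense_below F (\<lambda>r. \<exists>a\<in>elts A. \<exists>b\<in>elts B. forces_eq F z (check F (opair a b)) r) p"
proof (rule dense_belowI)
  fix q assume q: "q \<in> below F p" "q \<in> C"
  have "forces F (z \<^bold>\<in> f \<^bold>\<longrightarrow> (\<^bold>\<exists>x y. x \<^bold>\<in> check F A \<^bold>\<and> y \<^bold>\<in> check F B \<^bold>\<and> is_pair z x y)) p"
    using f n(2) unfolding is_fun_def forces.simps(4,5) by blast
  then have "forces F (\<^bold>\<exists>x y. x \<^bold>\<in> check F A \<^bold>\<and> y \<^bold>\<in> check F B \<^bold>\<and> is_pair z x y) q"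
    using n p q forces_mono[OF m p q(1)] by (simp add: forces_FImp del: forces.simps)
  then obtain s x where s: "s \<in> below F q" "s \<in> C" "is_name F x"
    "forces F (\<^bold>\<exists>y. x \<^bold>\<in> check F A \<^bold>\<and> y \<^bold>\<in> check F B \<^bold>\<and> is_pair z x y) s"
    unfolding forces_FEx[of _ q] using dense_below_self[OF _ q(2)] by blast
  then obtain t y where t: "t \<in> below F s" "t \<in> C" "is_name F y"
    "forces F (x \<^bold>\<in> check F A \<^bold>\<and> y \<^bold>\<in> check F B \<^bold>\<and> is_pair z x y) t"
    unfolding forces_FEx[of _ s] using dense_below_self[OF _ s(2)] by blast
  then have m2: "forces F (x \<^bold>\<in> check F A) t" "forces F (y \<^bold>\<in> check F B) t" and e: "forces_eq F z (opn F x y) t"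
    using n s(3) by (simp_all add: forces_is_pair del: forces.simps(1))
  obtain v a where v: "v \<in> below F t" "v \<in> C" "a \<in> elts A" "forces_eq F x (check F a) v"
    using dense_below_self[OF m2(1)[unfolded forces_mem_check[OF t(2)]] t(2)] by blast
  obtain w b where w: "w \<in> below F v" "w \<in> C" "b \<in> elts B" "forces_eq F y (check F b) w"
    using dense_belowD[OF m2(2)[unfolded forces_mem_check[OF t(2)]] v(1)] by blast
  have wt: "w \<in> below F t" using below_trans[OF t(2) v(1) w(1)] .
  have "forces_eq F (opn F x y) (check F (opair a b)) w" unfolding check_opair
    by (rule opn_cong[OF forces_eq_mono[OF v(4,2) w(1)] w(4)]) (use s t w in simp_all)
  then have "forces_eq F z (check F (opair a b)) w" using forces_eq_trans[OF forces_eq_mono[OF e t(2) wt]] w(2) by blast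
  moreover have "w \<in> below F q" using below_trans[OF q(2) s(1)] below_trans[OF s(2) t(1) wt] by blast
  ultimately show "\<exists>r\<in>below F q. \<exists>a\<in>elts A. \<exists>b\<in>elts B. forces_eq F z (check F (opair a b)) r" using v(3) w(3) by blast
qed

subsection \<open>Natural numbers and tuples\<close>

lemma forces_is_empty: "elts e = {} \<Longrightarrow> is_name F x \<Longrightarrow> p \<in> C \<Longrightarrow> forces F (is_empty x) p \<longleftrightarrow> forces_eq F x (check F e) p"
proof -
  assume e: "elts e = {}" and n: "is_name F x" and p: "p \<in> C"
  have no: "\<not> forces F (z \<^bold>\<in> check F e) q" if "q \<in> C" for z q
    unfolding forces_mem_check[OF that] e using below_refl[OF that] by (auto simp: dense_below_def)
  show ?thesis
    unfolding is_empty_def forces_eq_iff_mem[OF n is_name_check p, symmetric]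
    using no below_C by (auto simp del: forces.simps(1))
qed

lemma forces_imp_dense: "named \<phi> \<Longrightarrow> p \<in> C \<Longrightarrow> dense_below F A p \<Longrightarrow> (\<And>r. r \<in> C \<Longrightarrow> r \<in> below F p \<Longrightarrow> A r \<Longrightarrow> forces F \<phi> r) \<Longrightarrow> forces F \<phi> p"
  by (rule forces_dense) (auto elim: dense_below_weaken)

lemma forces_mem_check_insert:
  assumes e: "elts x' = insert v (elts x)" and z: "is_name F z" and q: "q \<in> C"
  shows "dense_below F (\<lambda>r. forces F (z \<^bold>\<in> check F x) r \<or> forces_eq F z (check F v) r) q \<longleftrightarrow> forces F (z \<^bold>\<in> check F x') q"
proof
  assume h: "dense_below F (\<lambda>r. forces F (z \<^bold>\<in> check F x) r \<or> forces_eq F z (check F v) r) q"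
  show "forces F (z \<^bold>\<in> check F x') q"
  proof (rule forces_imp_dense[OF _ q h])
    fix r assume r: "r \<in> C" "forces F (z \<^bold>\<in> check F x) r \<or> forces_eq F z (check F v) r"
    from r(2) show "forces F (z \<^bold>\<in> check F x') r"
    proof
      assume "forces F (z \<^bold>\<in> check F x) r"
      then show ?thesis unfolding forces_mem_check[OF r(1)] e by (rule dense_below_weaken) (use r in auto)
    next
      assume "forces_eq F z (check F v) r"
      then show ?thesis unfolding forces_mem_check[OF r(1)] e using forces_eq_mono r(1) by (intro dense_below_all) auto
    qed
  qed (use z in simp)
next
  assume h: "forces F (z \<^bold>\<in> check F x') q"
  show "dense_below F (\<lambda>r. forces F (z \<^bold>\<in> check F x) r \<or> forces_eq F z (check F v) r) q"
  proof (rule dense_below_weaken[OF h[unfolded forces_mem_check[OF q] e] _ q])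
    fix r assume r: "r \<in> C" "\<exists>u\<in>insert v (elts x). forces_eq F z (check F u) r"
    have "forces F (z \<^bold>\<in> check F x) r" if "u \<in> elts x" "forces_eq F z (check F u) r" for u
      unfolding forces_mem_check[OF r(1)] using that forces_eq_mono r(1) by (intro dense_below_all) blast+
    then show "forces F (z \<^bold>\<in> check F x) r \<or> forces_eq F z (check F v) r" using r(2) by auto
  qed
qed

lemma forces_is_succ:
  assumes e: "elts sx = insert x (elts x)" and n: "is_name F s" and p: "p \<in> C"
  shows "forces F (is_succ s (check F x)) p \<longleftrightarrow> forces_eq F s (check F sx) p"
proof -
  have "forces F (z \<^bold>\<in> check F x \<^bold>\<or> z \<^bold>= check F x) q \<longleftrightarrow> forces F (z \<^bold>\<in> check F sx) q" if "is_name F z" "q \<in> C" for z q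
    using forces_mem_check_insert[OF e that] forces_FOr[OF that(2)] by simp
  then show ?thesis
    unfolding is_succ_def forces_eq_iff_mem[OF n is_name_check p, symmetric] forces.simps(5)
    using n p below_C by (simp add: forces_FIff del: forces.simps)
qed

lemma forces_inductive_omega: "p \<in> C \<Longrightarrow> forces F (inductive_set_fm (check F omega)) p"
  unfolding inductive_set_fm_def forces.simps(4)
proof
  assume p: "p \<in> C"
  show "forces F (\<^bold>\<exists>e. is_empty e \<^bold>\<and> e \<^bold>\<in> check F omega) p"
    by (rule forces_FExI[OF p, of "check F (vnat 0)"])
      (simp_all add: forces_is_empty[OF elts_vnat(1) _ p] forces_eq_refl forces_check_mem_check[OF p] del: forces.simps(1) vnat.simps)
  show "forces F (\<^bold>\<forall>n. n \<^bold>\<in> check F omega \<^bold>\<longrightarrow> (\<^bold>\<exists>s. is_succ s n \<^bold>\<and> s \<^bold>\<in> check F omega)) p"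
  proof (subst forces_all_check'[OF _ _ p], goal_cases)
    case 1
    show ?case by (intro extensional_intros extensional_fm)
  next
    case 3
    have "forces F (\<^bold>\<exists>s. is_succ s (check F (vnat n)) \<^bold>\<and> s \<^bold>\<in> check F omega) p" for n
      by (rule forces_FExI[OF p, of "check F (vnat (Suc n))"])
        (simp_all add: forces_is_succ[OF elts_vnat(2) _ p] forces_eq_refl forces_check_mem_check[OF p] del: forces.simps(1) vnat.simps)
    then show ?case by (auto simp: elts_omega)
  qed simp
qed

lemma forces_inductive_mem:
  assumes v: "is_name F v" "forces F (inductive_set_fm v) p" and p: "p \<in> C"
  shows "forces F (check F (vnat n) \<^bold>\<in> v) p"
proof (induction n)
  case 0
  show ?case
  proof (rule forces_denseI[OF _ p])
    fix q assume q: "q \<in> below F p" "q \<in> C"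
    have "forces F (\<^bold>\<exists>e. is_empty e \<^bold>\<and> e \<^bold>\<in> v) p" using v unfolding inductive_set_fm_def by simp
    then obtain r e where r: "r \<in> below F q" "r \<in> C" "is_name F e" "forces F (is_empty e \<^bold>\<and> e \<^bold>\<in> v) r"
      unfolding forces_FEx using dense_belowD q(1) by blast
    then have "forces_eq F e (check F (vnat 0)) r" "forces F (e \<^bold>\<in> v) r"
      using forces_is_empty[OF elts_vnat(1) r(3,2)] by (simp_all del: vnat.simps forces.simps(1))
    then have "forces F (check F (vnat 0) \<^bold>\<in> v) r" using extensionalD[OF extensional_mem_left] r(2,3) by blast
    then show "\<exists>r\<in>below F q. forces F (check F (vnat 0) \<^bold>\<in> v) r" using r(1) by blast
  qed (use v in simp)
next
  case (Suc n)
  show ?case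
  proof (rule forces_denseI[OF _ p])
    fix q assume q: "q \<in> below F p" "q \<in> C"
    have "forces F (check F (vnat n) \<^bold>\<in> v \<^bold>\<longrightarrow> (\<^bold>\<exists>s. is_succ s (check F (vnat n)) \<^bold>\<and> s \<^bold>\<in> v)) p"
      using v unfolding inductive_set_fm_def by simp
    then have "forces F (\<^bold>\<exists>s. is_succ s (check F (vnat n)) \<^bold>\<and> s \<^bold>\<in> v) p"
      using Suc v p below_refl[OF p] by (simp add: forces_FImp del: forces.simps)
    then obtain r e where r: "r \<in> below F q" "r \<in> C" "is_name F e" "forces F (is_succ e (check F (vnat n)) \<^bold>\<and> e \<^bold>\<in> v) r"
      unfolding forces_FEx using dense_belowD q(1) by blast
    then have "forces_eq F e (check F (vnat (Suc n))) r" "forces F (e \<^bold>\<in> v) r"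
      using forces_is_succ[OF elts_vnat(2) r(3,2)] by (simp_all del: vnat.simps forces.simps(1))
    then have "forces F (check F (vnat (Suc n)) \<^bold>\<in> v) r" using extensionalD[OF extensional_mem_left] r(2,3) by blast
    then show "\<exists>r\<in>below F q. forces F (check F (vnat (Suc n)) \<^bold>\<in> v) r" using r(1) by blast
  qed (use v in simp)
qed

lemma forces_omega_subset:
  assumes v: "is_name F v" "forces F (inductive_set_fm v) p" and p: "p \<in> C" and z: "is_name F z" "forces F (z \<^bold>\<in> check F omega) p"
  shows "forces F (z \<^bold>\<in> v) p"
proof (rule forces_denseI[OF _ p])
  fix q assume q: "q \<in> below F p" "q \<in> C"
  obtain r n where r: "r \<in> below F q" "r \<in> C" "forces_eq F z (check F (vnat n)) r"
    using dense_belowD[OF z(2)[unfolded forces_mem_check[OF p]] q(1)] by (auto simp: elts_omega)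
  have "r \<in> below F p" using below_trans[OF p q(1) r(1)] .
  then have "forces F (check F (vnat n) \<^bold>\<in> v) r" using forces_mono[OF forces_inductive_mem[OF v p] p] by blast
  then have "forces F (z \<^bold>\<in> v) r" using extensionalD[OF extensional_mem_left r(3) z(1) is_name_check r(2)] by blast
  then show "\<exists>r\<in>below F q. forces F (z \<^bold>\<in> v) r" using r(1) by blast
qed (use v z in simp)

lemma forces_is_omega_check: "p \<in> C \<Longrightarrow> forces F (is_omega (check F omega)) p"
  unfolding is_omega_def forces.simps(4,5)
proof (intro conjI allI impI)
  fix v assume p: "p \<in> C" and v: "is_name F v"
  show "forces F (inductive_set_fm v \<^bold>\<longrightarrow> (\<^bold>\<forall>n. n \<^bold>\<in> check F omega \<^bold>\<longrightarrow> n \<^bold>\<in> v)) p"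
  proof (subst forces_FImp[OF _ p], simp add: v, intro ballI impI)
    fix q assume q: "q \<in> below F p" "forces F (inductive_set_fm v) q"
    have qC: "q \<in> C" using q below_C by blast
    show "forces F (\<^bold>\<forall>n. n \<^bold>\<in> check F omega \<^bold>\<longrightarrow> n \<^bold>\<in> v) q" unfolding forces.simps(5)
    proof (intro allI impI)
      fix n assume n: "is_name F n"
      show "forces F (n \<^bold>\<in> check F omega \<^bold>\<longrightarrow> n \<^bold>\<in> v) q"
        by (subst forces_FImp[OF _ qC]) (use n v forces_omega_subset[OF v] forces_mono[OF q(2) qC] below_C in \<open>auto simp del: forces.simps\<close>)
    qed
  qed
qed (rule forces_inductive_omega)

text \<open>Formulas quantify over a set satisfying \<open>is_omega\<close>; this identifies every
  such name with \<open>check F omega\<close>, where bounded quantifiers can be evaluated.\<close>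

lemma forces_is_omega:
  assumes w: "is_name F w" "forces F (is_omega w) p" and p: "p \<in> C"
  shows "forces_eq F w (check F omega) p"
proof (rule forces_eqI[OF w(1) is_name_check p])
  fix z q assume z: "is_name F z" and q: "q \<in> below F p" "q \<in> C"
  have w2: "forces F (inductive_set_fm w) q" "forces F (is_omega w) q"
    using w(2) forces_mono[OF _ p q(1)] unfolding is_omega_def by auto
  show "forces F (z \<^bold>\<in> w) q \<longleftrightarrow> forces F (z \<^bold>\<in> check F omega) q"
  proof
    assume h: "forces F (z \<^bold>\<in> w) q"
    have "forces F (inductive_set_fm (check F omega) \<^bold>\<longrightarrow> (\<^bold>\<forall>n. n \<^bold>\<in> w \<^bold>\<longrightarrow> n \<^bold>\<in> check F omega)) q"
      using w2(2) unfolding is_omega_def by simp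
    then have "forces F (\<^bold>\<forall>n. n \<^bold>\<in> w \<^bold>\<longrightarrow> n \<^bold>\<in> check F omega) q"
      using forces_inductive_omega[OF q(2)] below_refl[OF q(2)] q(2) w(1) by (simp add: forces_FImp del: forces.simps)
    then have "forces F (z \<^bold>\<in> w \<^bold>\<longrightarrow> z \<^bold>\<in> check F omega) q" using z by simp
    then show "forces F (z \<^bold>\<in> check F omega) q"
      using h below_refl[OF q(2)] q(2) z by (simp add: forces_FImp del: forces.simps)
  qed (rule forces_omega_subset[OF w(1) w2(1) q(2) z])
qed

text \<open>No new finite sequences arise: the \<open>n\<close> values can be decided one after the
  other. Hence quantifying over tuples in the extension amounts to quantifying over
  \<open>nat list\<close>.\<close>

lemma forces_tup:
  assumes f: "forces F (is_fun f (check F (vnat n)) (check F omega)) p" and nf: "is_name F f" and p: "p \<in> C"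
  shows "dense_below F (\<lambda>r. \<exists>t. length t = n \<and> forces_eq F f (check F (tup t)) r) p"
proof (rule dense_belowI)
  fix q assume q: "q \<in> below F p" "q \<in> C"
  \<comment> \<open>After \<open>k\<close> strengthenings the first \<open>k\<close> values are
    decided and collected in \<open>t\<close>.\<close>
  have "k \<le> n \<Longrightarrow> \<exists>r\<in>below F q. \<exists>t. length t = k \<and> (\<forall>i<k. forces F (maps_to f (check F (vnat i)) (check F (vnat (t ! i)))) r)" for k
  proof (induction k)
    case 0
    then show ?case using below_refl[OF q(2)] by auto
  next
    case (Suc k)
    then obtain r t where r: "r \<in> below F q" "length t = k" "\<And>i. i < k \<Longrightarrow> forces F (maps_to f (check F (vnat i)) (check F (vnat (t ! i)))) r"
      by auto
    have rp: "r \<in> below F p" using below_trans[OF p q(1) r(1)] .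
    have "(vnat k :: 'v) \<in> elts (vnat n)" by (rule vnat_mem_less) (use Suc.prems in simp)
    from dense_belowD[OF is_fun_total[OF f nf p this] rp]
    obtain s m where s: "s \<in> below F r" "s \<in> C" "forces F (maps_to f (check F (vnat k)) (check F (vnat m))) s"
      by (auto simp: elts_omega)
    have "forces F (maps_to f (check F (vnat i)) (check F (vnat ((t @ [m]) ! i)))) s" if "i < Suc k" for i
      using that r(2) s forces_mono[OF r(3) below_C[OF r(1)] s(1)] by (auto simp: nth_append less_Suc_eq simp del: forces.simps)
    moreover have "s \<in> below F q" using below_trans[OF q(2) r(1) s(1)] .
    ultimately show ?case using r(2) by (intro bexI[of _ s] exI[of _ "t @ [m]"]) auto
  qed
  then obtain r t where r: "r \<in> below F q" "length t = n" and m: "\<And>i. i < n \<Longrightarrow> forces F (maps_to f (check F (vnat i)) (check F (vnat (t ! i)))) r"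
    by blast
  have rC: "r \<in> C" using r below_C by blast
  have rp: "r \<in> below F p" using below_trans[OF p q(1) r(1)] .
  have "forces_eq F f (check F (tup t)) r"
  proof (rule forces_eqI[OF nf is_name_check rC])
    fix z s assume z: "is_name F z" and s: "s \<in> below F r" "s \<in> C"
    have sp: "s \<in> below F p" using below_trans[OF p rp s(1)] .
    show "forces F (z \<^bold>\<in> f) s \<longleftrightarrow> forces F (z \<^bold>\<in> check F (tup t)) s"
    proof
      assume h: "forces F (z \<^bold>\<in> f) s"
      show "forces F (z \<^bold>\<in> check F (tup t)) s" unfolding forces_mem_check[OF s(2)]
      proof (rule dense_below_weaken[OF is_fun_mem[OF forces_mono[OF f p sp] nf z s(2) h] _ s(2)])
        fix v assume v: "v \<in> C" "v \<in> below F s" "\<exists>a\<in>elts (vnat n). \<exists>b\<in>elts omega. forces_eq F z (check F (opair a b)) v"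
        then obtain i b where i: "i < n" "forces_eq F z (check F (opair (vnat i) b)) v" by (auto simp: elts_vnat_eq)
        have "forces F (check F (opair (vnat i) b) \<^bold>\<in> f) v"
          using extensionalD[OF extensional_mem_left i(2) z is_name_check v(1)] forces_mono[OF h s(2) v(2)] by blast
        then have "forces F (maps_to f (check F (vnat i)) (check F b)) v"
          using nf v(1) by (simp add: forces_maps_to check_opair del: forces.simps)
        moreover have "forces F (maps_to f (check F (vnat i)) (check F (vnat (t ! i)))) v"
          using forces_mono[OF m[OF i(1)] rC] below_trans[OF rC s(1) v(2)] by blast
        moreover have "v \<in> below F p" using below_trans[OF p sp v(2)] .
        ultimately have "b = vnat (t ! i)"
          using is_fun_unique[OF forces_mono[OF f p] nf v(1)] i(1) vnat_mem_less by blast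
        then show "\<exists>u\<in>elts (tup t). forces_eq F z (check F u) v" using i r(2) by (auto simp: elts_tup)
      qed
    next
      assume h: "forces F (z \<^bold>\<in> check F (tup t)) s"
      show "forces F (z \<^bold>\<in> f) s"
      proof (rule forces_denseI[OF _ s(2)])
        fix q' assume q': "q' \<in> below F s" "q' \<in> C"
        obtain v i where v: "v \<in> below F q'" "v \<in> C" "i < n" "forces_eq F z (check F (opair (vnat i) (vnat (t ! i)))) v"
          using dense_belowD[OF h[unfolded forces_mem_check[OF s(2)]] q'(1)] r(2) by (auto simp: elts_tup)
        have "v \<in> below F r" using below_trans[OF rC s(1)] below_trans[OF s(2) q'(1) v(1)] by blast
        then have "forces F (maps_to f (check F (vnat i)) (check F (vnat (t ! i)))) v"
          using forces_mono[OF m[OF v(3)] rC] by blast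
        then have "forces F (check F (opair (vnat i) (vnat (t ! i))) \<^bold>\<in> f) v"
          using nf v(2) by (simp add: forces_maps_to check_opair del: forces.simps)
        then have "forces F (z \<^bold>\<in> f) v" using extensionalD[OF extensional_mem_left v(4) z is_name_check v(2)] by blast
        then show "\<exists>v\<in>below F q'. forces F (z \<^bold>\<in> f) v" using v(1) by blast
      qed (use nf z in simp)
    qed
  qed
  then show "\<exists>r\<in>below F q. \<exists>t. length t = n \<and> forces_eq F f (check F (tup t)) r" using r by blast
qed

end

section \<open>Names and products\<close>

text \<open>The bound \<open>z\<close> ensures that the collection is a set, so that a HOL relation
  can serve as a name.\<close>

definition rname :: "'v::zfc_universe forcing \<Rightarrow> ('v \<Rightarrow> 'v \<Rightarrow> bool) \<Rightarrow> 'v \<Rightarrow> 'v" where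
  "rname F R z = vset {opair (check F u) s | u s. u \<in> elts z \<and> s \<in> elts (Cond F) \<and> R u s}"

lemma (in forcing) relname_rname:
  assumes R: "\<And>u r. r \<in> C \<Longrightarrow> R u r \<Longrightarrow> u \<in> elts z" "\<And>u r s. r \<in> C \<Longrightarrow> R u r \<Longrightarrow> s \<in> below F r \<Longrightarrow> R u s"
  shows "relname F (rname F R z) R"
proof -
  have "is_set {opair (check F u) s | u s. u \<in> elts z \<and> s \<in> C \<and> R u s}"
  proof (rule is_set_small, rule small_subset)
    show "small TYPE('v) ((\<lambda>(u, s). opair (check F u) s) ` (elts z \<times> C))" by (intro small_image small_Times small_elts)
  qed auto
  then have e: "elts (rname F R z) = {opair (check F u) s | u s. u \<in> elts z \<and> s \<in> C \<and> R u s}"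
    unfolding rname_def by (rule elts_vset)
  show ?thesis unfolding relname_def
  proof (intro conjI ballI allI iffI)
    fix r u assume r: "r \<in> C" and "\<exists>s. opair (check F u) s \<in> elts (rname F R z) \<and> r \<in> below F s"
    then obtain u' s where s: "check F u = check F u'" "s \<in> C" "R u' s" "r \<in> below F s" unfolding e by auto
    have "u = u'" using forces_eq_check[OF r, of u u'] s(1) forces_eq_refl[OF is_name_check] by simp
    then show "R u r" using R(2) s by blast
  next
    fix r u assume "r \<in> C" "R u r"
    then show "\<exists>s. opair (check F u) s \<in> elts (rname F R z) \<and> r \<in> below F s" unfolding e using R(1) below_refl by blast
  qed (auto simp: e)
qed

section \<open>Product forcings, projections and lifted names\<close>

lemma elts_Cond_prod: "elts (Cond (P \<otimes> Q)) = (\<lambda>(p, q). opair p q) ` (elts (Cond P) \<times> elts (Cond Q))"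
  unfolding prod_forcing_def by (simp, rule elts_vset) (intro is_set_small small_image small_Times small_elts)

lemma below_prod: "r \<in> below (P \<otimes> Q) (opair p q) \<longleftrightarrow> (\<exists>p'\<in>below P p. \<exists>q'\<in>below Q q. r = opair p' q')"
  unfolding below_def mem_Collect_eq elts_Cond_prod by (auto simp: prod_forcing_def)

lemma forcing_notionD:
  assumes P: "forcing_notion P"
  shows "p \<in> elts (Cond P) \<Longrightarrow> Le P p p"
    "p \<in> elts (Cond P) \<Longrightarrow> q \<in> elts (Cond P) \<Longrightarrow> r \<in> elts (Cond P) \<Longrightarrow> Le P p q \<Longrightarrow> Le P q r \<Longrightarrow> Le P p r"
    "Top P \<in> elts (Cond P)" "p \<in> elts (Cond P) \<Longrightarrow> Le P p (Top P)"
proof -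
  note P1 = P[unfolded forcing_notion_def] note P2 = P1[THEN conjunct2] note P3 = P2[THEN conjunct2]
  show "p \<in> elts (Cond P) \<Longrightarrow> Le P p p" by (rule P1[THEN conjunct1, THEN bspec])
  show "p \<in> elts (Cond P) \<Longrightarrow> q \<in> elts (Cond P) \<Longrightarrow> r \<in> elts (Cond P) \<Longrightarrow> Le P p q \<Longrightarrow> Le P q r \<Longrightarrow> Le P p r"
    by (rule P2[THEN conjunct1, rule_format])
  show "Top P \<in> elts (Cond P)" by (rule P3[THEN conjunct1])
  show "p \<in> elts (Cond P) \<Longrightarrow> Le P p (Top P)" by (rule P3[THEN conjunct2, THEN bspec])
qed

lemma forcing_notion_prod: "forcing_notion P \<Longrightarrow> forcing_notion Q \<Longrightarrow> forcing_notion (P \<otimes> Q)"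
proof -
  assume P: "forcing_notion P" and Q: "forcing_notion Q"
  have le: "Le (P \<otimes> Q) (opair p q) (opair p' q') \<longleftrightarrow> Le P p p' \<and> Le Q q q'" for p q p' q' by (auto simp: prod_forcing_def)
  have t: "Top (P \<otimes> Q) = opair (Top P) (Top Q)" by (simp add: prod_forcing_def)
  note Pr = forcing_notionD[OF P] and Qr = forcing_notionD[OF Q]
  show ?thesis unfolding forcing_notion_def
  proof (intro conjI ballI impI)
    fix u assume "u \<in> elts (Cond (P \<otimes> Q))"
    then obtain p q where "p \<in> elts (Cond P)" "q \<in> elts (Cond Q)" "u = opair p q" unfolding elts_Cond_prod by auto
    then show "Le (P \<otimes> Q) u u" "Le (P \<otimes> Q) u (Top (P \<otimes> Q))" using Pr(1,4) Qr(1,4) by (simp_all add: le t)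
  next
    fix u v w assume uvw: "u \<in> elts (Cond (P \<otimes> Q))" "v \<in> elts (Cond (P \<otimes> Q))" "w \<in> elts (Cond (P \<otimes> Q))"
      and l: "Le (P \<otimes> Q) u v" "Le (P \<otimes> Q) v w"
    obtain p q where u: "p \<in> elts (Cond P)" "q \<in> elts (Cond Q)" "u = opair p q" using uvw(1) unfolding elts_Cond_prod by auto
    obtain p' q' where v: "p' \<in> elts (Cond P)" "q' \<in> elts (Cond Q)" "v = opair p' q'" using uvw(2) unfolding elts_Cond_prod by auto
    obtain p'' q'' where w: "p'' \<in> elts (Cond P)" "q'' \<in> elts (Cond Q)" "w = opair p'' q''" using uvw(3) unfolding elts_Cond_prod by auto
    have "Le P p p''" by (rule Pr(2)[OF u(1) v(1) w(1)]) (use l u v w in \<open>simp_all add: le\<close>)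
    moreover have "Le Q q q''" by (rule Qr(2)[OF u(2) v(2) w(2)]) (use l u v w in \<open>simp_all add: le\<close>)
    ultimately show "Le (P \<otimes> Q) u w" using u w by (simp add: le)
  next
    show "Top (P \<otimes> Q) \<in> elts (Cond (P \<otimes> Q))" unfolding t elts_Cond_prod using Pr(3) Qr(3) by auto
  qed
qed

definition pfst :: "'v::zfc_universe \<Rightarrow> 'v" where "pfst r = (THE p. \<exists>q. r = opair p q)"

definition psnd :: "'v::zfc_universe \<Rightarrow> 'v" where "psnd r = (THE q. \<exists>p. r = opair p q)"

lemma pfst_opair [simp]: "pfst (opair p q) = p"
  by (auto simp: pfst_def)

lemma psnd_opair [simp]: "psnd (opair p q) = q"
  by (auto simp: psnd_def)

text \<open>The equation between images of cones is what lets density below a condition of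
  \<open>G\<close> be pulled back to \<open>F\<close>.\<close>

definition projection :: "'v::zfc_universe forcing \<Rightarrow> 'v forcing \<Rightarrow> ('v \<Rightarrow> 'v) \<Rightarrow> bool" where
  "projection F G \<pi> \<longleftrightarrow> (\<forall>r\<in>elts (Cond F). \<pi> r \<in> elts (Cond G) \<and> \<pi> ` below F r = below G (\<pi> r))"

lemma projection_pfst: "forcing_notion Q \<Longrightarrow> projection (P \<otimes> Q) P pfst"
proof -
  assume "forcing_notion Q"
  then have r: "q \<in> below Q q" if "q \<in> elts (Cond Q)" for q using forcing.below_refl forcing.intro that by blast
  have "pfst ` below (P \<otimes> Q) (opair p q) = below P p" if "q \<in> elts (Cond Q)" for p q
    using r[OF that] by (force simp: below_prod image_iff)
  then show ?thesis unfolding projection_def by (auto simp: elts_Cond_prod)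
qed

lemma projection_psnd: "forcing_notion P \<Longrightarrow> projection (P \<otimes> Q) Q psnd"
proof -
  assume "forcing_notion P"
  then have r: "p \<in> below P p" if "p \<in> elts (Cond P)" for p using forcing.below_refl forcing.intro that by blast
  have "psnd ` below (P \<otimes> Q) (opair p q) = below Q q" if "p \<in> elts (Cond P)" for p q
    using r[OF that] by (force simp: below_prod image_iff)
  then show ?thesis unfolding projection_def by (auto simp: elts_Cond_prod)
qed

lemma elts_lift_name: "elts (lift_name j x) = (\<lambda>(z, p). opair (lift_name j z) (j p)) ` {(z, p). opair z p \<in> elts x}"
proof (subst lift_name.simps, rule elts_vset, rule is_set_small, rule small_image)
  show "small TYPE('a) {(z, p). opair z p \<in> elts x}"
    by (rule small_inj[OF small_elts[of x], of "\<lambda>(z, p). opair z p"]) (auto simp: inj_on_def)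
qed

lemma lift_name_check: "j (Top P) = Top P' \<Longrightarrow> lift_name j (check P x) = check P' x"
proof (induction x rule: mem_induct)
  case (1 x)
  have e: "elts (check F x) = (\<lambda>y. opair (check F y) (Top F)) ` elts x" for F :: "'a forcing" and x
    by (subst check.simps) (simp add: elts_vset is_set_image)
  have "{(z, p). opair z p \<in> elts (check P x)} = (\<lambda>y. (check P y, Top P)) ` elts x" by (auto simp: e)
  then have "elts (lift_name j (check P x)) = (\<lambda>y. opair (lift_name j (check P y)) (j (Top P))) ` elts x"
    unfolding elts_lift_name by (simp add: image_image)
  also have "\<dots> = (\<lambda>y. opair (check P' y) (Top P')) ` elts x" using 1 by (intro image_cong) auto
  finally show ?case by (intro extensionality) (simp add: e)
qed

text \<open>Lifting sends check names to check names, and \<open>r\<close> lies below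
  \<open>j s\<close> exactly when its projection lies below \<open>s\<close>; so the lifted name is
  described by the old relation read through \<open>\<pi>\<close>.\<close>

lemma relname_lift_name:
  assumes N: "relname P N R" and top: "j (Top P) = Top P'"
    and j: "\<And>s. s \<in> elts (Cond P) \<Longrightarrow> j s \<in> elts (Cond P')"
    and b: "\<And>r s. r \<in> elts (Cond P') \<Longrightarrow> s \<in> elts (Cond P) \<Longrightarrow> r \<in> below P' (j s) \<longleftrightarrow> \<pi> r \<in> below P s"
    and \<pi>: "\<And>r. r \<in> elts (Cond P') \<Longrightarrow> \<pi> r \<in> elts (Cond P)"
    and F: "forcing_notion P'"
  shows "relname P' (lift_name j N) (\<lambda>u r. R u (\<pi> r))"
proof -
  interpret forcing P' using F by unfold_locales
  have N1: "\<exists>u. z = check P u \<and> s \<in> elts (Cond P)" if "opair z s \<in> elts N" for z s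
    using N that unfolding relname_def by (metis opair_iff)
  show ?thesis unfolding relname_def
  proof (intro conjI ballI allI)
    fix v assume "v \<in> elts (lift_name j N)"
    then obtain z s where zs: "v = opair (lift_name j z) (j s)" "opair z s \<in> elts N" unfolding elts_lift_name by auto
    obtain u where u: "z = check P u" "s \<in> elts (Cond P)" using N1[OF zs(2)] by blast
    then show "\<exists>u. \<exists>s\<in>elts (Cond P'). v = opair (check P' u) s" using zs(1) lift_name_check[of j, OF top] j by auto
  next
    fix r u assume r: "r \<in> elts (Cond P')"
    have "R u (\<pi> r) \<longleftrightarrow> (\<exists>s. opair (check P u) s \<in> elts N \<and> \<pi> r \<in> below P s)"
      using N \<pi>[OF r] unfolding relname_def by blast
    also have "\<dots> \<longleftrightarrow> (\<exists>s. opair (check P' u) s \<in> elts (lift_name j N) \<and> r \<in> below P' s)"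
    proof
      assume "\<exists>s. opair (check P u) s \<in> elts N \<and> \<pi> r \<in> below P s"
      then obtain s where s: "opair (check P u) s \<in> elts N" "\<pi> r \<in> below P s" by blast
      have "opair (check P' u) (j s) \<in> elts (lift_name j N)"
        unfolding elts_lift_name by (rule image_eqI[of _ _ "(check P u, s)"]) (simp_all add: lift_name_check[of j, OF top] s)
      then show "\<exists>s. opair (check P' u) s \<in> elts (lift_name j N) \<and> r \<in> below P' s"
        using s b[OF r] N1[OF s(1)] by blast
    next
      assume "\<exists>s. opair (check P' u) s \<in> elts (lift_name j N) \<and> r \<in> below P' s"
      then obtain z s where s: "check P' u = lift_name j z" "opair z s \<in> elts N" "r \<in> below P' (j s)"
        unfolding elts_lift_name by auto
      obtain u' where u': "z = check P u'" "s \<in> elts (Cond P)" using N1[OF s(2)] by blast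
      have "check P' u = check P' u'" using s(1) u'(1) lift_name_check[of j, OF top] by simp
      then have "u = u'" using forces_eq_check[OF r, of u u'] forces_eq_refl[OF is_name_check] by simp
      then show "\<exists>s. opair (check P u) s \<in> elts N \<and> \<pi> r \<in> below P s" using s u' b[OF r] by blast
    qed
    finally show "R u (\<pi> r) \<longleftrightarrow> (\<exists>s. opair (check P' u) s \<in> elts (lift_name j N) \<and> r \<in> below P' s)" .
  qed
qed

lemma relname_left_name:
  assumes N: "relname P N R" and P: "forcing_notion P" and Q: "forcing_notion Q"
  shows "relname (P \<otimes> Q) (left_name Q N) (\<lambda>u r. R u (pfst r))"
  unfolding left_name_def
proof (rule relname_lift_name[OF N])
  interpret Q: forcing Q using Q by unfold_locales
  show "opair (Top P) (Top Q) = Top (P \<otimes> Q)" by (simp add: prod_forcing_def)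
  show "r \<in> below (P \<otimes> Q) (opair s (Top Q)) \<longleftrightarrow> pfst r \<in> below P s" if "r \<in> elts (Cond (P \<otimes> Q))" for r s
    using that Q.below_Top by (auto simp: elts_Cond_prod below_prod)
  show "forcing_notion (P \<otimes> Q)" by (rule forcing_notion_prod[OF P Q])
qed (auto simp: elts_Cond_prod intro: forcing.Top_C[OF forcing.intro[OF Q]])

lemma relname_right_name:
  assumes N: "relname Q N R" and P: "forcing_notion P" and Q: "forcing_notion Q"
  shows "relname (P \<otimes> Q) (right_name P N) (\<lambda>u r. R u (psnd r))"
  unfolding right_name_def
proof (rule relname_lift_name[OF N])
  interpret P: forcing P using P by unfold_locales
  show "opair (Top P) (Top Q) = Top (P \<otimes> Q)" by (simp add: prod_forcing_def)
  show "r \<in> below (P \<otimes> Q) (opair (Top P) s) \<longleftrightarrow> psnd r \<in> below Q s" if "r \<in> elts (Cond (P \<otimes> Q))" for r s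
    using that P.below_Top by (auto simp: elts_Cond_prod below_prod)
  show "forcing_notion (P \<otimes> Q)" by (rule forcing_notion_prod[OF P Q])
qed (auto simp: elts_Cond_prod intro: forcing.Top_C[OF forcing.intro[OF P]])

subsection \<open>Generic enumerations\<close>

text \<open>\<open>d r m a\<close> says that \<open>r\<close> decides the \<open>m\<close>-th value of a generic bijection from \<open>\<omega>\<close> to \<open>A\<close> to be \<open>a\<close>.\<close>

definition enumerates :: "'v::zfc_universe forcing \<Rightarrow> 'a set \<Rightarrow> ('v \<Rightarrow> nat \<Rightarrow> 'a \<Rightarrow> bool) \<Rightarrow> bool" where
  "enumerates F A d \<longleftrightarrow> (\<forall>r\<in>elts (Cond F).
    (\<forall>m a. d r m a \<longrightarrow> a \<in> A \<and> (\<forall>s\<in>below F r. d s m a) \<and> (\<forall>b. d r m b \<longrightarrow> b = a) \<and> (\<forall>n. d r n a \<longrightarrow> n = m)) \<and>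
    (\<forall>m. \<exists>s\<in>below F r. \<exists>a. d s m a) \<and> (\<forall>a\<in>A. \<exists>s\<in>below F r. \<exists>m. d s m a))"

lemma enumeratesD:
  assumes d: "enumerates F A d" and r: "r \<in> elts (Cond F)"
  shows "d r m a \<Longrightarrow> a \<in> A" "d r m a \<Longrightarrow> s \<in> below F r \<Longrightarrow> d s m a" "d r m a \<Longrightarrow> d r m b \<Longrightarrow> b = a" "d r m a \<Longrightarrow> d r n a \<Longrightarrow> n = m"
    "\<exists>s\<in>below F r. \<exists>a. d s m a" "a \<in> A \<Longrightarrow> \<exists>s\<in>below F r. \<exists>m. d s m a"
proof -
  note d1 = bspec[OF d[unfolded enumerates_def] r] note d2 = d1[THEN conjunct2]
  { assume "d r m a"
    note e1 = d1[THEN conjunct1, rule_format, OF this] note e2 = e1[THEN conjunct2] note e3 = e2[THEN conjunct2]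
    show "a \<in> A" by (rule e1[THEN conjunct1])
    show "d s m a" if "s \<in> below F r" by (rule e2[THEN conjunct1, rule_format, OF that])
    show "b = a" if "d r m b" by (rule e3[THEN conjunct1, rule_format, OF that])
    show "n = m" if "d r n a" by (rule e3[THEN conjunct2, rule_format, OF that]) }
  show "\<exists>s\<in>below F r. \<exists>a. d s m a" by (rule d2[THEN conjunct1, THEN spec])
  show "\<exists>s\<in>below F r. \<exists>m. d s m a" if "a \<in> A" by (rule d2[THEN conjunct2, THEN bspec, OF that])
qed

lemma enumerates_projection:
  assumes d: "enumerates G A d" and \<pi>: "projection F G \<pi>"
  shows "enumerates F A (d \<circ> \<pi>)"
  unfolding enumerates_def
proof (intro ballI conjI allI impI)
  fix r assume r: "r \<in> elts (Cond F)"
  have g: "\<pi> r \<in> elts (Cond G)" and b: "below G (\<pi> r) = \<pi> ` below F r" using \<pi> r unfolding projection_def by auto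
  note e = enumeratesD[OF d g]
  show "a \<in> A" if "(d \<circ> \<pi>) r m a" for m a using e(1) that by simp
  show "(d \<circ> \<pi>) s m a" if "(d \<circ> \<pi>) r m a" "s \<in> below F r" for s m a
    using e(2)[of m a "\<pi> s"] that b by simp
  show "b = a" if "(d \<circ> \<pi>) r m a" "(d \<circ> \<pi>) r m b" for m a b using e(3)[of m a b] that by simp
  show "n = m" if "(d \<circ> \<pi>) r m a" "(d \<circ> \<pi>) r n a" for m a n using e(4)[of m a n] that by simp
  show "\<exists>s\<in>below F r. \<exists>a. (d \<circ> \<pi>) s m a" for m using e(5)[of m] b by simp
  show "\<exists>s\<in>below F r. \<exists>m. (d \<circ> \<pi>) s m a" if "a \<in> A" for a using e(6)[OF that] b by simp
qed

lemma enumerating_forcing: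
  assumes X: "small TYPE('v::zfc_universe) X" "infinite X"
  shows "\<exists>(P :: 'v forcing) d. forcing_notion P \<and> enumerates P X d"
proof -
  define K where "K = {g :: (nat \<times> 'a) set. finite g \<and> g \<subseteq> UNIV \<times> X \<and> inj_on fst g \<and> inj_on snd g}"
  have "small TYPE('v) ((UNIV :: nat set) \<times> X)" by (intro small_Times X small_countable) simp
  then have "small TYPE('v) K" by (rule small_subset[OF small_Pow]) (auto simp: K_def)
  then obtain c :: "_ \<Rightarrow> 'v" where c: "inj_on c K" "is_set (c ` K)" by (rule smallE)
  define P :: "'v forcing" where "P = \<lparr>Cond = vset (c ` K), Le = \<lambda>u v. \<exists>g\<in>K. \<exists>h\<in>K. u = c g \<and> v = c h \<and> h \<subseteq> g, Top = c {}\<rparr>"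
  define d where "d r m a \<longleftrightarrow> (\<exists>g\<in>K. r = c g \<and> (m, a) \<in> g)" for r m a
  have C: "elts (Cond P) = c ` K" using c(2) by (simp add: P_def elts_vset)
  have ceq: "c g = c h \<longleftrightarrow> g = h" if "g \<in> K" "h \<in> K" for g h using inj_onD[OF c(1)] that by blast
  have le: "Le P (c g) (c h) \<longleftrightarrow> h \<subseteq> g" if "g \<in> K" "h \<in> K" for g h
    using that ceq by (auto simp: P_def)
  have E: "{} \<in> K" by (simp add: K_def)
  have P: "forcing_notion P" unfolding forcing_notion_def C using E le by (auto simp: P_def)
  have b: "below P (c g) = c ` {h \<in> K. g \<subseteq> h}" if "g \<in> K" for g
    unfolding below_def C using le that by auto
  have dc: "d (c g) m a \<longleftrightarrow> (m, a) \<in> g" if "g \<in> K" for g m a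
    using ceq that by (auto simp: d_def)
  have ins: "insert (m, a) g \<in> K" if "g \<in> K" "m \<notin> fst ` g" "a \<in> X - snd ` g" for g m a
    using that by (auto simp: K_def)
  have "enumerates P X d" unfolding enumerates_def C
  proof (intro ballI conjI allI impI)
    fix r assume "r \<in> c ` K"
    then obtain g where g: "g \<in> K" "r = c g" by blast
    then have f: "finite g" "g \<subseteq> UNIV \<times> X" "inj_on fst g" "inj_on snd g" by (auto simp: K_def)
    show "a \<in> X" if "d r m a" for m a using that g dc f by auto
    show "d s m a" if "d r m a" "s \<in> below P r" for s m a using that g dc b by auto
    show "b = a" if "d r m a" "d r m b" for m a b using that g dc inj_onD[OF f(3), of "(m, a)" "(m, b)"] by auto
    show "n = m" if "d r m a" "d r n a" for m a n using that g dc inj_onD[OF f(4), of "(m, a)" "(n, a)"] by auto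
    show "\<exists>s\<in>below P r. \<exists>a. d s m a" for m
    proof (cases "m \<in> fst ` g")
      case True
      then show ?thesis using g b dc by force
    next
      case False
      obtain a where a: "a \<in> X - snd ` g" using X(2) f(1) by (metis finite_imageI Diff_infinite_finite ex_in_conv finite.emptyI)
      show ?thesis unfolding g(2) b[OF g(1)]
        using ins[OF g(1) False a] dc[OF ins[OF g(1) False a], of m a] by blast
    qed
    show "\<exists>s\<in>below P r. \<exists>m. d s m a" if "a \<in> X" for a
    proof (cases "a \<in> snd ` g")
      case True
      then show ?thesis using g b dc by force
    next
      case False
      obtain m where m: "m \<notin> fst ` g" using f(1) by (metis finite_imageI ex_new_if_finite infinite_UNIV_nat)
      have a: "a \<in> X - snd ` g" using that False by blast
      show ?thesis unfolding g(2) b[OF g(1)]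
        using ins[OF g(1) m a] dc[OF ins[OF g(1) m a], of m a] by blast
    qed
  qed
  with P show ?thesis by blast
qed

section \<open>Names for groups\<close>

text \<open>The addition of the ground-model group, transported to the natural numbers by the
  generic enumeration.\<close>

definition op_rel :: "('v::zfc_universe \<Rightarrow> nat \<Rightarrow> 'a::ab_group_add \<Rightarrow> bool) \<Rightarrow> 'v \<Rightarrow> 'v \<Rightarrow> bool" where
  "op_rel d u r \<longleftrightarrow> (\<exists>m n k a b. u = opair (opair (vnat m) (vnat n)) (vnat k) \<and> d r m a \<and> d r n b \<and> d r k (a + b))"

definition map_rel :: "('v::zfc_universe \<Rightarrow> nat \<Rightarrow> 'a \<Rightarrow> bool) \<Rightarrow> ('v \<Rightarrow> nat \<Rightarrow> 'b \<Rightarrow> bool) \<Rightarrow> ('a \<Rightarrow> 'b) \<Rightarrow> 'v \<Rightarrow> 'v \<Rightarrow> bool" where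
  "map_rel d d' \<theta> u r \<longleftrightarrow> (\<exists>m n a. u = opair (vnat m) (vnat n) \<and> d r m a \<and> d' r n (\<theta> a))"

definition vprod :: "'v::zfc_universe \<Rightarrow> 'v \<Rightarrow> 'v" where
  "vprod x y = vset ((\<lambda>(a, b). opair a b) ` (elts x \<times> elts y))"

lemma elts_vprod: "elts (vprod x y) = (\<lambda>(a, b). opair a b) ` (elts x \<times> elts y)"
  unfolding vprod_def by (rule elts_vset) (intro is_set_small small_image small_Times small_elts)

lemma opair_vprod [simp]: "opair a b \<in> elts (vprod x y) \<longleftrightarrow> a \<in> elts x \<and> b \<in> elts y"
  by (auto simp: elts_vprod)

context forcing
begin

lemma dense_below_conj:
  assumes "dense_below F A p" "dense_below F B p" "p \<in> C" and mono: "\<And>r s. r \<in> C \<Longrightarrow> s \<in> below F r \<Longrightarrow> A r \<Longrightarrow> A s"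
  shows "dense_below F (\<lambda>r. A r \<and> B r) p"
proof (rule dense_belowI)
  fix q assume q: "q \<in> below F p" "q \<in> C"
  obtain r where r: "r \<in> below F q" "r \<in> C" "A r" using dense_belowD[OF assms(1) q(1)] by blast
  have "r \<in> below F p" using below_trans[OF assms(3) q(1) r(1)] .
  then obtain s where s: "s \<in> below F r" "B s" using dense_belowD[OF assms(2)] by blast
  then show "\<exists>r\<in>below F q. A r \<and> B r" using mono[OF r(2) s(1) r(3)] below_trans[OF q(2) r(1) s(1)] by blast
qed

lemma forces_mp: "named \<psi> \<Longrightarrow> p \<in> C \<Longrightarrow> forces F (\<phi> \<^bold>\<longrightarrow> \<psi>) p \<Longrightarrow> q \<in> below F p \<Longrightarrow> forces F \<phi> q \<Longrightarrow> forces F \<psi> q"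
  by (simp add: forces_FImp)

lemma forces_FEx_dense: "p \<in> C \<Longrightarrow> (\<And>q. q \<in> below F p \<Longrightarrow> q \<in> C \<Longrightarrow> \<exists>r\<in>below F q. \<exists>x. is_name F x \<and> forces F (\<phi> x) r) \<Longrightarrow> forces F (FEx \<phi>) p"
  unfolding forces_FEx by (rule dense_belowI)

lemma forces_add_maps_to: "is_name F M \<Longrightarrow> is_name F x \<Longrightarrow> is_name F y \<Longrightarrow> is_name F z \<Longrightarrow> p \<in> C \<Longrightarrow>
   forces F (add M x y z) p \<longleftrightarrow> forces F (maps_to M (opn F x y) z) p"
  unfolding add_def by (rule forces_ex_pair[OF extensional_maps_to(2)]) simp_all

lemma forces_maps_to_tup:
  assumes n: "is_name F x" "is_name F y" and p: "p \<in> C"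
  shows "forces F (maps_to (check F (tup t)) x y) p \<longleftrightarrow>
    dense_below F (\<lambda>r. \<exists>k<length t. forces_eq F x (check F (vnat k)) r \<and> forces_eq F y (check F (vnat (t ! k))) r) p"
proof -
  have "vpair_rel (\<lambda>u (r::'v). u \<in> elts (tup t))" by (auto simp: vpair_rel_def elts_tup)
  from forces_maps_to_relname[OF relname_check this n p]
  have "forces F (maps_to (check F (tup t)) x y) p \<longleftrightarrow>
    dense_below F (\<lambda>r. \<exists>a b. opair a b \<in> elts (tup t) \<and> forces_eq F x (check F a) r \<and> forces_eq F y (check F b) r) p" .
  moreover have "(\<exists>a b. opair a b \<in> elts (tup t) \<and> forces_eq F x (check F a) r \<and> forces_eq F y (check F b) r) \<longleftrightarrow>
    (\<exists>k<length t. forces_eq F x (check F (vnat k)) r \<and> forces_eq F y (check F (vnat (t ! k))) r)" for r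
    by (auto simp: elts_tup)
  ultimately show ?thesis by simp
qed

subsection \<open>Deciding group elements\<close>

text \<open>The element of the group that a name for a natural number stands for, as far as
  \<open>r\<close> decides it. All group statements are translated through this relation.\<close>

definition val :: "('v \<Rightarrow> nat \<Rightarrow> 'a \<Rightarrow> bool) \<Rightarrow> 'v \<Rightarrow> 'v \<Rightarrow> 'a \<Rightarrow> bool" where
  "val d x r a \<longleftrightarrow> (\<exists>m. forces_eq F x (check F (vnat m)) r \<and> d r m a)"

lemma check_vnat_unique: "forces_eq F x (check F (vnat m)) r \<Longrightarrow> forces_eq F x (check F (vnat n)) r \<Longrightarrow> r \<in> C \<Longrightarrow> m = n"
  using forces_eq_check[of r "vnat m" "vnat n"] forces_eq_trans[OF forces_eq_sym, of x "check F (vnat m)" r "check F (vnat n)"]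
  by (auto simp: vnat_inj)

lemma val_mono:
  assumes d: "enumerates F A d" and r: "r \<in> C" and s: "s \<in> below F r" and v: "val d x r a"
  shows "val d x s a"
proof -
  obtain m where m: "forces_eq F x (check F (vnat m)) r" "d r m a" using v unfolding val_def by (elim exE conjE) (rule that)
  show ?thesis unfolding val_def
    by (rule exI[of _ m]) (rule conjI[OF forces_eq_mono[OF m(1) r s] enumeratesD(2)[OF d r m(2) s]])
qed

lemma val_unique:
  assumes d: "enumerates F A d" and r: "r \<in> C" and v: "val d x r a" "val d x r b"
  shows "a = b"
proof -
  obtain m where m: "forces_eq F x (check F (vnat m)) r" "d r m a" using v(1) unfolding val_def by (elim exE conjE) (rule that)
  obtain n where n: "forces_eq F x (check F (vnat n)) r" "d r n b" using v(2) unfolding val_def by (elim exE conjE) (rule that)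
  have "n = m" by (rule check_vnat_unique[OF n(1) m(1) r])
  then show ?thesis using enumeratesD(3)[OF d r n(2), of a] m(2) by simp
qed

lemma val_eq:
  assumes d: "enumerates F A d" and r: "r \<in> C" and v: "val d x r a" "val d y r a"
  shows "forces_eq F x y r"
proof -
  obtain m where m: "forces_eq F x (check F (vnat m)) r" "d r m a" using v(1) unfolding val_def by (elim exE conjE) (rule that)
  obtain n where n: "forces_eq F y (check F (vnat n)) r" "d r n a" using v(2) unfolding val_def by (elim exE conjE) (rule that)
  have "n = m" by (rule enumeratesD(4)[OF d r m(2) n(2)])
  then show ?thesis using forces_eq_trans[OF m(1) forces_eq_sym _] n(1) r by simp
qed

lemma val_in:
  assumes d: "enumerates F A d" and r: "r \<in> C" and v: "val d x r a"
  shows "a \<in> A"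
proof -
  obtain m where "d r m a" using v unfolding val_def by (elim exE conjE) (rule that)
  then show ?thesis by (rule enumeratesD(1)[OF d r])
qed

lemma val_check: "r \<in> C \<Longrightarrow> val d (check F (vnat m)) r a \<longleftrightarrow> d r m a"
  using forces_eq_check[of r "vnat m"] unfolding val_def by (auto simp: vnat_inj)

lemma val_omega:
  assumes "val d x r a" "r \<in> C"
  shows "forces F (x \<^bold>\<in> check F omega) r"
proof -
  obtain m where m: "forces_eq F x (check F (vnat m)) r" using assms(1) by (auto simp: val_def)
  show ?thesis unfolding forces_mem_check[OF assms(2)]
    using forces_eq_mono[OF m assms(2)] by (intro dense_below_all[OF assms(2)]) (auto simp: elts_omega)
qed

lemma omega_val:
  assumes d: "enumerates F A d" and x: "forces F (x \<^bold>\<in> check F omega) p" and p: "p \<in> C"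
  shows "dense_below F (\<lambda>r. \<exists>a. val d x r a) p"
proof (rule dense_belowI)
  fix q assume q: "q \<in> below F p" "q \<in> C"
  obtain r m where r: "r \<in> below F q" "r \<in> C" "forces_eq F x (check F (vnat m)) r"
    using dense_belowD[OF x[unfolded forces_mem_check[OF p]] q(1)] by (auto simp: elts_omega)
  obtain s a where s: "s \<in> below F r" "d s m a" using enumeratesD(5)[OF d r(2)] by blast
  then have "val d x s a" unfolding val_def using forces_eq_mono[OF r(3,2) s(1)] by blast
  then show "\<exists>r\<in>below F q. \<exists>a. val d x r a" using below_trans[OF q(2) r(1) s(1)] by blast
qed

lemma relname_map_rel:
  assumes d: "enumerates F A d" "enumerates F B d'"
  shows "relname F (rname F (map_rel d d' \<theta>) (vprod omega omega)) (map_rel d d' \<theta>)"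
proof (rule relname_rname)
  show "map_rel d d' \<theta> u s" if r: "r \<in> C" and m: "map_rel d d' \<theta> u r" and s: "s \<in> below F r" for u r s
    using m enumeratesD(2)[OF d(1) r _ s] enumeratesD(2)[OF d(2) r _ s] unfolding map_rel_def by blast
qed (auto simp: map_rel_def elts_omega)

lemma forces_maps_to_map_rel:
  assumes f: "relname F f (map_rel d d' \<theta>)" and n: "is_name F x" "is_name F y" and p: "p \<in> C"
  shows "forces F (maps_to f x y) p \<longleftrightarrow> dense_below F (\<lambda>r. \<exists>a. val d x r a \<and> val d' y r (\<theta> a)) p"
proof -
  have "vpair_rel (map_rel d d' \<theta>)" by (auto simp: vpair_rel_def map_rel_def)
  note e = forces_maps_to_relname[OF f this n p]
  have "(\<exists>a b. map_rel d d' \<theta> (opair a b) r \<and> forces_eq F x (check F a) r \<and> forces_eq F y (check F b) r) \<longleftrightarrow>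
    (\<exists>a. val d x r a \<and> val d' y r (\<theta> a))" for r
  proof
    assume "\<exists>a b. map_rel d d' \<theta> (opair a b) r \<and> forces_eq F x (check F a) r \<and> forces_eq F y (check F b) r"
    then show "\<exists>a. val d x r a \<and> val d' y r (\<theta> a)" unfolding map_rel_def val_def by auto
  next
    assume "\<exists>a. val d x r a \<and> val d' y r (\<theta> a)"
    then obtain a m n where "forces_eq F x (check F (vnat m)) r" "d r m a" "forces_eq F y (check F (vnat n)) r" "d' r n (\<theta> a)"
      unfolding val_def by (elim exE conjE) (rule that)
    then have "map_rel d d' \<theta> (opair (vnat m) (vnat n)) r \<and> forces_eq F x (check F (vnat m)) r \<and> forces_eq F y (check F (vnat n)) r"
      unfolding map_rel_def by (intro conjI exI) simp_all
    then show "\<exists>a b. map_rel d d' \<theta> (opair a b) r \<and> forces_eq F x (check F a) r \<and> forces_eq F y (check F b) r"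
      by (intro exI)
  qed
  then show ?thesis using e by simp
qed

end

locale group_name = forcing F for F :: "'v::zfc_universe forcing" +
  fixes A :: "'a::ab_group_add set" and d :: "'v \<Rightarrow> nat \<Rightarrow> 'a \<Rightarrow> bool" and M :: 'v
  assumes enum: "enumerates F A d" and M: "relname F M (op_rel d)"
    and zero: "0 \<in> A" and plus: "a \<in> A \<Longrightarrow> b \<in> A \<Longrightarrow> a + b \<in> A" and neg: "a \<in> A \<Longrightarrow> - a \<in> A"
begin

lemma is_name_M [simp]: "is_name F M"
  by (rule is_name_relname[OF M])

lemmas val_mono' = val_mono[OF enum] and val_unique' = val_unique[OF enum] and val_eq' = val_eq[OF enum]
  and val_in' = val_in[OF enum] and omega_val' = omega_val[OF enum]

definition sum_at :: "'v \<Rightarrow> 'v \<Rightarrow> 'v \<Rightarrow> 'v \<Rightarrow> bool" where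
  "sum_at x y z r \<longleftrightarrow> (\<exists>a b. val d x r a \<and> val d y r b \<and> val d z r (a + b))"

lemma sum_at_mono: "r \<in> C \<Longrightarrow> s \<in> below F r \<Longrightarrow> sum_at x y z r \<Longrightarrow> sum_at x y z s"
  unfolding sum_at_def using val_mono' by blast

text \<open>After this translation an atomic group statement in the extension speaks of actual
  elements of \<open>A\<close>, where the axioms are known.\<close>

lemma forces_add:
  assumes n: "is_name F x" "is_name F y" "is_name F z" and p: "p \<in> C"
  shows "forces F (add M x y z) p \<longleftrightarrow> dense_below F (sum_at x y z) p"
proof -
  have "vpair_rel (op_rel d)" by (auto simp: vpair_rel_def op_rel_def)
  from forces_maps_to_relname[OF M this is_name_opn[OF n(1,2)] n(3) p]
  have e: "forces F (add M x y z) p \<longleftrightarrow>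
    dense_below F (\<lambda>r. \<exists>a b. op_rel d (opair a b) r \<and> forces_eq F (opn F x y) (check F a) r \<and> forces_eq F z (check F b) r) p"
    unfolding forces_add_maps_to[OF is_name_M n p] .
  have "(\<exists>a b. op_rel d (opair a b) r \<and> forces_eq F (opn F x y) (check F a) r \<and> forces_eq F z (check F b) r) \<longleftrightarrow> sum_at x y z r"
    if r: "r \<in> C" for r
  proof
    assume "\<exists>a b. op_rel d (opair a b) r \<and> forces_eq F (opn F x y) (check F a) r \<and> forces_eq F z (check F b) r"
    then obtain i j k a b where h: "d r i a" "d r j b" "d r k (a + b)"
      "forces_eq F (opn F x y) (check F (opair (vnat i) (vnat j))) r" "forces_eq F z (check F (vnat k)) r"
      unfolding op_rel_def by auto
    have "forces_eq F x (check F (vnat i)) r \<and> forces_eq F y (check F (vnat j)) r"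
      using opn_inject[OF h(4)[unfolded check_opair]] n r by simp
    then show "sum_at x y z r" unfolding sum_at_def val_def using h
      by (intro exI[of _ a] exI[of _ b] conjI exI[of _ i] exI[of _ j] exI[of _ k]) simp_all
  next
    assume "sum_at x y z r"
    then obtain i j k a b where h: "d r i a" "d r j b" "d r k (a + b)" "forces_eq F x (check F (vnat i)) r"
      "forces_eq F y (check F (vnat j)) r" "forces_eq F z (check F (vnat k)) r"
      unfolding sum_at_def val_def by (elim exE conjE) (rule that)
    have "forces_eq F (opn F x y) (check F (opair (vnat i) (vnat j))) r"
      unfolding check_opair by (rule opn_cong[OF h(4,5)]) (use n r in simp_all)
    moreover have "op_rel d (opair (opair (vnat i) (vnat j)) (vnat k)) r" unfolding op_rel_def
      by (rule exI[of _ i], rule exI[of _ j], rule exI[of _ k], rule exI[of _ a], rule exI[of _ b]) (simp add: h)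
    ultimately show "\<exists>a b. op_rel d (opair a b) r \<and> forces_eq F (opn F x y) (check F a) r \<and> forces_eq F z (check F b) r"
      using h(6) by blast
  qed
  then show ?thesis unfolding e by (intro iffI; elim dense_below_weaken) (simp_all add: p)
qed

lemma forces_is_op: "p \<in> C \<Longrightarrow> forces F (is_op (check F omega) M) p"
  unfolding is_op_def
proof (rule forces_FExI[of _ "check F (vprod omega omega)"])
  assume p: "p \<in> C"
  have 1: "forces F (is_prod (check F (vprod omega omega)) (check F omega) (check F omega)) p"
    unfolding is_prod_def forces.simps(5)
  proof (intro allI impI)
    fix u assume u: "is_name F u"
    have "forces F (u \<^bold>\<in> check F (vprod omega omega)) q \<longleftrightarrow>
        forces F (\<^bold>\<exists>x y. x \<^bold>\<in> check F omega \<^bold>\<and> y \<^bold>\<in> check F omega \<^bold>\<and> is_pair u x y) q" if q: "q \<in> C" for q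
    proof
      assume h: "forces F (u \<^bold>\<in> check F (vprod omega omega)) q"
      show "forces F (\<^bold>\<exists>x y. x \<^bold>\<in> check F omega \<^bold>\<and> y \<^bold>\<in> check F omega \<^bold>\<and> is_pair u x y) q"
      proof (rule forces_imp_dense[OF _ q h[unfolded forces_mem_check[OF q]]])
        fix r assume r: "r \<in> C" "\<exists>v\<in>elts (vprod omega omega). forces_eq F u (check F v) r"
        then obtain a b where ab: "a \<in> elts omega" "b \<in> elts omega" "forces_eq F u (check F (opair a b)) r"
          by (auto simp: elts_vprod)
        show "forces F (\<^bold>\<exists>x y. x \<^bold>\<in> check F omega \<^bold>\<and> y \<^bold>\<in> check F omega \<^bold>\<and> is_pair u x y) r"
          by (rule forces_FExI[OF r(1) is_name_check[of a]], rule forces_FExI[OF r(1) is_name_check[of b]])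
            (use ab u r in \<open>simp add: forces_check_mem_check forces_is_pair check_opair del: forces.simps(1)\<close>)
      qed (use u in simp)
    next
      assume h: "forces F (\<^bold>\<exists>x y. x \<^bold>\<in> check F omega \<^bold>\<and> y \<^bold>\<in> check F omega \<^bold>\<and> is_pair u x y) q"
      show "forces F (u \<^bold>\<in> check F (vprod omega omega)) q"
      proof (rule forces_denseI[OF _ q])
        fix q' assume q': "q' \<in> below F q" "q' \<in> C"
        obtain r x where r: "r \<in> below F q'" "r \<in> C" "is_name F x"
            "forces F (\<^bold>\<exists>y. x \<^bold>\<in> check F omega \<^bold>\<and> y \<^bold>\<in> check F omega \<^bold>\<and> is_pair u x y) r"
          using dense_belowD[OF h[unfolded forces_FEx[of _ q]] q'(1)] by blast
        obtain s y where s: "s \<in> below F r" "s \<in> C" "is_name F y"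
            "forces F (x \<^bold>\<in> check F omega \<^bold>\<and> y \<^bold>\<in> check F omega \<^bold>\<and> is_pair u x y) s"
          using dense_belowD[OF r(4)[unfolded forces_FEx[of _ r]] below_refl[OF r(2)]] by blast
        have x: "forces F (x \<^bold>\<in> check F omega) s" and y: "forces F (y \<^bold>\<in> check F omega) s" and e: "forces_eq F u (opn F x y) s"
          using s u r(3) by (simp_all add: forces_is_pair del: forces.simps(1))
        obtain t a where t: "t \<in> below F s" "t \<in> C" "a \<in> elts omega" "forces_eq F x (check F a) t"
          using dense_belowD[OF x[unfolded forces_mem_check[OF s(2)]] below_refl[OF s(2)]] by blast
        obtain v b where v: "v \<in> below F t" "v \<in> C" "b \<in> elts omega" "forces_eq F y (check F b) v"
          using dense_belowD[OF y[unfolded forces_mem_check[OF s(2)]] t(1)] by blast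
        have vs: "v \<in> below F s" using below_trans[OF s(2) t(1) v(1)] .
        have "forces_eq F (opn F x y) (check F (opair a b)) v" unfolding check_opair
          by (rule opn_cong[OF forces_eq_mono[OF t(4,2) v(1)] v(4)]) (use r s v in simp_all)
        then have "forces_eq F u (check F (opair a b)) v" using forces_eq_trans[OF forces_eq_mono[OF e s(2) vs]] v(2) by blast
        then have "forces F (u \<^bold>\<in> check F (vprod omega omega)) v"
          using extensionalD[OF extensional_mem_left _ u is_name_check v(2)] forces_check_mem_check[OF v(2)] t(3) v(3) by fastforce
        then show "\<exists>r\<in>below F q'. forces F (u \<^bold>\<in> check F (vprod omega omega)) r"
          using below_trans[OF q'(2) r(1)] below_trans[OF r(2) s(1) vs] by blast
      qed (use u in simp)
    qed
    then show "forces F (u \<^bold>\<in> check F (vprod omega omega) \<^bold>\<longleftrightarrow>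
        (\<^bold>\<exists>x y. x \<^bold>\<in> check F omega \<^bold>\<and> y \<^bold>\<in> check F omega \<^bold>\<and> is_pair u x y)) p"
      using u p below_C by (subst forces_FIff) simp_all
  qed
  have 2: "forces F (is_fun M (check F (vprod omega omega)) (check F omega)) p"
  proof (rule is_fun_relname[OF M p])
    show "\<exists>a\<in>elts (vprod omega omega). \<exists>b\<in>elts omega. u = opair a b" if "op_rel d u r" for u r
      using that unfolding op_rel_def by (force simp: elts_omega)
    show "b = b'" if r: "r \<in> C" "op_rel d (opair a b) r" "op_rel d (opair a b') r" for a b b' r
    proof -
      obtain i j k x y where 1: "a = opair (vnat i) (vnat j)" "b = vnat k" "d r i x" "d r j y" "d r k (x + y)"
        using r(2) unfolding op_rel_def by auto
      obtain i' j' k' x' y' where 2: "a = opair (vnat i') (vnat j')" "b' = vnat k'" "d r i' x'" "d r j' y'" "d r k' (x' + y')"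
        using r(3) unfolding op_rel_def by auto
      have "i' = i" "j' = j" using 1(1) 2(1) by (auto simp: vnat_inj)
      then have "x' = x" "y' = y" using enumeratesD(3)[OF enum r(1)] 1 2 by blast+
      then have "k' = k" using enumeratesD(4)[OF enum r(1) 1(5)] 2(5) by blast
      then show ?thesis using 1 2 by simp
    qed
    show "\<exists>s\<in>below F r. \<exists>b. op_rel d (opair a b) s" if a: "a \<in> elts (vprod omega omega)" and r: "r \<in> C" for a r
    proof -
      obtain i j where a: "a = opair (vnat i) (vnat j)" using a by (auto simp: elts_vprod elts_omega)
      obtain s x where s: "s \<in> below F r" "d s i x" using enumeratesD(5)[OF enum r] by blast
      obtain t y where t: "t \<in> below F s" "d t j y" using enumeratesD(5)[OF enum below_C[OF s(1)]] by blast
      have "x + y \<in> A" using plus enumeratesD(1)[OF enum] below_C s t by blast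
      then obtain v k where v: "v \<in> below F t" "d v k (x + y)" using enumeratesD(6)[OF enum below_C[OF t(1)]] by blast
      have "d t i x" by (rule enumeratesD(2)[OF enum below_C[OF s(1)] s(2) t(1)])
      then have "d v i x" "d v j y" using enumeratesD(2)[OF enum below_C[OF t(1)] _ v(1)] t(2) by blast+
      then have "op_rel d (opair a (vnat k)) v" unfolding op_rel_def a using v by blast
      moreover have "v \<in> below F r" using below_trans[OF r s(1)] below_trans[OF below_C[OF s(1)] t(1) v(1)] by blast
      ultimately show ?thesis by blast
    qed
  qed
  show "forces F (is_prod (check F (vprod omega omega)) (check F omega) (check F omega) \<^bold>\<and> is_fun M (check F (vprod omega omega)) (check F omega)) p"
    using 1 2 by simp
qed auto

lemma forces_abelian_group:
  assumes p: "p \<in> C" and e: "val d e p 0" and ne: "is_name F e"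
  shows "forces F (abelian_group_fm (check F omega) M e) p"
proof -
  have comm: "forces F (\<^bold>\<forall>x y z. add M x y z \<^bold>\<longrightarrow> add M y x z) p" unfolding forces.simps(5)
  proof (intro allI impI)
    fix x y z assume n: "is_name F x" "is_name F y" "is_name F z"
    have "forces F (add M y x z) q" if q: "q \<in> C" "forces F (add M x y z) q" for q
    proof -
      have "sum_at y x z r" if "sum_at x y z r" for r using that unfolding sum_at_def by (metis add.commute)
      then show ?thesis using q n by (simp add: forces_add) (erule dense_below_weaken)
    qed
    then show "forces F (add M x y z \<^bold>\<longrightarrow> add M y x z) p" using p n below_C by (subst forces_FImp) auto
  qed
  have assoc: "forces F (\<^bold>\<forall>x y z xy yz r. add M x y xy \<^bold>\<and> add M y z yz \<^bold>\<and> add M xy z r \<^bold>\<longrightarrow> add M x yz r) p" unfolding forces.simps(5)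
  proof (intro allI impI)
    fix x y z xy yz r assume n: "is_name F x" "is_name F y" "is_name F z" "is_name F xy" "is_name F yz" "is_name F r"
    have "forces F (add M x yz r) q" if q: "q \<in> C" "forces F (add M x y xy \<^bold>\<and> add M y z yz \<^bold>\<and> add M xy z r) q" for q
    proof -
      have "dense_below F (sum_at x y xy) q" "dense_below F (sum_at y z yz) q" "dense_below F (sum_at xy z r) q"
        using q n by (simp_all add: forces_add)
      then have "dense_below F (\<lambda>s. sum_at x y xy s \<and> sum_at y z yz s \<and> sum_at xy z r s) q"
        using sum_at_mono q(1) by (intro dense_below_conj) blast+
      then have "dense_below F (sum_at x yz r) q"
      proof (rule dense_below_weaken[OF _ _ q(1)])
        fix s assume s: "s \<in> C" "sum_at x y xy s \<and> sum_at y z yz s \<and> sum_at xy z r s"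
        then obtain a b b' c g c' where h: "val d x s a" "val d y s b" "val d xy s (a + b)" "val d y s b'" "val d z s c" "val d yz s (b' + c)"
          "val d xy s g" "val d z s c'" "val d r s (g + c')" unfolding sum_at_def by blast
        have "b' = b" "g = a + b" "c' = c" using val_unique'[OF s(1)] h by blast+
        then show "sum_at x yz r s" unfolding sum_at_def using h by (metis add.assoc)
      qed
      then show ?thesis using n q(1) by (simp add: forces_add)
    qed
    then show "forces F (add M x y xy \<^bold>\<and> add M y z yz \<^bold>\<and> add M xy z r \<^bold>\<longrightarrow> add M x yz r) p" using p n below_C by (subst forces_FImp) auto
  qed
  have unit: "forces F (\<^bold>\<forall>x. x \<^bold>\<in> check F omega \<^bold>\<longrightarrow> add M e x x) p" unfolding forces.simps(5)
  proof (intro allI impI)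
    fix x assume n: "is_name F x"
    have "forces F (add M e x x) q" if q: "q \<in> below F p" "forces F (x \<^bold>\<in> check F omega) q" for q
    proof -
      have qC: "q \<in> C" using q below_C by blast
      have "dense_below F (sum_at e x x) q"
      proof (rule dense_below_weaken[OF omega_val'[OF q(2) qC] _ qC])
        fix r assume r: "r \<in> C" "r \<in> below F q" "\<exists>a. val d x r a"
        have "val d e r 0" using val_mono'[OF p _ e] below_trans[OF p q(1) r(2)] by blast
        then show "sum_at e x x r" unfolding sum_at_def using r(3) by (metis add_0)
      qed
      then show ?thesis using n ne qC by (simp add: forces_add)
    qed
    then show "forces F (x \<^bold>\<in> check F omega \<^bold>\<longrightarrow> add M e x x) p" using p n ne by (subst forces_FImp) auto
  qed
  have inv: "forces F (\<^bold>\<forall>x. x \<^bold>\<in> check F omega \<^bold>\<longrightarrow> (\<^bold>\<exists>y. y \<^bold>\<in> check F omega \<^bold>\<and> add M x y e)) p" unfolding forces.simps(5)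
  proof (intro allI impI)
    fix x assume n: "is_name F x"
    have "forces F (\<^bold>\<exists>y. y \<^bold>\<in> check F omega \<^bold>\<and> add M x y e) q" if q: "q \<in> below F p" "forces F (x \<^bold>\<in> check F omega) q" for q
    proof (rule forces_FEx_dense)
      show qC: "q \<in> C" using q below_C by blast
      fix q' assume q': "q' \<in> below F q" "q' \<in> C"
      obtain r a where r: "r \<in> below F q'" "r \<in> C" "val d x r a" using dense_belowD[OF omega_val'[OF q(2) qC] q'(1)] by blast
      have "- a \<in> A" using neg val_in' r by blast
      then obtain s m where s: "s \<in> below F r" "d s m (- a)" using enumeratesD(6)[OF enum r(2)] by blast
      have sC: "s \<in> C" using s below_C by blast
      have sp: "s \<in> below F p" using below_trans[OF p q(1)] below_trans[OF qC q'(1)] below_trans[OF q'(2) r(1) s(1)] by blast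
      have v: "val d (check F (vnat m)) s (- a)" using s sC by (simp add: val_check)
      have "sum_at x (check F (vnat m)) e t" if t: "t \<in> below F s" for t
      proof -
        have "val d x t a" "val d (check F (vnat m)) t (- a)" "val d e t 0"
          using val_mono'[OF r(2) below_trans[OF r(2) s(1) t] r(3)] val_mono'[OF sC t v] val_mono'[OF p below_trans[OF p sp t] e] by blast+
        then show ?thesis unfolding sum_at_def by (metis add.right_inverse)
      qed
      then have "forces F (add M x (check F (vnat m)) e) s" using n ne sC by (simp add: forces_add) (rule dense_below_all)
      then have "forces F (check F (vnat m) \<^bold>\<in> check F omega \<^bold>\<and> add M x (check F (vnat m)) e) s"
        using val_omega[OF v sC] by simp
      then show "\<exists>r\<in>below F q'. \<exists>y. is_name F y \<and> forces F (y \<^bold>\<in> check F omega \<^bold>\<and> add M x y e) r"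
        using below_trans[OF q'(2) r(1) s(1)] is_name_check by blast
    qed
    then show "forces F (x \<^bold>\<in> check F omega \<^bold>\<longrightarrow> (\<^bold>\<exists>y. y \<^bold>\<in> check F omega \<^bold>\<and> add M x y e)) p" using p n ne by (subst forces_FImp) auto
  qed
  show ?thesis unfolding abelian_group_fm_def forces.simps(4)
    using forces_is_op[OF p] val_omega[OF e p] comm assoc unit inv by blast
qed

text \<open>The defining clauses fix \<open>s\<close> only from one number to its successor, so the
  value at \<open>k\<close> is reached by an induction in which each step strengthens the condition
  to find the code of the next multiple.\<close>

lemma forces_multiples:
  assumes s: "forces F (is_multiples (check F omega) M e x s) p" and n: "is_name F s" "is_name F e" "is_name F x"
    and p: "p \<in> C" and e: "val d e p 0" and x: "val d x p a"
  shows "dense_below F (\<lambda>r. \<exists>m. forces F (maps_to s (check F (vnat k)) (check F (vnat m))) r \<and> d r m (((+) a ^^ k) 0)) p"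
proof (induction k)
  case 0
  have "forces F (is_empty (check F (vnat 0)) \<^bold>\<longrightarrow> maps_to s (check F (vnat 0)) e) p"
    using s is_name_check unfolding is_multiples_def forces.simps(4,5) by blast
  moreover have "forces F (is_empty (check F (vnat 0))) p"
    using p by (simp add: forces_is_empty[OF elts_vnat(1)] forces_eq_refl del: vnat.simps)
  ultimately have m: "forces F (maps_to s (check F (vnat 0)) e) p"
    using n p below_refl[OF p] by (subst (asm) forces_FImp) (auto simp del: vnat.simps)
  obtain i where i: "forces_eq F e (check F (vnat i)) p" "d p i 0" using e by (auto simp: val_def)
  have "forces F (maps_to s (check F (vnat 0)) (check F (vnat i))) p"
    using extensionalD[OF extensional_maps_to(3) i(1) n(2) is_name_check p] m by blast
  then show ?case using forces_mono[OF _ p] enumeratesD(2)[OF enum p i(2)] by (intro dense_below_all[OF p]) (auto simp del: vnat.simps)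
next
  case (Suc k)
  show ?case
  proof (rule dense_belowI)
    fix q assume q: "q \<in> below F p" "q \<in> C"
    let ?b = "((+) a ^^ k) 0"
    obtain r i where r: "r \<in> below F q" "r \<in> C" "forces F (maps_to s (check F (vnat k)) (check F (vnat i))) r" "d r i ?b"
      using dense_belowD[OF Suc q(1)] by blast
    have rp: "r \<in> below F p" using below_trans[OF p q(1) r(1)] .
    have "a \<in> A" "?b \<in> A" using val_in'[OF p x] enumeratesD(1)[OF enum r(2,4)] .
    then have "a + ?b \<in> A" by (rule plus)
    then obtain t j where t: "t \<in> below F r" "d t j (a + ?b)" using enumeratesD(6)[OF enum r(2)] by blast
    have tC: "t \<in> C" and tp: "t \<in> below F p" using t below_C below_trans[OF p rp] by blast+
    have "sum_at (check F (vnat i)) x (check F (vnat j)) v" if v: "v \<in> below F t" for v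
    proof -
      have vC: "v \<in> C" using v below_C by blast
      have "d v i ?b" using enumeratesD(2)[OF enum r(2,4) below_trans[OF r(2) t(1) v]] .
      moreover have "d v j (a + ?b)" using enumeratesD(2)[OF enum tC t(2) v] .
      moreover have "val d x v a" using val_mono'[OF p below_trans[OF p tp v] x] .
      ultimately show ?thesis unfolding sum_at_def
        by (intro exI[of _ ?b] exI[of _ a]) (simp add: val_check[OF vC] add.commute)
    qed
    then have ad: "forces F (add M (check F (vnat i)) x (check F (vnat j))) t"
      using n tC by (simp add: forces_add) (rule dense_below_all)
    let ?k = "check F (vnat k)" and ?k' = "check F (vnat (Suc k))" and ?i = "check F (vnat i)" and ?j = "check F (vnat j)"
    have "forces F (\<^bold>\<forall>n m y z. n \<^bold>\<in> check F omega \<^bold>\<and> is_succ m n \<^bold>\<and> maps_to s n y \<^bold>\<and> add M y x z \<^bold>\<longrightarrow> maps_to s m z) p"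
      using s unfolding is_multiples_def forces.simps(4) by (elim conjE)
    note f = this[unfolded forces.simps(5), rule_format, of ?k ?k' ?i ?j, OF is_name_check is_name_check is_name_check is_name_check]
    have 1: "forces F (?k \<^bold>\<in> check F omega) t" using tC by (simp add: forces_check_mem_check elts_omega del: forces.simps)
    have 2: "forces F (is_succ ?k' ?k) t"
      using tC by (simp add: forces_is_succ[OF elts_vnat(2)] forces_eq_refl del: vnat.simps)
    have 3: "forces F (maps_to s ?k ?i) t" by (rule forces_mono[OF r(3,2) t(1)])
    have h: "forces F (?k \<^bold>\<in> check F omega \<^bold>\<and> is_succ ?k' ?k \<^bold>\<and> maps_to s ?k ?i \<^bold>\<and> add M ?i x ?j) t"
      unfolding forces.simps(4) by (intro conjI 1 2 3 ad)
    have "forces F (maps_to s ?k' ?j) t" by (rule forces_mp[OF _ p f tp h]) (simp add: n)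
    moreover have "t \<in> below F q" using below_trans[OF q(2) r(1) t(1)] .
    ultimately show "\<exists>r\<in>below F q. \<exists>m. forces F (maps_to s (check F (vnat (Suc k))) (check F (vnat m))) r \<and> d r m (((+) a ^^ Suc k) 0)"
      using t(2) by auto
  qed
qed

lemma forces_TFAG:
  assumes tf: "\<And>a k. a \<in> A \<Longrightarrow> k > 0 \<Longrightarrow> ((+) a ^^ k) 0 = 0 \<Longrightarrow> a = 0" and p: "p \<in> C"
  shows "forces F (TFAG M) p"
proof -
  let ?t = "\<lambda>e. \<^bold>\<forall>x s n. x \<^bold>\<in> check F omega \<^bold>\<and> is_multiples (check F omega) M e x s \<^bold>\<and> n \<^bold>\<in> check F omega \<^bold>\<and> \<^bold>\<not> is_empty n \<^bold>\<and> maps_to s n e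
        \<^bold>\<longrightarrow> x \<^bold>= e"
  have tors: "forces F (?t e) q" if q: "q \<in> C" and e: "val d e q 0" and ne: "is_name F e" for q e
    unfolding forces.simps(5)
  proof (intro allI impI)
    fix x s n assume nm: "is_name F x" "is_name F s" "is_name F n"
    let ?h = "x \<^bold>\<in> check F omega \<^bold>\<and> is_multiples (check F omega) M e x s \<^bold>\<and> n \<^bold>\<in> check F omega \<^bold>\<and> \<^bold>\<not> is_empty n \<^bold>\<and> maps_to s n e"
    have "forces F (x \<^bold>= e) r" if r: "r \<in> below F q" and h: "forces F ?h r" for r
    proof (rule forces_denseI)
      show rC: "r \<in> C" using r below_C by blast
      fix r1 assume r1: "r1 \<in> below F r" "r1 \<in> C"
      obtain r2 a where r2: "r2 \<in> below F r1" "r2 \<in> C" "val d x r2 a"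
        using dense_belowD[OF omega_val'[OF _ rC] r1(1), of x] h by auto
      have n: "forces F (n \<^bold>\<in> check F omega) r2"
        using forces_mono[OF h rC below_trans[OF rC r1(1) r2(1)]] by simp
      obtain r3 k where r3: "r3 \<in> below F r2" "r3 \<in> C" "forces_eq F n (check F (vnat k)) r3"
        using dense_belowD[OF n[unfolded forces_mem_check[OF r2(2)]] below_refl[OF r2(2)]] by (auto simp: elts_omega)
      have r31: "r3 \<in> below F r1" using below_trans[OF r1(2) r2(1) r3(1)] .
      have r3r: "r3 \<in> below F r" using below_trans[OF rC r1(1) r31] .
      have r3q: "r3 \<in> below F q" using below_trans[OF q r r3r] .
      have h3: "forces F (is_multiples (check F omega) M e x s) r3" "forces F (\<^bold>\<not> is_empty n) r3" "forces F (maps_to s n e) r3"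
        using forces_mono[OF h rC r3r] by simp_all
      have k: "k > 0"
      proof (rule ccontr)
        assume "\<not> k > 0"
        then have "forces F (is_empty n) r3" using r3(3) forces_is_empty[OF elts_vnat(1) nm(3) r3(2)] by simp
        then show False using h3(2) below_refl[OF r3(2)] by simp
      qed
      have e3: "val d e r3 0" using val_mono'[OF q r3q e] .
      have x3: "val d x r3 a" using val_mono'[OF r2(2) r3(1) r2(3)] .
      obtain r4 m where r4: "r4 \<in> below F r3" "r4 \<in> C" "forces F (maps_to s (check F (vnat k)) (check F (vnat m))) r4" "d r4 m (((+) a ^^ k) 0)"
        using dense_belowD[OF forces_multiples[OF h3(1) nm(2) ne nm(1) r3(2) e3 x3, of k] below_refl[OF r3(2)]] by blast
      obtain i where i: "forces_eq F e (check F (vnat i)) r3" "d r3 i 0" using e3 by (auto simp: val_def)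
      have "forces F (maps_to s (check F (vnat k)) e) r3"
        using extensionalD[OF extensional_maps_to(2) r3(3) nm(3) is_name_check r3(2)] h3(3) by blast
      then have "forces F (maps_to s (check F (vnat k)) (check F (vnat i))) r3"
        using extensionalD[OF extensional_maps_to(3) i(1) ne is_name_check r3(2)] by blast
      then have mi: "forces F (maps_to s (check F (vnat k)) (check F (vnat i))) r4" using forces_mono r3(2) r4(1) by blast
      have "forces F (is_fun s (check F omega) (check F omega)) r4"
        using forces_mono[OF h3(1) r3(2) r4(1)] unfolding is_multiples_def by simp
      \<comment> \<open>At \<open>k\<close> the sequence takes the code \<open>m\<close> of the
        \<open>k\<close>-fold multiple and also the code \<open>i\<close> of 0; a function has only
        one value, so the multiple is 0.\<close>
      then have "(vnat m :: 'v) = vnat i" using is_fun_unique[OF _ nm(2) r4(2) _ r4(3) mi] by (simp add: elts_omega)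
      then have "m = i" by (simp only: vnat_inj)
      then have "((+) a ^^ k) 0 = 0" using enumeratesD(3)[OF enum r4(2)] r4(4) enumeratesD(2)[OF enum r3(2) i(2) r4(1)] by blast
      then have "a = 0" using tf k val_in'[OF r2(2,3)] by blast
      then have "forces F (x \<^bold>= e) r3" using val_eq'[OF r3(2) x3] e3 by simp
      then show "\<exists>r\<in>below F r1. forces F (x \<^bold>= e) r" using r31 by blast
    qed (use nm ne in simp)
    then show "forces F (?h \<^bold>\<longrightarrow> x \<^bold>= e) q" using q nm ne by (subst forces_FImp) auto
  qed
  show ?thesis unfolding TFAG_def
  proof (rule forces_FExI[OF p is_name_check[of omega]], rule forces_FEx_dense[OF p])
    fix q assume q: "q \<in> below F p" "q \<in> C"
    obtain r m where r: "r \<in> below F q" "d r m 0" using enumeratesD(6)[OF enum q(2) zero] by blast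
    have rC: "r \<in> C" using r below_C by blast
    have e: "val d (check F (vnat m)) r 0" using r rC by (simp add: val_check)
    have "forces F (is_omega (check F omega) \<^bold>\<and> abelian_group_fm (check F omega) M (check F (vnat m)) \<^bold>\<and> ?t (check F (vnat m))) r"
      unfolding forces.simps(4) using forces_is_omega_check[OF rC] forces_abelian_group[OF rC e is_name_check] tors[OF rC e is_name_check] by blast
    then show "\<exists>r\<in>below F q. \<exists>e. is_name F e \<and> forces F (is_omega (check F omega) \<^bold>\<and> abelian_group_fm (check F omega) M e \<^bold>\<and> ?t e) r"
      using r(1) is_name_check by blast
  qed
qed

end

text \<open>The partial isomorphisms of a back-and-forth system are given as subgroups of the product.\<close>

definition bf_system :: "'a::ab_group_add set \<Rightarrow> 'b::ab_group_add set \<Rightarrow> ('a \<times> 'b) set set \<Rightarrow> bool" where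
  "bf_system G H E \<longleftrightarrow> E \<noteq> {} \<and>
    (\<forall>D\<in>E. D \<subseteq> G \<times> H \<and> (\<forall>x b y c. (x, b) \<in> D \<longrightarrow> (y, c) \<in> D \<longrightarrow> (x - y, b - c) \<in> D) \<and>
      (\<forall>b. (0, b) \<in> D \<longrightarrow> b = 0) \<and> (\<forall>x. (x, 0) \<in> D \<longrightarrow> x = 0) \<and>
      (\<forall>x\<in>G. \<exists>D'\<in>E. D \<subseteq> D' \<and> (\<exists>b. (x, b) \<in> D')) \<and> (\<forall>b\<in>H. \<exists>D'\<in>E. D \<subseteq> D' \<and> (\<exists>x. (x, b) \<in> D')))"

subsection \<open>Homomorphisms\<close>

locale group_names = forcing F + M: group_name F A d M + N: group_name F B d' N
  for F :: "'v::zfc_universe forcing" and A :: "'a::ab_group_add set" and d M and B :: "'b::ab_group_add set" and d' N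
begin

definition hom_name :: "('a \<Rightarrow> 'b) \<Rightarrow> 'v" where
  "hom_name \<theta> = rname F (map_rel d d' \<theta>) (vprod omega omega)"

lemma hom_name: "relname F (hom_name \<theta>) (map_rel d d' \<theta>)"
  unfolding hom_name_def by (rule relname_map_rel[OF M.enum N.enum])

lemma is_name_hom_name [simp]: "is_name F (hom_name \<theta>)"
  by (rule is_name_relname[OF hom_name])

lemmas forces_maps_to_hom_name = forces_maps_to_map_rel[OF hom_name]

lemma is_fun_hom_name:
  assumes p: "p \<in> C" and \<theta>: "\<And>a. a \<in> A \<Longrightarrow> \<theta> a \<in> B"
  shows "forces F (is_fun (hom_name \<theta>) (check F omega) (check F omega)) p"
proof (rule is_fun_relname[OF hom_name p])
  show "\<exists>a\<in>elts omega. \<exists>b\<in>elts omega. u = opair a b" if "map_rel d d' \<theta> u r" for u r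
    using that unfolding map_rel_def by (force simp: elts_omega)
  show "b = b'" if r: "r \<in> C" "map_rel d d' \<theta> (opair x b) r" "map_rel d d' \<theta> (opair x b') r" for x b b' r
  proof -
    obtain i j a where 1: "x = vnat i" "b = vnat j" "d r i a" "d' r j (\<theta> a)" using r(2) unfolding map_rel_def by auto
    obtain i' j' a' where 2: "x = vnat i'" "b' = vnat j'" "d r i' a'" "d' r j' (\<theta> a')" using r(3) unfolding map_rel_def by auto
    have "i' = i" using 1(1) 2(1) by simp
    then have "a' = a" using enumeratesD(3)[OF M.enum r(1) 1(3)] 2(3) by blast
    then have "j' = j" using enumeratesD(4)[OF N.enum r(1) 1(4)] 2(4) by blast
    then show ?thesis using 1 2 by simp
  qed
  show "\<exists>s\<in>below F r. \<exists>b. map_rel d d' \<theta> (opair x b) s" if x: "x \<in> elts omega" and r: "r \<in> C" for x r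
  proof -
    obtain i where x: "x = vnat i" using x by (auto simp: elts_omega)
    obtain s a where s: "s \<in> below F r" "d s i a" using enumeratesD(5)[OF M.enum r] by blast
    have sC: "s \<in> C" using s below_C by blast
    have "\<theta> a \<in> B" using \<theta> enumeratesD(1)[OF M.enum sC s(2)] .
    then obtain t j where t: "t \<in> below F s" "d' t j (\<theta> a)" using enumeratesD(6)[OF N.enum sC] by blast
    have "d t i a" by (rule enumeratesD(2)[OF M.enum sC s(2) t(1)])
    then have "map_rel d d' \<theta> (opair x (vnat j)) t" unfolding map_rel_def x using t(2) by blast
    then show ?thesis using below_trans[OF r s(1) t(1)] by blast
  qed
qed

lemma is_inj_hom_name:
  assumes p: "p \<in> C" and \<theta>: "inj_on \<theta> A"
  shows "forces F (is_inj (hom_name \<theta>)) p"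
proof (rule is_inj_relname[OF hom_name _ p])
  show "vpair_rel (map_rel d d' \<theta>)" by (auto simp: vpair_rel_def map_rel_def)
  show "x = x'" if r: "r \<in> C" "map_rel d d' \<theta> (opair x b) r" "map_rel d d' \<theta> (opair x' b) r" for x x' b r
  proof -
    obtain i j a where 1: "x = vnat i" "b = vnat j" "d r i a" "d' r j (\<theta> a)" using r(2) unfolding map_rel_def by auto
    obtain i' j' a' where 2: "x' = vnat i'" "b = vnat j'" "d r i' a'" "d' r j' (\<theta> a')" using r(3) unfolding map_rel_def by auto
    have "j' = j" using 1(2) 2(2) by simp
    then have "\<theta> a' = \<theta> a" using enumeratesD(3)[OF N.enum r(1) 1(4)] 2(4) by blast
    then have "a' = a" using inj_onD[OF \<theta>] enumeratesD(1)[OF M.enum r(1)] 1(3) 2(3) by blast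
    then have "i' = i" using enumeratesD(4)[OF M.enum r(1) 1(3)] 2(3) by blast
    then show ?thesis using 1 2 by simp
  qed
qed

lemma is_surj_hom_name:
  assumes p: "p \<in> C" and \<theta>: "\<theta> ` A = B"
  shows "forces F (is_surj (hom_name \<theta>) (check F omega)) p"
proof (rule is_surj_relname[OF hom_name p])
  show "\<exists>s\<in>below F r. \<exists>x. map_rel d d' \<theta> (opair x y) s" if y: "y \<in> elts omega" and r: "r \<in> C" for y r
  proof -
    obtain j where y: "y = vnat j" using y by (auto simp: elts_omega)
    obtain s b where s: "s \<in> below F r" "d' s j b" using enumeratesD(5)[OF N.enum r] by blast
    have sC: "s \<in> C" using s below_C by blast
    have "b \<in> B" using enumeratesD(1)[OF N.enum sC s(2)] .
    then obtain a where a: "a \<in> A" "b = \<theta> a" using \<theta> by blast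
    then obtain t i where t: "t \<in> below F s" "d t i a" using enumeratesD(6)[OF M.enum sC] by blast
    have "d' t j b" by (rule enumeratesD(2)[OF N.enum sC s(2) t(1)])
    then have "map_rel d d' \<theta> (opair (vnat i) y) t" unfolding map_rel_def y a using t(2) by blast
    then show ?thesis using below_trans[OF r s(1) t(1)] by blast
  qed
qed

lemma is_hom_hom_name:
  assumes p: "p \<in> C" and \<theta>: "\<And>a b. a \<in> A \<Longrightarrow> b \<in> A \<Longrightarrow> \<theta> (a + b) = \<theta> a + \<theta> b"
  shows "forces F (is_hom (hom_name \<theta>) M N) p"
  unfolding is_hom_def forces.simps(5)
proof (intro allI impI)
  fix x y z x' y' z' assume n: "is_name F x" "is_name F y" "is_name F z" "is_name F x'" "is_name F y'" "is_name F z'"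
  define link where "link u u' r \<longleftrightarrow> (\<exists>a. val d u r a \<and> val d' u' r (\<theta> a))" for u u' r
  have link_mono: "link u u' s" if r: "r \<in> C" "s \<in> below F r" and u: "link u u' r" for u u' r s
  proof -
    obtain a where "val d u r a" "val d' u' r (\<theta> a)" using u unfolding link_def by (elim exE conjE) (rule that)
    then show ?thesis unfolding link_def using val_mono[OF M.enum r] val_mono[OF N.enum r] by blast
  qed
  let ?h = "add M x y z \<^bold>\<and> maps_to (hom_name \<theta>) x x' \<^bold>\<and> maps_to (hom_name \<theta>) y y' \<^bold>\<and> maps_to (hom_name \<theta>) z z'"
  have "forces F (add N x' y' z') q" if q: "q \<in> C" and h: "forces F ?h q" for q
  proof -
    have 1: "dense_below F (M.sum_at x y z) q" using h n q by (simp add: M.forces_add)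
    have 2: "dense_below F (link x x') q" "dense_below F (link y y') q" "dense_below F (link z z') q"
      using h n q forces_maps_to_hom_name[OF _ _ q, of _ _ \<theta>] unfolding link_def by simp_all
    have "dense_below F (\<lambda>r. M.sum_at x y z r \<and> link x x' r \<and> link y y' r \<and> link z z' r) q"
      by (rule dense_below_conj[OF 1 _ q M.sum_at_mono], rule dense_below_conj[OF 2(1) _ q link_mono], rule dense_below_conj[OF 2(2,3) q link_mono])
    then have "dense_below F (N.sum_at x' y' z') q"
    proof (rule dense_below_weaken[OF _ _ q])
      fix r assume r: "r \<in> C" "M.sum_at x y z r \<and> link x x' r \<and> link y y' r \<and> link z z' r"
      obtain a b where ab: "val d x r a" "val d y r b" "val d z r (a + b)" using r(2) unfolding M.sum_at_def by blast
      obtain a' where a': "val d x r a'" "val d' x' r (\<theta> a')" using r(2) unfolding link_def by blast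
      obtain b' where b': "val d y r b'" "val d' y' r (\<theta> b')" using r(2) unfolding link_def by blast
      obtain c' where c': "val d z r c'" "val d' z' r (\<theta> c')" using r(2) unfolding link_def by blast
      have "a' = a" "b' = b" "c' = a + b"
        using M.val_unique'[OF r(1) a'(1) ab(1)] M.val_unique'[OF r(1) b'(1) ab(2)] M.val_unique'[OF r(1) c'(1) ab(3)] by simp_all
      moreover have "\<theta> (a + b) = \<theta> a + \<theta> b" using \<theta> M.val_in'[OF r(1)] ab by blast
      ultimately show "N.sum_at x' y' z' r" unfolding N.sum_at_def using a' b' c' by auto
    qed
    then show ?thesis using n q by (simp add: N.forces_add)
  qed
  then show "forces F (?h \<^bold>\<longrightarrow> add N x' y' z') p" using n p below_C by (subst forces_FImp) auto
qed

lemma forces_iso_fm: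
  assumes p: "p \<in> C" and \<theta>: "bij_betw \<theta> A B" "\<And>a b. a \<in> A \<Longrightarrow> b \<in> A \<Longrightarrow> \<theta> (a + b) = \<theta> a + \<theta> b"
  shows "forces F (iso_fm M N) p"
  unfolding iso_fm_def
proof (rule forces_FExI[OF p is_name_check[of omega]], rule forces_FExI[OF p is_name_hom_name[of \<theta>]])
  have im: "inj_on \<theta> A" "\<theta> ` A = B" using \<theta>(1) by (auto simp: bij_betw_def)
  have B: "\<And>a. a \<in> A \<Longrightarrow> \<theta> a \<in> B" using im by blast
  show "forces F (is_omega (check F omega) \<^bold>\<and> is_fun (hom_name \<theta>) (check F omega) (check F omega) \<^bold>\<and> is_inj (hom_name \<theta>) \<^bold>\<and>
      is_surj (hom_name \<theta>) (check F omega) \<^bold>\<and> is_hom (hom_name \<theta>) M N) p"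
    unfolding forces.simps(4)
    by (intro conjI forces_is_omega_check is_fun_hom_name is_inj_hom_name is_surj_hom_name is_hom_hom_name p B im \<theta>(2))
qed

lemma forces_embeds_fm:
  assumes p: "p \<in> C" and \<theta>: "\<And>a. a \<in> A \<Longrightarrow> \<theta> a \<in> B" "inj_on \<theta> A" "\<And>a b. a \<in> A \<Longrightarrow> b \<in> A \<Longrightarrow> \<theta> (a + b) = \<theta> a + \<theta> b"
    and st: "length s = length xs" "length t = length xs"
      "\<And>i. i < length xs \<Longrightarrow> d p (s ! i) (xs ! i)" "\<And>i. i < length xs \<Longrightarrow> d' p (t ! i) (\<theta> (xs ! i))"
  shows "forces F (embeds_fm M (check F (tup s)) N (check F (tup t))) p"
  unfolding embeds_fm_def
proof (rule forces_FExI[OF p is_name_check[of omega]], rule forces_FExI[OF p is_name_hom_name[of \<theta>]])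
  let ?s = "check F (tup s)" and ?t = "check F (tup t)" and ?f = "hom_name \<theta>"
  have "forces F (\<^bold>\<forall>i y. maps_to ?t i y \<^bold>\<longleftrightarrow> (\<^bold>\<exists>x. maps_to ?s i x \<^bold>\<and> maps_to ?f x y)) p" unfolding forces.simps(5)
  proof (intro allI impI)
    fix i y assume n: "is_name F i" "is_name F y"
    have "forces F (maps_to ?t i y) q \<longleftrightarrow> forces F (\<^bold>\<exists>x. maps_to ?s i x \<^bold>\<and> maps_to ?f x y) q" if q: "q \<in> below F p" "q \<in> C" for q
    proof
      assume h: "forces F (maps_to ?t i y) q"
      show "forces F (\<^bold>\<exists>x. maps_to ?s i x \<^bold>\<and> maps_to ?f x y) q"
      proof (rule forces_imp_dense[OF _ q(2) h[unfolded forces_maps_to_tup[OF n q(2)]]])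
        fix r assume r: "r \<in> C" "r \<in> below F q"
          and "\<exists>k<length t. forces_eq F i (check F (vnat k)) r \<and> forces_eq F y (check F (vnat (t ! k))) r"
        then obtain k where k: "k < length xs" "forces_eq F i (check F (vnat k)) r" "forces_eq F y (check F (vnat (t ! k))) r" using st by auto
        have rp: "r \<in> below F p" using below_trans[OF p q(1) r(2)] .
        let ?x = "check F (vnat (s ! k))"
        have "forces F (maps_to ?s i ?x) r" unfolding forces_maps_to_tup[OF n(1) is_name_check r(1)]
          using forces_eq_mono[OF k(2) r(1)] k(1) st(1) forces_eq_refl[OF is_name_check] by (intro dense_below_all[OF r(1)]) auto
        moreover have "forces F (maps_to ?f ?x y) r" unfolding forces_maps_to_hom_name[OF is_name_check n(2) r(1)]
        proof (rule dense_below_all[OF r(1)])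
          fix v assume v: "v \<in> below F r" "v \<in> C"
          have vp: "v \<in> below F p" using below_trans[OF p rp v(1)] .
          have "val d ?x v (xs ! k)" unfolding val_check[OF v(2)] by (rule enumeratesD(2)[OF M.enum p st(3)[OF k(1)] vp])
          moreover have "d' v (t ! k) (\<theta> (xs ! k))" by (rule enumeratesD(2)[OF N.enum p st(4)[OF k(1)] vp])
          then have "val d' y v (\<theta> (xs ! k))" unfolding val_def using forces_eq_mono[OF k(3) r(1) v(1)] by blast
          ultimately show "\<exists>a. val d ?x v a \<and> val d' y v (\<theta> a)" by blast
        qed
        ultimately show "forces F (\<^bold>\<exists>x. maps_to ?s i x \<^bold>\<and> maps_to ?f x y) r" using r(1) by (intro forces_FExI[of _ ?x]) simp_all
      qed (use n in simp)
    next
      assume h: "forces F (\<^bold>\<exists>x. maps_to ?s i x \<^bold>\<and> maps_to ?f x y) q"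
      show "forces F (maps_to ?t i y) q" unfolding forces_maps_to_tup[OF n q(2)]
      proof (rule dense_belowI)
        fix q' assume q': "q' \<in> below F q" "q' \<in> C"
        obtain r x where r: "r \<in> below F q'" "r \<in> C" and x: "is_name F x" "forces F (maps_to ?s i x) r" "forces F (maps_to ?f x y) r"
          using dense_belowD[OF h[unfolded forces_FEx] q'(1)] by auto
        obtain r2 k where r2: "r2 \<in> below F r" "r2 \<in> C" "k < length s" "forces_eq F i (check F (vnat k)) r2" "forces_eq F x (check F (vnat (s ! k))) r2"
          using dense_belowD[OF x(2)[unfolded forces_maps_to_tup[OF n(1) x(1) r(2)]] below_refl[OF r(2)]] by blast
        obtain r3 a where r3: "r3 \<in> below F r2" "r3 \<in> C" "val d x r3 a" "val d' y r3 (\<theta> a)"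
          using dense_belowD[OF x(3)[unfolded forces_maps_to_hom_name[OF x(1) n(2) r(2)]] r2(1)] by blast
        have k: "k < length xs" using r2(3) st(1) by simp
        have r3q: "r3 \<in> below F q'" using below_trans[OF q'(2) r(1)] below_trans[OF r(2) r2(1) r3(1)] by blast
        have r3p: "r3 \<in> below F p" using below_trans[OF p q(1)] below_trans[OF q(2) q'(1) r3q] by blast
        have "d r3 (s ! k) (xs ! k)" by (rule enumeratesD(2)[OF M.enum p st(3)[OF k] r3p])
        then have "val d x r3 (xs ! k)" unfolding val_def using forces_eq_mono[OF r2(5,2) r3(1)] by blast
        then have "a = xs ! k" using M.val_unique'[OF r3(2,3)] by simp
        moreover have "d' r3 (t ! k) (\<theta> (xs ! k))" by (rule enumeratesD(2)[OF N.enum p st(4)[OF k] r3p])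
        ultimately have "val d' (check F (vnat (t ! k))) r3 (\<theta> a)" unfolding val_check[OF r3(2)] by simp
        then have "forces_eq F y (check F (vnat (t ! k))) r3" using N.val_eq'[OF r3(2,4)] by blast
        then show "\<exists>r\<in>below F q'. \<exists>k<length t. forces_eq F i (check F (vnat k)) r \<and> forces_eq F y (check F (vnat (t ! k))) r"
          using forces_eq_mono[OF r2(4,2) r3(1)] r3q k st(2) by auto
      qed
    qed
    then show "forces F (maps_to ?t i y \<^bold>\<longleftrightarrow> (\<^bold>\<exists>x. maps_to ?s i x \<^bold>\<and> maps_to ?f x y)) p"
      using n p below_C by (subst forces_FIff) simp_all
  qed
  then show "forces F (is_omega (check F omega) \<^bold>\<and> is_fun ?f (check F omega) (check F omega) \<^bold>\<and> is_inj ?f \<^bold>\<and> is_hom ?f M N \<^bold>\<and>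
      (\<^bold>\<forall>i y. maps_to ?t i y \<^bold>\<longleftrightarrow> (\<^bold>\<exists>x. maps_to ?s i x \<^bold>\<and> maps_to ?f x y))) p"
    unfolding forces.simps(4)
    by (intro conjI forces_is_omega_check is_fun_hom_name is_inj_hom_name is_hom_hom_name p \<theta>)
qed

subsection \<open>Back-and-forth from a forced isomorphism\<close>

text \<open>The generic isomorphism leaves a trace in the ground universe: each condition
  \<open>r\<close> determines the subgroup \<open>D r\<close> of pairs that it forces to correspond.
  A stronger condition determines more, and deciding one more value of the isomorphism or of its
  inverse is a back-and-forth step.\<close>

lemma iso_bf_system:
  assumes iso: "forces F (iso_fm M N) p" and p: "p \<in> C"
  shows "\<exists>E. bf_system A B E"
proof -
  have n1: "named (\<^bold>\<exists>f. is_omega w \<^bold>\<and> is_fun f w w \<^bold>\<and> is_inj f \<^bold>\<and> is_surj f w \<^bold>\<and> is_hom f M N)" if "is_name F w" for w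
    using that by simp
  obtain p1 w where p1: "p1 \<in> C" "is_name F w"
      "forces F (\<^bold>\<exists>f. is_omega w \<^bold>\<and> is_fun f w w \<^bold>\<and> is_inj f \<^bold>\<and> is_surj f w \<^bold>\<and> is_hom f M N) p1"
    using dense_belowD[OF iso[unfolded iso_fm_def forces_FEx[of _ p]] below_refl[OF p]] by blast
  obtain p0 f where p0: "p0 \<in> C" and f: "is_name F f"
      and h: "forces F (is_omega w \<^bold>\<and> is_fun f w w \<^bold>\<and> is_inj f \<^bold>\<and> is_surj f w \<^bold>\<and> is_hom f M N) p0"
    using dense_belowD[OF p1(3)[unfolded forces_FEx[of _ p1]] below_refl[OF p1(1)]] by blast
  let ?w = "check F omega"
  have hs: "forces F (is_omega w) p0" "forces F (is_fun f w w) p0" "forces F (is_inj f) p0" "forces F (is_surj f w) p0" "forces F (is_hom f M N) p0"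
    using h[unfolded forces.simps(4)] by (simp_all del: forces.simps)
  have w: "forces_eq F w ?w p0" by (rule forces_is_omega[OF p1(2) hs(1) p0])
  have fun0: "forces F (is_fun f ?w ?w) p0"
    using extensionalD[OF extensional_is_fun(2) w p1(2) is_name_check p0] extensionalD[OF extensional_is_fun(3) w p1(2) is_name_check p0] hs(2) by blast
  have es: "extensional F (\<lambda>w. is_surj f w)" unfolding is_surj_def by (intro extensional_intros)
  have surj0: "forces F (is_surj f ?w) p0" using extensionalD[OF es w p1(2) is_name_check p0] hs(4) by blast
  let ?m = "\<lambda>i j. maps_to f (check F (vnat i)) (check F (vnat j))"
  define pt where "pt r a b i j \<longleftrightarrow> d r i a \<and> d' r j b \<and> forces F (?m i j) r" for r a b i j
  \<comment> \<open>Only density is required, since \<open>r\<close> may know that \<open>a\<close>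
    corresponds to \<open>b\<close> without deciding which numbers code them.\<close>
  define mt where "mt r a b \<longleftrightarrow> dense_below F (\<lambda>s. \<exists>i j. pt s a b i j) r" for r a b
  have pt_mono: "pt s a b i j" if "pt r a b i j" "r \<in> C" "s \<in> below F r" for r s a b i j
    using that enumeratesD(2)[OF M.enum that(2) _ that(3)] enumeratesD(2)[OF N.enum that(2) _ that(3)] forces_mono[OF _ that(2,3)]
    unfolding pt_def by simp
  have pt_mt: "mt r a b" if "pt r a b i j" "r \<in> C" for r a b i j
    unfolding mt_def by (rule dense_below_all[OF that(2)]) (use pt_mono[OF that] in blast)
  have pt_in: "a \<in> A" "b \<in> B" if "pt r a b i j" "r \<in> C" for r a b i j
    using that enumeratesD(1)[OF M.enum that(2)] enumeratesD(1)[OF N.enum that(2)] unfolding pt_def by blast+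
  have mt_pt: "\<exists>s\<in>below F q. s \<in> C \<and> (\<exists>i j. pt s a b i j)" if "mt r a b" "q \<in> below F r" for r q a b
    using dense_belowD[OF that(1)[unfolded mt_def] that(2)] by blast
  have forth: "\<exists>s\<in>below F r. s \<in> C \<and> (\<exists>b i j. pt s a b i j)" if a: "a \<in> A" and r: "r \<in> below F p0" "r \<in> C" for a r
  proof -
    obtain r1 i where r1: "r1 \<in> below F r" "d r1 i a" using enumeratesD(6)[OF M.enum r(2) a] by blast
    have r1C: "r1 \<in> C" and r1p: "r1 \<in> below F p0" using r1 below_C below_trans[OF p0 r(1)] by blast+
    have "(vnat i :: 'v) \<in> elts omega" by (simp add: elts_omega)
    from dense_belowD[OF is_fun_total[OF fun0 f p0 this] r1p]
    obtain r2 j where r2: "r2 \<in> below F r1" "r2 \<in> C" "forces F (?m i j) r2" by (auto simp: elts_omega)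
    obtain r3 b where r3: "r3 \<in> below F r2" "d' r3 j b" using enumeratesD(5)[OF N.enum r2(2)] by blast
    have r31: "r3 \<in> below F r1" using below_trans[OF r1C r2(1) r3(1)] .
    have "pt r3 a b i j" unfolding pt_def using r3(2) enumeratesD(2)[OF M.enum r1C r1(2) r31] forces_mono[OF r2(3,2) r3(1)] by blast
    then show ?thesis using below_trans[OF r(2) r1(1) r31] below_C[OF r31] by blast
  qed
  have bck: "\<exists>s\<in>below F r. s \<in> C \<and> (\<exists>a i j. pt s a b i j)" if b: "b \<in> B" and r: "r \<in> below F p0" "r \<in> C" for b r
  proof -
    obtain r1 j where r1: "r1 \<in> below F r" "d' r1 j b" using enumeratesD(6)[OF N.enum r(2) b] by blast
    have r1C: "r1 \<in> C" and r1p: "r1 \<in> below F p0" using r1 below_C below_trans[OF p0 r(1)] by blast+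
    let ?y = "check F (vnat j)"
    have "forces F (?y \<^bold>\<in> ?w \<^bold>\<longrightarrow> (\<^bold>\<exists>x. maps_to f x ?y)) p0"
      using surj0[unfolded is_surj_def forces.simps(5), rule_format, of ?y] by simp
    moreover have "forces F (?y \<^bold>\<in> ?w) r1" using r1C by (simp add: forces_check_mem_check elts_omega del: forces.simps)
    ultimately have "forces F (\<^bold>\<exists>x. maps_to f x ?y) r1" using forces_mp[OF _ p0 _ r1p] f by simp
    then obtain r2 x where r2: "r2 \<in> below F r1" "r2 \<in> C" "is_name F x" "forces F (maps_to f x ?y) r2"
      unfolding forces_FEx using dense_belowD below_refl[OF r1C] by blast
    have r2p: "r2 \<in> below F p0" using below_trans[OF p0 r1p r2(1)] .
    have "forces F (opn F x ?y \<^bold>\<in> f) r2" using r2 f by (simp add: forces_maps_to del: forces.simps)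
    from dense_belowD[OF is_fun_mem[OF forces_mono[OF fun0 p0 r2p] f _ r2(2) this] below_refl[OF r2(2)]]
    obtain r3 u v where r3: "r3 \<in> below F r2" "r3 \<in> C" "u \<in> elts omega" "forces_eq F (opn F x ?y) (check F (opair u v)) r3"
      using r2(3) by auto
    obtain i where u: "u = vnat i" using r3(3) by (auto simp: elts_omega)
    have "forces_eq F x (check F u) r3" using opn_inject[OF r3(4)[unfolded check_opair]] r2(3) r3(2) by simp
    then have m: "forces F (?m i j) r3"
      using extensionalD[OF extensional_maps_to(2) _ r2(3) is_name_check r3(2)] forces_mono[OF r2(4,2) r3(1)] u by blast
    obtain r4 a where r4: "r4 \<in> below F r3" "d r4 i a" using enumeratesD(5)[OF M.enum r3(2)] by blast
    have r41: "r4 \<in> below F r1" using below_trans[OF r1C r2(1)] below_trans[OF r2(2) r3(1) r4(1)] by blast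
    have "pt r4 a b i j" unfolding pt_def using r4(2) enumeratesD(2)[OF N.enum r1C r1(2) r41] forces_mono[OF m r3(2) r4(1)] by blast
    then show ?thesis using below_trans[OF r(2) r1(1) r41] below_C[OF r41] by blast
  qed
  have hom: "c = b + b'" if r: "r \<in> below F p0" "r \<in> C" and h: "pt r a b i j" "pt r a' b' i' j'" "pt r (a + a') c k l" for r a b i j a' b' i' j' c k l
  proof -
    let ?c = "\<lambda>i. check F (vnat i)"
    have "forces F (add M (?c i) (?c i') (?c k) \<^bold>\<and> maps_to f (?c i) (?c j) \<^bold>\<and> maps_to f (?c i') (?c j') \<^bold>\<and> maps_to f (?c k) (?c l)
        \<^bold>\<longrightarrow> add N (?c j) (?c j') (?c l)) p0"
      using hs(5)[unfolded is_hom_def forces.simps(5), rule_format, of "?c i" "?c i'" "?c k" "?c j" "?c j'" "?c l"] by simp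
    moreover have "M.sum_at (?c i) (?c i') (?c k) s" if s: "s \<in> below F r" "s \<in> C" for s
      using pt_mono[OF h(1) r(2) s(1)] pt_mono[OF h(2) r(2) s(1)] pt_mono[OF h(3) r(2) s(1)]
      unfolding M.sum_at_def val_check[OF s(2)] pt_def by blast
    then have "forces F (add M (?c i) (?c i') (?c k)) r"
      unfolding M.forces_add[OF is_name_check is_name_check is_name_check r(2)] by (rule dense_below_all[OF r(2)])
    then have "forces F (add M (?c i) (?c i') (?c k) \<^bold>\<and> maps_to f (?c i) (?c j) \<^bold>\<and> maps_to f (?c i') (?c j') \<^bold>\<and> maps_to f (?c k) (?c l)) r"
      using h unfolding pt_def forces.simps(4) by blast
    ultimately have "forces F (add N (?c j) (?c j') (?c l)) r" using forces_mp[OF _ p0 _ r(1)] by simp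
    then obtain s where s: "s \<in> below F r" "s \<in> C" "N.sum_at (?c j) (?c j') (?c l) s"
      unfolding N.forces_add[OF is_name_check is_name_check is_name_check r(2)] using dense_belowD below_refl[OF r(2)] by blast
    then obtain e e' where e: "d' s j e" "d' s j' e'" "d' s l (e + e')" unfolding N.sum_at_def val_check[OF s(2)] by blast
    have "e = b" "e' = b'" "e + e' = c"
      using enumeratesD(3)[OF N.enum s(2)] e pt_mono[OF h(1) r(2) s(1)] pt_mono[OF h(2) r(2) s(1)] pt_mono[OF h(3) r(2) s(1)]
      unfolding pt_def by blast+
    then show ?thesis by simp
  qed
  have func: "b' = b" if r: "r \<in> below F p0" "r \<in> C" and h: "pt r a b i j" "pt r a b' i' j'" for r a b i j b' i' j'
  proof -
    have "i' = i" using enumeratesD(4)[OF M.enum r(2)] h unfolding pt_def by blast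
    then have m: "forces F (?m i j) r" "forces F (?m i j') r" using h unfolding pt_def by simp_all
    have "(vnat j :: 'v) = vnat j'"
      by (rule is_fun_unique[OF forces_mono[OF fun0 p0 r(1)] f r(2) _ m]) (simp add: elts_omega)
    then show ?thesis using enumeratesD(3)[OF N.enum r(2), of j b b'] h unfolding pt_def by simp
  qed
  have inj: "a' = a" if r: "r \<in> below F p0" "r \<in> C" and h: "pt r a b i j" "pt r a' b i' j'" for r a b i j a' i' j'
  proof -
    let ?c = "\<lambda>i. check F (vnat i)"
    have "j' = j" using enumeratesD(4)[OF N.enum r(2)] h unfolding pt_def by blast
    then have 1: "forces F (maps_to f (?c i) (?c j) \<^bold>\<and> maps_to f (?c i') (?c j)) r" using h unfolding pt_def by simp
    have 2: "forces F (maps_to f (?c i) (?c j) \<^bold>\<and> maps_to f (?c i') (?c j) \<^bold>\<longrightarrow> ?c i \<^bold>= ?c i') p0"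
      using hs(3)[unfolded is_inj_def forces.simps(5), rule_format, of "?c i" "?c i'" "?c j"] by simp
    have "forces F (?c i \<^bold>= ?c i') r" by (rule forces_mp[OF _ p0 2 r(1) 1]) simp
    then have "i' = i" using r(2) by (simp add: forces_eq_check)
    then show ?thesis using enumeratesD(3)[OF M.enum r(2), of i a a'] h unfolding pt_def by simp
  qed
  define D where "D r = {(a, b). a \<in> A \<and> b \<in> B \<and> mt r a b}" for r
  have D_mono: "D r \<subseteq> D s" if "r \<in> C" "s \<in> below F r" for r s
    unfolding D_def mt_def using dense_below_mono[OF _ that] by auto
  \<comment> \<open>From \<open>0 + 0 = 0\<close> the partner \<open>b\<close> of 0 satisfies
    \<open>b = b + b\<close>.\<close>
  have zero_B: "b = 0" if r: "r \<in> below F p0" "r \<in> C" and h: "pt r 0 b i j" for r b i j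
    using hom[OF r h h, of b i j] h by simp
  have "bf_system A B (D ` below F p0)" unfolding bf_system_def
  proof (intro conjI ballI allI impI)
    show "D ` below F p0 \<noteq> {}" using below_refl[OF p0] by blast
    fix X assume "X \<in> D ` below F p0"
    then obtain r where r: "r \<in> below F p0" and X: "X = D r" by blast
    have rC: "r \<in> C" using r below_C by blast
    show "X \<subseteq> A \<times> B" unfolding X D_def by blast
    show "(x - y, b - c) \<in> X" if xy: "(x, b) \<in> X" "(y, c) \<in> X" for x b y c
    proof -
      have h: "x \<in> A" "b \<in> B" "mt r x b" "y \<in> A" "c \<in> B" "mt r y c" using xy unfolding X D_def by auto
      have xyA: "x - y \<in> A" using M.plus[OF h(1) M.neg[OF h(4)]] by simp
      have bcB: "b - c \<in> B" using N.plus[OF h(2) N.neg[OF h(5)]] by simp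
      have "mt r (x - y) (b - c)" unfolding mt_def
      proof (rule dense_belowI)
        fix q assume q: "q \<in> below F r" "q \<in> C"
        obtain q1 i j where q1: "q1 \<in> below F q" "q1 \<in> C" "pt q1 x b i j" using mt_pt[OF h(3) q(1)] by blast
        have q1r: "q1 \<in> below F r" using below_trans[OF rC q(1) q1(1)] .
        obtain q2 i' j' where q2: "q2 \<in> below F q1" "q2 \<in> C" "pt q2 y c i' j'" using mt_pt[OF h(6) q1r] by blast
        have q2r: "q2 \<in> below F r" using below_trans[OF rC q1r q2(1)] .
        have q2p: "q2 \<in> below F p0" using below_trans[OF p0 r q2r] .
        obtain q3 e k l where q3: "q3 \<in> below F q2" "q3 \<in> C" "pt q3 (x - y) e k l" using forth[OF xyA q2p q2(2)] by blast
        have q3p: "q3 \<in> below F p0" using below_trans[OF p0 q2p q3(1)] .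
        \<comment> \<open>Homomorphisms are only known to respect sums, so the partner of the
          difference is read off from \<open>(x - y) + y = x\<close>.\<close>
        have "pt q3 (x - y + y) b i j"
          using pt_mono[OF q1(3,2) below_trans[OF q1(2) q2(1) q3(1)]] by simp
        from hom[OF q3p q3(2) q3(3) pt_mono[OF q2(3,2) q3(1)] this] have "e = b - c" by simp
        then show "\<exists>s\<in>below F q. \<exists>i j. pt s (x - y) (b - c) i j"
          using q3 below_trans[OF q(2) q1(1)] below_trans[OF q1(2) q2(1) q3(1)] by blast
      qed
      then show ?thesis unfolding X D_def using xyA bcB by simp
    qed
    show "b = 0" if "(0, b) \<in> X" for b
    proof -
      obtain s i j where s: "s \<in> below F r" "s \<in> C" "pt s 0 b i j"
        using \<open>(0, b) \<in> X\<close> mt_pt[OF _ below_refl[OF rC]] unfolding X D_def by blast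
      then show ?thesis using zero_B[OF below_trans[OF p0 r s(1)] s(2,3)] by simp
    qed
    show "x = 0" if "(x, 0) \<in> X" for x
    proof -
      obtain s i j where s: "s \<in> below F r" "s \<in> C" "pt s x 0 i j"
        using \<open>(x, 0) \<in> X\<close> mt_pt[OF _ below_refl[OF rC]] unfolding X D_def by blast
      have sp: "s \<in> below F p0" using below_trans[OF p0 r s(1)] .
      \<comment> \<open>The element 0 is matched with 0 as well, so injectivity of the generic
        isomorphism gives \<open>x = 0\<close>.\<close>
      obtain t b i' j' where t: "t \<in> below F s" "t \<in> C" "pt t 0 b i' j'" using forth[OF M.zero sp s(2)] by blast
      have tp: "t \<in> below F p0" using below_trans[OF p0 sp t(1)] .
      have "b = 0" by (rule zero_B[OF tp t(2,3)])
      then show ?thesis using inj[OF tp t(2), of 0 0 i' j' x i j] t(3) pt_mono[OF s(3,2) t(1)] by simp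
    qed
    show "\<exists>D'\<in>D ` below F p0. X \<subseteq> D' \<and> (\<exists>b. (x, b) \<in> D')" if x: "x \<in> A" for x
    proof -
      obtain s b i j where s: "s \<in> below F r" "s \<in> C" "pt s x b i j" using forth[OF x r rC] by blast
      have "(x, b) \<in> D s" unfolding D_def using pt_mt[OF s(3,2)] pt_in[OF s(3,2)] by simp
      then show ?thesis using D_mono[OF rC s(1)] below_trans[OF p0 r s(1)] X by blast
    qed
    show "\<exists>D'\<in>D ` below F p0. X \<subseteq> D' \<and> (\<exists>x. (x, b) \<in> D')" if b: "b \<in> B" for b
    proof -
      obtain s a i j where s: "s \<in> below F r" "s \<in> C" "pt s a b i j" using bck[OF b r rC] by blast
      have "(a, b) \<in> D s" unfolding D_def using pt_mt[OF s(3,2)] pt_in[OF s(3,2)] by simp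
      then show ?thesis using D_mono[OF rC s(1)] below_trans[OF p0 r s(1)] X by blast
    qed
  qed
  then show ?thesis by blast
qed

end

section \<open>The relations between the generic groups\<close>

lemma tup_inj [simp]: "tup s = (tup t :: 'v::zfc_universe) \<longleftrightarrow> s = t"
proof
  have sub: "i < length t \<and> s ! i = t ! i" if e: "tup s = (tup t :: 'v)" and i: "i < length s" for s t i
  proof -
    have "opair (vnat i) (vnat (s ! i)) \<in> elts (tup s :: 'v)" using i by (simp add: elts_tup)
    then have "opair (vnat i) (vnat (s ! i)) \<in> elts (tup t :: 'v)" by (simp only: e)
    then show ?thesis by (auto simp: elts_tup)
  qed
  assume e: "tup s = (tup t :: 'v)"
  have "length s \<le> length t" "length t \<le> length s"
    using sub[OF e, of "length t"] sub[OF e[symmetric], of "length s"] by (auto simp: not_le[symmetric])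
  then show "s = t" using sub[OF e] by (intro nth_equalityI) auto
qed simp

lemma elts_tup_append: "elts (tup (s @ [x]) :: 'v::zfc_universe) = insert (opair (vnat (length s)) (vnat x)) (elts (tup s))"
  by (auto simp: elts_tup nth_append less_Suc_eq image_iff)

lemma succ_unique:
  assumes "elts \<beta> = insert \<gamma> (elts \<gamma>)" "elts \<beta> = insert \<gamma>' (elts (\<gamma>' :: 'v::zfc_universe))"
  shows "\<gamma>' = \<gamma>"
proof (rule ccontr)
  assume n: "\<gamma>' \<noteq> \<gamma>"
  have "\<gamma>' \<in> elts \<beta>" unfolding assms(2) by simp
  moreover have "\<gamma> \<in> elts \<beta>" unfolding assms(1) by simp
  ultimately have "\<gamma>' \<in> insert \<gamma> (elts \<gamma>)" "\<gamma> \<in> insert \<gamma>' (elts \<gamma>')" by (simp only: assms(1), simp only: assms(2))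
  then show False using n mem_not_sym[of \<gamma> \<gamma>'] by auto
qed

lemma ex_succ: "\<exists>\<beta>. elts \<beta> = insert \<gamma> (elts (\<gamma> :: 'v::zfc_universe))"
  by (rule exI[of _ "vset (insert \<gamma> (elts \<gamma>))"]) (simp add: elts_vset is_set_insert)

context forcing
begin

lemma extensional_is_limit: "extensional F is_limit"
proof -
  have "extensional F (\<lambda>x. \<^bold>\<not> is_empty x \<^bold>\<and> \<^bold>\<not> (\<^bold>\<exists>y. is_succ x y))"
    by (intro extensional_intros extensional_is_empty extensional_is_succ)
  then show ?thesis unfolding is_limit_def[abs_def] .
qed

lemma extensional_embeds_fm: "extensional F (\<lambda>a. embeds_fm M a N b)" "extensional F (\<lambda>b. embeds_fm M a N b)"
  unfolding embeds_fm_def by (intro extensional_intros extensional_maps_to)+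

lemma extensional_in_level: "extensional F (\<lambda>\<beta>. in_level S \<beta> a b)" "extensional F (\<lambda>a. in_level S \<beta> a b)" "extensional F (\<lambda>b. in_level S \<beta> a b)"
  unfolding in_level_def by (intro extensional_intros extensional_is_pair extensional_maps_to)+

lemma extensional_is_append: "extensional F (\<lambda>a'. is_append a' a n x)" "extensional F (\<lambda>a. is_append a' a n x)"
  "extensional F (\<lambda>n. is_append a' a n x)" "extensional F (\<lambda>x. is_append a' a n x)"
  unfolding is_append_def by (intro extensional_intros extensional_is_pair)+

lemma extensional_in_level_append: "extensional F (\<lambda>\<beta>. in_level_append S \<beta> n a x b y)" "extensional F (\<lambda>n. in_level_append S \<beta> n a x b y)"
  "extensional F (\<lambda>a. in_level_append S \<beta> n a x b y)" "extensional F (\<lambda>x. in_level_append S \<beta> n a x b y)"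
  "extensional F (\<lambda>b. in_level_append S \<beta> n a x b y)" "extensional F (\<lambda>y. in_level_append S \<beta> n a x b y)"
  unfolding in_level_append_def by (intro extensional_intros extensional_is_append extensional_in_level)+

lemma named_in_level_append [simp]: "is_name F S \<Longrightarrow> is_name F \<beta> \<Longrightarrow> is_name F n \<Longrightarrow> is_name F a \<Longrightarrow> is_name F x \<Longrightarrow> is_name F b \<Longrightarrow>
  is_name F y \<Longrightarrow> named (in_level_append S \<beta> n a x b y)"
  by (simp add: in_level_append_def)

lemma forces_all_omega: "extensional F \<phi> \<Longrightarrow> (\<And>x. is_name F x \<Longrightarrow> named (\<phi> x)) \<Longrightarrow> p \<in> C \<Longrightarrow>
   forces F (\<^bold>\<forall>x. x \<^bold>\<in> check F omega \<^bold>\<longrightarrow> \<phi> x) p \<longleftrightarrow> (\<forall>i. forces F (\<phi> (check F (vnat i))) p)"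
  by (subst forces_all_check') (auto simp: elts_omega)

lemma forces_ex_omega: "extensional F \<phi> \<Longrightarrow> (\<And>x. is_name F x \<Longrightarrow> named (\<phi> x)) \<Longrightarrow> p \<in> C \<Longrightarrow>
   forces F (\<^bold>\<exists>x. x \<^bold>\<in> check F omega \<^bold>\<and> \<phi> x) p \<longleftrightarrow> dense_below F (\<lambda>r. \<exists>i. forces F (\<phi> (check F (vnat i))) r) p"
proof -
  assume a: "extensional F \<phi>" "\<And>x. is_name F x \<Longrightarrow> named (\<phi> x)" "p \<in> C"
  have "(\<exists>u. u \<in> elts omega \<and> forces F (\<phi> (check F u)) r) \<longleftrightarrow> (\<exists>i. forces F (\<phi> (check F (vnat i))) r)" for r
    by (auto simp: elts_omega)
  then show ?thesis using forces_ex_check[OF a, of omega] by (simp del: forces.simps)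
qed

lemma forces_in_level_maps_to: "is_name F S \<Longrightarrow> is_name F \<beta> \<Longrightarrow> is_name F a \<Longrightarrow> is_name F b \<Longrightarrow> p \<in> C \<Longrightarrow>
   forces F (in_level S \<beta> a b) p \<longleftrightarrow> forces F (maps_to S \<beta> (opn F a b)) p"
  unfolding in_level_def by (rule forces_ex_pair[OF extensional_maps_to(3)]) simp_all

lemma forces_is_append:
  assumes n: "is_name F a" and p: "p \<in> C"
  shows "forces F (is_append a (check F (tup s)) (check F (vnat (length s))) (check F (vnat x))) p \<longleftrightarrow> forces_eq F a (check F (tup (s @ [x]))) p"
proof -
  have "forces F (u \<^bold>\<in> check F (tup s) \<^bold>\<or> is_pair u (check F (vnat (length s))) (check F (vnat x))) q \<longleftrightarrow>
      forces F (u \<^bold>\<in> check F (tup (s @ [x]))) q" if u: "is_name F u" and q: "q \<in> C" for u q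
  proof -
    have "forces F (u \<^bold>\<in> check F (tup s) \<^bold>\<or> is_pair u (check F (vnat (length s))) (check F (vnat x))) q \<longleftrightarrow>
      dense_below F (\<lambda>r. forces F (u \<^bold>\<in> check F (tup s)) r \<or> forces F (is_pair u (check F (vnat (length s))) (check F (vnat x))) r) q"
      by (rule forces_FOr[OF q])
    also have "\<dots> \<longleftrightarrow> dense_below F (\<lambda>r. forces F (u \<^bold>\<in> check F (tup s)) r \<or> forces_eq F u (check F (opair (vnat (length s)) (vnat x))) r) q"
      by (intro iffI; elim dense_below_weaken) (simp_all add: forces_is_pair[OF u is_name_check is_name_check] check_opair q del: forces.simps)
    finally show ?thesis unfolding forces_mem_check_insert[OF elts_tup_append u q] .
  qed
  then show ?thesis
    unfolding is_append_def forces_eq_iff_mem[OF n is_name_check p, symmetric] forces.simps(5)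
    using n p below_C by (simp add: forces_FIff del: forces.simps)
qed

lemma is_succ_check_name:
  assumes s: "forces F (is_succ (check F \<beta>) y) q" and y: "is_name F y" and q: "q \<in> C"
  shows "\<exists>r\<in>below F q. \<exists>\<gamma>. forces_eq F y (check F \<gamma>) r \<and> elts \<beta> = insert \<gamma> (elts \<gamma>)"
proof -
  have "forces F (y \<^bold>\<in> check F \<beta> \<^bold>\<longleftrightarrow> y \<^bold>\<in> y \<^bold>\<or> y \<^bold>= y) q"
    using s y unfolding is_succ_def forces.simps(5) by blast
  moreover have "forces F (y \<^bold>\<in> y \<^bold>\<or> y \<^bold>= y) q"
    unfolding forces_FOr[OF q] using forces_eq_refl[OF y] by (intro dense_below_all[OF q]) simp
  ultimately have "forces F (y \<^bold>\<in> check F \<beta>) q"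
    using y q below_refl[OF q] by (subst (asm) forces_FIff) simp_all
  from dense_belowD[OF this[unfolded forces_mem_check[OF q]] below_refl[OF q]]
  obtain r \<gamma> where r: "r \<in> below F q" "r \<in> C" "forces_eq F y (check F \<gamma>) r" by blast
  obtain \<beta>' where \<beta>': "elts \<beta>' = insert \<gamma> (elts \<gamma>)" using ex_succ by blast
  have "forces F (is_succ (check F \<beta>) (check F \<gamma>)) r"
    using extensionalD[OF extensional_is_succ(2) r(3) y is_name_check r(2)] forces_mono[OF s q r(1)] by blast
  then have "\<beta> = \<beta>'" using forces_is_succ[OF \<beta>' is_name_check r(2)] forces_eq_check[OF r(2)] by blast
  then show ?thesis using r \<beta>' by blast
qed

lemma forces_is_empty_check: "p \<in> C \<Longrightarrow> forces F (is_empty (check F \<beta>)) p \<longleftrightarrow> elts \<beta> = {}"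
  unfolding forces_is_empty[OF elts_vnat(1) is_name_check] forces_eq_check
  using extensionality[of \<beta> "vnat 0"] elts_vnat(1) by auto

lemma forces_is_limit_check:
  assumes p: "p \<in> C"
  shows "forces F (is_limit (check F \<beta>)) p \<longleftrightarrow> elts \<beta> \<noteq> {} \<and> \<not> (\<exists>\<gamma>. elts \<beta> = insert \<gamma> (elts \<gamma>))"
proof -
  have 1: "forces F (\<^bold>\<not> is_empty (check F \<beta>)) p \<longleftrightarrow> elts \<beta> \<noteq> {}"
    using forces_is_empty_check below_C below_refl[OF p] by auto
  have 2: "forces F (\<^bold>\<not> (\<^bold>\<exists>y. is_succ (check F \<beta>) y)) p \<longleftrightarrow> \<not> (\<exists>\<gamma>. elts \<beta> = insert \<gamma> (elts \<gamma>))"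
    unfolding forces.simps(3)
  proof (intro iffI ballI notI)
    assume h: "\<forall>q\<in>below F p. \<not> forces F (\<^bold>\<exists>y. is_succ (check F \<beta>) y) q" and "\<exists>\<gamma>. elts \<beta> = insert \<gamma> (elts \<gamma>)"
    then obtain \<gamma> where \<gamma>: "elts \<beta> = insert \<gamma> (elts \<gamma>)" by blast
    have "forces F (is_succ (check F \<beta>) (check F \<gamma>)) p"
      unfolding forces_is_succ[OF \<gamma> is_name_check p] by (rule forces_eq_refl[OF is_name_check])
    then have "forces F (\<^bold>\<exists>y. is_succ (check F \<beta>) y) p" by (rule forces_FExI[OF p is_name_check])
    then show False using h below_refl[OF p] by blast
  next
    fix q assume n: "\<not> (\<exists>\<gamma>. elts \<beta> = insert \<gamma> (elts \<gamma>))" and q: "q \<in> below F p" and h: "forces F (\<^bold>\<exists>y. is_succ (check F \<beta>) y) q"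
    have qC: "q \<in> C" using q below_C by blast
    obtain r y where r: "r \<in> C" "is_name F y" "forces F (is_succ (check F \<beta>) y) r"
      using dense_belowD[OF h[unfolded forces_FEx] below_refl[OF qC]] by blast
    then show False using is_succ_check_name[OF r(3,2,1)] n by blast
  qed
  show ?thesis unfolding is_limit_def forces.simps(4) 1 2 ..
qed

end

section \<open>The levels of the recursion as a ground-model predicate\<close>

context group_names
begin

text \<open>\<open>lev \<beta> s t r\<close> says that \<open>r\<close> forces \<open>(M, s) \<sim>\<^sub>\<beta> (N, t)\<close>.\<close>

inductive lev :: "'v \<Rightarrow> nat list \<Rightarrow> nat list \<Rightarrow> 'v \<Rightarrow> bool" where
  lev_0: "elts \<beta> = {} \<Longrightarrow> forces F (embeds_fm M (check F (tup s)) N (check F (tup t))) r \<Longrightarrow>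
    forces F (embeds_fm N (check F (tup t)) M (check F (tup s))) r \<Longrightarrow> lev \<beta> s t r"
| lev_lim: "elts \<beta> \<noteq> {} \<Longrightarrow> \<not> (\<exists>\<gamma>. elts \<beta> = insert \<gamma> (elts \<gamma>)) \<Longrightarrow> (\<And>\<gamma>. \<gamma> \<in> elts \<beta> \<Longrightarrow> lev \<gamma> s t r) \<Longrightarrow> lev \<beta> s t r"
| lev_suc: "elts \<beta> = insert \<gamma> (elts \<gamma>) \<Longrightarrow> (\<And>x q. q \<in> below F r \<Longrightarrow> \<exists>r'\<in>below F q. \<exists>y. lev \<gamma> (s @ [x]) (t @ [y]) r') \<Longrightarrow>
    (\<And>y q. q \<in> below F r \<Longrightarrow> \<exists>r'\<in>below F q. \<exists>x. lev \<gamma> (s @ [x]) (t @ [y]) r') \<Longrightarrow> lev \<beta> s t r"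

lemma lev_0_iff:
  assumes "elts \<beta> = {}"
  shows "lev \<beta> s t r \<longleftrightarrow> forces F (embeds_fm M (check F (tup s)) N (check F (tup t))) r \<and>
    forces F (embeds_fm N (check F (tup t)) M (check F (tup s))) r"
proof
  assume "lev \<beta> s t r"
  then show "forces F (embeds_fm M (check F (tup s)) N (check F (tup t))) r \<and> forces F (embeds_fm N (check F (tup t)) M (check F (tup s))) r"
    by cases (use assms in auto)
qed (use assms lev_0 in blast)

lemma lev_lim_iff:
  assumes "elts \<beta> \<noteq> {}" "\<not> (\<exists>\<gamma>. elts \<beta> = insert \<gamma> (elts \<gamma>))"
  shows "lev \<beta> s t r \<longleftrightarrow> (\<forall>\<gamma>\<in>elts \<beta>. lev \<gamma> s t r)"
proof
  assume "lev \<beta> s t r"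
  then show "\<forall>\<gamma>\<in>elts \<beta>. lev \<gamma> s t r" by cases (use assms in auto)
qed (use assms lev_lim in blast)

lemma lev_suc_iff:
  assumes "elts \<beta> = insert \<gamma> (elts \<gamma>)"
  shows "lev \<beta> s t r \<longleftrightarrow> (\<forall>x. dense_below F (\<lambda>r'. \<exists>y. lev \<gamma> (s @ [x]) (t @ [y]) r') r) \<and>
    (\<forall>y. dense_below F (\<lambda>r'. \<exists>x. lev \<gamma> (s @ [x]) (t @ [y]) r') r)" (is "_ \<longleftrightarrow> ?R")
proof
  assume "lev \<beta> s t r"
  then show ?R
  proof cases
    case (lev_suc \<gamma>')
    then have "\<gamma>' = \<gamma>" using succ_unique assms by blast
    then show ?thesis using lev_suc(2,3) unfolding dense_below_def by simp
  qed (use assms in auto)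
next
  assume ?R
  then show "lev \<beta> s t r" unfolding dense_below_def by (intro lev_suc[OF assms]) simp_all
qed

lemma lev_mono:
  assumes r: "r \<in> C" "q \<in> below F r"
  shows "lev \<beta> s t r \<Longrightarrow> lev \<beta> s t q"
proof (induction \<beta> arbitrary: s t rule: mem_induct)
  case (1 \<beta>)
  from \<open>lev \<beta> s t r\<close> show ?case
  proof cases
    case lev_0
    show ?thesis by (rule lev.lev_0[OF lev_0(1) forces_mono[OF lev_0(2) r] forces_mono[OF lev_0(3) r]])
  next
    case lev_lim
    show ?thesis by (rule lev.lev_lim[OF lev_lim(1,2) 1(1)[OF _ lev_lim(3)]])
  next
    case (lev_suc \<gamma>)
    show ?thesis by (rule lev.lev_suc[OF lev_suc(1) lev_suc(2) lev_suc(3)]) (rule below_trans[OF r], assumption)+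
  qed
qed

text \<open>Membership in a name only requires density. The ground-model predicate must have the
  same closure before it can agree with forced membership in \<open>level_name\<close>.\<close>

lemma lev_dense: "dense_below F (lev \<beta> s t) p \<Longrightarrow> p \<in> C \<Longrightarrow> lev \<beta> s t p"
proof (induction \<beta> arbitrary: s t p rule: mem_induct)
  case (1 \<beta>)
  note d = \<open>dense_below F (lev \<beta> s t) p\<close> and p = \<open>p \<in> C\<close>
  consider "elts \<beta> = {}" | "elts \<beta> \<noteq> {}" "\<not> (\<exists>\<gamma>. elts \<beta> = insert \<gamma> (elts \<gamma>))" | \<gamma> where "elts \<beta> = insert \<gamma> (elts \<gamma>)" by blast
  then show ?case
  proof cases
    case 1
    have "dense_below F (\<lambda>r. forces F (embeds_fm M (check F (tup s)) N (check F (tup t))) r) p"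
      by (rule dense_below_weaken[OF d _ p]) (simp add: lev_0_iff[OF 1])
    then have a: "forces F (embeds_fm M (check F (tup s)) N (check F (tup t))) p" using p by (intro forces_dense) simp_all
    have "dense_below F (\<lambda>r. forces F (embeds_fm N (check F (tup t)) M (check F (tup s))) r) p"
      by (rule dense_below_weaken[OF d _ p]) (simp add: lev_0_iff[OF 1])
    then have "forces F (embeds_fm N (check F (tup t)) M (check F (tup s))) p" using p by (intro forces_dense) simp_all
    then show ?thesis using a by (intro lev_0[OF 1])
  next
    case 2
    have "lev \<gamma> s t p" if "\<gamma> \<in> elts \<beta>" for \<gamma>
    proof (rule 1(1)[OF that _ p])
      show "dense_below F (lev \<gamma> s t) p" by (rule dense_below_weaken[OF d _ p]) (use that in \<open>simp add: lev_lim_iff[OF 2]\<close>)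
    qed
    then show ?thesis by (intro lev_lim[OF 2])
  next
    case (3 \<gamma>)
    have "\<exists>r'\<in>below F q. \<exists>y. lev \<gamma> (s @ [x]) (t @ [y]) r'" if q: "q \<in> below F p" for x q
    proof -
      obtain r where r: "r \<in> below F q" "r \<in> C" "lev \<beta> s t r" using dense_belowD[OF d q] by blast
      then have "dense_below F (\<lambda>r'. \<exists>y. lev \<gamma> (s @ [x]) (t @ [y]) r') r" unfolding lev_suc_iff[OF 3] by blast
      from dense_belowD[OF this below_refl[OF r(2)]] show ?thesis using below_trans[OF below_C[OF q] r(1)] by blast
    qed
    moreover have "\<exists>r'\<in>below F q. \<exists>x. lev \<gamma> (s @ [x]) (t @ [y]) r'" if q: "q \<in> below F p" for y q
    proof -
      obtain r where r: "r \<in> below F q" "r \<in> C" "lev \<beta> s t r" using dense_belowD[OF d q] by blast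
      then have "dense_below F (\<lambda>r'. \<exists>x. lev \<gamma> (s @ [x]) (t @ [y]) r') r" unfolding lev_suc_iff[OF 3] by blast
      from dense_belowD[OF this below_refl[OF r(2)]] show ?thesis using below_trans[OF below_C[OF q] r(1)] by blast
    qed
    ultimately show ?thesis by (intro lev_suc[OF 3])
  qed
qed

lemma lev_dense_iff:
  assumes p: "p \<in> C"
  shows "dense_below F (lev \<beta> s t) p \<longleftrightarrow> lev \<beta> s t p"
proof
  show "lev \<beta> s t p" if "dense_below F (lev \<beta> s t) p" by (rule lev_dense[OF that p])
  show "dense_below F (lev \<beta> s t) p" if "lev \<beta> s t p"
    by (rule dense_below_all[OF p]) (rule lev_mono[OF p _ that])
qed

text \<open>Separates forcing from algebra: \<open>game\<close> speaks of lists of group elements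
  only, and the condition \<open>r\<close> enters only by deciding which numbers code them.\<close>

lemma lev_game:
  assumes emb: "\<And>\<beta> xs ys. game \<beta> xs ys \<Longrightarrow> \<exists>\<theta>. (\<forall>a\<in>A. \<theta> a \<in> B) \<and> inj_on \<theta> A \<and> (\<forall>a b. \<theta> (a + b) = \<theta> a + \<theta> b) \<and> ys = map \<theta> xs"
    and emb': "\<And>\<beta> xs ys. game \<beta> xs ys \<Longrightarrow> \<exists>\<theta>. (\<forall>b\<in>B. \<theta> b \<in> A) \<and> inj_on \<theta> B \<and> (\<forall>a b. \<theta> (a + b) = \<theta> a + \<theta> b) \<and> xs = map \<theta> ys"
    and mono: "\<And>\<beta> \<gamma> xs ys. game \<beta> xs ys \<Longrightarrow> Ord \<beta> \<Longrightarrow> \<gamma> \<in> elts \<beta> \<Longrightarrow> game \<gamma> xs ys"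
    and forth: "\<And>\<beta> \<gamma> xs ys x. game \<beta> xs ys \<Longrightarrow> elts \<beta> = insert \<gamma> (elts \<gamma>) \<Longrightarrow> Ord \<beta> \<Longrightarrow> x \<in> A \<Longrightarrow> \<exists>y\<in>B. game \<gamma> (xs @ [x]) (ys @ [y])"
    and back': "\<And>\<beta> \<gamma> xs ys y. game \<beta> xs ys \<Longrightarrow> elts \<beta> = insert \<gamma> (elts \<gamma>) \<Longrightarrow> Ord \<beta> \<Longrightarrow> y \<in> B \<Longrightarrow> \<exists>x\<in>A. game \<gamma> (xs @ [x]) (ys @ [y])"
  shows "Ord \<beta> \<Longrightarrow> game \<beta> xs ys \<Longrightarrow> r \<in> C \<Longrightarrow> list_all2 (d r) s xs \<Longrightarrow> list_all2 (d' r) t ys \<Longrightarrow> lev \<beta> s t r"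
proof (induction \<beta> arbitrary: xs ys s t r rule: mem_induct)
  case (1 \<beta>)
  note \<beta> = \<open>Ord \<beta>\<close> and g = \<open>game \<beta> xs ys\<close> and r = \<open>r \<in> C\<close> and s = \<open>list_all2 (d r) s xs\<close> and t = \<open>list_all2 (d' r) t ys\<close>
  note IH = 1(1)
  have keep: "list_all2 (d q) s xs" "list_all2 (d' q) t ys" if q: "q \<in> below F r" for q
    by (rule list_all2_mono[OF s enumeratesD(2)[OF M.enum r _ q]], assumption) (rule list_all2_mono[OF t enumeratesD(2)[OF N.enum r _ q]])
  have len: "length s = length xs" "length t = length ys" using s t by (simp_all add: list_all2_lengthD)
  consider "elts \<beta> = {}" | "elts \<beta> \<noteq> {}" "\<not> (\<exists>\<gamma>. elts \<beta> = insert \<gamma> (elts \<gamma>))" | \<gamma> where "elts \<beta> = insert \<gamma> (elts \<gamma>)" by blast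
  then show ?case
  proof cases
    case 1
    \<comment> \<open>The same locale with the two groups exchanged, for the embedding in the other
      direction.\<close>
    interpret R: group_names F B d' N A d M by unfold_locales
    obtain \<theta> where \<theta>: "\<And>a. a \<in> A \<Longrightarrow> \<theta> a \<in> B" "inj_on \<theta> A" "\<And>a b. \<theta> (a + b) = \<theta> a + \<theta> b" "ys = map \<theta> xs"
      using emb[OF g] by blast
    obtain \<theta>' where \<theta>': "\<And>a. a \<in> B \<Longrightarrow> \<theta>' a \<in> A" "inj_on \<theta>' B" "\<And>a b. \<theta>' (a + b) = \<theta>' a + \<theta>' b" "xs = map \<theta>' ys"
      using emb'[OF g] by blast
    have l: "length ys = length xs" using \<theta>(4) by simp
    have yi: "ys ! i = \<theta> (xs ! i)" and xi: "xs ! i = \<theta>' (ys ! i)" if "i < length xs" for i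
      using nth_map[of i xs \<theta>] nth_map[of i ys \<theta>'] that l by (simp_all flip: \<theta>(4) \<theta>'(4))
    have "forces F (embeds_fm M (check F (tup s)) N (check F (tup t))) r"
      by (rule forces_embeds_fm[OF r \<theta>(1,2,3), of s xs]) (use len l list_all2_nthD2[OF s] list_all2_nthD2[OF t] yi in auto)
    moreover have "forces F (embeds_fm N (check F (tup t)) M (check F (tup s))) r"
      by (rule R.forces_embeds_fm[OF r \<theta>'(1,2,3), of t ys]) (use len l list_all2_nthD2[OF s] list_all2_nthD2[OF t] xi in auto)
    ultimately show ?thesis by (rule lev_0[OF 1])
  next
    case 2
    have "lev \<gamma> s t r" if "\<gamma> \<in> elts \<beta>" for \<gamma>
      by (rule IH[OF that Ord_mem[OF \<beta> that] mono[OF g \<beta> that] r s t])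
    then show ?thesis by (rule lev_lim[OF 2])
  next
    case (3 \<gamma>)
    have \<gamma>: "\<gamma> \<in> elts \<beta>" "Ord \<gamma>" using Ord_mem[OF \<beta>, of \<gamma>] 3 by simp_all
    have "\<exists>r'\<in>below F q. \<exists>j. lev \<gamma> (s @ [i]) (t @ [j]) r'" if q: "q \<in> below F r" for i q
    proof -
      \<comment> \<open>A move is a number; the group element behind it has to be decided before it
        can be answered.\<close>
      obtain q1 x where q1: "q1 \<in> below F q" "d q1 i x" using enumeratesD(5)[OF M.enum below_C[OF q]] by blast
      have q1C: "q1 \<in> C" using q1 below_C by blast
      have "x \<in> A" by (rule enumeratesD(1)[OF M.enum q1C q1(2)])
      then obtain y where y: "y \<in> B" "game \<gamma> (xs @ [x]) (ys @ [y])" using forth[OF g 3 \<beta>] by blast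
      obtain q2 j where q2: "q2 \<in> below F q1" "d' q2 j y" using enumeratesD(6)[OF N.enum q1C y(1)] by blast
      have q2q: "q2 \<in> below F q" using below_trans[OF below_C[OF q] q1(1) q2(1)] .
      have "d q2 i x" by (rule enumeratesD(2)[OF M.enum q1C q1(2) q2(1)])
      then have "list_all2 (d q2) (s @ [i]) (xs @ [x])" "list_all2 (d' q2) (t @ [j]) (ys @ [y])"
        using keep[OF below_trans[OF r q q2q]] q2(2) by (simp_all add: list_all2_appendI)
      then have "lev \<gamma> (s @ [i]) (t @ [j]) q2" by (rule IH[OF \<gamma> y(2) below_C[OF q2(1)]])
      then show ?thesis using q2q by blast
    qed
    moreover have "\<exists>r'\<in>below F q. \<exists>i. lev \<gamma> (s @ [i]) (t @ [j]) r'" if q: "q \<in> below F r" for j q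
    proof -
      obtain q1 y where q1: "q1 \<in> below F q" "d' q1 j y" using enumeratesD(5)[OF N.enum below_C[OF q]] by blast
      have q1C: "q1 \<in> C" using q1 below_C by blast
      have "y \<in> B" by (rule enumeratesD(1)[OF N.enum q1C q1(2)])
      then obtain x where x: "x \<in> A" "game \<gamma> (xs @ [x]) (ys @ [y])" using back'[OF g 3 \<beta>] by blast
      obtain q2 i where q2: "q2 \<in> below F q1" "d q2 i x" using enumeratesD(6)[OF M.enum q1C x(1)] by blast
      have q2q: "q2 \<in> below F q" using below_trans[OF below_C[OF q] q1(1) q2(1)] .
      have "d' q2 j y" by (rule enumeratesD(2)[OF N.enum q1C q1(2) q2(1)])
      then have "list_all2 (d q2) (s @ [i]) (xs @ [x])" "list_all2 (d' q2) (t @ [j]) (ys @ [y])"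
        using keep[OF below_trans[OF r q q2q]] q2(2) by (simp_all add: list_all2_appendI)
      then have "lev \<gamma> (s @ [i]) (t @ [j]) q2" by (rule IH[OF \<gamma> x(2) below_C[OF q2(1)]])
      then show ?thesis using q2q by blast
    qed
    ultimately show ?thesis by (rule lev_suc[OF 3])
  qed
qed

text \<open>The witness for the recursion quantified over in \<open>sim_fm\<close>: a name whose
  elements are exactly the triples for which \<open>lev\<close> holds.\<close>

definition level_rel :: "'v \<Rightarrow> 'v \<Rightarrow> 'v \<Rightarrow> bool" where
  "level_rel \<alpha> u r \<longleftrightarrow> (\<exists>\<beta> s t. u = opair \<beta> (opair (tup s) (tup t)) \<and> (\<beta> \<in> elts \<alpha> \<or> \<beta> = \<alpha>) \<and> lev \<beta> s t r)"

definition level_name :: "'v \<Rightarrow> 'v" where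
  "level_name \<alpha> = rname F (level_rel \<alpha>) (vprod (vset (insert \<alpha> (elts \<alpha>))) (vprod (vset (range tup)) (vset (range tup))))"

lemma level_name: "relname F (level_name \<alpha>) (level_rel \<alpha>)"
  unfolding level_name_def
proof (rule relname_rname)
  have "is_set (range (tup :: _ \<Rightarrow> 'v))" by (rule is_set_small[OF small_countable]) simp
  then have "elts (vset (range (tup :: _ \<Rightarrow> 'v))) = range tup" by (rule elts_vset)
  moreover have "elts (vset (insert \<alpha> (elts \<alpha>))) = insert \<alpha> (elts \<alpha>)" by (simp add: elts_vset is_set_insert)
  ultimately show "u \<in> elts (vprod (vset (insert \<alpha> (elts \<alpha>))) (vprod (vset (range tup)) (vset (range tup))))" if "level_rel \<alpha> u r" for u r
    using that unfolding level_rel_def by auto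
  show "level_rel \<alpha> u s" if "r \<in> C" "level_rel \<alpha> u r" "s \<in> below F r" for u r s
    using that lev_mono unfolding level_rel_def by blast
qed

lemma is_name_level_name [simp]: "is_name F (level_name \<alpha>)"
  by (rule is_name_relname[OF level_name])

lemma forces_in_level:
  assumes p: "p \<in> C" and \<beta>: "\<beta> \<in> elts \<alpha> \<or> \<beta> = \<alpha>"
  shows "forces F (in_level (level_name \<alpha>) (check F \<beta>) (check F (tup s)) (check F (tup t))) p \<longleftrightarrow> lev \<beta> s t p"
proof -
  have "level_rel \<alpha> (opair \<beta> (opair (tup s) (tup t))) r \<longleftrightarrow> lev \<beta> s t r" for r
    using \<beta> by (auto simp: level_rel_def)
  then have "level_rel \<alpha> (opair \<beta> (opair (tup s) (tup t))) = lev \<beta> s t" by blast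
  then show ?thesis
    unfolding forces_in_level_maps_to[OF is_name_level_name is_name_check is_name_check is_name_check p] check_opair[symmetric]
      forces_maps_to_check[OF level_name p] using lev_dense_iff[OF p] by simp
qed

lemma forces_in_level_append:
  assumes p: "p \<in> C" and \<beta>: "\<beta> \<in> elts \<alpha> \<or> \<beta> = \<alpha>" and l: "length t = length s"
  shows "forces F (in_level_append (level_name \<alpha>) (check F \<beta>) (check F (vnat (length s))) (check F (tup s)) (check F (vnat x))
      (check F (tup t)) (check F (vnat y))) p \<longleftrightarrow> lev \<beta> (s @ [x]) (t @ [y]) p"
proof
  let ?S = "level_name \<alpha>" and ?\<beta> = "check F \<beta>" and ?n = "check F (vnat (length s))"
  let ?a = "check F (tup (s @ [x]))" and ?b = "check F (tup (t @ [y]))"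
  let ?A = "\<lambda>a. is_append a (check F (tup s)) ?n (check F (vnat x))" and ?B = "\<lambda>b. is_append b (check F (tup t)) ?n (check F (vnat y))"
  { assume h: "forces F (in_level_append ?S ?\<beta> ?n (check F (tup s)) (check F (vnat x)) (check F (tup t)) (check F (vnat y))) p"
    have "forces F (in_level ?S ?\<beta> ?a ?b) p"
    proof (rule forces_denseI[OF _ p])
      fix q assume q: "q \<in> below F p" "q \<in> C"
      obtain r a where r: "r \<in> below F q" "r \<in> C" "is_name F a" "forces F (\<^bold>\<exists>b. ?A a \<^bold>\<and> ?B b \<^bold>\<and> in_level ?S ?\<beta> a b) r"
        using dense_belowD[OF h[unfolded in_level_append_def forces_FEx[of _ p]] q(1)] by blast
      obtain v b where v: "v \<in> below F r" "v \<in> C" "is_name F b" "forces F (?A a \<^bold>\<and> ?B b \<^bold>\<and> in_level ?S ?\<beta> a b) v"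
        using dense_belowD[OF r(4)[unfolded forces_FEx[of _ r]] below_refl[OF r(2)]] by blast
      have ab: "forces F (?A a) v" "forces F (?B b) v" "forces F (in_level ?S ?\<beta> a b) v"
        using v(4) by (simp_all del: forces.simps add: forces.simps(4))
      have a: "forces_eq F a ?a v" using ab(1) forces_is_append[OF r(3) v(2)] by blast
      have b: "forces_eq F b ?b v" using ab(2) forces_is_append[OF v(3,2), of t] l by simp
      have "forces F (in_level ?S ?\<beta> ?a b) v"
        using ab(3) extensionalD[OF extensional_in_level(2) a r(3) is_name_check v(2)] by blast
      then have "forces F (in_level ?S ?\<beta> ?a ?b) v"
        using extensionalD[OF extensional_in_level(3) b v(3) is_name_check v(2)] by blast
      then show "\<exists>r\<in>below F q. forces F (in_level ?S ?\<beta> ?a ?b) r" using below_trans[OF q(2) r(1) v(1)] by blast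
    qed simp
    then show "lev \<beta> (s @ [x]) (t @ [y]) p" unfolding forces_in_level[OF p \<beta>] . }
  assume h: "lev \<beta> (s @ [x]) (t @ [y]) p"
  show "forces F (in_level_append ?S ?\<beta> ?n (check F (tup s)) (check F (vnat x)) (check F (tup t)) (check F (vnat y))) p"
    unfolding in_level_append_def
  proof (rule forces_FExI[OF p is_name_check[of "tup (s @ [x])"]], rule forces_FExI[OF p is_name_check[of "tup (t @ [y])"]])
    have "forces F (?A ?a) p" unfolding forces_is_append[OF is_name_check p] by (rule forces_eq_refl[OF is_name_check])
    moreover have "forces F (?B ?b) p" using forces_is_append[OF is_name_check p, of _ t y] forces_eq_refl[OF is_name_check] l by metis
    ultimately show "forces F (?A ?a \<^bold>\<and> ?B ?b \<^bold>\<and> in_level ?S ?\<beta> ?a ?b) p"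
      unfolding forces.simps(4) forces_in_level[OF p \<beta>] using h by blast
  qed
qed

text \<open>The right-hand side of \<open>sim_recursion\<close> with omega fixed to its check name,
  isolated so that substitution of equals can be stated for each of its arguments.\<close>

definition level_step :: "'v \<Rightarrow> 'v \<Rightarrow> 'v \<Rightarrow> 'v \<Rightarrow> 'v \<Rightarrow> 'v fm" where
  "level_step S \<beta> n a b =
    ((is_empty \<beta> \<^bold>\<and> embeds_fm M a N b \<^bold>\<and> embeds_fm N b M a) \<^bold>\<or>
    (is_limit \<beta> \<^bold>\<and> (\<^bold>\<forall>\<gamma>. \<gamma> \<^bold>\<in> \<beta> \<^bold>\<longrightarrow> in_level S \<gamma> a b)) \<^bold>\<or>
    (\<^bold>\<exists>\<gamma>. is_succ \<beta> \<gamma> \<^bold>\<and>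
      (\<^bold>\<forall>x. x \<^bold>\<in> check F omega \<^bold>\<longrightarrow> (\<^bold>\<exists>y. y \<^bold>\<in> check F omega \<^bold>\<and> in_level_append S \<gamma> n a x b y)) \<^bold>\<and>
      (\<^bold>\<forall>y. y \<^bold>\<in> check F omega \<^bold>\<longrightarrow> (\<^bold>\<exists>x. x \<^bold>\<in> check F omega \<^bold>\<and> in_level_append S \<gamma> n a x b y))))"

lemma extensional_level_step: "extensional F (\<lambda>\<beta>. level_step S \<beta> n a b)" "extensional F (\<lambda>n. level_step S \<beta> n a b)"
  "extensional F (\<lambda>a. level_step S \<beta> n a b)" "extensional F (\<lambda>b. level_step S \<beta> n a b)"
  unfolding level_step_def
  by (intro extensional_intros extensional_is_limit extensional_is_empty extensional_is_succ extensional_embeds_fm extensional_in_level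
      extensional_in_level_append)+

lemma named_level_step [simp]: "is_name F S \<Longrightarrow> is_name F \<beta> \<Longrightarrow> is_name F n \<Longrightarrow> is_name F a \<Longrightarrow> is_name F b \<Longrightarrow> named (level_step S \<beta> n a b)"
  by (simp add: level_step_def)

lemma forces_level_step:
  assumes \<alpha>: "Ord \<alpha>" and p: "p \<in> C" and \<beta>: "\<beta> \<in> elts \<alpha> \<or> \<beta> = \<alpha>" and l: "length t = length s"
  shows "forces F (level_step (level_name \<alpha>) (check F \<beta>) (check F (vnat (length s))) (check F (tup s)) (check F (tup t))) p \<longleftrightarrow> lev \<beta> s t p"
proof -
  let ?S = "level_name \<alpha>" and ?\<beta> = "check F \<beta>" and ?n = "check F (vnat (length s))" and ?s = "check F (tup s)" and ?t = "check F (tup t)"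
  let ?w = "check F omega"
  define \<phi>0 where "\<phi>0 = (is_empty ?\<beta> \<^bold>\<and> embeds_fm M ?s N ?t \<^bold>\<and> embeds_fm N ?t M ?s)"
  define \<phi>1 where "\<phi>1 = (is_limit ?\<beta> \<^bold>\<and> (\<^bold>\<forall>\<gamma>. \<gamma> \<^bold>\<in> ?\<beta> \<^bold>\<longrightarrow> in_level ?S \<gamma> ?s ?t))"
  define \<psi> where "\<psi> \<gamma> = (\<^bold>\<forall>x. x \<^bold>\<in> ?w \<^bold>\<longrightarrow> (\<^bold>\<exists>y. y \<^bold>\<in> ?w \<^bold>\<and> in_level_append ?S \<gamma> ?n ?s x ?t y))" for \<gamma>
  define \<psi>' where "\<psi>' \<gamma> = (\<^bold>\<forall>y. y \<^bold>\<in> ?w \<^bold>\<longrightarrow> (\<^bold>\<exists>x. x \<^bold>\<in> ?w \<^bold>\<and> in_level_append ?S \<gamma> ?n ?s x ?t y))" for \<gamma>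
  define \<phi>2 where "\<phi>2 = (\<^bold>\<exists>\<gamma>. is_succ ?\<beta> \<gamma> \<^bold>\<and> \<psi> \<gamma> \<^bold>\<and> \<psi>' \<gamma>)"
  have eq: "level_step ?S ?\<beta> ?n ?s ?t = (\<phi>0 \<^bold>\<or> \<phi>1 \<^bold>\<or> \<phi>2)"
    unfolding level_step_def \<phi>0_def \<phi>1_def \<phi>2_def \<psi>_def \<psi>'_def ..
  have le: "\<gamma> \<in> elts \<alpha> \<or> \<gamma> = \<alpha>" if "\<gamma> \<in> elts \<beta>" for \<gamma> using \<beta> that Ord_trans[OF \<alpha>] by blast
  have e\<psi>: "extensional F \<psi>" "extensional F \<psi>'" unfolding \<psi>_def \<psi>'_def by (intro extensional_intros extensional_in_level_append)+
  have 0: "forces F \<phi>0 r \<longleftrightarrow> elts \<beta> = {} \<and> lev \<beta> s t r" if r: "r \<in> C" for r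
    unfolding \<phi>0_def forces.simps(4) forces_is_empty_check[OF r] using lev_0_iff[of \<beta> s t r] by blast
  have 1: "forces F \<phi>1 r \<longleftrightarrow> (elts \<beta> \<noteq> {} \<and> \<not> (\<exists>\<gamma>. elts \<beta> = insert \<gamma> (elts \<gamma>))) \<and> lev \<beta> s t r" if r: "r \<in> C" for r
  proof -
    have "forces F (\<^bold>\<forall>\<gamma>. \<gamma> \<^bold>\<in> ?\<beta> \<^bold>\<longrightarrow> in_level ?S \<gamma> ?s ?t) r \<longleftrightarrow> (\<forall>\<gamma>\<in>elts \<beta>. forces F (in_level ?S (check F \<gamma>) ?s ?t) r)"
      by (rule forces_all_check'[OF extensional_in_level(1) _ r]) simp
    also have "\<dots> \<longleftrightarrow> (\<forall>\<gamma>\<in>elts \<beta>. lev \<gamma> s t r)" using forces_in_level[OF r le] by blast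
    finally show ?thesis unfolding \<phi>1_def forces.simps(4) forces_is_limit_check[OF r] using lev_lim_iff[of \<beta> s t r] by blast
  qed
  have \<psi>: "forces F (\<psi> (check F \<gamma>) \<^bold>\<and> \<psi>' (check F \<gamma>)) r \<longleftrightarrow> lev \<beta> s t r" if r: "r \<in> C" and \<gamma>: "elts \<beta> = insert \<gamma> (elts \<gamma>)" for r \<gamma>
  proof -
    have \<gamma>\<alpha>: "\<gamma> \<in> elts \<alpha> \<or> \<gamma> = \<alpha>" using le \<gamma> by blast
    let ?I = "\<lambda>x y. in_level_append ?S (check F \<gamma>) ?n ?s x ?t y"
    have x: "extensional F (\<lambda>x. \<^bold>\<exists>y. y \<^bold>\<in> ?w \<^bold>\<and> ?I x y)" "extensional F (\<lambda>y. \<^bold>\<exists>x. x \<^bold>\<in> ?w \<^bold>\<and> ?I x y)"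
      by (intro extensional_intros extensional_in_level_append)+
    have lev: "forces F (?I (check F (vnat i)) (check F (vnat j))) q \<longleftrightarrow> lev \<gamma> (s @ [i]) (t @ [j]) q" if "q \<in> C" for q i j
      by (rule forces_in_level_append[OF that \<gamma>\<alpha> l])
    have "forces F (\<psi> (check F \<gamma>)) r \<longleftrightarrow> (\<forall>i. forces F (\<^bold>\<exists>y. y \<^bold>\<in> ?w \<^bold>\<and> ?I (check F (vnat i)) y) r)"
      unfolding \<psi>_def by (rule forces_all_omega[OF x(1) _ r]) simp
    also have "\<dots> \<longleftrightarrow> (\<forall>i. dense_below F (\<lambda>q. \<exists>j. forces F (?I (check F (vnat i)) (check F (vnat j))) q) r)"
      by (intro all_cong1 forces_ex_omega[OF extensional_in_level_append(6) _ r]) simp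
    also have "\<dots> \<longleftrightarrow> (\<forall>i. dense_below F (\<lambda>q. \<exists>j. lev \<gamma> (s @ [i]) (t @ [j]) q) r)"
      by (intro all_cong1 iffI; elim dense_below_weaken) (simp_all add: lev r)
    finally have 1: "forces F (\<psi> (check F \<gamma>)) r \<longleftrightarrow> (\<forall>i. dense_below F (\<lambda>q. \<exists>j. lev \<gamma> (s @ [i]) (t @ [j]) q) r)" .
    have "forces F (\<psi>' (check F \<gamma>)) r \<longleftrightarrow> (\<forall>j. forces F (\<^bold>\<exists>x. x \<^bold>\<in> ?w \<^bold>\<and> ?I x (check F (vnat j))) r)"
      unfolding \<psi>'_def by (rule forces_all_omega[OF x(2) _ r]) simp
    also have "\<dots> \<longleftrightarrow> (\<forall>j. dense_below F (\<lambda>q. \<exists>i. forces F (?I (check F (vnat i)) (check F (vnat j))) q) r)"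
      by (intro all_cong1 forces_ex_omega[OF extensional_in_level_append(4) _ r]) simp
    also have "\<dots> \<longleftrightarrow> (\<forall>j. dense_below F (\<lambda>q. \<exists>i. lev \<gamma> (s @ [i]) (t @ [j]) q) r)"
      by (intro all_cong1 iffI; elim dense_below_weaken) (simp_all add: lev r)
    finally show ?thesis unfolding forces.simps(4) 1 lev_suc_iff[OF \<gamma>] by simp
  qed
  have n: "named \<phi>0" "named \<phi>1" "named \<phi>2" unfolding \<phi>0_def \<phi>1_def \<phi>2_def \<psi>_def \<psi>'_def by simp_all
  show ?thesis unfolding eq
  proof
    assume h: "forces F (\<phi>0 \<^bold>\<or> \<phi>1 \<^bold>\<or> \<phi>2) p"
    show "lev \<beta> s t p"
    proof (rule lev_dense[OF dense_belowI p])
      fix q assume q: "q \<in> below F p" "q \<in> C"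
      obtain r where r: "r \<in> below F q" "r \<in> C" "forces F \<phi>0 r \<or> forces F (\<phi>1 \<^bold>\<or> \<phi>2) r"
        using dense_belowD[OF h[unfolded forces_FOr[OF p]] q(1)] by blast
      from r(3) show "\<exists>r\<in>below F q. lev \<beta> s t r"
      proof
        assume "forces F \<phi>0 r"
        then show ?thesis using 0[OF r(2)] r(1) by blast
      next
        assume h2: "forces F (\<phi>1 \<^bold>\<or> \<phi>2) r"
        obtain v where v: "v \<in> below F r" "v \<in> C" "forces F \<phi>1 v \<or> forces F \<phi>2 v"
          using dense_belowD[OF h2[unfolded forces_FOr[OF r(2)]] below_refl[OF r(2)]] by blast
        have vq: "v \<in> below F q" using below_trans[OF q(2) r(1) v(1)] .
        from v(3) show ?thesis
        proof
          assume "forces F \<phi>1 v"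
          then show ?thesis using 1[OF v(2)] vq by blast
        next
          assume h3: "forces F \<phi>2 v"
          obtain v1 y where v1: "v1 \<in> below F v" "v1 \<in> C" "is_name F y" "forces F (is_succ ?\<beta> y \<^bold>\<and> \<psi> y \<^bold>\<and> \<psi>' y) v1"
            using dense_belowD[OF h3[unfolded \<phi>2_def forces_FEx] below_refl[OF v(2)]] by blast
          have sy: "forces F (is_succ ?\<beta> y) v1" "forces F (\<psi> y \<^bold>\<and> \<psi>' y) v1" using v1(4) unfolding forces.simps(4)[of F "is_succ ?\<beta> y"] by simp_all
          obtain v2 \<gamma> where v2: "v2 \<in> below F v1" "forces_eq F y (check F \<gamma>) v2" "elts \<beta> = insert \<gamma> (elts \<gamma>)"
            using is_succ_check_name[OF sy(1) v1(3,2)] by blast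
          have v2C: "v2 \<in> C" using v2(1) below_C by blast
          have ee: "extensional F (\<lambda>\<gamma>. \<psi> \<gamma> \<^bold>\<and> \<psi>' \<gamma>)" by (rule extensional_and[OF e\<psi>])
          have "forces F (\<psi> (check F \<gamma>) \<^bold>\<and> \<psi>' (check F \<gamma>)) v2"
            using extensionalD[OF ee v2(2) v1(3) is_name_check v2C] forces_mono[OF sy(2) v1(2) v2(1)] by blast
          then have "lev \<beta> s t v2" using \<psi>[OF v2C v2(3)] by blast
          then show ?thesis using below_trans[OF q(2) vq] below_trans[OF v(2) v1(1) v2(1)] by blast
        qed
      qed
    qed
  next
    assume h: "lev \<beta> s t p"
    have or1: "forces F (\<phi> \<^bold>\<or> \<chi>) p" if "forces F \<phi> p" for \<phi> \<chi>
      unfolding forces_FOr[OF p] using forces_mono[OF that p] by (intro dense_below_all[OF p]) blast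
    have or2: "forces F (\<phi> \<^bold>\<or> \<chi>) p" if "forces F \<chi> p" for \<phi> \<chi>
      unfolding forces_FOr[OF p] using forces_mono[OF that p] by (intro dense_below_all[OF p]) blast
    consider "elts \<beta> = {}" | "elts \<beta> \<noteq> {}" "\<not> (\<exists>\<gamma>. elts \<beta> = insert \<gamma> (elts \<gamma>))" | \<gamma> where "elts \<beta> = insert \<gamma> (elts \<gamma>)" by blast
    then show "forces F (\<phi>0 \<^bold>\<or> \<phi>1 \<^bold>\<or> \<phi>2) p"
    proof cases
      case 1
      then show ?thesis using 0[OF p] h by (intro or1) blast
    next
      case 2
      then have "forces F \<phi>1 p" using 1[OF p] h by blast
      then show ?thesis by (intro or2 or1)
    next
      case (3 \<gamma>)
      have "forces F (is_succ ?\<beta> (check F \<gamma>)) p" unfolding forces_is_succ[OF 3 is_name_check p] by (rule forces_eq_refl[OF is_name_check])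
      then have "forces F (is_succ ?\<beta> (check F \<gamma>) \<^bold>\<and> \<psi> (check F \<gamma>) \<^bold>\<and> \<psi>' (check F \<gamma>)) p"
        using \<psi>[OF p 3] h by simp
      then have "forces F \<phi>2 p" unfolding \<phi>2_def by (rule forces_FExI[OF p is_name_check])
      then show ?thesis by (intro or2)
    qed
  qed
qed

text \<open>Ordinal, length and both tuples are arbitrary names. Densely they equal check names, for
  which \<open>lev\<close> satisfies the recursion, and extensionality replaces the four names one
  at a time.\<close>

lemma forces_sim_recursion:
  assumes \<alpha>: "Ord \<alpha>" and p: "p \<in> C"
  shows "forces F (sim_recursion (check F omega) (check F \<alpha>) M N (level_name \<alpha>)) p"
proof -
  let ?w = "check F omega" and ?S = "level_name \<alpha>" and ?\<alpha> = "check F \<alpha>"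
  let ?\<chi> = "\<lambda>\<beta> n a b. in_level ?S \<beta> a b \<^bold>\<longleftrightarrow> level_step ?S \<beta> n a b"
  let ?h = "\<lambda>\<beta> n a b. (\<beta> \<^bold>\<in> ?\<alpha> \<^bold>\<or> \<beta> \<^bold>= ?\<alpha>) \<^bold>\<and> n \<^bold>\<in> ?w \<^bold>\<and> is_fun a n ?w \<^bold>\<and> is_fun b n ?w"
  have eq: "sim_recursion ?w ?\<alpha> M N ?S = (\<^bold>\<forall>\<beta> n a b. ?h \<beta> n a b \<^bold>\<longrightarrow> ?\<chi> \<beta> n a b)"
    unfolding sim_recursion_def level_step_def ..
  have ext: "extensional F (\<lambda>\<beta>. ?\<chi> \<beta> n a b)" "extensional F (\<lambda>n. ?\<chi> \<beta> n a b)" "extensional F (\<lambda>a. ?\<chi> \<beta> n a b)" "extensional F (\<lambda>b. ?\<chi> \<beta> n a b)" for \<beta> n a b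
    by (intro extensional_intros extensional_in_level extensional_level_step)+
  have "forces F (?\<chi> \<beta> n a b) q" if nm: "is_name F \<beta>" "is_name F n" "is_name F a" "is_name F b" and q: "q \<in> C" and h: "forces F (?h \<beta> n a b) q" for \<beta> n a b q
  proof (rule forces_denseI[OF _ q])
    fix q' assume q': "q' \<in> below F q" "q' \<in> C"
    have hs: "forces F (\<beta> \<^bold>\<in> ?\<alpha> \<^bold>\<or> \<beta> \<^bold>= ?\<alpha>) q" "forces F (n \<^bold>\<in> ?w) q" "forces F (is_fun a n ?w) q" "forces F (is_fun b n ?w) q"
      using h unfolding forces.simps(4) by simp_all
    obtain r1 where r1: "r1 \<in> below F q'" "r1 \<in> C" "forces F (\<beta> \<^bold>\<in> ?\<alpha>) r1 \<or> forces F (\<beta> \<^bold>= ?\<alpha>) r1"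
      using dense_belowD[OF hs(1)[unfolded forces_FOr[OF q]] q'(1)] by blast
    have "\<exists>r2\<in>below F r1. \<exists>\<beta>0. (\<beta>0 \<in> elts \<alpha> \<or> \<beta>0 = \<alpha>) \<and> forces_eq F \<beta> (check F \<beta>0) r2"
      using r1(3)
    proof
      assume "forces F (\<beta> \<^bold>\<in> ?\<alpha>) r1"
      from dense_belowD[OF this[unfolded forces_mem_check[OF r1(2)]] below_refl[OF r1(2)]] show ?thesis by blast
    next
      assume "forces F (\<beta> \<^bold>= ?\<alpha>) r1"
      then show ?thesis using below_refl[OF r1(2)] by auto
    qed
    then obtain r2 \<beta>0 where r2: "r2 \<in> below F r1" "\<beta>0 \<in> elts \<alpha> \<or> \<beta>0 = \<alpha>" "forces_eq F \<beta> (check F \<beta>0) r2" by blast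
    have r2C: "r2 \<in> C" and r2q: "r2 \<in> below F q" using r2(1) below_C below_trans[OF q q'(1)] below_trans[OF q'(2) r1(1)] by blast+
    obtain r3 k where r3: "r3 \<in> below F r2" "r3 \<in> C" "forces_eq F n (check F (vnat k)) r3"
      using dense_belowD[OF hs(2)[unfolded forces_mem_check[OF q]] r2q] by (auto simp: elts_omega)
    have r3q: "r3 \<in> below F q" using below_trans[OF q r2q r3(1)] .
    have "forces F (is_fun a (check F (vnat k)) ?w) r3" "forces F (is_fun b (check F (vnat k)) ?w) r3"
      using extensionalD[OF extensional_is_fun(2) r3(3) nm(2) is_name_check r3(2)] forces_mono[OF hs(3) q r3q] forces_mono[OF hs(4) q r3q] by blast+
    note ft = forces_tup[OF this(1) nm(3) r3(2)] forces_tup[OF this(2) nm(4) r3(2)]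
    obtain r4 s where r4: "r4 \<in> below F r3" "r4 \<in> C" "length s = k" "forces_eq F a (check F (tup s)) r4"
      using dense_belowD[OF ft(1) below_refl[OF r3(2)]] by blast
    obtain r t where r: "r \<in> below F r4" "r \<in> C" "length t = k" "forces_eq F b (check F (tup t)) r"
      using dense_belowD[OF ft(2) r4(1)] by blast
    have r_r3: "r \<in> below F r3" using below_trans[OF r3(2) r4(1) r(1)] .
    have r_r2: "r \<in> below F r2" using below_trans[OF r2C r3(1) r_r3] .
    have eqs: "forces_eq F \<beta> (check F \<beta>0) r" "forces_eq F n (check F (vnat (length s))) r" "forces_eq F a (check F (tup s)) r"
      using forces_eq_mono[OF r2(3) r2C r_r2] forces_eq_mono[OF r3(3,2) r_r3] forces_eq_mono[OF r4(4,2) r(1)] r4(3) by simp_all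
    have "forces F (?\<chi> (check F \<beta>0) (check F (vnat (length s))) (check F (tup s)) (check F (tup t))) r"
    proof -
      have "length t = length s" using r r4 by simp
      then have "forces F (in_level ?S (check F \<beta>0) (check F (tup s)) (check F (tup t))) v \<longleftrightarrow>
          forces F (level_step ?S (check F \<beta>0) (check F (vnat (length s))) (check F (tup s)) (check F (tup t))) v" if "v \<in> C" for v
        using forces_in_level[OF that r2(2)] forces_level_step[OF \<alpha> that r2(2)] by simp
      then show ?thesis using r(2) below_C by (subst forces_FIff) simp_all
    qed
    then have "forces F (?\<chi> (check F \<beta>0) (check F (vnat (length s))) (check F (tup s)) b) r"
      using extensionalD[OF ext(4) r(4) nm(4) is_name_check r(2)] by blast
    then have "forces F (?\<chi> (check F \<beta>0) (check F (vnat (length s))) a b) r"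
      using extensionalD[OF ext(3) eqs(3) nm(3) is_name_check r(2)] by blast
    then have "forces F (?\<chi> (check F \<beta>0) n a b) r"
      using extensionalD[OF ext(2) eqs(2) nm(2) is_name_check r(2)] by blast
    then have "forces F (?\<chi> \<beta> n a b) r"
      using extensionalD[OF ext(1) eqs(1) nm(1) is_name_check r(2)] by blast
    moreover have "r \<in> below F q'" using below_trans[OF q'(2) r1(1)] below_trans[OF r1(2) r2(1) r_r2] by blast
    ultimately show "\<exists>r\<in>below F q'. forces F (?\<chi> \<beta> n a b) r" by blast
  qed (use nm in simp)
  then show ?thesis unfolding eq forces.simps(5) using p below_C
    by (intro allI impI) (subst forces_FImp, simp_all del: forces.simps)
qed

lemma forces_sim_fm:
  assumes \<alpha>: "Ord \<alpha>" and lev: "\<And>p. p \<in> C \<Longrightarrow> lev \<alpha> [] [] p" and p: "p \<in> C"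
  shows "forces F (sim_fm (check F \<alpha>) M N) p"
  unfolding sim_fm_def
proof (rule forces_FExI[OF p is_name_check[of omega]], rule forces_FExI[OF p is_name_level_name[of \<alpha>]], rule forces_FExI[OF p is_name_check[of "tup []"]])
  have "forces F (is_empty (check F (tup []))) p" unfolding forces_is_empty_check[OF p] by (simp add: elts_tup)
  moreover have "forces F (in_level (level_name \<alpha>) (check F \<alpha>) (check F (tup [])) (check F (tup []))) p"
    unfolding forces_in_level[OF p disjI2[OF refl]] by (rule lev[OF p])
  ultimately show "forces F (is_omega (check F omega) \<^bold>\<and> is_empty (check F (tup [])) \<^bold>\<and>
      sim_recursion (check F omega) (check F \<alpha>) M N (level_name \<alpha>) \<^bold>\<and> in_level (level_name \<alpha>) (check F \<alpha>) (check F (tup [])) (check F (tup []))) p"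
    unfolding forces.simps(4) using forces_is_omega_check[OF p] forces_sim_recursion[OF \<alpha> p] by blast
qed

end

section \<open>A colouring without shift-invariant sequences\<close>

text \<open>
  Terms denote ordinals computed from a sequence \<open>m\<close>: \<open>Var\<close> is \<open>m 0\<close>, and \<open>Wit t n r j\<close> is the \<open>j\<close>-th entry of
  a chosen \<open>r\<close>-tuple which shows that the first \<open>n\<close> and the next \<open>n\<close> consecutive values of \<open>t\<close> are not
  interchangeable for the colouring \<open>c\<close>.
\<close>

datatype tm = Var | Wit tm nat nat nat

instance tm :: countable by countable_datatype

text \<open>With \<open>us\<close> of length \<open>Suc n\<close>, the lists
  \<open>take n us\<close> and \<open>tl us\<close> are two overlapping blocks of \<open>n\<close>
  consecutive values; the parameters \<open>xs\<close>, all below the first value, make the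
  colouring distinguish them.\<close>

definition witness :: "('v::zfc_universe set \<Rightarrow> bool) \<Rightarrow> nat \<Rightarrow> nat \<Rightarrow> 'v list \<Rightarrow> 'v list \<Rightarrow> bool" where
  "witness c n r us xs \<longleftrightarrow> length xs = r \<and> (\<forall>x\<in>set xs. x \<in> elts (hd us)) \<and>
    c (set xs \<union> set (take n us)) \<noteq> c (set xs \<union> set (tl us))"

definition chosen :: "('v::zfc_universe set \<Rightarrow> bool) \<Rightarrow> nat \<Rightarrow> nat \<Rightarrow> 'v list \<Rightarrow> 'v list" where
  "chosen c n r us = (SOME xs. witness c n r us xs)"

definition shift :: "nat \<Rightarrow> (nat \<Rightarrow> 'v) \<Rightarrow> nat \<Rightarrow> 'v" where
  "shift i m = (\<lambda>k. m (k + i))"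

lemma shift_simps [simp]: "shift 0 m = m" "shift i (shift j m) = shift (i + j) m" "shift i m k = m (k + i)"
  by (simp_all add: shift_def add_ac)

text \<open>The default \<open>m 0\<close> for missing witnesses keeps all values below \<kappa>
  whenever the sequence stays below \<kappa>.\<close>

primrec ev :: "('v::zfc_universe set \<Rightarrow> bool) \<Rightarrow> tm \<Rightarrow> (nat \<Rightarrow> 'v) \<Rightarrow> 'v" where
  "ev c Var m = m 0"
| "ev c (Wit t n r j) m =
    (let us = map (\<lambda>i. ev c t (shift i m)) [0..<Suc n] in
     if j < r \<and> (\<exists>xs. witness c n r us xs) then chosen c n r us ! j else m 0)"

definition segment :: "('v::zfc_universe set \<Rightarrow> bool) \<Rightarrow> tm \<Rightarrow> nat \<Rightarrow> (nat \<Rightarrow> 'v) \<Rightarrow> 'v list" where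
  "segment c t n m = map (\<lambda>i. ev c t (shift i m)) [0..<Suc n]"

text \<open>The properties whose invariance under the shift is exploited: whether consecutive values
  increase or decrease, whether a witness exists, and the colour that the chosen witness gives to
  the first block.\<close>

datatype fo = Less tm | Greater tm | Has tm nat nat | Col tm nat nat

instance fo :: countable by countable_datatype

primrec holds :: "('v::zfc_universe set \<Rightarrow> bool) \<Rightarrow> fo \<Rightarrow> (nat \<Rightarrow> 'v) \<Rightarrow> bool" where
  "holds c (Less t) m \<longleftrightarrow> ev c t m \<in> elts (ev c t (shift 1 m))"
| "holds c (Greater t) m \<longleftrightarrow> ev c t (shift 1 m) \<in> elts (ev c t m)"
| "holds c (Has t n r) m \<longleftrightarrow> (\<exists>xs. witness c n r (segment c t n m) xs)"
| "holds c (Col t n r) m \<longleftrightarrow>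
    c (set (chosen c n r (segment c t n m)) \<union> set (take n (segment c t n m)))"

text \<open>Only finitely many entries of the sequence matter. This is what allows an infinite type
  to be recorded by colours of finite lists.\<close>

lemma ev_dep: "\<exists>d. \<forall>m m'. (\<forall>k<d. m k = m' k) \<longrightarrow> ev c t m = ev c t m'"
proof (induction t)
  case Var
  show ?case by (rule exI[of _ 1]) simp
next
  case (Wit t n r j)
  then obtain d where d: "\<And>m m'. (\<forall>k<d. m k = m' k) \<Longrightarrow> ev c t m = ev c t m'" by blast
  show ?case
  proof (rule exI[of _ "d + Suc n"], intro allI impI)
    fix m m' :: "nat \<Rightarrow> 'a" assume m: "\<forall>k<d + Suc n. m k = m' k"
    have "ev c t (shift i m) = ev c t (shift i m')" if "i < Suc n" for i
      by (rule d) (use m that in simp)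
    then have "map (\<lambda>i. ev c t (shift i m)) [0..<Suc n] = map (\<lambda>i. ev c t (shift i m')) [0..<Suc n]"
      by (intro map_cong) auto
    moreover have "m 0 = m' 0" using m by simp
    ultimately show "ev c (Wit t n r j) m = ev c (Wit t n r j) m'" by (simp only: ev.simps)
  qed
qed

lemma segment_dep: "\<exists>d. \<forall>m m'. (\<forall>k<d. m k = m' k) \<longrightarrow> segment c t n m = segment c t n m'"
proof -
  obtain d where d: "\<And>m m'. (\<forall>k<d. m k = m' k) \<Longrightarrow> ev c t m = ev c t m'" using ev_dep by blast
  show ?thesis
  proof (rule exI[of _ "d + Suc n"], intro allI impI)
    fix m m' :: "nat \<Rightarrow> 'a" assume m: "\<forall>k<d + Suc n. m k = m' k"
    have "ev c t (shift i m) = ev c t (shift i m')" if "i < Suc n" for i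
      by (rule d) (use m that in simp)
    then show "segment c t n m = segment c t n m'" unfolding segment_def
      by (intro map_cong) auto
  qed
qed

lemma holds_dep: "\<exists>d. \<forall>m m'. (\<forall>k<d. m k = m' k) \<longrightarrow> holds c \<phi> m = holds c \<phi> m'"
proof -
  have ex: "\<exists>d. \<forall>m m'. (\<forall>k<d. m k = m' k) \<longrightarrow> Q m = Q m'"
    if "\<exists>d. \<forall>m m'. (\<forall>k<d. m k = m' k) \<longrightarrow> f m = f m'" "\<And>m m'. f m = f m' \<Longrightarrow> Q m = Q m'"
    for f :: "(nat \<Rightarrow> 'a) \<Rightarrow> 'b" and Q :: "(nat \<Rightarrow> 'a) \<Rightarrow> bool"
    using that by blast
  show ?thesis
  proof (cases \<phi>)
    case (Less t)
    show ?thesis unfolding Less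
      by (rule ex[OF segment_dep[of c t 1]]) (auto simp: segment_def)
  next
    case (Greater t)
    show ?thesis unfolding Greater
      by (rule ex[OF segment_dep[of c t 1]]) (auto simp: segment_def)
  next
    case (Has t n r)
    show ?thesis unfolding Has
      by (rule ex[OF segment_dep[of c t n]]) simp
  next
    case (Col t n r)
    show ?thesis unfolding Col
      by (rule ex[OF segment_dep[of c t n]]) simp
  qed
qed

definition agree_depth :: "('v::zfc_universe set \<Rightarrow> bool) \<Rightarrow> fo \<times> nat \<Rightarrow> nat" where
  "agree_depth c \<psi> = (SOME d. \<forall>m m'. (\<forall>k<d. m k = m' k) \<longrightarrow>
    holds c (fst \<psi>) (shift (snd \<psi>) m) = holds c (fst \<psi>) (shift (snd \<psi>) m'))"

lemma agree_depth:
  assumes "\<And>k. k < agree_depth c \<psi> \<Longrightarrow> m k = m' k"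
  shows "holds c (fst \<psi>) (shift (snd \<psi>) m) = holds c (fst \<psi>) (shift (snd \<psi>) m')"
proof -
  obtain d where d: "\<And>m m'. (\<forall>k<d. m k = m' k) \<Longrightarrow> holds c (fst \<psi>) m = holds c (fst \<psi>) m'"
    using holds_dep by blast
  have "\<exists>d. \<forall>m m'. (\<forall>k<d. m k = m' k) \<longrightarrow>
      holds c (fst \<psi>) (shift (snd \<psi>) m) = holds c (fst \<psi>) (shift (snd \<psi>) m')"
    by (rule exI[of _ "d + snd \<psi>"]) (auto intro!: d)
  from someI_ex[OF this] assms show ?thesis unfolding agree_depth_def by blast
qed

text \<open>A finite table of truth values coded as one number: entry \<open>i\<close> belongs to
  the \<open>i\<close>-th pair of formula and shift, and is \<open>False\<close> as long as
  \<open>l\<close> is too short to decide it. Equal colours on all initial segments thus mean equal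
  types.\<close>

definition type_colour :: "('v::zfc_universe set \<Rightarrow> bool) \<Rightarrow> 'v list \<Rightarrow> nat" where
  "type_colour c l = to_nat (map (\<lambda>i. agree_depth c (from_nat i) \<le> length l \<and>
     holds c (fst (from_nat i :: fo \<times> nat)) (shift (snd (from_nat i :: fo \<times> nat)) ((!) l))) [0..<length l])"

lemma type_colour_invariant:
  assumes "\<And>k. type_colour c (map m [0..<Suc k]) = type_colour c (map (\<lambda>i. m (Suc i)) [0..<Suc k])"
  shows "holds c \<phi> (shift a m) = holds c \<phi> (shift (Suc a) m)"
proof -
  define i where "i = to_nat (\<phi>, a)"
  have i: "from_nat i = (\<phi>, a)" by (simp add: i_def)
  \<comment> \<open>Large enough for the table to have an entry \<open>i\<close> and for both lists
    to decide it.\<close>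
  define k where "k = max i (agree_depth c (\<phi>, a))"
  let ?l = "map m [0..<Suc k]" and ?l' = "map (\<lambda>i. m (Suc i)) [0..<Suc k]"
  let ?f = "\<lambda>l i. agree_depth c (from_nat i) \<le> length l \<and>
     holds c (fst (from_nat i :: fo \<times> nat)) (shift (snd (from_nat i :: fo \<times> nat)) ((!) l))"
  have "map (?f ?l) [0..<length ?l] = map (?f ?l') [0..<length ?l']"
    using assms[of k] unfolding type_colour_def to_nat_split by simp
  then have "map (?f ?l) [0..<length ?l] ! i = map (?f ?l') [0..<length ?l'] ! i" by (rule arg_cong)
  moreover have "i < Suc k" by (simp add: k_def)
  ultimately have "?f ?l i = ?f ?l' i" by (simp add: nth_map nth_upt del: upt_Suc)
  moreover have "agree_depth c (\<phi>, a) \<le> k" by (simp add: k_def)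
  ultimately have "holds c \<phi> (shift a ((!) ?l)) = holds c \<phi> (shift a ((!) ?l'))"
    by (simp add: i del: upt_Suc)
  moreover have "holds c \<phi> (shift a ((!) ?l)) = holds c \<phi> (shift a m)"
    using agree_depth[of c "(\<phi>, a)" "(!) ?l" m] \<open>agree_depth c (\<phi>, a) \<le> k\<close> by (simp add: nth_map del: upt_Suc)
  moreover have "holds c \<phi> (shift a ((!) ?l')) = holds c \<phi> (shift a (shift 1 m))"
    using agree_depth[of c "(\<phi>, a)" "(!) ?l'" "shift 1 m"] \<open>agree_depth c (\<phi>, a) \<le> k\<close> by (simp add: nth_map del: upt_Suc)
  ultimately show ?thesis by simp
qed

text \<open>The top block of consecutive indices of \<open>J\<close> can be moved down by one
  without changing the colour. This lowers the sum of the indices, and it is possible until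
  \<open>J\<close> is an initial segment.\<close>

lemma homogeneous_of_shift:
  fixes h :: "nat \<Rightarrow> 'v" and c :: "'v set \<Rightarrow> bool"
  assumes step: "\<And>i n X. X \<subseteq> {..<i} \<Longrightarrow> finite X \<Longrightarrow> c (h ` (X \<union> {i..<i + n})) = c (h ` (X \<union> {Suc i..<Suc i + n}))"
  shows "finite J \<Longrightarrow> c (h ` J) = c (h ` {..<card J})"
proof (induction "\<Sum>J" arbitrary: J rule: less_induct)
  case less
  show ?case
  proof (cases "J = {..<card J}")
    case False
    \<comment> \<open>The first index of the block of consecutive elements ending in
      \<open>Max J\<close>; the index before it is free.\<close>
    define a where "a = (LEAST a. {a..<Suc (Max J)} \<subseteq> J)"
    have J: "J \<noteq> {}" using False by auto
    have M: "Max J \<in> J" using J less.prems by simp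
    have ex: "{Max J..<Suc (Max J)} \<subseteq> J" using M by auto
    have aJ: "{a..<Suc (Max J)} \<subseteq> J" unfolding a_def by (rule LeastI[of _ "Max J"]) (rule ex)
    have aM: "a \<le> Max J" unfolding a_def by (rule Least_le) (rule ex)
    have a0: "a \<noteq> 0"
    proof
      assume "a = 0"
      then have "{..<Suc (Max J)} \<subseteq> J" using aJ by auto
      moreover have "J \<subseteq> {..<Suc (Max J)}" using less.prems by (auto simp: less_Suc_eq_le)
      ultimately have e: "J = {..<Suc (Max J)}" by (rule equalityI[rotated])
      have "card J = Suc (Max J)" by (subst e) (rule card_lessThan)
      then show False using False e by (simp only: simp_thms)
    qed
    then obtain i where i: "a = Suc i" by (cases a) auto
    have iJ: "i \<notin> J"
    proof
      assume "i \<in> J"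
      moreover have "{i..<Suc (Max J)} \<subseteq> insert i {a..<Suc (Max J)}" using i by auto
      ultimately have "{i..<Suc (Max J)} \<subseteq> J" using aJ by blast
      then have "a \<le> i" unfolding a_def by (rule Least_le)
      then show False using i by simp
    qed
    define n where "n = Suc (Max J) - a"
    define X where "X = J \<inter> {..<i}"
    have X: "X \<subseteq> {..<i}" "finite X" using less.prems by (auto simp: X_def)
    have Jeq: "J = X \<union> {Suc i..<Suc i + n}"
    proof
      show "J \<subseteq> X \<union> {Suc i..<Suc i + n}"
      proof
        fix j assume j: "j \<in> J"
        then have "j \<le> Max J" "j \<noteq> i" using less.prems iJ by auto
        then show "j \<in> X \<union> {Suc i..<Suc i + n}" using j aM i by (auto simp: X_def n_def)
      qed
      show "X \<union> {Suc i..<Suc i + n} \<subseteq> J" using aJ aM i by (auto simp: X_def n_def)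
    qed
    let ?J = "X \<union> {i..<i + n}"
    have n0: "n > 0" using aM by (simp add: n_def)
    have d1: "X \<inter> {Suc i..<Suc i + n} = {}" "X \<inter> {i..<i + n} = {}" using X by auto
    have cardJ: "card ?J = card J" unfolding Jeq using X d1 by (simp add: card_Un_disjoint)
    have "\<Sum>{Suc i..<Suc i + n} = (\<Sum>k\<in>{i..<i + n}. Suc k)"
      using sum.shift_bounds_Suc_ivl[of "\<lambda>k. k" i "i + n"] by simp
    also have "\<dots> = \<Sum>{i..<i + n} + n" by (simp add: sum_Suc)
    finally have "\<Sum>?J < \<Sum>J" unfolding Jeq using X d1 n0 by (simp add: sum.union_disjoint)
    then have "c (h ` ?J) = c (h ` {..<card ?J})" using X by (intro less.hyps) auto
    moreover have "c (h ` ?J) = c (h ` J)" unfolding Jeq by (rule step[OF X])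
    ultimately show ?thesis using cardJ by simp
  next
    case True
    show ?thesis by (rule arg_cong[where f = "\<lambda>J. c (h ` J)", OF True])
  qed
qed

text \<open>
  If the type of \<open>m\<close> over terms is invariant under the shift, take a term whose value is \<open>\<in>\<close>-minimal among the
  values moved by the shift. Its values along \<open>m\<close> increase, and the witnesses lie below them, so they are not
  moved. Hence no witnesses exist and the values form a homogeneous set of order type \<open>\<omega>\<close>.
\<close>

lemma colouring_without_shift_invariant_sequences:
  assumes \<kappa>: "Card (\<kappa>::'v::zfc_universe)" "\<not> arrows_omega \<kappa>"
  shows "\<exists>col :: 'v list \<Rightarrow> nat. \<forall>m. (\<forall>i. m i \<in> elts \<kappa>) \<and> m 0 \<noteq> m 1 \<longrightarrow>
    (\<exists>k. col (map m [0..<Suc k]) \<noteq> col (map (\<lambda>i. m (Suc i)) [0..<Suc k]))"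
proof -
  have O: "Ord \<kappa>" using \<kappa>(1) by (simp add: Card_def)
  \<comment> \<open>A colouring of \<kappa> for which no increasing sequence has a homogeneous
    range.\<close>
  obtain c :: "'v set \<Rightarrow> bool" where
    c: "\<And>h. (\<forall>i. h i \<in> elts \<kappa>) \<Longrightarrow> (\<forall>i j. i < j \<longrightarrow> h i \<in> elts (h j)) \<Longrightarrow>
      \<exists>s t. s \<subseteq> range (h :: nat \<Rightarrow> 'v) \<and> t \<subseteq> range h \<and> finite s \<and> finite t \<and> card s = card t \<and> c s \<noteq> c t"
    using \<kappa>(2) unfolding arrows_omega_def by (metis UNIV_I image_subsetI)
  have "\<exists>k. type_colour c (map m [0..<Suc k]) \<noteq> type_colour c (map (\<lambda>i. m (Suc i)) [0..<Suc k])"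
    if m: "\<And>i. m i \<in> elts \<kappa>" and m01: "m 0 \<noteq> m 1" for m
  proof (rule ccontr)
    assume "\<not> ?thesis"
    then have inv: "holds c \<phi> (shift a m) = holds c \<phi> (shift (Suc a) m)" for \<phi> a
      by (intro type_colour_invariant) blast
    have inv0: "holds c \<phi> (shift a m) = holds c \<phi> m" for \<phi> a
    proof (induction a)
      case (Suc a)
      then show ?case using inv[of \<phi> a] by metis
    qed simp
    have ev\<kappa>: "(\<And>i. m' i \<in> elts \<kappa>) \<Longrightarrow> ev c t m' \<in> elts \<kappa>" for t m'
    proof (induction t arbitrary: m')
      case (Wit t n r j)
      let ?us = "map (\<lambda>i. ev c t (shift i m')) [0..<Suc n]"
      show ?case
      proof (cases "j < r \<and> (\<exists>xs. witness c n r ?us xs)")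
        case True
        then have "witness c n r ?us (chosen c n r ?us)" unfolding chosen_def by (blast intro: someI_ex)
        then have "chosen c n r ?us ! j \<in> elts (hd ?us)" using True by (auto simp: witness_def)
        moreover have "hd ?us = ev c t m'" by (simp add: hd_map del: upt_Suc)
        ultimately have "chosen c n r ?us ! j \<in> elts \<kappa>" using Wit Ord_trans[OF O] by metis
        then show ?thesis using True by (auto simp add: Let_def simp del: upt_Suc)
      next
        case False
        then have "ev c (Wit t n r j) m' = m' 0" by (auto simp add: Let_def simp del: upt_Suc)
        then show ?thesis using Wit.prems by simp
      qed
    qed simp
    \<comment> \<open>A value that is not moved looks the same from \<open>m\<close> and from its
      shift; a \<in>-minimal moved value has only unmoved values of terms below it.\<close>
    define moved where "moved = {ev c t m | t. ev c t m \<noteq> ev c t (shift 1 m)}"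
    have "ev c Var m \<in> moved" unfolding moved_def using m01 by (auto intro!: exI[of _ Var])
    then obtain z where z: "z \<in> moved" "\<And>y. y \<in> elts z \<Longrightarrow> y \<notin> moved"
      using wfE_min[OF foundation, of _ moved] by (metis case_prodI mem_Collect_eq)
    obtain t where t: "z = ev c t m" "ev c t m \<noteq> ev c t (shift 1 m)" using z(1) unfolding moved_def by blast
    have fixed: "ev c s m = ev c s (shift 1 m)" if "ev c s m \<in> elts z" for s
      using z(2)[OF that] unfolding moved_def by blast
    define h where "h i = ev c t (shift i m)" for i
    have h\<kappa>: "h i \<in> elts \<kappa>" for i unfolding h_def by (rule ev\<kappa>) (simp add: m)
    have hS: "h (Suc i) = ev c t (shift 1 (shift i m))" for i by (simp add: h_def)
    have "h 0 \<noteq> h 1" using t(2) by (simp add: h_def)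
    then have "h 0 \<in> elts (h 1) \<or> h 1 \<in> elts (h 0)" using Ord_linear[of "h 0" "h 1"] h\<kappa> Ord_mem[OF O] by blast
    \<comment> \<open>By invariance one decrease would recur at every step and give an infinite
      \<in>-descending chain.\<close>
    moreover have "h 1 \<notin> elts (h 0)"
    proof
      assume "h 1 \<in> elts (h 0)"
      then have "holds c (Greater t) m" by (simp add: h_def)
      then have "h (Suc i) \<in> elts (h i)" for i using inv0[of "Greater t" i] by (simp add: h_def)
      then show False using foundation unfolding wf_iff_no_infinite_down_chain by (metis case_prodI mem_Collect_eq)
    qed
    ultimately have "holds c (Less t) m" by (simp add: h_def)
    then have hSuc: "h i \<in> elts (h (Suc i))" for i using inv0[of "Less t" i] by (simp add: h_def)
    have hinc: "i < j \<Longrightarrow> h i \<in> elts (h j)" for i j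
    proof (induction j)
      case (Suc j)
      then show ?case using hSuc[of j] Ord_trans[OF Ord_mem[OF O h\<kappa>[of "Suc j"]]] by (metis less_Suc_eq)
    qed simp
    have seg: "segment c t n (shift i m) = map h [i..<Suc (i + n)]" for i n
      unfolding segment_def h_def by (rule nth_equalityI) (simp_all add: add_ac del: upt_Suc)
    have no: "\<not> holds c (Has t n r) m" for n r
    proof
      assume H: "holds c (Has t n r) m"
      then have H1: "holds c (Has t n r) (shift 1 m)" using inv0 by blast
      let ?u = "segment c t n m" and ?u1 = "segment c t n (shift 1 m)"
      let ?x = "chosen c n r ?u" and ?x1 = "chosen c n r ?u1"
      have w: "witness c n r ?u ?x" unfolding chosen_def using H by (auto intro: someI_ex)
      have w1: "witness c n r ?u1 ?x1" unfolding chosen_def using H1 by (auto intro: someI_ex)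
      have hd: "hd ?u = z" by (simp add: segment_def t(1) hd_map del: upt_Suc)
      have "?x = ?x1"
      proof (rule nth_equalityI)
        show "length ?x = length ?x1" using w w1 by (simp add: witness_def)
        fix j assume "j < length ?x"
        then have j: "j < r" using w by (simp add: witness_def)
        have e: "ev c (Wit t n r j) m = ?x ! j" using H j by (auto simp: segment_def Let_def simp del: upt_Suc)
        have e1: "ev c (Wit t n r j) (shift 1 m) = ?x1 ! j" using H1 j by (auto simp: segment_def Let_def simp del: upt_Suc)
        \<comment> \<open>Each entry of the witness is itself the value of a term and lies below the
          minimal moved value, so the shifted sequence chooses the same witness.\<close>
        have "?x ! j \<in> elts z" using w j hd by (auto simp: witness_def)
        then show "?x ! j = ?x1 ! j" using fixed[of "Wit t n r j"] e e1 by simp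
      qed
      \<comment> \<open>The witness gives the first block of \<open>m\<close> and the first block of
        the shift the same colour. But the latter is the second block of \<open>m\<close>, so the
        tuple is no witness.\<close>
      moreover have "holds c (Col t n r) m = holds c (Col t n r) (shift 1 m)" using inv0[of "Col t n r" 1] by simp
      ultimately have "c (set ?x \<union> set (take n ?u)) = c (set ?x \<union> set (take n ?u1))" by simp
      moreover have "take n ?u1 = tl ?u"
        using seg[of n 0] seg[of n 1] by (simp add: take_map map_tl[symmetric] tl_upt del: upt_Suc)
      ultimately show False using w by (simp add: witness_def)
    qed
    have step: "c (h ` (X \<union> {i..<i + n})) = c (h ` (X \<union> {Suc i..<Suc i + n}))"
      if X: "X \<subseteq> {..<i}" "finite X" for i n X
    proof (rule ccontr)
      assume ne: "\<not> ?thesis"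
      obtain xs where xs: "set xs = h ` X" using finite_list[of "h ` X"] X by blast
      have "witness c n (length xs) (segment c t n (shift i m)) xs"
        unfolding witness_def
      proof (intro conjI ballI)
        fix x assume "x \<in> set xs"
        then obtain j where "j \<in> X" "x = h j" using xs by auto
        then show "x \<in> elts (hd (segment c t n (shift i m)))"
          unfolding seg using hinc[of j i] X by (auto simp: hd_map simp del: upt_Suc)
      next
        show "c (set xs \<union> set (take n (segment c t n (shift i m)))) \<noteq> c (set xs \<union> set (tl (segment c t n (shift i m))))"
          using ne unfolding xs seg by (simp add: take_map map_tl[symmetric] tl_upt image_Un del: upt_Suc)
      qed simp
      then have "holds c (Has t n (length xs)) (shift i m)" by auto
      then show False using inv0 no by blast
    qed
    have hinj: "inj h"
    proof (rule injI, rule ccontr)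
      fix i j assume "h i = h j" "i \<noteq> j"
      then show False using hinc[of i j] hinc[of j i] mem_not_refl by (metis linorder_neqE_nat)
    qed
    have hom: "c s = c (h ` {..<card s})" if s: "s \<subseteq> range h" "finite s" for s
    proof -
      obtain J where J: "s = h ` J" using s(1) by (meson subset_imageE)
      have "finite J" using s(2) J hinj by (metis finite_imageD inj_on_subset subset_UNIV)
      moreover have "card J = card s" unfolding J using hinj by (metis card_image inj_on_subset subset_UNIV)
      ultimately show ?thesis using homogeneous_of_shift[of c h J, OF step] J by simp
    qed
    show False using c[of h] h\<kappa> hinc hom by metis
  qed
  then show ?thesis by blast
qed

section \<open>The groups\<close>

declare split_paired_All [simp del] split_paired_Ex [simp del]

subsection \<open>Integrality at a prime\<close>

text \<open>Membership in the localisation of the integers at \<open>p\<close>.\<close>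

definition integral_at :: "nat \<Rightarrow> rat \<Rightarrow> bool" where
  "integral_at p q \<longleftrightarrow> (\<exists>a b. q = of_int a / of_int b \<and> \<not> int p dvd b)"

lemma integral_at_of_int: "prime p \<Longrightarrow> integral_at p (of_int a)"
  unfolding integral_at_def by (rule exI[of _ a], rule exI[of _ 1]) (auto dest: prime_gt_1_nat)

lemma integral_at_0: "prime p \<Longrightarrow> integral_at p 0"
  using integral_at_of_int[of p 0] by simp

lemma integral_at_add:
  assumes "prime p" "integral_at p x" "integral_at p y"
  shows "integral_at p (x + y)"
proof -
  obtain a b c d where x: "x = of_int a / of_int b" "\<not> int p dvd b" and y: "y = of_int c / of_int d" "\<not> int p dvd d"
    using assms(2,3) unfolding integral_at_def by blast
  then have "b \<noteq> 0" "d \<noteq> 0" by auto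
  then have "x + y = of_int (a * d + c * b) / of_int (b * d)" by (simp add: x y field_simps)
  moreover have "\<not> int p dvd b * d" using x y assms(1) prime_dvd_mult_iff[of "int p" b d] by simp
  ultimately show ?thesis unfolding integral_at_def by blast
qed

lemma integral_at_mult:
  assumes "prime p" "integral_at p x" "integral_at p y"
  shows "integral_at p (x * y)"
proof -
  obtain a b c d where x: "x = of_int a / of_int b" "\<not> int p dvd b" and y: "y = of_int c / of_int d" "\<not> int p dvd d"
    using assms(2,3) unfolding integral_at_def by blast
  have "x * y = of_int (a * c) / of_int (b * d)" by (simp add: x y)
  moreover have "\<not> int p dvd b * d" using x y assms(1) prime_dvd_mult_iff[of "int p" b d] by simp
  ultimately show ?thesis unfolding integral_at_def by blast
qed

lemma integral_at_inverse_power: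
  assumes "prime p" "prime r" "r \<noteq> p"
  shows "integral_at p (1 / of_nat r ^ n)"
proof -
  have "\<not> int p dvd int r ^ n"
    using assms by (metis int_dvd_int_iff of_nat_power prime_dvd_power primes_dvd_imp_eq)
  moreover have "1 / of_nat r ^ n = (of_int 1 / of_int (int r ^ n) :: rat)" by simp
  ultimately show ?thesis unfolding integral_at_def by blast
qed

lemma integral_at_all_powers:
  assumes p: "prime p" and q: "\<And>n. integral_at p (1 / of_nat p ^ n * q)"
  shows "q = 0"
proof -
  obtain a b where ab: "q = of_int a / of_int b" "b > 0" using quotient_of_div quotient_of_denom_pos by (metis prod.collapse)
  \<comment> \<open>Chosen so that \<open>p ^ n\<close> exceeds the numerator, which it will have to
    divide.\<close>
  define n where "n = nat \<bar>a\<bar>"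
  have "n < 2 ^ n" by (rule less_exp)
  also have "(2::nat) ^ n \<le> p ^ n" using prime_ge_2_nat[OF p] by (rule power_mono) simp
  finally have n: "nat \<bar>a\<bar> < p ^ n" by (simp add: n_def)
  obtain c d where cd: "1 / of_nat p ^ n * q = of_int c / of_int d" "\<not> int p dvd d" using q[of n] unfolding integral_at_def by blast
  have d0: "d \<noteq> 0" using cd(2) by auto
  have p0: "(of_nat p :: rat) \<noteq> 0" using prime_gt_0_nat[OF p] by simp
  have "of_int a * of_int d = (of_int c * of_int b * of_nat p ^ n :: rat)"
    using cd(1) ab d0 p0 by (simp add: field_simps)
  then have "(of_int (a * d) :: rat) = of_int (c * b * int p ^ n)" by simp
  then have "a * d = c * b * int p ^ n" by (simp only: of_int_eq_iff)
  then have "int p ^ n dvd a * d" by simp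
  moreover have "coprime (int p ^ n) d"
    using p cd(2) by (simp add: prime_imp_coprime)
  ultimately have "int p ^ n dvd a" by (simp add: coprime_dvd_mult_left_iff)
  then have "a = 0 \<or> int p ^ n \<le> \<bar>a\<bar>" using zdvd_imp_le[of "int p ^ n" "\<bar>a\<bar>"] by auto
  moreover have "\<bar>a\<bar> < int p ^ n" using n by (metis nat_less_iff abs_ge_zero of_nat_power)
  ultimately show ?thesis using ab by simp
qed

text \<open>An injective assignment of primes to pairs of numbers: divisibility by one prime then
  says nothing about the functionals attached to another.\<close>

definition prime_at :: "nat \<times> nat \<Rightarrow> nat" where
  "prime_at i = enumerate {p. prime p} (prod_encode i)"

lemma prime_prime_at: "prime (prime_at i)"
  using enumerate_in_set[OF primes_infinite] by (simp add: prime_at_def)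

lemma prime_at_inj: "prime_at i = prime_at j \<Longrightarrow> i = j"
  using inj_enumerate[OF primes_infinite] inj_prod_encode unfolding prime_at_def by (metis inj_eq)

subsection \<open>Positions and points\<close>

type_synonym 'v idx = "'v \<times> nat"

text \<open>Lexicographic order on pairs of an ordinal and a number. The second component pays for
  the finitely many positions that a single move adds, so that a move costs only one step of the
  ordinal component.\<close>

definition lt :: "'v::zfc_universe idx \<Rightarrow> 'v idx \<Rightarrow> bool" where
  "lt i j \<longleftrightarrow> fst i \<in> elts (fst j) \<or> fst i = fst j \<and> snd i < snd j"

text \<open>
  A position is a node of a well-founded tree, a list of indices of decreasing rank with the last index first. It has
  the points \<open>Dn p\<close>, \<open>Up p i\<close> for each possible child \<open>i # p\<close>, and \<open>Lf p n\<close> if it is a leaf. A vector assigns a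
  rational to every point; the functionals compare the values at \<open>Up p i\<close> and \<open>Dn (i # p)\<close>, at \<open>Lf p 1\<close> and
  \<open>Inf\<close>, and, with the sign \<open>\<epsilon>\<close> that distinguishes the two groups, at \<open>Inf\<close> and \<open>Dn []\<close>.
\<close>

datatype 'v pt = Inf | Dn "('v \<times> nat) list" | Up "('v \<times> nat) list" "'v \<times> nat" | Lf "('v \<times> nat) list" nat

datatype 'v fnl = Ev "'v pt" | Lk "('v \<times> nat) list" "'v \<times> nat" | Tip "('v \<times> nat) list" | Root

lemma wf_lt: "wf {(i, j). lt i (j :: 'v::zfc_universe idx)}"
proof (rule wf_subset)
  show "wf (inv_image ({(x, y). x \<in> elts (y::'v)} <*lex*> less_than) id)"
    by (intro wf_inv_image wf_lex_prod foundation wf_less_than)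
qed (auto simp: lt_def)

lemma lt_trans: "lt i j \<Longrightarrow> lt j k \<Longrightarrow> Ord (fst k) \<Longrightarrow> lt i k"
  unfolding lt_def using Ord_trans[of "fst k" "fst j" "fst i"] by auto

lemma lt_linear: "Ord (fst i) \<Longrightarrow> Ord (fst j) \<Longrightarrow> lt i j \<or> i = j \<or> lt j i"
  unfolding lt_def using Ord_linear[of "fst i" "fst j"] by (metis linorder_neqE_nat prod.expand)

lemma lt_irrefl: "\<not> lt i i"
  by (simp add: lt_def mem_not_refl)

definition scale :: "rat \<Rightarrow> ('a \<Rightarrow> 'b \<Rightarrow> rat) \<Rightarrow> 'a \<Rightarrow> 'b \<Rightarrow> rat" where
  "scale c x = (\<lambda>\<eta> \<xi>. c * x \<eta> \<xi>)"

definition single :: "'a \<Rightarrow> 'b \<Rightarrow> 'a \<Rightarrow> 'b::zero" where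
  "single \<eta> u = (\<lambda>\<eta>'. if \<eta>' = \<eta> then u else 0)"

text \<open>The sum of a vector over the one-point extensions of the list \<open>v\<close>,
  restricted to the nonzero ones so that the sum is finite.\<close>

definition push :: "('v list \<Rightarrow> 'b \<Rightarrow> rat) \<Rightarrow> 'v list \<Rightarrow> 'b \<Rightarrow> rat" where
  "push x v \<xi> = (\<Sum>m\<in>{m. x (v @ [m]) \<noteq> 0}. x (v @ [m]) \<xi>)"

definition fev :: "rat \<Rightarrow> 'v fnl \<Rightarrow> ('v pt \<Rightarrow> rat) \<Rightarrow> rat" where
  "fev \<epsilon> \<phi> u = (case \<phi> of Ev \<xi> \<Rightarrow> u \<xi> | Lk p i \<Rightarrow> u (Up p i) - u (Dn (i # p)) | Tip p \<Rightarrow> u (Lf p 1) - u Inf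
    | Root \<Rightarrow> u Inf - \<epsilon> * u (Dn []))"

lemma fev_linear: "fev \<epsilon> \<phi> (\<lambda>\<xi>. a * u \<xi> + b * v \<xi>) = a * fev \<epsilon> \<phi> u + b * fev \<epsilon> \<phi> v"
  by (cases \<phi>) (simp_all add: fev_def algebra_simps)

lemma fev_0: "fev \<epsilon> \<phi> 0 = 0" "fev \<epsilon> \<phi> (\<lambda>_. 0) = 0"
  by (cases \<phi>; simp add: fev_def)+

section \<open>The vector spaces, the functionals and the groups\<close>

locale group_data =
  fixes \<alpha> \<kappa> :: "'v::zfc_universe" and lab :: "'v fnl \<Rightarrow> 'v" and col :: "'v list \<Rightarrow> nat"
  assumes Ord_\<alpha>: "Ord \<alpha>"
begin

definition rk :: "('v \<times> nat) list \<Rightarrow> 'v \<times> nat" where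
  "rk p = (case p of [] \<Rightarrow> (\<alpha>, 0) | i # _ \<Rightarrow> i)"

definition Pos :: "('v \<times> nat) list set" where
  "Pos = lists {i. fst i \<in> elts \<alpha>}"

definition leaf :: "('v \<times> nat) list \<Rightarrow> bool" where
  "leaf p \<longleftrightarrow> \<not> (\<exists>i. lt i (rk p))"

definition dom :: "('v \<times> nat) list \<Rightarrow> 'v pt set" where
  "dom p = insert (Dn p) ({Up p i | i. lt i (rk p)} \<union> {Lf p n | n. leaf p})"

text \<open>Support is finite in positions, not in points, because the vector that is 1 on all
  points of a position is needed. The bound \<open>b\<close> expresses that the value at
  \<open>Dn p\<close> is taken at all large children, and \<open>Dn p\<close> of a leaf carries the
  value of its polynomial at 0.\<close>

definition U :: "('v pt \<Rightarrow> rat) set" where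
  "U = {u. (\<exists>S. finite S \<and> S \<subseteq> Pos \<and> (\<forall>\<xi>. u \<xi> \<noteq> 0 \<longrightarrow> \<xi> = Inf \<or> (\<exists>p\<in>S. \<xi> \<in> dom p))) \<and>
    (\<forall>p\<in>Pos. \<not> leaf p \<longrightarrow> (\<exists>b. lt b (rk p) \<and> (\<forall>i. lt i (rk p) \<and> \<not> lt i b \<longrightarrow> u (Up p i) = u (Dn p)))) \<and>
    (\<forall>p\<in>Pos. leaf p \<longrightarrow> (\<exists>P. u (Dn p) = poly P 0 \<and> (\<forall>n. u (Lf p n) = poly P (of_nat n))))}"

definition Fn :: "'v fnl set" where
  "Fn = {Ev \<xi> | \<xi>. \<xi> = Inf \<or> (\<exists>p\<in>Pos. \<xi> \<in> dom p)} \<union> {Lk p i | p i. p \<in> Pos \<and> lt i (rk p)} \<union>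
    {Tip p | p. p \<in> Pos \<and> leaf p} \<union> {Root}"

text \<open>The empty list carries no vector, so the functionals of
  \<open>Phi \<epsilon> (1, 0)\<close> at \<open>[]\<close> measure the sum over the first level
  alone.\<close>

definition V :: "('v list \<Rightarrow> 'v pt \<Rightarrow> rat) set" where
  "V = {x. finite {\<eta>. x \<eta> \<noteq> 0} \<and> (\<forall>\<eta>. x \<eta> \<noteq> 0 \<longrightarrow> \<eta> \<in> lists (elts \<kappa>) - {[]}) \<and> (\<forall>\<eta>. x \<eta> \<in> U)}"

text \<open>The kernel of the functionals \<open>Phi \<epsilon> (n, Suc k)\<close> consists of the vectors on level \<open>n\<close> with colour \<open>k\<close>;
  \<open>Phi \<epsilon> (Suc n, 0)\<close> ties each vector on level \<open>n\<close> to its copies on level \<open>n + 1\<close>, and \<open>Phi \<epsilon> (0, 0)\<close>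
  records on the first level the zero sets of the functionals on \<open>U\<close>.\<close>

fun Phi :: "rat \<Rightarrow> nat \<times> nat \<Rightarrow> (('v list \<Rightarrow> 'v pt \<Rightarrow> rat) \<Rightarrow> rat) set" where
  "Phi \<epsilon> (0, 0) = {\<lambda>x. x \<eta> \<xi> | \<eta> \<xi>. length \<eta> \<noteq> 1} \<union> {\<lambda>x. fev \<epsilon> \<phi> (x [lab \<phi>]) | \<phi>. \<phi> \<in> Fn}"
| "Phi \<epsilon> (Suc n, 0) = {\<lambda>x. x \<eta> \<xi> | \<eta> \<xi>. length \<eta> \<noteq> n \<and> length \<eta> \<noteq> Suc n} \<union>
     {\<lambda>x. x v \<xi> + push x v \<xi> | v \<xi>. length v = n}"
| "Phi \<epsilon> (n, Suc k) = {\<lambda>x. x \<eta> \<xi> | \<eta> \<xi>. \<not> (length \<eta> = n \<and> col \<eta> = k)}"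

definition Gr :: "rat \<Rightarrow> ('v list \<Rightarrow> 'v pt \<Rightarrow> rat) set" where
  "Gr \<epsilon> = {x \<in> V. \<forall>i. \<forall>\<phi>\<in>Phi \<epsilon> i. integral_at (prime_at i) (\<phi> x)}"

lemma rk_simps [simp]: "rk [] = (\<alpha>, 0)" "rk (i # p) = i"
  by (simp_all add: rk_def)

lemma Pos_Nil [simp]: "[] \<in> Pos"
  by (simp add: Pos_def)

lemma Pos_Cons: "i # p \<in> Pos \<longleftrightarrow> fst i \<in> elts \<alpha> \<and> p \<in> Pos"
  by (simp add: Pos_def)

lemma Ord_rk: "p \<in> Pos \<Longrightarrow> Ord (fst (rk p))"
  by (cases p) (auto simp: Pos_Cons Ord_\<alpha> intro: Ord_mem[OF Ord_\<alpha>])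

lemma Pos_child: "p \<in> Pos \<Longrightarrow> lt i (rk p) \<Longrightarrow> i # p \<in> Pos"
  by (cases p) (auto simp: Pos_Cons lt_def intro: Ord_trans[OF Ord_\<alpha>])

lemma dom_simps [simp]:
  "Inf \<notin> dom p" "Dn q \<in> dom p \<longleftrightarrow> q = p" "Up q i \<in> dom p \<longleftrightarrow> q = p \<and> lt i (rk p)" "Lf q n \<in> dom p \<longleftrightarrow> q = p \<and> leaf p"
  by (auto simp: dom_def simp del: split_paired_Ex)

lemma U_linear:
  assumes "u \<in> U" "v \<in> U"
  shows "(\<lambda>\<xi>. a * u \<xi> + b * v \<xi>) \<in> U"
proof -
  let ?w = "\<lambda>\<xi>. a * u \<xi> + b * v \<xi>"
  obtain S where S: "finite S" "S \<subseteq> Pos" "\<forall>\<xi>. u \<xi> \<noteq> 0 \<longrightarrow> \<xi> = Inf \<or> (\<exists>p\<in>S. \<xi> \<in> dom p)"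
    using assms(1) unfolding U_def by blast
  obtain T where T: "finite T" "T \<subseteq> Pos" "\<forall>\<xi>. v \<xi> \<noteq> 0 \<longrightarrow> \<xi> = Inf \<or> (\<exists>p\<in>T. \<xi> \<in> dom p)"
    using assms(2) unfolding U_def by blast
  have 1: "\<exists>S. finite S \<and> S \<subseteq> Pos \<and> (\<forall>\<xi>. ?w \<xi> \<noteq> 0 \<longrightarrow> \<xi> = Inf \<or> (\<exists>p\<in>S. \<xi> \<in> dom p))"
  proof (intro exI conjI allI impI)
    fix \<xi> assume "?w \<xi> \<noteq> 0"
    then have "u \<xi> \<noteq> 0 \<or> v \<xi> \<noteq> 0" by auto
    then show "\<xi> = Inf \<or> (\<exists>p\<in>S \<union> T. \<xi> \<in> dom p)" using S(3) T(3) by blast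
  qed (use S T in auto)
  have 2: "\<exists>b. lt b (rk p) \<and> (\<forall>i. lt i (rk p) \<and> \<not> lt i b \<longrightarrow> ?w (Up p i) = ?w (Dn p))" if p: "p \<in> Pos" "\<not> leaf p" for p
  proof -
    obtain b where b: "lt b (rk p)" "\<And>i. lt i (rk p) \<Longrightarrow> \<not> lt i b \<Longrightarrow> u (Up p i) = u (Dn p)"
      using assms(1) p unfolding U_def by blast
    obtain c where c: "lt c (rk p)" "\<And>i. lt i (rk p) \<Longrightarrow> \<not> lt i c \<Longrightarrow> v (Up p i) = v (Dn p)"
      using assms(2) p unfolding U_def by blast
    have O: "Ord (fst b)" "Ord (fst c)"
      using b(1) c(1) Ord_rk[OF p(1)] by (auto simp: lt_def intro: Ord_mem)
    \<comment> \<open>The larger of the two bounds; indices with ordinal components are linearly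
      ordered, so beyond it both vectors are constant.\<close>
    define d where "d = (if lt b c then c else b)"
    have d: "lt d (rk p)" using b(1) c(1) by (simp add: d_def)
    have "\<not> lt i b \<and> \<not> lt i c" if "\<not> lt i d" for i
      using that lt_trans[of i b c] lt_trans[of i c b] lt_linear[OF O] O by (auto simp: d_def split: if_splits)
    then show ?thesis using b c d by (intro exI[of _ d]) auto
  qed
  have 3: "\<exists>P. ?w (Dn p) = poly P 0 \<and> (\<forall>n. ?w (Lf p n) = poly P (of_nat n))" if p: "p \<in> Pos" "leaf p" for p
  proof -
    obtain P where P: "u (Dn p) = poly P 0" "\<And>n. u (Lf p n) = poly P (of_nat n)" using assms(1) p unfolding U_def by blast
    obtain Q where Q: "v (Dn p) = poly Q 0" "\<And>n. v (Lf p n) = poly Q (of_nat n)" using assms(2) p unfolding U_def by blast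
    show ?thesis by (rule exI[of _ "smult a P + smult b Q"]) (simp add: P Q)
  qed
  show ?thesis unfolding U_def using 1 2 3 by blast
qed

lemma U_0 [simp]: "0 \<in> U"
proof -
  have "\<exists>b. lt b (rk p)" if "\<not> leaf p" for p using that by (simp add: leaf_def)
  then show ?thesis unfolding U_def
    by (auto intro!: exI[of _ "{}"] exI[of _ "0 :: rat poly"] simp del: split_paired_Ex)
qed

lemma V_linear:
  assumes "x \<in> V" "y \<in> V"
  shows "scale a x + scale b y \<in> V"
proof -
  let ?w = "scale a x + scale b y"
  have sub: "{\<eta>. ?w \<eta> \<noteq> 0} \<subseteq> {\<eta>. x \<eta> \<noteq> 0} \<union> {\<eta>. y \<eta> \<noteq> 0}"
    by (auto simp: scale_def fun_eq_iff)
  have "finite {\<eta>. ?w \<eta> \<noteq> 0}" using assms by (intro finite_subset[OF sub]) (auto simp: V_def)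
  moreover have "\<eta> \<in> lists (elts \<kappa>) - {[]}" if "?w \<eta> \<noteq> 0" for \<eta> using sub that assms unfolding V_def by blast
  moreover have "?w \<eta> \<in> U" for \<eta>
    using U_linear[of "x \<eta>" "y \<eta>" a b] assms by (simp add: V_def scale_def plus_fun_def)
  ultimately show ?thesis unfolding V_def by blast
qed

lemma push_sum: "x \<in> V \<Longrightarrow> finite A \<Longrightarrow> {m. x (v @ [m]) \<noteq> 0} \<subseteq> A \<Longrightarrow> push x v \<xi> = (\<Sum>m\<in>A. x (v @ [m]) \<xi>)"
  unfolding push_def by (rule sum.mono_neutral_left) auto

lemma finite_children: "x \<in> V \<Longrightarrow> finite {m. x (v @ [m]) \<noteq> 0}"
proof -
  assume "x \<in> V"
  then have "finite {\<eta>. x \<eta> \<noteq> 0}" by (simp add: V_def)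
  then have "finite ((\<lambda>m. v @ [m]) -` {\<eta>. x \<eta> \<noteq> 0})" by (rule finite_vimageI) (simp add: inj_def)
  then show ?thesis by (simp add: vimage_def)
qed

lemma push_linear:
  assumes "x \<in> V" "y \<in> V"
  shows "push (scale a x + scale b y) v \<xi> = a * push x v \<xi> + b * push y v \<xi>"
proof -
  let ?A = "{m. x (v @ [m]) \<noteq> 0} \<union> {m. y (v @ [m]) \<noteq> 0}"
  have f: "finite ?A" using assms by (simp add: finite_children)
  have "{m. (scale a x + scale b y) (v @ [m]) \<noteq> 0} \<subseteq> ?A" by (auto simp: scale_def fun_eq_iff)
  then have "push (scale a x + scale b y) v \<xi> = (\<Sum>m\<in>?A. (scale a x + scale b y) (v @ [m]) \<xi>)"
    using push_sum[OF V_linear[OF assms] f] by blast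
  also have "\<dots> = a * (\<Sum>m\<in>?A. x (v @ [m]) \<xi>) + b * (\<Sum>m\<in>?A. y (v @ [m]) \<xi>)"
    by (simp add: scale_def sum.distrib sum_distrib_left)
  finally show ?thesis using push_sum[OF assms(1) f] push_sum[OF assms(2) f] by auto
qed

text \<open>Sorts the functionals by what they read: one entry, one functional of \<open>Fn\<close>
  at its label, or a list together with its extensions. The sign \<epsilon> matters only in the
  second kind.\<close>

lemma Phi_cases:
  assumes "\<phi> \<in> Phi \<epsilon> i"
  obtains (entry) \<eta> \<xi> where "\<phi> = (\<lambda>x. x \<eta> \<xi>)" "\<And>\<epsilon>'. \<phi> \<in> Phi \<epsilon>' i"
    | (functional) \<psi> where "\<psi> \<in> Fn" "i = (0, 0)" "\<phi> = (\<lambda>x. fev \<epsilon> \<psi> (x [lab \<psi>]))"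
    | (level) v \<xi> where "\<phi> = (\<lambda>x. x v \<xi> + push x v \<xi>)" "i = (Suc (length v), 0)"
  using assms by (cases "(\<epsilon>, i)" rule: Phi.cases) auto

lemma Phi_linear:
  assumes "\<phi> \<in> Phi \<epsilon> i" "x \<in> V" "y \<in> V"
  shows "\<phi> (scale a x + scale b y) = a * \<phi> x + b * \<phi> y"
  using assms(1)
proof (cases rule: Phi_cases)
  case (functional \<psi>)
  then show ?thesis using fev_linear[of \<epsilon> \<psi> a "x [lab \<psi>]" b "y [lab \<psi>]"] by (simp add: scale_def plus_fun_def)
next
  case (level v \<xi>)
  then show ?thesis using push_linear[OF assms(2,3)] by (simp add: scale_def algebra_simps)
qed (simp add: scale_def)

lemma scale_add: "scale 1 x + scale 1 y = x + y" "scale 1 x + scale (- 1) y = x - y" "scale c x + scale 0 y = scale c x"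
  by (auto simp: scale_def fun_eq_iff)

lemma V_0: "0 \<in> V" by (simp add: V_def)

lemma Phi_scale: "\<phi> \<in> Phi \<epsilon> i \<Longrightarrow> x \<in> V \<Longrightarrow> \<phi> (scale c x) = c * \<phi> x"
  using Phi_linear[of \<phi> \<epsilon> i x x c 0] by (simp add: scale_add)

lemma V_scale: "x \<in> V \<Longrightarrow> scale c x \<in> V"
  using V_linear[of x x c 0] by (simp add: scale_add)

lemma Gr_V: "x \<in> Gr \<epsilon> \<Longrightarrow> x \<in> V"
  by (simp add: Gr_def)

lemma GrD: "x \<in> Gr \<epsilon> \<Longrightarrow> \<phi> \<in> Phi \<epsilon> i \<Longrightarrow> integral_at (prime_at i) (\<phi> x)"
  unfolding Gr_def by blast

lemma GrI: "x \<in> V \<Longrightarrow> (\<And>i \<phi>. \<phi> \<in> Phi \<epsilon> i \<Longrightarrow> integral_at (prime_at i) (\<phi> x)) \<Longrightarrow> x \<in> Gr \<epsilon>"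
  unfolding Gr_def by blast

lemma Gr_linear:
  assumes "x \<in> Gr \<epsilon>" "y \<in> Gr \<epsilon>"
  shows "scale (of_int a) x + scale (of_int b) y \<in> Gr \<epsilon>"
  unfolding Gr_def
proof (intro CollectI conjI allI ballI)
  fix i \<phi> assume \<phi>: "\<phi> \<in> Phi \<epsilon> i"
  have "integral_at (prime_at i) (of_int a * \<phi> x + of_int b * \<phi> y)"
    by (intro integral_at_add integral_at_mult integral_at_of_int prime_prime_at GrD[OF _ \<phi>] assms)
  then show "integral_at (prime_at i) (\<phi> (scale (of_int a) x + scale (of_int b) y))"
    using Phi_linear[OF \<phi>] assms Gr_V by auto
qed (use assms V_linear Gr_V in blast)

lemma Gr_0: "0 \<in> Gr \<epsilon>"
proof -
  have "\<phi> 0 = 0" if "\<phi> \<in> Phi \<epsilon> i" for \<phi> i using Phi_scale[OF that V_0, of 0] by (simp add: scale_def zero_fun_def)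
  then show ?thesis by (intro GrI[OF V_0]) (metis integral_at_0 prime_prime_at)
qed

lemma Gr_add: "x \<in> Gr \<epsilon> \<Longrightarrow> y \<in> Gr \<epsilon> \<Longrightarrow> x + y \<in> Gr \<epsilon>"
  using Gr_linear[of x \<epsilon> y 1 1] by (simp add: scale_add)

lemma Gr_diff: "x \<in> Gr \<epsilon> \<Longrightarrow> y \<in> Gr \<epsilon> \<Longrightarrow> x - y \<in> Gr \<epsilon>"
  using Gr_linear[of x \<epsilon> y 1 "-1"] by (simp add: scale_add)

text \<open>Dividing by a power of one prime preserves integrality at all other primes, and at the
  prime itself all functionals give 0.\<close>

lemma Gr_divide:
  assumes x: "x \<in> Gr \<epsilon>" and ker: "\<And>\<phi>. \<phi> \<in> Phi \<epsilon> i \<Longrightarrow> \<phi> x = 0"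
  shows "scale (1 / of_nat (prime_at i) ^ n) x \<in> Gr \<epsilon>"
  unfolding Gr_def
proof (intro CollectI conjI allI ballI)
  fix j \<phi> assume \<phi>: "\<phi> \<in> Phi \<epsilon> j"
  have e: "\<phi> (scale (1 / of_nat (prime_at i) ^ n) x) = 1 / of_nat (prime_at i) ^ n * \<phi> x"
    by (rule Phi_scale[OF \<phi> Gr_V[OF x]])
  show "integral_at (prime_at j) (\<phi> (scale (1 / of_nat (prime_at i) ^ n) x))"
  proof (cases "i = j")
    case True
    then have "\<phi> x = 0" using ker \<phi> by blast
    then show ?thesis unfolding e by (simp add: integral_at_0 prime_prime_at)
  next
    case False
    then have "prime_at i \<noteq> prime_at j" using prime_at_inj by blast
    then show ?thesis unfolding e
      by (intro integral_at_mult integral_at_inverse_power prime_prime_at GrD[OF x \<phi>])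
  qed
qed (use x V_scale Gr_V in blast)

text \<open>Converse of \<open>Gr_divide\<close>: together they identify the common kernel of
  \<open>Phi \<epsilon> i\<close> with the elements infinitely divisible by
  \<open>prime_at i\<close>, a notion that refers only to the group.\<close>

lemma Gr_divisible:
  assumes "\<And>n. scale (1 / of_nat (prime_at i) ^ n) x \<in> Gr \<epsilon>" and \<phi>: "\<phi> \<in> Phi \<epsilon> i"
  shows "\<phi> x = 0"
proof (rule integral_at_all_powers[OF prime_prime_at])
  fix n
  have "x \<in> V" using Gr_V[OF assms(1)[of 0]] by (simp add: scale_def)
  then show "integral_at (prime_at i) (1 / of_nat (prime_at i) ^ n * \<phi> x)"
    using GrD[OF assms(1)[of n] \<phi>] Phi_scale[OF \<phi>, of x] by simp
qed

lemma push_single: "push (single \<eta> u) v \<xi> = (if \<eta> \<noteq> [] \<and> v = butlast \<eta> then u \<xi> else 0)"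
proof -
  have s: "{m. single \<eta> u (v @ [m]) \<noteq> 0} = (if \<eta> \<noteq> [] \<and> v = butlast \<eta> \<and> u \<noteq> 0 then {last \<eta>} else {})"
    using append_butlast_last_id[of \<eta>] by (auto simp: single_def) (metis last_snoc)
  show ?thesis unfolding push_def s by (auto simp: single_def)
qed

lemma single_V: "u \<in> U \<Longrightarrow> \<eta> \<in> lists (elts \<kappa>) \<Longrightarrow> \<eta> \<noteq> [] \<Longrightarrow> single \<eta> u \<in> V"
proof -
  assume u: "u \<in> U" and \<eta>: "\<eta> \<in> lists (elts \<kappa>)" "\<eta> \<noteq> []"
  have "{\<eta>'. single \<eta> u \<eta>' \<noteq> 0} \<subseteq> {\<eta>}" by (auto simp: single_def)
  then have "finite {\<eta>'. single \<eta> u \<eta>' \<noteq> 0}" by (rule finite_subset) simp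
  then show ?thesis using u \<eta> by (auto simp: V_def single_def split: if_splits)
qed

lemma fev_Ints: "(\<And>\<xi>. u \<xi> \<in> \<int>) \<Longrightarrow> \<epsilon> \<in> \<int> \<Longrightarrow> fev \<epsilon> \<phi> u \<in> \<int>"
  by (cases \<phi>) (auto simp: fev_def)

lemma single_Gr:
  assumes u: "u \<in> U" "\<And>\<xi>. u \<xi> \<in> \<int>" and \<eta>: "\<eta> \<in> lists (elts \<kappa>)" "\<eta> \<noteq> []" and \<epsilon>: "\<epsilon> \<in> \<int>"
  shows "single \<eta> u \<in> Gr \<epsilon>"
proof -
  have s: "single \<eta> u \<eta>' \<xi> \<in> \<int>" for \<eta>' \<xi> using u by (simp add: single_def)
  have "\<phi> (single \<eta> u) \<in> \<int>" if "\<phi> \<in> Phi \<epsilon> i" for \<phi> i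
    using that by (cases rule: Phi_cases) (use s u \<epsilon> in \<open>auto intro!: fev_Ints simp: push_single\<close>)
  then show ?thesis using single_V[OF u(1) \<eta>] integral_at_of_int[OF prime_prime_at]
    by (intro GrI) (assumption, metis Ints_cases)
qed


subsection \<open>Multiplication by signs\<close>

text \<open>A link compares two points with the same factor, that of the child. At a leaf in
  \<open>B\<close> the factor is the linear polynomial through -1 at 0 and 1 at 1: it agrees with
  the factor at \<open>Dn p\<close> and leaves the comparison of \<open>Lf p 1\<close> with
  \<open>Inf\<close> intact.\<close>

definition sg :: "('v \<times> nat) list set \<Rightarrow> 'v pt \<Rightarrow> rat" where
  "sg B \<xi> = (case \<xi> of Inf \<Rightarrow> 1 | Dn p \<Rightarrow> if p \<in> B then - 1 else 1 | Up p i \<Rightarrow> if i # p \<in> B then - 1 else 1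
     | Lf p n \<Rightarrow> if p \<in> B then 2 * of_nat n - 1 else 1)"

text \<open>The root must be negative to turn the sign \<epsilon> around, and membership must be
  eventually constant along children so that \<open>U\<close> is preserved.\<close>

definition admissible :: "('v \<times> nat) list set \<Rightarrow> bool" where
  "admissible B \<longleftrightarrow> [] \<in> B \<and> (\<forall>p\<in>Pos. \<not> leaf p \<longrightarrow>
     (\<exists>b. lt b (rk p) \<and> (\<forall>i. lt i (rk p) \<and> \<not> lt i b \<longrightarrow> (i # p \<in> B \<longleftrightarrow> p \<in> B))))"

definition mulx :: "('v \<times> nat) list set \<Rightarrow> ('v list \<Rightarrow> 'v pt \<Rightarrow> rat) \<Rightarrow> 'v list \<Rightarrow> 'v pt \<Rightarrow> rat" where
  "mulx B x = (\<lambda>\<eta> \<xi>. sg B \<xi> * x \<eta> \<xi>)"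

lemma sg_nonzero: "sg B \<xi> \<noteq> 0"
proof -
  have "(2 * of_nat n - 1 :: rat) \<noteq> 0" for n
  proof
    assume "(2 * of_nat n - 1 :: rat) = 0"
    then have "(of_nat (2 * n) :: rat) = of_nat 1" by simp
    then have "2 * n = 1" by (simp only: of_nat_eq_iff)
    then show False by presburger
  qed
  then show ?thesis by (cases \<xi>) (auto simp: sg_def)
qed

lemma sg_Ints: "\<exists>a. sg B \<xi> = of_int a"
proof -
  have "sg B \<xi> \<in> \<int>" by (cases \<xi>) (auto simp: sg_def)
  then show ?thesis by (auto elim: Ints_cases)
qed

lemma U_mul:
  assumes B: "admissible B" and u: "u \<in> U"
  shows "(\<lambda>\<xi>. sg B \<xi> * u \<xi>) \<in> U"
proof -
  let ?w = "\<lambda>\<xi>. sg B \<xi> * u \<xi>"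
  have 1: "\<exists>S. finite S \<and> S \<subseteq> Pos \<and> (\<forall>\<xi>. ?w \<xi> \<noteq> 0 \<longrightarrow> \<xi> = Inf \<or> (\<exists>p\<in>S. \<xi> \<in> dom p))"
    using u unfolding U_def by (auto simp: sg_nonzero)
  have 2: "\<exists>b. lt b (rk p) \<and> (\<forall>i. lt i (rk p) \<and> \<not> lt i b \<longrightarrow> ?w (Up p i) = ?w (Dn p))" if p: "p \<in> Pos" "\<not> leaf p" for p
  proof -
    obtain b where b: "lt b (rk p)" "\<And>i. lt i (rk p) \<Longrightarrow> \<not> lt i b \<Longrightarrow> u (Up p i) = u (Dn p)"
      using u p unfolding U_def by blast
    obtain c where c: "lt c (rk p)" "\<And>i. lt i (rk p) \<Longrightarrow> \<not> lt i c \<Longrightarrow> i # p \<in> B \<longleftrightarrow> p \<in> B"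
      using B p unfolding admissible_def by blast
    have O: "Ord (fst b)" "Ord (fst c)"
      using b(1) c(1) Ord_rk[OF p(1)] by (auto simp: lt_def intro: Ord_mem)
    define d where "d = (if lt b c then c else b)"
    have d: "lt d (rk p)" using b(1) c(1) by (simp add: d_def)
    have "\<not> lt i b \<and> \<not> lt i c" if "\<not> lt i d" for i
      using that lt_trans[of i b c] lt_trans[of i c b] lt_linear[OF O] O by (auto simp: d_def split: if_splits)
    then show ?thesis using b c d by (intro exI[of _ d]) (auto simp: sg_def)
  qed
  have 3: "\<exists>P. ?w (Dn p) = poly P 0 \<and> (\<forall>n. ?w (Lf p n) = poly P (of_nat n))" if p: "p \<in> Pos" "leaf p" for p
  proof -
    obtain P where P: "u (Dn p) = poly P 0" "\<And>n. u (Lf p n) = poly P (of_nat n)" using u p unfolding U_def by blast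
    show ?thesis
      by (rule exI[of _ "if p \<in> B then [:- 1, 2:] * P else P"]) (simp add: P sg_def algebra_simps)
  qed
  show ?thesis unfolding U_def using 1 2 3 by blast
qed

lemma mulx_eq_0: "mulx B x \<eta> = 0 \<longleftrightarrow> x \<eta> = 0"
  by (auto simp: mulx_def fun_eq_iff sg_nonzero)

lemma mulx_V: "admissible B \<Longrightarrow> x \<in> V \<Longrightarrow> mulx B x \<in> V"
  unfolding V_def using U_mul by (auto simp: mulx_eq_0) (simp add: mulx_def)

lemma mulx_push: "push (mulx B x) v \<xi> = sg B \<xi> * push x v \<xi>"
  by (simp add: push_def mulx_eq_0) (simp add: mulx_def sum_distrib_left)

text \<open>Both points compared by \<open>Lk\<close> or \<open>Tip\<close> carry the same factor.
  For \<open>Root\<close> the factors are 1 and -1, and the second is absorbed by passing from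
  \<epsilon> to its negative.\<close>

lemma fev_mul:
  assumes B: "admissible B" and \<psi>: "\<psi> \<in> Fn"
  shows "\<exists>\<xi>. \<forall>u. fev (- \<epsilon>) \<psi> (\<lambda>\<xi>. sg B \<xi> * u \<xi>) = sg B \<xi> * fev \<epsilon> \<psi> u"
proof (cases \<psi>)
  case (Ev \<xi>)
  then show ?thesis by (auto simp: fev_def)
next
  case (Lk p i)
  show ?thesis unfolding Lk by (rule exI[of _ "Up p i"]) (auto simp: fev_def sg_def algebra_simps)
next
  case (Tip p)
  show ?thesis unfolding Tip by (rule exI[of _ "Inf"]) (auto simp: fev_def sg_def algebra_simps)
next
  case Root
  show ?thesis unfolding Root by (rule exI[of _ "Inf"]) (use B in \<open>auto simp: fev_def sg_def algebra_simps admissible_def\<close>)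
qed

lemma mulx_Gr:
  assumes B: "admissible B" and x: "x \<in> Gr \<epsilon>"
  shows "mulx B x \<in> Gr (- \<epsilon>)"
proof (rule GrI[OF mulx_V[OF B Gr_V[OF x]]])
  fix i \<phi> assume "\<phi> \<in> Phi (- \<epsilon>) i"
  then have "\<exists>\<psi>\<in>Phi \<epsilon> i. \<exists>\<xi>. \<phi> (mulx B x) = sg B \<xi> * \<psi> x"
  proof (cases rule: Phi_cases)
    case (entry \<eta> \<xi>)
    then show ?thesis using entry by (auto simp: mulx_def intro!: bexI[of _ \<phi>])
  next
    case (functional \<psi>)
    obtain \<xi> where "\<forall>u. fev (- \<epsilon>) \<psi> (\<lambda>\<xi>. sg B \<xi> * u \<xi>) = sg B \<xi> * fev \<epsilon> \<psi> u" using fev_mul[OF B functional(1)] by blast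
    then have "\<phi> (mulx B x) = sg B \<xi> * fev \<epsilon> \<psi> (x [lab \<psi>])" using functional(3) by (simp add: mulx_def)
    moreover have "(\<lambda>x. fev \<epsilon> \<psi> (x [lab \<psi>])) \<in> Phi \<epsilon> i" using functional by auto
    ultimately show ?thesis by (intro bexI[of _ "\<lambda>x. fev \<epsilon> \<psi> (x [lab \<psi>])"] exI[of _ \<xi>])
  next
    case (level v \<xi>)
    then have "\<phi> \<in> Phi \<epsilon> i" by auto
    moreover have "\<phi> (mulx B x) = sg B \<xi> * \<phi> x" using level by (simp add: mulx_push) (simp add: mulx_def algebra_simps)
    ultimately show ?thesis by blast
  qed
  then obtain \<psi> \<xi> where \<psi>: "\<psi> \<in> Phi \<epsilon> i" "\<phi> (mulx B x) = sg B \<xi> * \<psi> x" by blast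
  obtain a where "sg B \<xi> = of_int a" using sg_Ints by blast
  then show "integral_at (prime_at i) (\<phi> (mulx B x))" unfolding \<psi>(2)
    using GrD[OF x \<psi>(1)] by (auto intro: integral_at_mult integral_at_of_int prime_prime_at)
qed

lemma mulx_add: "mulx B (x + y) = mulx B x + mulx B y"
  by (auto simp: mulx_def fun_eq_iff algebra_simps)

lemma mulx_inj: "mulx B x = mulx B y \<Longrightarrow> x = y"
  by (auto simp: mulx_def fun_eq_iff sg_nonzero)

subsection \<open>The back-and-forth game\<close>

end

context group_data
begin

definition touches :: "('v list \<Rightarrow> 'v pt \<Rightarrow> rat) \<Rightarrow> ('v \<times> nat) list set \<Rightarrow> bool" where
  "touches x S \<longleftrightarrow> (\<forall>\<eta> \<xi>. x \<eta> \<xi> \<noteq> 0 \<longrightarrow> \<xi> = Inf \<or> (\<exists>p\<in>S. \<xi> \<in> dom p))"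

definition tree :: "('v \<times> nat) list set \<Rightarrow> bool" where
  "tree S \<longleftrightarrow> finite S \<and> S \<subseteq> Pos \<and> (\<forall>p\<in>S. p \<noteq> [] \<longrightarrow> tl p \<in> S)"

definition border :: "('v \<times> nat) list set \<Rightarrow> ('v \<times> nat) list set" where
  "border S = {q \<in> Pos. q \<notin> S \<and> (q = [] \<or> tl q \<in> S)}"

text \<open>On the finite tree \<open>S\<close> of positions touched so far nothing is wrong yet; every bad position on its
  border still has high rank.\<close>

definition safe :: "('v \<times> nat) list set \<Rightarrow> ('v \<times> nat) list set \<Rightarrow> ('v \<times> nat \<Rightarrow> bool) \<Rightarrow> bool" where
  "safe S B high \<longleftrightarrow> admissible B \<and> tree S \<and> (\<forall>p\<in>S \<inter> B. \<not> leaf p) \<and> (\<forall>q\<in>border S \<inter> B. high (rk q))"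

text \<open>For ordinals this says that the ordinal component of \<open>i\<close> is at least
  \<beta>.\<close>

definition big :: "'v \<Rightarrow> 'v \<times> nat \<Rightarrow> bool" where
  "big \<beta> i \<longleftrightarrow> (\<forall>\<gamma>\<in>elts \<beta>. \<forall>k. lt (\<gamma>, k) i)"

text \<open>All answers come from one multiplication. Later \<open>B\<close> may be replaced,
  provided the vectors played so far do not notice.\<close>

definition game :: "rat \<Rightarrow> 'v \<Rightarrow> ('v list \<Rightarrow> 'v pt \<Rightarrow> rat) list \<Rightarrow> ('v list \<Rightarrow> 'v pt \<Rightarrow> rat) list \<Rightarrow> bool" where
  "game \<epsilon> \<beta> xs ys \<longleftrightarrow> (\<exists>B S. safe S B (big \<beta>) \<and> (\<forall>x\<in>set xs. x \<in> Gr \<epsilon> \<and> touches x S) \<and> ys = map (mulx B) xs)"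

text \<open>On the positions in \<open>S\<close> all factors are 1 or -1, as no leaf of
  \<open>S\<close> lies in \<open>B\<close>.\<close>

lemma mulx_mulx:
  assumes "safe S B high" "touches x S"
  shows "mulx B (mulx B x) = x"
proof (intro ext)
  fix \<eta> \<xi>
  have "sg B \<xi> * sg B \<xi> = 1" if "x \<eta> \<xi> \<noteq> 0"
  proof -
    have "\<xi> = Inf \<or> (\<exists>p\<in>S. \<xi> \<in> dom p)" using assms(2) that unfolding touches_def by blast
    then show ?thesis using assms(1) by (cases \<xi>) (auto simp: sg_def safe_def)
  qed
  then show "mulx B (mulx B x) \<eta> \<xi> = x \<eta> \<xi>"
    by (cases "x \<eta> \<xi> = 0") (simp_all add: mulx_def mult.assoc[symmetric])
qed

lemma touches_mulx: "touches (mulx B x) S \<longleftrightarrow> touches x S"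
  by (simp add: touches_def mulx_def sg_nonzero)

text \<open>On the vectors played so far the multiplication is an involution, so the same
  \<open>B\<close> and \<open>S\<close> serve for the game with the groups exchanged.\<close>

lemma game_sym:
  assumes "game \<epsilon> \<beta> xs ys"
  shows "game (- \<epsilon>) \<beta> ys xs"
proof -
  obtain B S where BS: "safe S B (big \<beta>)" "\<And>x. x \<in> set xs \<Longrightarrow> x \<in> Gr \<epsilon> \<and> touches x S" "ys = map (mulx B) xs"
    using assms unfolding game_def by blast
  have "xs = map (mulx B) ys"
    unfolding BS(3) using BS(2) mulx_mulx[OF BS(1)] by (simp add: map_idI)
  moreover have "admissible B" using BS(1) by (simp add: safe_def)
  ultimately show ?thesis unfolding game_def using BS
    by (intro exI[of _ B] exI[of _ S]) (auto simp: touches_mulx intro: mulx_Gr)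
qed

lemma game_start: "game \<epsilon> \<alpha> [] []"
proof -
  \<comment> \<open>At the start every position may be negative: the tree is empty, and the only
    position on its border is the root, of rank \<open>(\<alpha>, 0)\<close>.\<close>
  have "admissible UNIV" unfolding admissible_def by (auto simp: leaf_def)
  then have "safe {} UNIV (big \<alpha>)"
    by (auto simp: safe_def tree_def border_def big_def lt_def)
  then show ?thesis unfolding game_def by (intro exI) auto
qed

lemma game_mono:
  assumes "game \<epsilon> \<beta> xs ys" "Ord \<beta>" "\<gamma> \<in> elts \<beta>"
  shows "game \<epsilon> \<gamma> xs ys"
proof -
  have "big \<beta> i \<Longrightarrow> big \<gamma> i" for i using Ord_trans[OF assms(2,3)] by (simp add: big_def)
  then show ?thesis using assms(1) unfolding game_def safe_def by blast
qed

lemma game_embedding: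
  assumes "game \<epsilon> \<beta> xs ys"
  shows "\<exists>\<theta>. (\<forall>x\<in>Gr \<epsilon>. \<theta> x \<in> Gr (- \<epsilon>)) \<and> inj_on \<theta> (Gr \<epsilon>) \<and> (\<forall>x y. \<theta> (x + y) = \<theta> x + \<theta> y) \<and> ys = map \<theta> xs"
proof -
  obtain B S where "safe S B (big \<beta>)" "ys = map (mulx B) xs"
    using assms unfolding game_def by blast
  then show ?thesis
    by (intro exI[of _ "mulx B"]) (auto simp: safe_def mulx_add inj_on_def intro: mulx_Gr mulx_inj)
qed

text \<open>If \<open>q\<close> is negative, its small children are made positive and its large ones
  negative. So \<open>q\<close> can join the tree without being a leaf, and the negative positions
  on the new border still have rank above \<open>(\<gamma>, k)\<close>. Signs change only strictly
  below \<open>q\<close>, which vectors living on \<open>S\<close> do not see.\<close>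

lemma border_step:
  assumes s: "safe S B (lt (\<gamma>, Suc k))" and q: "q \<in> border S" and \<gamma>: "Ord \<gamma>"
  shows "\<exists>B'. safe (insert q S) B' (lt (\<gamma>, k)) \<and> (\<forall>p. p = [] \<or> tl p \<in> S \<or> p \<in> S \<longrightarrow> (p \<in> B' \<longleftrightarrow> p \<in> B))"
proof -
  have adm: "admissible B" and tr: "tree S" and nl: "\<And>p. p \<in> S \<Longrightarrow> p \<in> B \<Longrightarrow> \<not> leaf p"
    and high: "\<And>q. q \<in> border S \<Longrightarrow> q \<in> B \<Longrightarrow> lt (\<gamma>, Suc k) (rk q)"
    using s by (auto simp: safe_def)
  have qP: "q \<in> Pos" and qS: "q \<notin> S" and qt: "q = [] \<or> tl q \<in> S" using q by (auto simp: border_def)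
  define ext where "ext p \<longleftrightarrow> (\<exists>r i. p = r @ i # q)" for p
  define child where "child p = (THE i. \<exists>r. p = r @ i # q)" for p
  have child: "child (r @ i # q) = i" for r i
    unfolding child_def by (rule the_equality) auto
  \<comment> \<open>All positions above a child \<open>i # q\<close> in the list order of extensions
    follow that child; if \<open>q\<close> is positive, all of them become positive.\<close>
  define B' where "B' = {p. if ext p then q \<in> B \<and> \<not> lt (child p) (\<gamma>, Suc k) else p \<in> B}"
  have notext: "\<not> ext q" "\<not> ext []" unfolding ext_def by auto
  have extS: "ext p \<Longrightarrow> p \<notin> S" for p
  proof
    assume "ext p" "p \<in> S"
    then obtain r i where "r @ i # q \<in> S" unfolding ext_def by blast
    then have "q \<in> S" by (induction r) (use tr in \<open>force simp: tree_def\<close>)+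
    then show False using qS by simp
  qed
  have agree: "p \<in> B' \<longleftrightarrow> p \<in> B" if "p = [] \<or> tl p \<in> S \<or> p \<in> S" for p
  proof -
    have "\<not> ext p"
    proof
      assume e: "ext p"
      then obtain r i where p: "p = r @ i # q" unfolding ext_def by blast
      have "tl p = q \<or> ext (tl p)" unfolding p by (cases r) (auto simp: ext_def)
      then have "tl p \<notin> S" using qS extS by auto
      then show False using that extS[OF e] p by auto
    qed
    then show ?thesis by (simp add: B'_def)
  qed
  have B'q: "q \<in> B' \<longleftrightarrow> q \<in> B" using notext by (simp add: B'_def)
  have B'c: "i # q \<in> B' \<longleftrightarrow> q \<in> B \<and> \<not> lt i (\<gamma>, Suc k)" for i
    using child[of "[]" i] by (auto simp: B'_def ext_def)
  have adm': "admissible B'" unfolding admissible_def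
  proof (intro conjI ballI impI)
    show "[] \<in> B'" using adm notext by (simp add: B'_def admissible_def)
    fix p assume p: "p \<in> Pos" "\<not> leaf p"
    show "\<exists>b. lt b (rk p) \<and> (\<forall>i. lt i (rk p) \<and> \<not> lt i b \<longrightarrow> (i # p \<in> B' \<longleftrightarrow> p \<in> B'))"
    proof (cases "p = q")
      case True
      show ?thesis
      proof (cases "q \<in> B")
        case T: True
        \<comment> \<open>The threshold for the children is itself an index below the rank of
          \<open>q\<close>, because negative positions on the border have rank above it.\<close>
        show ?thesis using high[OF q T] T True B'q B'c by (intro exI[of _ "(\<gamma>, Suc k)"]) auto
      next
        case False
        then show ?thesis using p(2) True B'q B'c by (auto simp: leaf_def simp del: split_paired_Ex)
      qed
    next
      case pq: False
      show ?thesis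
      proof (cases "ext p")
        case True
        then obtain r j where r: "p = r @ j # q" unfolding ext_def by blast
        have "i # p \<in> B' \<longleftrightarrow> p \<in> B'" for i
          using child[of r j] child[of "i # r" j] True by (auto simp: B'_def r ext_def)
        then show ?thesis using p(2) by (auto simp: leaf_def simp del: split_paired_Ex)
      next
        case False
        have "\<not> ext (i # p)" for i
        proof
          assume "ext (i # p)"
          then obtain r j where "i # p = r @ j # q" unfolding ext_def by blast
          then show False using pq False by (cases r) (auto simp: ext_def)
        qed
        then show ?thesis using adm p False unfolding admissible_def B'_def by simp
      qed
    qed
  qed
  have tr': "tree (insert q S)" using tr qP qt by (auto simp: tree_def)
  have nl': "\<not> leaf p" if p: "p \<in> insert q S" "p \<in> B'" for p
  proof (cases "p = q")
    case True
    then show ?thesis using high[OF q] p B'q by (auto simp: leaf_def)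
  next
    case False
    then show ?thesis using nl agree[of p] p by auto
  qed
  have high': "lt (\<gamma>, k) (rk q')" if q': "q' \<in> border (insert q S)" "q' \<in> B'" for q'
  proof -
    have P: "q' \<in> Pos" "q' \<notin> S" "q' \<noteq> q" "q' = [] \<or> tl q' \<in> insert q S" using q'(1) by (auto simp: border_def)
    have lk: "lt (\<gamma>, k) (\<gamma>, Suc k)" by (simp add: lt_def)
    show ?thesis
    proof (cases "q' = [] \<or> tl q' \<in> S")
      case True
      then have "q' \<in> border S" "q' \<in> B" using P agree[of q'] q'(2) by (auto simp: border_def)
      then show ?thesis using lt_trans[OF lk high Ord_rk[OF P(1)]] by blast
    next
      case False
      then have "tl q' = q" "q' \<noteq> []" using P by auto
      then obtain i where i: "q' = i # q" by (cases q') auto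
      then have "\<not> lt i (\<gamma>, Suc k)" using q'(2) B'c by blast
      moreover have "Ord (fst i)" using Ord_rk[OF P(1)] by (simp add: i)
      ultimately have "i = (\<gamma>, Suc k) \<or> lt (\<gamma>, Suc k) i" using lt_linear[of i "(\<gamma>, Suc k)"] \<gamma> by auto
      then show ?thesis using lk lt_trans[OF lk] \<open>Ord (fst i)\<close> unfolding i rk_simps by blast
    qed
  qed
  show ?thesis
    using adm' tr' nl' high' agree unfolding safe_def by (intro exI[of _ B']) blast
qed

text \<open>Each new position lowers the second component of the reserve by one, so
  \<open>card (T - S)\<close> steps are paid for in advance.\<close>

lemma border_steps:
  assumes \<gamma>: "Ord \<gamma>" and T: "tree T"
  shows "S \<subseteq> T \<Longrightarrow> safe S B (lt (\<gamma>, card (T - S))) \<Longrightarrow>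
    \<exists>B'. safe T B' (lt (\<gamma>, 0)) \<and> (\<forall>p. tl p \<in> S \<or> p \<in> S \<longrightarrow> (p \<in> B' \<longleftrightarrow> p \<in> B))"
proof (induction "card (T - S)" arbitrary: S B)
  case 0
  then have "T = S" using T by (auto simp: tree_def)
  then show ?case using 0 by (intro exI[of _ B]) auto
next
  case (Suc n)
  then have ne: "T - S \<noteq> {}" by (metis card.empty nat.distinct(1))
  \<comment> \<open>A shortest missing position has its parent in the tree already, so it lies on
    the border.\<close>
  define q where "q = arg_min length (\<lambda>q. q \<in> T - S)"
  have q: "q \<in> T - S" "\<And>p. p \<in> T - S \<Longrightarrow> length q \<le> length p"
    unfolding q_def using arg_min_nat_lemma[of "\<lambda>q. q \<in> T - S" _ length] ne by blast+
  have "q = [] \<or> tl q \<in> S"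
  proof (cases q)
    case (Cons i p)
    then have "p \<in> T" using q(1) T unfolding tree_def by force
    then show ?thesis using q(2)[of p] Cons by (cases "p \<in> S") auto
  qed simp
  then have qb: "q \<in> border S" using q(1) T by (auto simp: border_def tree_def)
  have "safe S B (lt (\<gamma>, Suc n))" using Suc by simp
  from border_step[OF this qb \<gamma>] obtain B1 where B1: "safe (insert q S) B1 (lt (\<gamma>, n))"
    "\<And>p. tl p \<in> S \<or> p \<in> S \<Longrightarrow> p \<in> B1 \<longleftrightarrow> p \<in> B" by blast
  have "T - insert q S = (T - S) - {q}" by blast
  then have c: "card (T - insert q S) = n" using Suc(2) q(1) T by (simp add: tree_def)
  then have "\<exists>B'. safe T B' (lt (\<gamma>, 0)) \<and> (\<forall>p. tl p \<in> insert q S \<or> p \<in> insert q S \<longrightarrow> (p \<in> B' \<longleftrightarrow> p \<in> B1))"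
    using Suc(1)[of "insert q S" B1] B1(1) Suc(3) q(1) by simp
  then show ?case using B1(2) by blast
qed

lemma finite_tree:
  assumes "finite T" "T \<subseteq> Pos"
  shows "\<exists>T'. T \<subseteq> T' \<and> tree T'"
proof -
  define T' where "T' = (\<Union>p\<in>T. (\<lambda>n. drop n p) ` {..length p})"
  have "p \<in> T'" if "p \<in> T" for p using that by (force simp: T'_def intro!: bexI[of _ p] image_eqI[of _ _ 0])
  moreover have "finite T'" using assms by (simp add: T'_def)
  moreover have "T' \<subseteq> Pos" using assms unfolding T'_def Pos_def by (auto dest: in_set_dropD)
  moreover have "p \<in> T'" if ip: "i # p \<in> T'" for i p
  proof -
    obtain t n where t: "t \<in> T" "n \<le> length t" "i # p = drop n t" using ip by (auto simp: T'_def)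
    have "p = drop (Suc n) t" using t(3) by (metis drop_Suc drop_tl list.sel(3))
    moreover have "Suc n \<le> length t" using t(3) by (metis drop_all list.distinct(1) not_less_eq_eq)
    ultimately show ?thesis using t(1) unfolding T'_def by blast
  qed
  then have "\<forall>p\<in>T'. p \<noteq> [] \<longrightarrow> tl p \<in> T'" by (metis list.collapse)
  ultimately show ?thesis unfolding tree_def by blast
qed

lemma touches_finite:
  assumes "x \<in> V"
  shows "\<exists>T. finite T \<and> T \<subseteq> Pos \<and> touches x T"
proof -
  let ?N = "{\<eta>. x \<eta> \<noteq> 0}"
  define Q where "Q \<eta> S \<longleftrightarrow> finite S \<and> S \<subseteq> Pos \<and> (\<forall>\<xi>. x \<eta> \<xi> \<noteq> 0 \<longrightarrow> \<xi> = Inf \<or> (\<exists>p\<in>S. \<xi> \<in> dom p))" for \<eta> S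
  have xU: "x \<eta> \<in> U" for \<eta> using assms by (simp add: V_def)
  have "\<exists>S. Q \<eta> S" for \<eta> using xU[of \<eta>] unfolding U_def Q_def by simp
  then obtain S where "\<And>\<eta>. Q \<eta> (S \<eta>)" by metis
  then have S: "finite (S \<eta>)" "S \<eta> \<subseteq> Pos" "x \<eta> \<xi> \<noteq> 0 \<Longrightarrow> \<xi> = Inf \<or> (\<exists>p\<in>S \<eta>. \<xi> \<in> dom p)" for \<eta> \<xi>
    unfolding Q_def by simp_all
  have "\<xi> = Inf \<or> (\<exists>p\<in>\<Union>\<eta>\<in>?N. S \<eta>. \<xi> \<in> dom p)" if "x \<eta> \<xi> \<noteq> 0" for \<eta> \<xi>
  proof -
    have "\<eta> \<in> ?N" using that by auto
    then show ?thesis using S(3)[OF that] by auto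
  qed
  then have "touches x (\<Union>\<eta>\<in>?N. S \<eta>)" unfolding touches_def by simp
  moreover have "finite (\<Union>\<eta>\<in>?N. S \<eta>)" using assms S(1) by (simp add: V_def)
  ultimately show ?thesis using S(2) by blast
qed

text \<open>The factor at \<open>Up p i\<close> is that of the child \<open>i # p\<close>, so
  agreement is needed at \<open>S\<close> and at the children of positions in
  \<open>S\<close>.\<close>

lemma mulx_agree:
  assumes "touches x S" "\<And>p. tl p \<in> S \<or> p \<in> S \<Longrightarrow> p \<in> B' \<longleftrightarrow> p \<in> B"
  shows "mulx B' x = mulx B x"
proof (intro ext)
  fix \<eta> \<xi>
  have "sg B' \<xi> = sg B \<xi>" if "x \<eta> \<xi> \<noteq> 0"
  proof -
    have "\<xi> = Inf \<or> (\<exists>p\<in>S. \<xi> \<in> dom p)" using assms(1) that unfolding touches_def by blast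
    then show ?thesis using assms(2) by (cases \<xi>) (auto simp: sg_def)
  qed
  then show "mulx B' x \<eta> \<xi> = mulx B x \<eta> \<xi>" by (cases "x \<eta> \<xi> = 0") (simp_all add: mulx_def)
qed

text \<open>The tree is enlarged to contain all positions used by \<open>x\<close>, the signs are
  moved out of the way, and \<open>x\<close> is answered by its product with the new
  factors.\<close>

lemma game_forth:
  assumes g: "game \<epsilon> \<beta> xs ys" and \<beta>: "elts \<beta> = insert \<gamma> (elts \<gamma>)" "Ord \<beta>" and x: "x \<in> Gr \<epsilon>"
  shows "\<exists>y\<in>Gr (- \<epsilon>). game \<epsilon> \<gamma> (xs @ [x]) (ys @ [y])"
proof -
  have \<gamma>: "Ord \<gamma>" using Ord_mem[OF \<beta>(2), of \<gamma>] \<beta>(1) by simp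
  obtain B S where BS: "safe S B (big \<beta>)" "\<And>x. x \<in> set xs \<Longrightarrow> x \<in> Gr \<epsilon> \<and> touches x S" "ys = map (mulx B) xs"
    using g unfolding game_def by blast
  obtain T0 where T0: "finite T0" "T0 \<subseteq> Pos" "touches x T0" using touches_finite[OF Gr_V[OF x]] by blast
  have f: "finite (S \<union> T0)" "S \<union> T0 \<subseteq> Pos" using T0 BS(1) by (auto simp: safe_def tree_def)
  obtain T where T: "S \<union> T0 \<subseteq> T" "tree T" using finite_tree[OF f] by blast
  \<comment> \<open>The step from \<gamma> to its successor \<beta> buys any finite number of new
    positions, whatever the size of \<open>T\<close>.\<close>
  have "big \<beta> i \<Longrightarrow> lt (\<gamma>, k) i" for i k by (simp add: big_def \<beta>(1))
  then have "safe S B (lt (\<gamma>, card (T - S)))" using BS(1) unfolding safe_def by blast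
  from border_steps[OF \<gamma> T(2) _ this] T(1) obtain B' where B': "safe T B' (lt (\<gamma>, 0))"
    "\<And>p. tl p \<in> S \<or> p \<in> S \<Longrightarrow> p \<in> B' \<longleftrightarrow> p \<in> B" by blast
  \<comment> \<open>When the second component is used up, exactly the reserve required for \<gamma>
    remains.\<close>
  have "big \<gamma> (rk q)" if "lt (\<gamma>, 0) (rk q)" "q \<in> Pos" for q
    unfolding big_def
  proof (intro ballI allI)
    fix \<gamma>' k assume "\<gamma>' \<in> elts \<gamma>"
    then have "lt (\<gamma>', k) (\<gamma>, 0)" by (simp add: lt_def)
    then show "lt (\<gamma>', k) (rk q)" using that(1) Ord_rk[OF that(2)] by (rule lt_trans)
  qed
  then have s: "safe T B' (big \<gamma>)" using B'(1) unfolding safe_def border_def by blast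
  have mono: "touches z S' \<Longrightarrow> S' \<subseteq> T \<Longrightarrow> touches z T" for z S' unfolding touches_def by blast
  have "mulx B' z = mulx B z" if "z \<in> set xs" for z using mulx_agree[OF _ B'(2)] BS(2)[OF that] by blast
  then have ys: "ys = map (mulx B') xs" unfolding BS(3) by simp
  have "z \<in> Gr \<epsilon> \<and> touches z T" if "z \<in> set (xs @ [x])" for z
    using that BS(2)[of z] x mono[of z S] mono[of z T0] T0(3) T(1) by auto
  then have "game \<epsilon> \<gamma> (xs @ [x]) (ys @ [mulx B' x])"
    unfolding game_def ys using s by (intro exI[of _ B'] exI[of _ T] conjI ballI) simp_all
  moreover have "mulx B' x \<in> Gr (- \<epsilon>)" using mulx_Gr x s by (simp add: safe_def)
  ultimately show ?thesis by blast
qed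

lemma game_back:
  assumes g: "game \<epsilon> \<beta> xs ys" and \<beta>: "elts \<beta> = insert \<gamma> (elts \<gamma>)" "Ord \<beta>" and y: "y \<in> Gr (- \<epsilon>)"
  shows "\<exists>x\<in>Gr \<epsilon>. game \<epsilon> \<gamma> (xs @ [x]) (ys @ [y])"
  using game_forth[OF game_sym[OF g] \<beta> y] game_sym[of "- \<epsilon>"] by (metis minus_minus)

end

subsection \<open>No back-and-forth system\<close>

lemma bf_systemD:
  assumes E: "bf_system G H E" and D: "D \<in> E"
  shows "D \<subseteq> G \<times> H" "(x, b) \<in> D \<Longrightarrow> (y, c) \<in> D \<Longrightarrow> (x - y, b - c) \<in> D" "(0, b) \<in> D \<Longrightarrow> b = 0" "(x, 0) \<in> D \<Longrightarrow> x = 0"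
    "x \<in> G \<Longrightarrow> \<exists>D'\<in>E. D \<subseteq> D' \<and> (\<exists>b. (x, b) \<in> D')" "b \<in> H \<Longrightarrow> \<exists>D'\<in>E. D \<subseteq> D' \<and> (\<exists>x. (x, b) \<in> D')"
proof -
  note d = bspec[OF conjunct2[OF E[unfolded bf_system_def]] D]
  note d1 = d[THEN conjunct2] note d2 = d1[THEN conjunct2] note d3 = d2[THEN conjunct2] note d4 = d3[THEN conjunct2]
  show "D \<subseteq> G \<times> H" "(x, b) \<in> D \<Longrightarrow> (y, c) \<in> D \<Longrightarrow> (x - y, b - c) \<in> D" "(0, b) \<in> D \<Longrightarrow> b = 0" "(x, 0) \<in> D \<Longrightarrow> x = 0"
    "x \<in> G \<Longrightarrow> \<exists>D'\<in>E. D \<subseteq> D' \<and> (\<exists>b. (x, b) \<in> D')" "b \<in> H \<Longrightarrow> \<exists>D'\<in>E. D \<subseteq> D' \<and> (\<exists>x. (x, b) \<in> D')"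
    by (rule d[THEN conjunct1], rule d1[THEN conjunct1, rule_format], assumption+, rule d2[THEN conjunct1, rule_format], assumption,
      rule d3[THEN conjunct1, rule_format], assumption, rule d4[THEN conjunct1, rule_format], assumption,
      rule d4[THEN conjunct2, rule_format], assumption)
qed

lemma bf_system_converse:
  assumes E: "bf_system G H E"
  shows "bf_system H G (converse ` E)"
  unfolding bf_system_def
proof (intro conjI ballI allI impI)
  show "converse ` E \<noteq> {}" using E unfolding bf_system_def by simp
next
  fix D assume "D \<in> converse ` E"
  then obtain D0 where D: "D0 \<in> E" "D = converse D0" by blast
  note d = bf_systemD[OF E D(1)]
  show "D \<subseteq> H \<times> G" using d(1) D(2) by blast
  show "(x - y, b - c) \<in> D" if "(x, b) \<in> D" "(y, c) \<in> D" for x b y c using d(2) D(2) that by simp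
  show "b = 0" if "(0, b) \<in> D" for b using d(4) D(2) that by simp
  show "x = 0" if "(x, 0) \<in> D" for x using d(3) D(2) that by simp
  show "\<exists>D'\<in>converse ` E. D \<subseteq> D' \<and> (\<exists>b. (x, b) \<in> D')" if "x \<in> H" for x
    using d(6)[OF that] D(2) by auto
  show "\<exists>D'\<in>converse ` E. D \<subseteq> D' \<and> (\<exists>x. (x, b) \<in> D')" if "b \<in> G" for b
    using d(5)[OF that] D(2) by auto
qed

lemma bf_system_linear:
  fixes G H :: "('a \<Rightarrow> 'b \<Rightarrow> rat) set"
  assumes E: "bf_system G H E" "D \<in> E" and m: "(x, b) \<in> D" "(y, c) \<in> D"
  shows "(scale (of_int k) x + scale (of_int l) y, scale (of_int k) b + scale (of_int l) c) \<in> D"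
proof -
  have diff: "(x - y, b - c) \<in> D" if "(x, b) \<in> D" "(y, c) \<in> D" for x y b c using bf_systemD(2)[OF E] that by blast
  have zero: "(0, 0) \<in> D" using diff[OF m(1,1)] by simp
  have neg: "(- x, - b) \<in> D" if "(x, b) \<in> D" for x b using diff[OF zero that] by simp
  have plus: "(x + y, b + c) \<in> D" if "(x, b) \<in> D" "(y, c) \<in> D" for x y b c using diff[OF that(1) neg[OF that(2)]] by simp
  have nat: "(scale (of_nat n) x, scale (of_nat n) b) \<in> D" if "(x, b) \<in> D" for n x b
  proof (induction n)
    case 0
    then show ?case using zero by (simp add: scale_def zero_fun_def)
  next
    case (Suc n)
    have e: "scale (of_nat (Suc n)) z = scale (of_nat n) z + z" for z :: "'a \<Rightarrow> 'b \<Rightarrow> rat"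
      by (auto simp: scale_def fun_eq_iff algebra_simps)
    show ?case unfolding e by (rule plus[OF Suc that])
  qed
  have int: "(scale (of_int k) x, scale (of_int k) b) \<in> D" if "(x, b) \<in> D" for k x b
  proof (cases "k \<ge> 0")
    case True
    then have e: "(of_int k :: rat) = of_nat (nat k)" by simp
    show ?thesis unfolding e by (rule nat[OF that])
  next
    case False
    then have e: "of_int k = - (of_nat (nat (- k)) :: rat)" by simp
    have e': "scale (- c) z = - scale c z" for c and z :: "'a \<Rightarrow> 'b \<Rightarrow> rat" by (auto simp: scale_def fun_eq_iff)
    show ?thesis unfolding e e' by (rule neg[OF nat[OF that]])
  qed
  show ?thesis by (rule plus[OF int[OF m(1)] int[OF m(2)]])
qed

context group_data
begin

text \<open>The kernels of the functionals are the infinitely divisible elements, hence preserved.\<close>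

lemma bf_kernel:
  assumes E: "bf_system (Gr \<epsilon>) (Gr \<epsilon>') E" "D \<in> E" and m: "(x, b) \<in> D"
    and ker: "\<And>\<phi>. \<phi> \<in> Phi \<epsilon> i \<Longrightarrow> \<phi> x = 0" and \<phi>: "\<phi> \<in> Phi \<epsilon>' i"
  shows "\<phi> b = 0"
proof (rule Gr_divisible[OF _ \<phi>])
  fix n
  let ?c = "of_nat (prime_at i) ^ n :: rat"
  have c0: "?c \<noteq> 0" using prime_gt_0_nat[OF prime_prime_at[of i]] by simp
  have ci: "?c = of_int (int (prime_at i) ^ n)" by simp
  have xG: "x \<in> Gr \<epsilon>" using bf_systemD(1)[OF E] m by blast
  have "scale (1 / ?c) x \<in> Gr \<epsilon>" 
  proof (rule Gr_divide[OF xG])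
    fix \<psi> assume "\<psi> \<in> Phi \<epsilon> i"
    then show "\<psi> x = 0" by (rule ker)
  qed
  then obtain D' d where D': "D' \<in> E" "D \<subseteq> D'" "(scale (1 / ?c) x, d) \<in> D'" using bf_systemD(5)[OF E] by blast
  \<comment> \<open>The quotient of \<open>x\<close> has a partner \<open>d\<close> in a larger
    subgroup. The multiple of the quotient minus \<open>x\<close> is 0, hence so is the multiple of
    \<open>d\<close> minus \<open>b\<close>, and \<open>d\<close> is the quotient of
    \<open>b\<close>.\<close>
  have "(scale (of_int (int (prime_at i) ^ n)) (scale (1 / ?c) x) + scale (of_int (- 1)) x,
      scale (of_int (int (prime_at i) ^ n)) d + scale (of_int (- 1)) b) \<in> D'"
    using D' m by (intro bf_system_linear[OF E(1)]) auto
  moreover have "scale (of_int (int (prime_at i) ^ n)) (scale (1 / ?c) x) + scale (of_int (- 1)) x = 0"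
    using c0 by (auto simp: scale_def fun_eq_iff)
  ultimately have z: "scale ?c d + scale (- 1) b = 0" using bf_systemD(3)[OF E(1) D'(1)] by simp
  have "scale (1 / ?c) b = d"
  proof (intro ext)
    fix \<eta> \<xi>
    have "(scale ?c d + scale (- 1) b) \<eta> \<xi> = 0" using z by simp
    then show "scale (1 / ?c) b \<eta> \<xi> = d \<eta> \<xi>" using c0 by (simp add: scale_def field_simps)
  qed
  then show "scale (1 / ?c) b \<in> Gr \<epsilon>'" using bf_systemD(1)[OF E(1) D'(1)] D'(3) by auto
qed

lemma single_kernel_colour: "\<phi> \<in> Phi \<epsilon> (length \<eta>, Suc (col \<eta>)) \<Longrightarrow> \<phi> (single \<eta> u) = 0"
  by (auto simp: single_def)

text \<open>At \<open>\<eta>\<close> the entry of the second summand cancels against the entry of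
  the first, which \<open>push\<close> brings down from the child.\<close>

lemma single_kernel_level: "\<phi> \<in> Phi \<epsilon> (Suc (length \<eta>), 0) \<Longrightarrow> \<eta> \<noteq> [] \<Longrightarrow> \<phi> (scale 1 (single (\<eta> @ [m]) u) + scale (- 1) (single \<eta> u)) = 0"
proof -
  assume \<phi>: "\<phi> \<in> Phi \<epsilon> (Suc (length \<eta>), 0)" "\<eta> \<noteq> []"
  have p: "push (single (\<eta> @ [m]) u - single \<eta> u) v \<xi> = (if v = \<eta> then u \<xi> else 0)" if l: "length v = length \<eta>" for v \<xi>
  proof -
    have "v @ [n] \<noteq> \<eta>" for n using l by auto
    then have "(single (\<eta> @ [m]) u - single \<eta> u) (v @ [n]) = single (\<eta> @ [m]) u (v @ [n])" for n
      by (simp add: single_def)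
    then have "push (single (\<eta> @ [m]) u - single \<eta> u) v \<xi> = push (single (\<eta> @ [m]) u) v \<xi>"
      unfolding push_def by simp
    then show ?thesis by (simp add: push_single)
  qed
  show ?thesis unfolding scale_add using \<phi> by (auto simp: p) (auto simp: single_def)
qed

definition integral :: "('v pt \<Rightarrow> rat) \<Rightarrow> bool" where
  "integral u \<longleftrightarrow> u \<in> U \<and> (\<forall>\<xi>. u \<xi> \<in> \<int>)"

text \<open>If the image had support at another list \<open>[n]\<close>, repeated extension would
  produce a sequence starting with \<open>m\<close>, \<open>n\<close> that has at every length the
  same colour as its shift, which \<open>col\<close> excludes. Integrality of \<open>u\<close> puts
  its copies at all lists into the group.\<close>

lemma bf_single:
  assumes E: "bf_system (Gr \<epsilon>) (Gr \<epsilon>') E" "D \<in> E" and \<epsilon>: "\<epsilon> \<in> \<int>"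
    and col: "\<And>m. (\<forall>i. m i \<in> elts \<kappa>) \<Longrightarrow> m 0 \<noteq> m (1::nat) \<Longrightarrow>
      \<exists>k. col (map m [0..<Suc k]) \<noteq> col (map (\<lambda>i. m (Suc i)) [0..<Suc k])"
    and u: "integral u" and m: "m \<in> elts \<kappa>" and b: "(single [m] u, b) \<in> D"
  shows "\<exists>u'\<in>U. b = single [m] u'"
proof -
  have bV: "b \<in> V" using bf_systemD(1)[OF E] b Gr_V by blast
  \<comment> \<open>One list \<open>s\<close> records both sides: the source sits at
    \<open>butlast s\<close>, and the image has support at \<open>tl s\<close>.\<close>
  define Q where "Q s \<longleftrightarrow> length s \<ge> 2 \<and> set s \<subseteq> elts \<kappa> \<and> (\<exists>D\<in>E. \<exists>b. (single (butlast s) u, b) \<in> D \<and> b (tl s) \<noteq> 0)" for s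
  have supp: "length \<eta>' = length \<eta> \<and> col \<eta>' = col \<eta>"
    if "D \<in> E" "(single \<eta> u, b) \<in> D" "b \<eta>' \<noteq> 0" for D \<eta> b \<eta>'
  proof (rule ccontr)
    assume n: "\<not> ?thesis"
    have "(\<lambda>x. x \<eta>' \<xi>) b = 0" for \<xi>
    proof (rule bf_kernel[OF E(1) that(1,2), of "(length \<eta>, Suc (col \<eta>))" "\<lambda>x. x \<eta>' \<xi>"])
      show "(\<lambda>x. x \<eta>' \<xi>) \<in> Phi \<epsilon>' (length \<eta>, Suc (col \<eta>))" using n unfolding Phi.simps by blast
    qed (rule single_kernel_colour)
    then show False using that(3) by (auto simp: fun_eq_iff)
  qed
  have Qcol: "col (butlast s) = col (tl s)" if Q: "Q s" for s
  proof -
    obtain D b where D: "D \<in> E" "(single (butlast s) u, b) \<in> D" "b (tl s) \<noteq> 0" using Q unfolding Q_def by (elim conjE bexE exE) (rule that)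
    show ?thesis using supp[OF D] by simp
  qed
  have step: "\<exists>n\<in>elts \<kappa>. Q (s @ [n])" if Q: "Q s" for s
  proof -
    obtain D b where D: "D \<in> E" "(single (butlast s) u, b) \<in> D" "b (tl s) \<noteq> 0" and s: "length s \<ge> 2" "set s \<subseteq> elts \<kappa>"
      using Q unfolding Q_def by (elim conjE bexE exE) (rule that)
    have bls: "butlast s \<noteq> []" "butlast s @ [last s] = s" "s \<noteq> []" "tl s \<noteq> []" using s(1) by (cases s; auto)+
    have sG: "single s u \<in> Gr \<epsilon>" using u s bls \<epsilon> by (intro single_Gr) (auto simp: integral_def)
    obtain D' c where D': "D' \<in> E" "D \<subseteq> D'" "(single s u, c) \<in> D'" using bf_systemD(5)[OF E(1) D(1) sG] by blast
    have cV: "c \<in> V" using bf_systemD(1)[OF E(1) D'(1)] D'(3) Gr_V by blast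
    have bV: "b \<in> V" using bf_systemD(1)[OF E(1) D(1)] D(2) Gr_V by blast
    \<comment> \<open>The vector at \<open>butlast s\<close> and its copy at \<open>s\<close> differ
      by an element of a level kernel, so the difference of the images satisfies the same
      equations.\<close>
    have d: "(scale 1 (single s u) + scale (- 1) (single (butlast s) u), scale 1 c + scale (- 1) b) \<in> D'"
      using bf_system_linear[OF E(1) D'(1) D'(3), of "single (butlast s) u" b 1 "- 1"] D(2) D'(2) by auto
    have tls: "length (tl s) = length (butlast s)" by simp
    obtain \<xi> where \<xi>: "b (tl s) \<xi> \<noteq> 0" using D(3) by (auto simp: fun_eq_iff)
    let ?\<phi> = "\<lambda>x. x (tl s) \<xi> + push x (tl s) \<xi>"
    have "?\<phi> (scale 1 c + scale (- 1) b) = 0"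
    proof (rule bf_kernel[OF E(1) D'(1) d, of "(Suc (length (butlast s)), 0)" ?\<phi>])
      fix \<phi> assume "\<phi> \<in> Phi \<epsilon> (Suc (length (butlast s)), 0)"
      from single_kernel_level[OF this bls(1), of "last s" u]
      show "\<phi> (scale 1 (single s u) + scale (- 1) (single (butlast s) u)) = 0" unfolding bls(2) .
    qed (use tls in \<open>unfold Phi.simps, blast\<close>)
    then have "c (tl s) \<xi> - b (tl s) \<xi> + (push c (tl s) \<xi> - push b (tl s) \<xi>) = 0"
      using push_linear[OF cV bV, of 1 "- 1"] by (simp add: scale_def)
    \<comment> \<open>The images \<open>c\<close> and \<open>b\<close> live on different levels, so
      the equation at \<open>tl s\<close> balances the nonzero value of \<open>b\<close> there
      against the values of \<open>c\<close> at extensions of \<open>tl s\<close>.\<close>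
    moreover have "c (tl s) = 0" using supp[OF D'(1,3), of "tl s"] s(1) by fastforce
    moreover have "b (tl s @ [n]) = 0" for n using supp[OF D(1,2), of "tl s @ [n]"] tls by fastforce
    then have "push b (tl s) \<xi> = 0" unfolding push_def by simp
    ultimately have "push c (tl s) \<xi> \<noteq> 0" using \<xi> by simp
    then have "{n. c (tl s @ [n]) \<noteq> 0} \<noteq> {}" unfolding push_def by (metis sum.empty)
    then obtain n where n: "c (tl s @ [n]) \<noteq> 0" by blast
    have "n \<in> elts \<kappa>" using n cV by (auto simp: V_def)
    moreover have "Q (s @ [n])" unfolding Q_def using D' n s bls \<open>n \<in> elts \<kappa>\<close> by auto
    ultimately show ?thesis by blast
  qed
  have noQ: "\<not> Q [m, n]" if mn: "n \<noteq> m" for n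
  proof
    assume Q0: "Q [m, n]"
    define nx where "nx s = (SOME n. n \<in> elts \<kappa> \<and> Q (s @ [n]))" for s
    define S where "S k = ((\<lambda>s. s @ [nx s]) ^^ k) [m, n]" for k
    have nx: "nx s \<in> elts \<kappa> \<and> Q (s @ [nx s])" if Q: "Q s" for s
      unfolding nx_def by (rule someI_ex) (use step[OF Q] in \<open>simp only: Bex_def\<close>)
    have S0: "S 0 = [m, n]" and SSuc: "S (Suc k) = S k @ [nx (S k)]" for k by (simp_all add: S_def)
    have QS: "Q (S k)" for k
    proof (induction k)
      case (Suc k)
      show ?case unfolding SSuc using nx[OF Suc] by (rule conjunct2)
    qed (unfold S0, rule Q0)
    \<comment> \<open>The lists \<open>S k\<close> extend each other, so their diagonal is the
      infinite sequence of which all of them are initial segments.\<close>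
    define f where "f i = S i ! i" for i
    have len: "length (S k) = k + 2" for k by (induction k) (simp_all add: S0 SSuc)
    have ext: "i < j + 2 \<Longrightarrow> S (j + d) ! i = S j ! i" for i j d
      by (induction d) (simp_all add: SSuc nth_append len)
    have SS: "S k = map f [0..<k + 2]" for k
    proof (rule nth_equalityI)
      fix i assume "i < length (S k)"
      then have i: "i < k + 2" by (simp add: len)
      have "S k ! i = S i ! i"
      proof (cases "i \<le> k")
        case True
        then show ?thesis using ext[of i i "k - i"] by simp
      next
        case False
        then show ?thesis using ext[of i k "i - k"] i by simp
      qed
      then show "S k ! i = map f [0..<k + 2] ! i" using i by (simp add: f_def del: upt_Suc)
    qed (simp add: len)
    have "f i \<in> elts \<kappa>" for i
      using QS[of i] nth_mem[of i "S i"] len[of i] unfolding Q_def f_def by auto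
    moreover have "f 0 \<noteq> f 1"
      using mn SS[of 0] by (simp add: S0 upt_rec)
    ultimately obtain k where k: "col (map f [0..<Suc k]) \<noteq> col (map (\<lambda>i. f (Suc i)) [0..<Suc k])" using col by blast
    \<comment> \<open>Dropping the last entry of \<open>S k\<close> gives an initial segment of
      \<open>f\<close>, dropping the first the corresponding segment of its shift; \<open>Q\<close>
      makes their colours equal.\<close>
    have "[0..<k + 2] = [0..<Suc k] @ [Suc k]" by simp
    then have "butlast (S k) = map f [0..<Suc k]" unfolding SS by (simp del: upt_Suc)
    moreover have "tl (S k) = map (\<lambda>i. f (Suc i)) [0..<Suc k]"
      unfolding SS by (rule nth_equalityI) (simp_all add: nth_tl del: upt_Suc)
    ultimately show False using Qcol[OF QS[of k]] k by simp
  qed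
  have "b \<eta> = 0" if \<eta>: "\<eta> \<noteq> [m]" for \<eta>
  proof (rule ccontr)
    assume b\<eta>: "b \<eta> \<noteq> 0"
    then have "length \<eta> = 1" using supp[OF E(2) b] by fastforce
    then obtain n where n: "\<eta> = [n]" by (cases \<eta>) auto
    have "n \<in> elts \<kappa>" using b\<eta> bV by (auto simp: V_def n)
    then have "Q [m, n]" unfolding Q_def using m b E(2) b\<eta> by (auto simp: n)
    then show False using noQ \<eta> n by auto
  qed
  then have "b = single [m] (b [m])" by (auto simp: single_def fun_eq_iff)
  moreover have "b [m] \<in> U" using bV by (simp add: V_def)
  ultimately show ?thesis by blast
qed

end

section \<open>Matched vectors and the contradiction\<close>

locale rigid_group_data = group_data \<alpha> \<kappa> lab col
  for \<alpha> \<kappa> :: "'v::zfc_universe" and lab :: "'v fnl \<Rightarrow> 'v" and col :: "'v list \<Rightarrow> nat" +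
  assumes lab_\<kappa>: "\<And>\<phi>. \<phi> \<in> Fn \<Longrightarrow> lab \<phi> \<in> elts \<kappa>" and lab_inj: "inj_on lab Fn"
    and no_shift: "\<And>m. (\<forall>i. m i \<in> elts \<kappa>) \<Longrightarrow> m 0 \<noteq> m (1::nat) \<Longrightarrow>
      \<exists>k. col (map m [0..<Suc k]) \<noteq> col (map (\<lambda>i. m (Suc i)) [0..<Suc k])"
begin

text \<open>Only one of \<open>u\<close> and \<open>u'\<close> need be integral, so that matches can be started from either group.\<close>

definition match :: "(('v list \<Rightarrow> 'v pt \<Rightarrow> rat) \<times> ('v list \<Rightarrow> 'v pt \<Rightarrow> rat)) set \<Rightarrow> ('v pt \<Rightarrow> rat) \<Rightarrow> ('v pt \<Rightarrow> rat) \<Rightarrow> bool" where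
  "match D u u' \<longleftrightarrow> u \<in> U \<and> u' \<in> U \<and> (integral u \<or> integral u') \<and> (\<exists>m\<in>elts \<kappa>. (single [m] u, single [m] u') \<in> D)"

lemma match_mono: "match D u u' \<Longrightarrow> D \<subseteq> D' \<Longrightarrow> match D' u u'"
  unfolding match_def by blast

lemma match_converse: "match D u u' \<Longrightarrow> match (converse D) u' u"
  unfolding match_def by blast

lemma match_exists:
  assumes E: "bf_system (Gr \<epsilon>) (Gr \<epsilon>') E" "D \<in> E" and \<epsilon>: "\<epsilon> \<in> \<int>" and u: "integral u"
  shows "\<exists>D'\<in>E. \<exists>u'. D \<subseteq> D' \<and> match D' u u'"
proof -
  have m: "lab Root \<in> elts \<kappa>" using lab_\<kappa> by (simp add: Fn_def)
  then have "single [lab Root] u \<in> Gr \<epsilon>" using u \<epsilon> by (intro single_Gr) (auto simp: integral_def)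
  then obtain D' b where D': "D' \<in> E" "D \<subseteq> D'" "(single [lab Root] u, b) \<in> D'" using bf_systemD(5)[OF E] by blast
  obtain u' where "u' \<in> U" "b = single [lab Root] u'" using bf_single[OF E(1) D'(1) \<epsilon> no_shift u m D'(3)] by blast
  then show ?thesis using D' m u unfolding match_def integral_def by blast
qed

lemma match_back:
  assumes E: "bf_system (Gr \<epsilon>) (Gr \<epsilon>') E" "D \<in> E" and \<epsilon>: "\<epsilon>' \<in> \<int>" and u: "integral u'"
  shows "\<exists>D'\<in>E. \<exists>u. D \<subseteq> D' \<and> match D' u u'"
proof -
  obtain D' u where "D' \<in> E" "D\<inverse> \<subseteq> D'\<inverse>" "match (D'\<inverse>) u' u"
    using match_exists[OF bf_system_converse[OF E(1)] _ \<epsilon> u, of "converse D"] E(2) by blast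
  then show ?thesis using match_converse[of "D'\<inverse>" u' u] by auto
qed

text \<open>Copies of a vector at two lists of length 1 differ by a vector whose sum over the first
  level is 0. The images have this property too, so the partner \<open>u'\<close> does not depend on
  the list.\<close>

lemma match_spread_integral:
  assumes E: "bf_system (Gr \<epsilon>) (Gr \<epsilon>') E" "D \<in> E" and \<epsilon>: "\<epsilon> \<in> \<int>" and u: "integral u" "u' \<in> U"
    and m0: "m0 \<in> elts \<kappa>" "(single [m0] u, single [m0] u') \<in> D" and m: "m \<in> elts \<kappa>"
  shows "\<exists>D'\<in>E. D \<subseteq> D' \<and> (single [m] u, single [m] u') \<in> D'"
proof -
  have "single [m] u \<in> Gr \<epsilon>" using u \<epsilon> m by (intro single_Gr) (auto simp: integral_def)
  then obtain D' b where D': "D' \<in> E" "D \<subseteq> D'" "(single [m] u, b) \<in> D'" using bf_systemD(5)[OF E] by blast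
  obtain w where w: "w \<in> U" "b = single [m] w" using bf_single[OF E(1) D'(1) \<epsilon> no_shift u(1) m D'(3)] by blast
  have d: "(scale 1 (single [m] u) + scale (- 1) (single [m0] u), scale 1 (single [m] w) + scale (- 1) (single [m0] u')) \<in> D'"
    using bf_system_linear[OF E(1) D'(1) D'(3), of "single [m0] u" "single [m0] u'" 1 "- 1"] m0(2) D'(2) w(2) by auto
  have V: "single [m] u \<in> V" "single [m0] u \<in> V" "single [m] w \<in> V" "single [m0] u' \<in> V"
    using u w m m0 by (auto intro!: single_V simp: integral_def)
  have "w \<xi> = u' \<xi>" for \<xi>
  proof -
    have "(\<lambda>x. x [] \<xi> + push x [] \<xi>) (scale 1 (single [m] w) + scale (- 1) (single [m0] u')) = 0"
    proof (rule bf_kernel[OF E(1) D'(1) d, of "(1, 0)"])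
      fix \<phi> assume "\<phi> \<in> Phi \<epsilon> (1, 0)"
      then show "\<phi> (scale 1 (single [m] u) + scale (- 1) (single [m0] u)) = 0"
        using push_linear[OF V(1,2), of 1 "- 1"] by (auto simp: push_single) (auto simp: single_def scale_def)
    qed auto
    then show ?thesis using push_linear[OF V(3,4), of 1 "- 1"] by (simp add: push_single) (simp add: single_def scale_def)
  qed
  then have "w = u'" by auto
  then show ?thesis using D' w by blast
qed

text \<open>Needed to bring a match to the label where a given functional is recorded. If only
  \<open>u'\<close> is integral, the argument is run in the converse system.\<close>

lemma match_spread:
  assumes E: "bf_system (Gr \<epsilon>) (Gr \<epsilon>') E" "D \<in> E" and \<epsilon>: "\<epsilon> \<in> \<int>" "\<epsilon>' \<in> \<int>" and u: "match D u u'" and m: "m \<in> elts \<kappa>"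
  shows "\<exists>D'\<in>E. D \<subseteq> D' \<and> (single [m] u, single [m] u') \<in> D'"
proof -
  obtain m0 where m0: "m0 \<in> elts \<kappa>" "(single [m0] u, single [m0] u') \<in> D" using u by (auto simp: match_def)
  from u consider "integral u" | "integral u'" by (auto simp: match_def)
  then show ?thesis
  proof cases
    case 1
    then show ?thesis using match_spread_integral[OF E \<epsilon>(1) _ _ m0 m] u by (simp add: match_def)
  next
    case 2
    have "\<exists>D'\<in>converse ` E. converse D \<subseteq> D' \<and> (single [m] u', single [m] u) \<in> D'"
      using match_spread_integral[OF bf_system_converse[OF E(1)] _ \<epsilon>(2) 2 _ m0(1) _ m, of "converse D" u] E(2) u m0(2)
      by (auto simp: match_def)
    then show ?thesis by auto
  qed
qed

text \<open>At the label of \<open>\<phi>\<close> a vanishing integer combination of values becomes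
  membership in the kernel of \<open>Phi \<epsilon> (0, 0)\<close>. The image lies in the
  corresponding kernel, whose functionals are taken with \<epsilon>'.\<close>

lemma match_functional:
  assumes E: "bf_system (Gr \<epsilon>) (Gr \<epsilon>') E" "D \<in> E" and \<epsilon>: "\<epsilon> \<in> \<int>" "\<epsilon>' \<in> \<int>"
    and uv: "match D u u'" "match D v v'" and \<phi>: "\<phi> \<in> Fn"
    and z: "of_int a * fev \<epsilon> \<phi> u + of_int b * fev \<epsilon> \<phi> v = 0"
  shows "of_int a * fev \<epsilon>' \<phi> u' + of_int b * fev \<epsilon>' \<phi> v' = 0"
proof -
  have m: "lab \<phi> \<in> elts \<kappa>" by (rule lab_\<kappa>[OF \<phi>])
  obtain D1 where D1: "D1 \<in> E" "D \<subseteq> D1" "(single [lab \<phi>] u, single [lab \<phi>] u') \<in> D1"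
    using match_spread[OF E \<epsilon> uv(1) m] by blast
  obtain D2 where D2: "D2 \<in> E" "D1 \<subseteq> D2" "(single [lab \<phi>] v, single [lab \<phi>] v') \<in> D2"
    using match_spread[OF E(1) D1(1) \<epsilon> match_mono[OF uv(2) D1(2)] m] by blast
  let ?s = "\<lambda>u v. scale (of_int a) (single [lab \<phi>] u) + scale (of_int b) (single [lab \<phi>] v)"
  \<comment> \<open>Labels are distinct, so at the labels of all other functionals the combination
    vanishes.\<close>
  have s: "?s u v [lab \<psi>] = (if \<psi> = \<phi> then (\<lambda>\<xi>. of_int a * u \<xi> + of_int b * v \<xi>) else 0)" if "\<psi> \<in> Fn" for \<psi> u v
    using inj_onD[OF lab_inj _ that \<phi>] by (auto simp: scale_def single_def fun_eq_iff)
  have d: "(?s u v, ?s u' v') \<in> D2" using bf_system_linear[OF E(1) D2(1) _ D2(3)] D1(3) D2(2) by blast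
  have "(\<lambda>x. fev \<epsilon>' \<phi> (x [lab \<phi>])) (?s u' v') = 0"
  proof (rule bf_kernel[OF E(1) D2(1) d, of "(0, 0)"])
    fix \<psi> assume "\<psi> \<in> Phi \<epsilon> (0, 0)"
    then show "\<psi> (?s u v) = 0"
      using z by (auto simp: s fev_linear fev_0 simp del: plus_fun_apply) (auto simp: single_def scale_def)
  qed (use \<phi> in auto)
  then show ?thesis by (simp only: s[OF \<phi>] fev_linear if_True refl)
qed

definition one_Inf :: "'v pt \<Rightarrow> rat" where "one_Inf \<xi> = (if \<xi> = Inf then 1 else 0)"

definition one_dom :: "('v \<times> nat) list \<Rightarrow> 'v pt \<Rightarrow> rat" where "one_dom p \<xi> = (if \<xi> \<in> dom p then 1 else 0)"

lemma integral_one_Inf: "integral one_Inf"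
proof -
  have "\<exists>b. lt b (rk p)" if "\<not> leaf p" for p using that by (simp add: leaf_def)
  then show ?thesis unfolding integral_def U_def
    by (auto simp: one_Inf_def intro!: exI[of _ "{}"] exI[of _ "0 :: rat poly"])
qed

lemma integral_one_dom: "p \<in> Pos \<Longrightarrow> integral (one_dom p)"
proof -
  assume p: "p \<in> Pos"
  have 1: "\<exists>S. finite S \<and> S \<subseteq> Pos \<and> (\<forall>\<xi>. one_dom p \<xi> \<noteq> 0 \<longrightarrow> \<xi> = Inf \<or> (\<exists>p\<in>S. \<xi> \<in> dom p))"
    using p by (intro exI[of _ "{p}"]) (auto simp: one_dom_def)
  have 2: "\<exists>b. lt b (rk q) \<and> (\<forall>i. lt i (rk q) \<and> \<not> lt i b \<longrightarrow> one_dom p (Up q i) = one_dom p (Dn q))" if "\<not> leaf q" for q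
    using that by (auto simp: one_dom_def leaf_def)
  have 3: "\<exists>P. one_dom p (Dn q) = poly P 0 \<and> (\<forall>n. one_dom p (Lf q n) = poly P (of_nat n))" if "leaf q" for q
    using that by (intro exI[of _ "if q = p then 1 else 0"]) (auto simp: one_dom_def)
  show ?thesis unfolding integral_def U_def using 1 2 3 by (auto simp: one_dom_def)
qed

text \<open>The product agrees with 1 at infinitely many points, so it is the polynomial 1 and both
  factors are units.\<close>

lemma poly_product_one_const:
  fixes P Q :: "rat poly"
  assumes "\<And>n. poly P (of_nat n) * poly Q (of_nat n) = 1"
  shows "poly P x = poly P y"
proof -
  have "infinite (range (of_nat :: nat \<Rightarrow> rat))" by (rule range_inj_infinite) (simp add: inj_on_def)
  moreover have "range of_nat \<subseteq> {x. poly (P * Q - 1) x = 0}" using assms by auto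
  ultimately have "infinite {x. poly (P * Q - 1) x = 0}" using finite_subset by blast
  then have "P * Q = 1" using poly_roots_finite[of "P * Q - 1"] by fastforce
  then have "is_unit P" by (metis dvd_triv_left)
  then obtain c where "P = [:c:]" using is_unit_polyE by blast
  then show ?thesis by simp
qed

lemma U_stable:
  "u \<in> U \<Longrightarrow> p \<in> Pos \<Longrightarrow> \<not> leaf p \<Longrightarrow> \<exists>b. lt b (rk p) \<and> (\<forall>i. lt i (rk p) \<and> \<not> lt i b \<longrightarrow> u (Up p i) = u (Dn p))"
  unfolding U_def by simp

text \<open>The factor by which values are multiplied, measured at \<open>Inf\<close>, is carried to
  every position by induction on the rank: at leaves through \<open>Lf p 1\<close> and constancy of
  the polynomial, elsewhere through a large child.\<close>

lemma match_value:
  assumes E: "bf_system (Gr \<epsilon>) (Gr \<epsilon>') E" and \<epsilon>: "\<epsilon> \<in> \<int>" "\<epsilon>' \<in> \<int>"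
  shows "D \<in> E \<Longrightarrow> match D one_Inf c \<Longrightarrow> p \<in> Pos \<Longrightarrow> match D (one_dom p) v \<Longrightarrow> v (Dn p) = c Inf"
proof (induction "rk p" arbitrary: p D v rule: wf_induct_rule[OF wf_lt])
  case (1 p)
  note D = \<open>D \<in> E\<close> and c = \<open>match D one_Inf c\<close> and p = \<open>p \<in> Pos\<close> and v = \<open>match D (one_dom p) v\<close>
  have Ev: "w \<xi> = 0" if "match D' u w" "u \<xi> = 0" "\<xi> = Inf \<or> (\<exists>p\<in>Pos. \<xi> \<in> dom p)" "D' \<in> E" for D' u w \<xi>
  proof -
    have "Ev \<xi> \<in> Fn" using that(3) by (auto simp: Fn_def)
    then show ?thesis using match_functional[OF E that(4) \<epsilon> that(1,1), of "Ev \<xi>" 1 0] that(2) by (simp add: fev_def)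
  qed
  show ?case
  proof (cases "leaf p")
    case True
    obtain P where P: "v (Dn p) = poly P 0" "\<And>n. v (Lf p n) = poly P (of_nat n)"
      using v p True unfolding match_def U_def by blast
    \<comment> \<open>The vector matched with \<open>one_dom p\<close> from the other side supplies
      the inverse polynomial.\<close>
    obtain D' t where D': "D' \<in> E" "D \<subseteq> D'" "match D' t (one_dom p)"
      using match_back[OF E D \<epsilon>(2) integral_one_dom[OF p]] by blast
    obtain Q where Q: "t (Dn p) = poly Q 0" "\<And>n. t (Lf p n) = poly Q (of_nat n)"
      using D'(3) p True unfolding match_def U_def by blast
    have v': "match D' (one_dom p) v" using match_mono[OF v D'(2)] .
    have "poly P (of_nat n) * poly Q (of_nat n) = 1" for n
    proof -
      let ?\<xi> = "Lf p n"
      have F: "Ev ?\<xi> \<in> Fn" using p True by (auto simp: Fn_def)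
      \<comment> \<open>Only integer combinations are preserved, so the rational value of
        \<open>t\<close> is written as a fraction and the relation multiplied by its
        denominator.\<close>
      obtain a b where ab: "t ?\<xi> = of_int a / of_int b" "b > 0" using quotient_of_div quotient_of_denom_pos by (metis prod.collapse)
      have "of_int a * fev \<epsilon> (Ev ?\<xi>) (one_dom p) + of_int (- b) * fev \<epsilon> (Ev ?\<xi>) t = 0"
        using ab True by (simp add: fev_def one_dom_def)
      from match_functional[OF E D'(1) \<epsilon> v' D'(3) F this]
      have "of_int a * v ?\<xi> - of_int b = 0" using True by (simp add: fev_def one_dom_def)
      then have h: "of_int a * v ?\<xi> = of_int b" by simp
      have "v ?\<xi> * t ?\<xi> = of_int a * v ?\<xi> / of_int b" unfolding ab(1) by simp
      also have "\<dots> = 1" unfolding h using ab(2) by simp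
      finally have "v ?\<xi> * t ?\<xi> = 1" .
      then show ?thesis using P(2)[of n] Q(2)[of n] by simp
    qed
    then have "v (Dn p) = v (Lf p 1)" using poly_product_one_const[of P Q 0 1] P by simp
    moreover have "v (Lf p 1) = c Inf"
    proof -
      have F: "Tip p \<in> Fn" using p True by (auto simp: Fn_def)
      have "of_int 1 * fev \<epsilon> (Tip p) (one_dom p) + of_int 1 * fev \<epsilon> (Tip p) one_Inf = 0"
        using True by (simp add: fev_def one_dom_def one_Inf_def)
      from match_functional[OF E D \<epsilon> v c F this]
      have "v (Lf p 1) - v Inf + (c (Lf p 1) - c Inf) = 0" by (simp add: fev_def)
      moreover have "v Inf = 0" using Ev[OF v _ _ D] by (simp add: one_dom_def)
      moreover have "c (Lf p 1) = 0" using p True by (intro Ev[OF c _ _ D]) (auto simp: one_Inf_def)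
      ultimately show ?thesis by simp
    qed
    ultimately show ?thesis by simp
  next
    case False
    have "v \<in> U" using v by (simp add: match_def)
    \<comment> \<open>The bound itself is an index not below itself, so \<open>v\<close> already has
      its eventual value at the child \<open>b\<close>.\<close>
    from U_stable[OF this p False] obtain b where "lt b (rk p) \<and> (\<forall>i. lt i (rk p) \<and> \<not> lt i b \<longrightarrow> v (Up p i) = v (Dn p))"
      by (rule exE)
    then have b: "lt b (rk p)" "\<And>i. lt i (rk p) \<Longrightarrow> \<not> lt i b \<Longrightarrow> v (Up p i) = v (Dn p)" by simp_all
    let ?q = "b # p"
    have q: "?q \<in> Pos" by (rule Pos_child[OF p b(1)])
    obtain D' w where D': "D' \<in> E" "D \<subseteq> D'" "match D' (one_dom ?q) w"
      using match_exists[OF E D \<epsilon>(1) integral_one_dom[OF q]] by blast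
    have "w (Dn ?q) = c Inf"
      by (rule 1(1)[OF _ D'(1) match_mono[OF c D'(2)] q D'(3)]) (simp add: b(1))
    moreover have "v (Up p b) = w (Dn ?q)"
    proof -
      have F: "Lk p b \<in> Fn" using p b(1) by (auto simp: Fn_def)
      have v': "match D' (one_dom p) v" using match_mono[OF v D'(2)] .
      have "of_int 1 * fev \<epsilon> (Lk p b) (one_dom p) + of_int 1 * fev \<epsilon> (Lk p b) (one_dom ?q) = 0"
        using b(1) by (simp add: fev_def one_dom_def)
      from match_functional[OF E D'(1) \<epsilon> v' D'(3) F this]
      have "v (Up p b) - v (Dn ?q) + (w (Up p b) - w (Dn ?q)) = 0" by (simp add: fev_def)
      moreover have "v (Dn ?q) = 0" using q by (intro Ev[OF v _ _ D]) (auto simp: one_dom_def)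
      moreover have "w (Up p b) = 0" using p b(1) by (intro Ev[OF D'(3) _ _ D'(1)]) (auto simp: one_dom_def)
      ultimately show ?thesis by simp
    qed
    ultimately show ?thesis using b(2)[OF b(1) lt_irrefl] by simp
  qed
qed

lemma U_support:
  assumes u: "u \<in> U" and \<xi>: "u \<xi> \<noteq> 0"
  shows "\<xi> = Inf \<or> (\<exists>p\<in>Pos. \<xi> \<in> dom p)"
proof -
  have "\<exists>S. finite S \<and> S \<subseteq> Pos \<and> (\<forall>\<xi>. u \<xi> \<noteq> 0 \<longrightarrow> \<xi> = Inf \<or> (\<exists>p\<in>S. \<xi> \<in> dom p))" using u unfolding U_def by simp
  then obtain S where "S \<subseteq> Pos \<and> (\<forall>\<xi>. u \<xi> \<noteq> 0 \<longrightarrow> \<xi> = Inf \<or> (\<exists>p\<in>S. \<xi> \<in> dom p))" by (elim exE conjE) simp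
  then show ?thesis using \<xi> by blast
qed

text \<open>By \<open>match_value\<close> the factor at the root equals the factor
  \<open>c Inf\<close>, whereas the two versions of \<open>Root\<close> require it to be the
  negative of \<open>c Inf\<close>; so the image of \<open>one_Inf\<close> would be 0.\<close>

theorem no_bf_system: "\<not> bf_system (Gr 1) (Gr (- 1)) E"
proof
  assume E: "bf_system (Gr 1) (Gr (- 1)) E"
  have \<epsilon>: "(1::rat) \<in> \<int>" "(- 1::rat) \<in> \<int>" by simp_all
  obtain D0 where D0: "D0 \<in> E" using conjunct1[OF E[unfolded bf_system_def]] by blast
  obtain D1 c where D1: "D1 \<in> E" "match D1 one_Inf c" using match_exists[OF E D0 \<epsilon>(1) integral_one_Inf] by blast
  obtain D v where D: "D \<in> E" "D1 \<subseteq> D" "match D (one_dom []) v"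
    using match_exists[OF E D1(1) \<epsilon>(1) integral_one_dom[OF Pos_Nil]] by blast
  have c: "match D one_Inf c" using match_mono[OF D1(2) D(2)] .
  have v: "v (Dn []) = c Inf" by (rule match_value[OF E \<epsilon> D(1) c Pos_Nil D(3)])
  have Ev: "w \<xi> = 0" if "match D u w" "u \<xi> = 0" "\<xi> = Inf \<or> (\<exists>p\<in>Pos. \<xi> \<in> dom p)" for u w \<xi>
  proof -
    have "Ev \<xi> \<in> Fn" using that(3) by (auto simp: Fn_def)
    then show ?thesis using match_functional[OF E D(1) \<epsilon> that(1,1), of "Ev \<xi>" 1 0] that(2) by (simp add: fev_def)
  qed
  have F: "Root \<in> Fn" by (simp add: Fn_def)
  \<comment> \<open>The sum of the two test vectors has equal values at \<open>Inf\<close> and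
    \<open>Dn []\<close>, so the functional with sign 1 kills it, but with sign -1 their images
    contribute twice \<open>c Inf\<close>.\<close>
  have "of_int 1 * fev 1 Root one_Inf + of_int 1 * fev 1 Root (one_dom []) = 0"
    by (simp add: fev_def one_Inf_def one_dom_def)
  from match_functional[OF E D(1) \<epsilon> c D(3) F this]
  have "c Inf + c (Dn []) + (v Inf + v (Dn [])) = 0" by (simp add: fev_def)
  moreover have "c (Dn []) = 0" by (rule Ev[OF c]) (auto simp: one_Inf_def)
  moreover have "v Inf = 0" by (rule Ev[OF D(3)]) (auto simp: one_dom_def)
  ultimately have c0: "c Inf = 0" using v by simp
  \<comment> \<open>Outside \<open>Inf\<close> the vector \<open>one_Inf\<close> is 0, and
    evaluation functionals transfer this to \<open>c\<close>.\<close>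
  have "c = 0"
  proof
    fix \<xi>
    show "c \<xi> = 0 \<xi>"
    proof (cases "\<exists>p\<in>Pos. \<xi> \<in> dom p")
      case True
      then have "one_Inf \<xi> = 0" by (auto simp: one_Inf_def)
      then show ?thesis using Ev[OF c] True by simp
    next
      case False
      have "c \<in> U" using c by (simp add: match_def)
      from U_support[OF this, of \<xi>] have "c \<xi> \<noteq> 0 \<Longrightarrow> \<xi> = Inf" using False by blast
      then show ?thesis using c0 by auto
    qed
  qed
  moreover obtain m where "(single [m] one_Inf, single [m] c) \<in> D" using c unfolding match_def by blast
  moreover have "single [m] (0 :: 'v pt \<Rightarrow> rat) = 0" by (simp add: single_def fun_eq_iff)
  ultimately have "(single [m] one_Inf, 0) \<in> D" by simp
  then have "single [m] one_Inf = 0" by (rule bf_systemD(4)[OF E D(1)])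
  then have "single [m] one_Inf [m] Inf = 0" by simp
  then show False by (simp add: single_def one_Inf_def)
qed

end

section \<open>The counterexample\<close>

subsection \<open>Smallness of the groups\<close>

lemma funpow_add: "((+) x ^^ n) 0 = (\<lambda>\<eta> \<xi>. of_nat n * x \<eta> \<xi> :: rat)"
  by (induction n) (auto simp: fun_eq_iff algebra_simps)

lemma torsion_free:
  assumes "k > 0" "((+) x ^^ k) 0 = (0 :: 'a \<Rightarrow> 'b \<Rightarrow> rat)"
  shows "x = 0"
proof (intro ext)
  fix \<eta> \<xi>
  have "((+) x ^^ k) 0 \<eta> \<xi> = 0" using assms(2) by simp
  then show "x \<eta> \<xi> = 0 \<eta> \<xi>" using assms(1) unfolding funpow_add by simp
qed

context group_data
begin

definition Pts :: "'v pt set" where "Pts = {\<xi>. \<xi> = Inf \<or> (\<exists>p\<in>Pos. \<xi> \<in> dom p)}"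

lemma small_Pos: "small TYPE('v) Pos"
proof -
  have "{i. fst i \<in> elts \<alpha>} = elts \<alpha> \<times> (UNIV :: nat set)" by auto
  moreover have "small TYPE('v) (elts \<alpha> \<times> (UNIV :: nat set))" by (intro small_Times small_elts small_countable) simp
  ultimately show ?thesis unfolding Pos_def by (metis small_lists)
qed

lemma Pos_Cons_lt: "p \<in> Pos \<Longrightarrow> lt i (rk p) \<Longrightarrow> fst i \<in> elts \<alpha>"
  using Pos_child[of p i] by (auto simp: Pos_def)

text \<open>A single product parametrises all points, the first component selecting the constructor.\<close>

lemma small_Pts: "small TYPE('v) Pts"
proof -
  let ?I = "insert \<alpha> (elts \<alpha>) \<times> (UNIV :: nat set)"
  let ?f = "\<lambda>(k :: nat, q, i, n). if k = 0 then Inf else if k = 1 then Dn q else if k = 2 then Up q i else Lf q n"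
  let ?D = "(UNIV :: nat set) \<times> Pos \<times> ?I \<times> (UNIV :: nat set)"
  have "small TYPE('v) (?f ` ?D)" by (intro small_image small_Times small_Pos small_insert small_elts small_countable) simp_all
  moreover have "\<xi> \<in> ?f ` ?D" if "\<xi> \<in> Pts" for \<xi>
  proof (cases \<xi>)
    case Inf
    then show ?thesis by (intro image_eqI[of _ _ "(0, [], (\<alpha>, 0), 0)"]) auto
  next
    case (Dn p)
    then have "p \<in> Pos" using that by (auto simp: Pts_def)
    then show ?thesis using Dn by (intro image_eqI[of _ _ "(1, p, (\<alpha>, 0), 0)"]) auto
  next
    case (Up p i)
    then have "p \<in> Pos" "fst i \<in> elts \<alpha>" using that Pos_Cons_lt[of p i] by (auto simp: Pts_def)
    then show ?thesis using Up by (intro image_eqI[of _ _ "(2, p, i, 0)"]) (auto simp: mem_Times_iff)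
  next
    case (Lf p n)
    then have "p \<in> Pos" using that by (auto simp: Pts_def)
    then show ?thesis using Lf by (intro image_eqI[of _ _ "(3, p, (\<alpha>, 0), n)"]) auto
  qed
  ultimately show ?thesis using small_subset by blast
qed

lemma small_Fn: "small TYPE('v) Fn"
proof -
  let ?I = "insert \<alpha> (elts \<alpha>) \<times> (UNIV :: nat set)"
  let ?f = "\<lambda>(k :: nat, \<xi>, p, i). if k = 0 then Ev \<xi> else if k = 1 then Lk p i else if k = 2 then Tip p else Root"
  let ?D = "(UNIV :: nat set) \<times> Pts \<times> Pos \<times> ?I"
  have "small TYPE('v) (?f ` ?D)" by (intro small_image small_Times small_Pos small_Pts small_insert small_elts small_countable) simp_all
  moreover have I: "Inf \<in> Pts" by (simp add: Pts_def)
  have "\<phi> \<in> ?f ` ?D" if \<phi>: "\<phi> \<in> Fn" for \<phi>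
  proof (cases \<phi>)
    case (Ev \<xi>)
    then have "\<xi> \<in> Pts" using \<phi> by (auto simp: Fn_def Pts_def)
    then show ?thesis using Ev by (intro image_eqI[of _ _ "(0, \<xi>, [], (\<alpha>, 0))"]) auto
  next
    case (Lk p i)
    then have "p \<in> Pos" "fst i \<in> elts \<alpha>" using \<phi> Pos_Cons_lt[of p i] by (auto simp: Fn_def)
    then show ?thesis using Lk I by (intro image_eqI[of _ _ "(1, Inf, p, i)"]) (auto simp: mem_Times_iff)
  next
    case (Tip p)
    then have "p \<in> Pos" using \<phi> by (auto simp: Fn_def)
    then show ?thesis using Tip I by (intro image_eqI[of _ _ "(2, Inf, p, (\<alpha>, 0))"]) auto
  next
    case Root
    then show ?thesis using I by (intro image_eqI[of _ _ "(3, Inf, [], (\<alpha>, 0))"]) auto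
  qed
  ultimately show ?thesis using small_subset by blast
qed

end

context rigid_group_data
begin

lemma small_Gr: "small TYPE('v) (Gr \<epsilon>)"
proof -
  let ?U = "{u. (\<forall>\<xi>. \<xi> \<notin> Pts \<longrightarrow> u \<xi> = 0) \<and> (\<forall>\<xi>\<in>Pts. u \<xi> \<in> (UNIV :: rat set))}"
  let ?V = "{x. (\<forall>\<eta>. \<eta> \<notin> lists (elts \<kappa>) \<longrightarrow> x \<eta> = 0) \<and> (\<forall>\<eta>\<in>lists (elts \<kappa>). x \<eta> \<in> ?U)}"
  have "small TYPE('v) ?U" by (rule small_functions[OF small_Pts small_countable]) simp
  then have V: "small TYPE('v) ?V" by (rule small_functions[OF small_lists[OF small_elts]])
  show ?thesis
  proof (rule small_subset[OF V], rule subsetI)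
    fix x assume "x \<in> Gr \<epsilon>"
    then have x: "x \<in> V" by (rule Gr_V)
    have U: "x \<eta> \<in> U" and \<eta>: "x \<eta> \<noteq> 0 \<Longrightarrow> \<eta> \<in> lists (elts \<kappa>)" for \<eta> using x unfolding V_def by simp_all
    have "x \<eta> \<xi> = 0" if "\<xi> \<notin> Pts" for \<eta> \<xi> using U_support[OF U, of \<eta> \<xi>] that unfolding Pts_def by blast
    then have "x \<eta> \<in> ?U" for \<eta> by simp
    then show "x \<in> ?V" using \<eta> by blast
  qed
qed

lemma infinite_Gr:
  assumes m: "m \<in> elts \<kappa>" and \<epsilon>: "\<epsilon> \<in> \<int>"
  shows "infinite (Gr \<epsilon>)"
proof -
  let ?x = "single [m] one_Inf :: 'v list \<Rightarrow> 'v pt \<Rightarrow> rat"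
  have x: "?x \<in> Gr \<epsilon>" using integral_one_Inf m \<epsilon> by (intro single_Gr) (auto simp: integral_def)
  have "((+) ?x ^^ n) 0 \<in> Gr \<epsilon>" for n by (induction n) (simp_all only: funpow.simps o_apply id_apply Gr_0 Gr_add[OF x])
  moreover have "inj (\<lambda>n. ((+) ?x ^^ n) 0)"
  proof (rule injI)
    fix i j assume "((+) ?x ^^ i) 0 = ((+) ?x ^^ j) 0"
    then have "((+) ?x ^^ i) 0 [m] Inf = ((+) ?x ^^ j) 0 [m] Inf" by simp
    then show "i = j" unfolding funpow_add by (simp add: single_def one_Inf_def)
  qed
  ultimately show ?thesis using range_inj_infinite finite_subset by (metis image_subsetI)
qed

end

subsection \<open>Pinned names\<close>

text \<open>A generic enumeration over \<open>G\<close> stays generic over any forcing that projects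
  to \<open>G\<close>, so the lifted name codes the same group with the same addition.\<close>

lemma group_name_projection:
  assumes M: "group_name G A d M" and F: "forcing_notion F" and \<pi>: "projection F G \<pi>"
    and M': "relname F M' (\<lambda>u r. op_rel d u (\<pi> r))"
  shows "group_name F A (d \<circ> \<pi>) M'"
proof -
  interpret M: group_name G A d M by (rule M)
  have "op_rel (d \<circ> \<pi>) = (\<lambda>u r. op_rel d u (\<pi> r))" by (simp add: op_rel_def fun_eq_iff)
  then show ?thesis
    using F M' enumerates_projection[OF M.enum \<pi>] M.zero M.plus M.neg by unfold_locales simp_all
qed

lemma group_name_left:
  assumes M: "group_name P A d M" and Q: "forcing_notion Q"
  shows "group_name (P \<otimes> Q) A (d \<circ> pfst) (left_name Q M)"
proof -
  interpret M: group_name P A d M by (rule M)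
  show ?thesis
    by (rule group_name_projection[OF M forcing_notion_prod[OF M.forcing_notion Q] projection_pfst[OF Q] relname_left_name[OF M.M M.forcing_notion Q]])
qed

lemma group_name_right:
  assumes N: "group_name Q A d N" and P: "forcing_notion P"
  shows "group_name (P \<otimes> Q) A (d \<circ> psnd) (right_name P N)"
proof -
  interpret N: group_name Q A d N by (rule N)
  show ?thesis
    by (rule group_name_projection[OF N forcing_notion_prod[OF P N.forcing_notion] projection_psnd[OF P] relname_right_name[OF N.M P N.forcing_notion]])
qed

lemma group_names_pair:
  assumes "group_name F A d M" "group_name F B d' N"
  shows "group_names F A d M B d' N"
  using assms by (simp add: group_names_def group_name_def)

lemma ex_group_name:
  fixes A :: "'a::ab_group_add set"
  assumes A: "small TYPE('v::zfc_universe) A" "infinite A" "0 \<in> A" "\<And>a b. a \<in> A \<Longrightarrow> b \<in> A \<Longrightarrow> a - b \<in> A"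
  shows "\<exists>(P :: 'v forcing) d M. group_name P A d M"
proof -
  obtain P :: "'v forcing" and d where P: "forcing_notion P" "enumerates P A d"
    using enumerating_forcing[OF A(1,2)] by blast
  interpret forcing P using P(1) by unfold_locales
  define M where "M = rname P (op_rel d) (vprod (vprod omega omega) omega)"
  have M: "relname P M (op_rel d)" unfolding M_def
  proof (rule relname_rname)
    show "op_rel d u s" if r: "r \<in> C" "op_rel d u r" "s \<in> below P r" for u r s
    proof -
      obtain i j k a b where "u = opair (opair (vnat i) (vnat j)) (vnat k)" "d r i a" "d r j b" "d r k (a + b)"
        using r(2) unfolding op_rel_def by (elim exE conjE) (rule that)
      then show ?thesis unfolding op_rel_def using enumeratesD(2)[OF P(2) r(1) _ r(3)] by blast
    qed
  qed (auto simp: op_rel_def elts_omega)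
  have n: "- a \<in> A" if "a \<in> A" for a using A(4)[OF A(3) that] by simp
  have "a + b \<in> A" if "a \<in> A" "b \<in> A" for a b using A(4)[OF that(1) n[OF that(2)]] by simp
  then have "group_name P A d M" using P(2) M A(3) n by unfold_locales
  then show ?thesis by blast
qed

lemma pinned_name_TFAG:
  assumes M: "group_name P A d M" and tf: "\<And>a k. a \<in> A \<Longrightarrow> k > 0 \<Longrightarrow> ((+) a ^^ k) 0 = 0 \<Longrightarrow> a = 0"
  shows "pinned_name TFAG P M"
proof -
  interpret M: group_name P A d M by (rule M)
  have T: "forces P (TFAG M) p" if p: "p \<in> elts (Cond P)" for p
  proof (rule M.forces_TFAG[OF _ p])
    show "a = 0" if "a \<in> A" "0 < k" "((+) a ^^ k) 0 = 0" for a k by (rule tf[OF that])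
  qed
  have "forces (P \<otimes> P) (iso_fm (left_name P M) (right_name P M)) p" if p: "p \<in> elts (Cond (P \<otimes> P))" for p
  proof -
    interpret PP: group_names "P \<otimes> P" A "d \<circ> pfst" "left_name P M" A "d \<circ> psnd" "right_name P M"
      by (rule group_names_pair[OF group_name_left[OF M M.forcing_notion] group_name_right[OF M M.forcing_notion]])
    \<comment> \<open>The two generics enumerate the same group, so its identity map is the
      isomorphism between the copies.\<close>
    show ?thesis by (rule PP.forces_iso_fm[OF p, of id]) simp_all
  qed
  then show ?thesis unfolding pinned_name_def forced_def
    using M.forcing_notion M.is_name_M T by blast
qed

text \<open>The inverse of the generic enumeration of \<open>X\<close> injects the subset
  \<open>elts z\<close> into omega.\<close>

lemma collapses_enumerated:
  assumes R: "forcing_notion R" and d: "enumerates R X d" and z: "elts z \<subseteq> X"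
  shows "collapses R z"
proof -
  interpret forcing R using R by unfold_locales
  define c where "c u r \<longleftrightarrow> (\<exists>n a. u = opair a (vnat n) \<and> a \<in> elts z \<and> d r n a)" for u r
  have N: "relname R (rname R c (vprod z omega)) c"
  proof (rule relname_rname)
    show "c u s" if r: "r \<in> C" "c u r" "s \<in> below R r" for u r s
      using r(2) enumeratesD(2)[OF d r(1) _ r(3)] unfolding c_def by blast
  qed (auto simp: c_def elts_omega)
  have "forces R (is_countable (check R z)) p" if p: "p \<in> C" for p
    unfolding is_countable_def
  proof (rule forces_FExI[OF p is_name_check[of omega]], rule forces_FExI[OF p is_name_relname[OF N]])
    have 1: "forces R (is_fun (rname R c (vprod z omega)) (check R z) (check R omega)) p"
    proof (rule is_fun_relname[OF N p])
      show "\<exists>a\<in>elts z. \<exists>b\<in>elts omega. u = opair a b" if "c u r" for u r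
        using that unfolding c_def by (auto simp: elts_omega)
      show "\<exists>s\<in>below R r. \<exists>b. c (opair a b) s" if a: "a \<in> elts z" and r: "r \<in> C" for a r
      proof -
        obtain s n where "s \<in> below R r" "d s n a" using enumeratesD(6)[OF d r] a z by blast
        then show ?thesis using a unfolding c_def by blast
      qed
      show "b = b'" if r: "r \<in> C" "c (opair a b) r" "c (opair a b') r" for a b b' r
        using r(2,3) enumeratesD(4)[OF d r(1)] unfolding c_def by auto
    qed
    have 2: "forces R (is_inj (rname R c (vprod z omega))) p"
    proof (rule is_inj_relname[OF N _ p])
      show "vpair_rel c" by (auto simp: vpair_rel_def c_def)
      show "a = a'" if r: "r \<in> C" "c (opair a b) r" "c (opair a' b) r" for a a' b r
        using r(2,3) enumeratesD(3)[OF d r(1)] unfolding c_def by auto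
    qed
    show "forces R (is_omega (check R omega) \<^bold>\<and> is_fun (rname R c (vprod z omega)) (check R z) (check R omega) \<^bold>\<and>
        is_inj (rname R c (vprod z omega))) p"
      unfolding forces.simps(4) using forces_is_omega_check[OF p] 1 2 by blast
  qed
  then show ?thesis by (simp add: collapses_def forced_def del: forces.simps)
qed

text \<open>One forcing enumerates the union of all the given sets; omega is added to make the union
  infinite.\<close>

lemma collapsing_forcing: "\<exists>R :: 'v::zfc_universe forcing. forcing_notion R \<and> (\<forall>z\<in>set zs. collapses R z)"
proof -
  let ?X = "elts omega \<union> (\<Union>z\<in>set zs. elts z)"
  have "is_set (\<Union>z\<in>set zs. elts z)"
    by (induction zs) (auto intro: is_set_Un)
  then have "is_set ?X" by (intro is_set_Un) auto
  then have X: "small TYPE('v) ?X" by (rule small_is_set)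
  have "infinite (elts (omega :: 'v))"
    unfolding elts_omega by (rule range_inj_infinite) (simp add: inj_on_def)
  then have "infinite ?X" by simp
  from enumerating_forcing[OF X this] obtain R :: "'v forcing" and d where R: "forcing_notion R" "enumerates R ?X d" by blast
  have "collapses R z" if "z \<in> set zs" for z by (rule collapses_enumerated[OF R]) (use that in auto)
  then show ?thesis using R(1) by blast
qed

theorem mainTheorem15:
  assumes "\<nexists>\<kappa> :: 'v::zfc_universe. is_kappa_omega \<kappa>"
  shows "\<forall>\<alpha> :: 'v. Ord \<alpha> \<longrightarrow> \<not> Schroeder_Bernstein TFAG \<alpha>"
proof (intro allI impI notI)
  fix \<alpha> :: 'v assume \<alpha>: "Ord \<alpha>" and SB: "Schroeder_Bernstein TFAG \<alpha>"
  \<comment> \<open>The functionals in \<open>Fn\<close> depend on \<alpha> alone, so dummy values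
    of the other parameters suffice to determine the cardinal \<kappa> that labels them
    bijectively.\<close>
  interpret G0: group_data \<alpha> \<alpha> "\<lambda>_. \<alpha>" "\<lambda>_. 0" using \<alpha> by unfold_locales
  obtain \<kappa> :: 'v and lab where \<kappa>: "Card \<kappa>" and lab: "bij_betw lab G0.Fn (elts \<kappa>)"
    using small_cardinal[OF G0.small_Fn] by blast
  \<comment> \<open>The nonexistence of \<kappa>(\<omega>) enters here: the labelling cardinal fails
    the partition property whatever its size.\<close>
  obtain col :: "'v list \<Rightarrow> nat" where col: "\<forall>m. (\<forall>i. m i \<in> elts \<kappa>) \<and> m 0 \<noteq> m 1 \<longrightarrow>
    (\<exists>k. col (map m [0..<Suc k]) \<noteq> col (map (\<lambda>i. m (Suc i)) [0..<Suc k]))"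
    using colouring_without_shift_invariant_sequences[OF \<kappa> not_arrows_omega[OF assms \<kappa>]] by (rule exE)
  interpret rigid_group_data \<alpha> \<kappa> lab col
  proof (unfold_locales)
    show "lab \<phi> \<in> elts \<kappa>" if "\<phi> \<in> G0.Fn" for \<phi> using lab that by (auto simp: bij_betw_def)
    show "inj_on lab G0.Fn" using lab by (simp add: bij_betw_def)
    show "\<exists>k. col (map m [0..<Suc k]) \<noteq> col (map (\<lambda>i. m (Suc i)) [0..<Suc k])" if "\<forall>i. m i \<in> elts \<kappa>" "m 0 \<noteq> m 1" for m
      using col that by blast
  qed
  have m: "lab Root \<in> elts \<kappa>" by (rule lab_\<kappa>) (simp add: Fn_def)
  have ex: "\<exists>(P :: 'v forcing) d M. group_name P (Gr \<epsilon>) d M" if "\<epsilon> \<in> \<int>" for \<epsilon>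
    by (rule ex_group_name[OF small_Gr infinite_Gr[OF m that] Gr_0 Gr_diff])
  obtain P :: "'v forcing" and d M where M: "group_name P (Gr 1) d M" using ex[of 1] by auto
  obtain Q :: "'v forcing" and d' N where N: "group_name Q (Gr (- 1)) d' N" using ex[of "- 1"] by auto
  interpret M: group_name P "Gr 1" d M by (rule M)
  interpret N: group_name Q "Gr (- 1)" d' N by (rule N)
  obtain R :: "'v forcing" where R: "forcing_notion R" "\<And>z. z \<in> set [\<alpha>, Cond P, Cond Q, M, N] \<Longrightarrow> collapses R z"
    using collapsing_forcing by blast
  have QR: "forcing_notion (Q \<otimes> R)" by (rule forcing_notion_prod[OF N.forcing_notion R(1)])
  have "forces (P \<otimes> Q \<otimes> R) (sim_fm (check (P \<otimes> Q \<otimes> R) \<alpha>) (left_name (Q \<otimes> R) M) (right_name P (left_name R N))) p"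
    if p: "p \<in> elts (Cond (P \<otimes> Q \<otimes> R))" for p
  proof -
    interpret S: group_names "P \<otimes> Q \<otimes> R" "Gr 1" "d \<circ> pfst" "left_name (Q \<otimes> R) M"
        "Gr (- 1)" "d' \<circ> pfst \<circ> psnd" "right_name P (left_name R N)"
      by (rule group_names_pair[OF group_name_left[OF M QR] group_name_right[OF group_name_left[OF N R(1)] M.forcing_notion]])
    have "S.lev \<alpha> [] [] q" if q: "q \<in> elts (Cond (P \<otimes> Q \<otimes> R))" for q
    proof (rule S.lev_game[where game = "game 1", OF _ _ game_mono game_forth game_back \<alpha> game_start q])
      \<comment> \<open>The reverse embedding comes from the same position of the game read from the
        other side.\<close>
      show "\<exists>\<theta>. (\<forall>a\<in>Gr (- 1). \<theta> a \<in> Gr 1) \<and> inj_on \<theta> (Gr (- 1)) \<and> (\<forall>a b. \<theta> (a + b) = \<theta> a + \<theta> b) \<and> xs = map \<theta> ys"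
        if "game 1 \<beta> xs ys" for \<beta> xs ys
        using game_embedding[OF game_sym[OF that]] by simp
    qed (use game_embedding in simp_all)
    then show ?thesis by (rule S.forces_sim_fm[OF \<alpha> _ p])
  qed
  then have sim: "pinned_sim \<alpha> P M Q N" unfolding pinned_sim_def forced_def using R by (intro exI[of _ R]) simp
  have tf: "a = 0" if "k > 0" "((+) a ^^ k) 0 = 0" for a :: "'v list \<Rightarrow> 'v pt \<Rightarrow> rat" and k
    using torsion_free that by blast
  have "pinned_name TFAG P M" "pinned_name TFAG Q N" by (rule pinned_name_TFAG[OF M tf] pinned_name_TFAG[OF N tf]; assumption)+
  then have iso: "pinned_iso P M Q N" using SB sim unfolding Schroeder_Bernstein_def by blast
  interpret PQ: group_names "P \<otimes> Q" "Gr 1" "d \<circ> pfst" "left_name Q M" "Gr (- 1)" "d' \<circ> psnd" "right_name P N"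
    by (rule group_names_pair[OF group_name_left[OF M N.forcing_notion] group_name_right[OF N M.forcing_notion]])
  \<comment> \<open>A forced isomorphism of the generic copies yields a back-and-forth system
    between the groups themselves.\<close>
  have "forces (P \<otimes> Q) (iso_fm (left_name Q M) (right_name P N)) (Top (P \<otimes> Q))"
    using iso PQ.Top_C unfolding pinned_iso_def forced_def by blast
  from PQ.iso_bf_system[OF this PQ.Top_C] show False using no_bf_system by blast
qed

end
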